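(* Let $\vec\beta$ be non-degenerate. For every $f_2\in L^2(\mathbb R)$ and every pair of measurable sets $F_1,F_3\subset\mathbb R$ of finite positive measure there exists a major subset $F_3'$ of $F_3$ (depending on $f_2,F_1,F_3$) such that $$|\Lambda_{\vec\beta}(f_1,f_2,f_3)|\le C_{\vec\beta}\,|F_1|\,\|f_2\|_2\,|F_3|^{-1/2}\log\Big(e+\frac{|F_3|}{|F_1|}\Big)$$ for all measurable $f_1,f_3$ with $|f_1|\le \mathbf 1_{F_1}$, $|f_3|\le\mathbf 1_{F_3'}$.
   Context: Let $\vec\beta=(\beta_1,\beta_2,\beta_3)\in\mathbb R^3$ be a unit vector with $\vec\beta\cdot(1,1,1)=0$, non-degenerate meaning $\beta_1,\beta_2,\beta_3$ are pairwise distinct. The trilinear form is $\Lambda_{\vec\beta}(f_1,f_2,f_3)=\int_{\mathbb R}\mathrm{p.v.}\int_{\mathbb R} f_1(x-\beta_1t)f_2(x-\beta_2t)f_3(x-\beta_3t)\,\frac{dt}{t}\,dx$, defined a priori for Schwartz functions and extended in the standard way to the functions considered. The bilinear Hilbert transform is $\mathrm{BHT}_{\vec b}(f_1,f_2)(x)=\mathrm{p.v.}\int f_1(x-b_1t)f_2(x-b_2t)\frac{dt}{t}$ with $b_1=\beta_1-\beta_3$, $b_2=\beta_2-\beta_3$, so that $\Lambda_{\vec\beta}(f_1,f_2,f_3)=\langle \mathrm{BHT}_{\vec b}(f_1,f_2),\overline{f_3}\rangle$. $C_{\vec\beta}$ denotes a positive constant depending only on $\vec\beta$. A major subset of a set $F$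 of finite measure is a measurable $F'\subset F$ with $|F|\le 2|F'|$. *)

theory Defs
  imports "HOL-Analysis.Analysis"
begin

definition nondegenerate :: "real \<Rightarrow> real \<Rightarrow> real \<Rightarrow> bool" where
  "nondegenerate b1 b2 b3 \<longleftrightarrow>
     b1^2 + b2^2 + b3^2 = 1 \<and> b1 + b2 + b3 = 0 \<and>
     b1 \<noteq> b2 \<and> b1 \<noteq> b3 \<and> b2 \<noteq> b3"

definition Lambda_trunc ::
  "real \<Rightarrow> real \<Rightarrow> real \<Rightarrow> (real \<Rightarrow> complex) \<Rightarrow> (real \<Rightarrow> complex) \<Rightarrow> (real \<Rightarrow> complex)
   \<Rightarrow> real \<Rightarrow> complex" where
  "Lambda_trunc b1 b2 b3 f1 f2 f3 eps =
     (\<integral>x. (\<integral>t. (if eps < \<bar>t\<bar>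
                 then f1 (x - b1 * t) * f2 (x - b2 * t) * f3 (x - b3 * t) / complex_of_real t
                 else 0) \<partial>lebesgue) \<partial>lebesgue)"

definition Lambda ::
  "real \<Rightarrow> real \<Rightarrow> real \<Rightarrow> (real \<Rightarrow> complex) \<Rightarrow> (real \<Rightarrow> complex) \<Rightarrow> (real \<Rightarrow> complex) \<Rightarrow> complex" where
  "Lambda b1 b2 b3 f1 f2 f3 = Lim (at_right 0) (Lambda_trunc b1 b2 b3 f1 f2 f3)"

definition L2norm :: "(real \<Rightarrow> complex) \<Rightarrow> real" where
  "L2norm f = sqrt (\<integral>x. (norm (f x))^2 \<partial>lebesgue)"

definition in_L2 :: "(real \<Rightarrow> complex) \<Rightarrow> bool" where
  "in_L2 f \<longleftrightarrow> f \<in> borel_measurable lebesgue \<and> integrable lebesgue (\<lambda>x. (norm (f x))^2)"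

definition finite_pos_set :: "real set \<Rightarrow> bool" where
  "finite_pos_set F \<longleftrightarrow> F \<in> sets lebesgue \<and> emeasure lebesgue F < \<infinity> \<and> 0 < measure lebesgue F"

definition major_subset :: "real set \<Rightarrow> real set \<Rightarrow> bool" where
  "major_subset F' F \<longleftrightarrow> F' \<in> sets lebesgue \<and> F' \<subseteq> F \<and> measure lebesgue F \<le> 2 * measure lebesgue F'"

end

theory Submission
  imports Defs "HOL-Probability.Probability"
begin

text \<open>
  The form is expanded in wave packets, following Lacey and Thiele in the continuous formulation of Do and Thiele.
  Let \<open>(d1, d2, d3) = (b2 - b3, b3 - b1, b1 - b2)\<close>, let \<open>phi(x) = (sin(x/4) / (x/4))^4\<close>, a nonnegative function whose Fourier
  transform has compact support, and let \<open>F_j(y, \<eta>, t)\<close> be the coefficient of \<open>f_j\<close> against the packet at position \<open>y\<close>,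
  scale \<open>t\<close> and frequency \<open>d_j \<eta> + k b_j / t\<close>. Since the \<open>d_j\<close> sum to zero and \<open>\<Sum> d_j b_j = 0\<close>, Plancherel in \<open>\<eta>\<close> shows that
  \<open>F_1 F_2 F_3\<close> integrates over \<open>(y, \<eta>)\<close> to \<open>(2 pi / t) \<integral> e^(i k v) G(v) L(t v) dv\<close>, where \<open>L(\<tau>) = \<integral> \<Prod> f_j(x - b_j \<tau>) dx\<close>.
  Subtracting the same quantity for \<open>- k\<close> and integrating over \<open>t\<close> reproduces \<open>p.v. \<integral> L(\<tau>) d\<tau> / \<tau>\<close> up to a constant which is
  nonzero for some large \<open>k\<close>, so it suffices to bound the integral of \<open>|F_1 F_2 F_3|\<close>.

  The set \<open>F3'\<close> is \<open>F3\<close> minus the open set \<open>\<Omega>\<close> where the maximal function of \<open>1_F1\<close> or of \<open>|f2|^2\<close> exceeds a multiple of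
  \<open>|F1| / |F3|\<close> or \<open>|f2|^2 / |F3|\<close>. Where \<open>t\<close> is smaller than the distance from \<open>y\<close> to the complement of \<open>\<Omega>\<close>, the decay of \<open>phi\<close>
  and Plancherel suffice. The remaining region is averaged over lattices of scales, positions and frequencies and the
  lattice points are sorted into trees: on a tree at most one of the three functions is not lacunary, a \<open>TT*\<close> argument bounds
  the total length of the trees of size \<open>2^-n\<close> by \<open>4^n |f_j|^2\<close>, and the size itself is at most a multiple of the averages of
  \<open>f_j\<close> near the complement of \<open>\<Omega>\<close>. With \<open>a = |F1| / |F3|\<close> the resulting sum
  \<open>\<Sum> 4^n min(a, 2^-n sqrt a) min(1, 2^-n)^2\<close> is at most a multiple of \<open>a log(e + 1/a)\<close>.
\<close>

text \<open>The form is invariant under modulating \<open>f_j\<close> by \<open>d_j \<eta>\<close>,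
  so no single frequency can serve as the origin of a decomposition; this is why
  \<open>\<eta>\<close> runs over the whole line and why trees with arbitrary top frequency are
  needed. A tree can be summed only if two of the three packets oscillate relative to its top. As
  \<open>b\<close> is a unit vector orthogonal to \<open>(1, 1, 1)\<close>, the two-by-two minors of
  \<open>d\<close> and \<open>k b\<close> are all \<open>k\<close> up to sign, and
  \<open>k \<ge> 16\<close> suffices. But the constant in the representation is a sine transform
  evaluated at \<open>k\<close>, which may vanish at a given point, so it has to be shown nonzero
  somewhere beyond 16. The packets produce averages of truncations, while the form is defined by
  sharp ones, and the limit of these has to be shown to exist. The function \<open>L\<close> is used
  only through being bounded, integrable and continuous at 0; convergence is therefore deduced from
  the absolute integrability of the packet integral.\<close>

abbreviation sq_integrable :: "(real \<Rightarrow> complex) \<Rightarrow> bool" where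
  "sq_integrable f \<equiv> integrable lborel (\<lambda>x. (norm (f x))^2)"

abbreviation nn_lborel :: "(real \<Rightarrow> ennreal) \<Rightarrow> ennreal" (binder "NINT " 10) where
  "nn_lborel \<equiv> integral\<^sup>N lborel"

text \<open>Lattice sums of nonnegative terms are written as integrals against counting measure, so
  that exchanging them with integrals is a Fubini statement.\<close>

abbreviation nn_sum :: "('a \<Rightarrow> ennreal) \<Rightarrow> ennreal" (binder "NSUM " 10) where
  "nn_sum \<equiv> integral\<^sup>N (count_space UNIV)"

abbreviation cx :: "real \<Rightarrow> complex" where "cx \<equiv> complex_of_real"

abbreviation bm :: "('a::topological_space \<Rightarrow> 'b::topological_space) set" where "bm \<equiv> borel_measurable borel"

lemmas dominated_integrable = Bochner_Integration.integrable_bound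
lemmas bochner_cong = Bochner_Integration.integral_cong

section \<open>Continuity of translations in L2\<close>

lemma integrable_mult_L2:
 fixes f g :: "'a \<Rightarrow> 'b::{real_normed_algebra, banach, second_countable_topology}"
 assumes [measurable]: "f \<in> borel_measurable M" "g \<in> borel_measurable M"
  and f2: "integrable M (\<lambda>x. (norm (f x))^2)" and g2: "integrable M (\<lambda>x. (norm (g x))^2)"
 shows "integrable M (\<lambda>x. f x * g x)"
proof (rule dominated_integrable)
 show "integrable M (\<lambda>x. (norm (f x))^2 + (norm (g x))^2)" using f2 g2 by simp
 show "AE x in M. norm (f x * g x) \<le> norm ((norm (f x))^2 + (norm (g x))^2)"
 proof (intro AE_I2)
  fix x
  have "norm (f x * g x) \<le> norm (f x) * norm (g x)" by (rule norm_mult_ineq)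
  also have "... \<le> (norm (f x))^2 + (norm (g x))^2"
   using sum_squares_bound[of "norm (f x)" "norm (g x)"] mult_nonneg_nonneg[OF norm_ge_zero[of "f x"] norm_ge_zero[of "g x"]]
   by linarith
  finally show "norm (f x * g x) \<le> norm ((norm (f x))^2 + (norm (g x))^2)" by simp
 qed
qed measurable

lemma CS_integral:
 fixes f g :: "'a \<Rightarrow> real"
 assumes [measurable]: "f \<in> borel_measurable M" "g \<in> borel_measurable M"
  and f2: "integrable M (\<lambda>x. (f x)^2)" and g2: "integrable M (\<lambda>x. (g x)^2)"
 shows "(\<integral>x. \<bar>f x * g x\<bar> \<partial>M) \<le> sqrt (\<integral>x. (f x)^2 \<partial>M) * sqrt (\<integral>x. (g x)^2 \<partial>M)"
proof -
 have fg: "integrable M (\<lambda>x. f x * g x)"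
  by (rule integrable_mult_L2) (use f2 g2 in auto)
 have "(\<integral>\<^sup>+x. ennreal \<bar>f x\<bar> * ennreal \<bar>g x\<bar> \<partial>M) = ennreal (\<integral>x. \<bar>f x * g x\<bar> \<partial>M)"
  using nn_integral_eq_integral[OF integrable_abs[OF fg]] by (simp add: abs_mult ennreal_mult)
 then have "ennreal ((\<integral>x. \<bar>f x * g x\<bar> \<partial>M)^2) = (\<integral>\<^sup>+x. ennreal \<bar>f x\<bar> * ennreal \<bar>g x\<bar> \<partial>M)^2"
  by (simp add: ennreal_power)
 also have "... \<le> (\<integral>\<^sup>+x. ennreal \<bar>f x\<bar>^2 \<partial>M) * (\<integral>\<^sup>+x. ennreal \<bar>g x\<bar>^2 \<partial>M)"
  by (rule Cauchy_Schwarz_nn_integral) auto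
 also have "... = ennreal ((\<integral>x. (f x)^2 \<partial>M) * (\<integral>x. (g x)^2 \<partial>M))"
  using f2 g2 by (simp add: nn_integral_eq_integral[symmetric] ennreal_mult ennreal_power)
 finally have "(\<integral>x. \<bar>f x * g x\<bar> \<partial>M)^2 \<le> (\<integral>x. (f x)^2 \<partial>M) * (\<integral>x. (g x)^2 \<partial>M)"
  by (subst (asm) ennreal_le_iff) auto
 then show ?thesis
  by (metis real_le_rsqrt real_sqrt_mult)
qed

lemma CS_integral_norm:
 fixes f g :: "'a \<Rightarrow> complex"
 assumes [measurable]: "f \<in> borel_measurable M" "g \<in> borel_measurable M"
  and f2: "integrable M (\<lambda>x. (norm (f x))^2)" and g2: "integrable M (\<lambda>x. (norm (g x))^2)"
 shows "norm (\<integral>x. f x * g x \<partial>M) \<le> sqrt (\<integral>x. (norm (f x))^2 \<partial>M) * sqrt (\<integral>x. (norm (g x))^2 \<partial>M)"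
proof -
 have "norm (\<integral>x. f x * g x \<partial>M) \<le> (\<integral>x. \<bar>norm (f x) * norm (g x)\<bar> \<partial>M)"
  using integral_norm_bound[of M "\<lambda>x. f x * g x"] by (simp add: norm_mult)
 also have "... \<le> sqrt (\<integral>x. (norm (f x))^2 \<partial>M) * sqrt (\<integral>x. (norm (g x))^2 \<partial>M)"
  by (rule CS_integral) (use f2 g2 in auto)
 finally show ?thesis .
qed

lemma integrable_lborel_shift:
 fixes f :: "real \<Rightarrow> 'a::{banach, second_countable_topology}"
 assumes "integrable lborel f"
 shows "integrable lborel (\<lambda>x. f (x + h))"
 using lborel_integrable_real_affine[OF assms, of 1 h] by (simp add: add.commute)

lemma integral_lborel_shift:
 fixes f :: "real \<Rightarrow> 'a::{banach, second_countable_topology}"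
 shows "(LBINT x. f (x + h)) = (LBINT x. f x)"
 using lborel_integral_real_affine[of 1 f h] by (simp add: add.commute)

lemma integral_lborel_scale:
 fixes f :: "real \<Rightarrow> 'a::{banach, second_countable_topology}"
 assumes "c \<noteq> 0"
 shows "(LBINT x. f (c * x)) = (LBINT x. f x) /\<^sub>R \<bar>c\<bar>"
 using lborel_integral_real_affine[OF assms, of f 0] assms by simp

lemma integral_lborel_minus:
 fixes f :: "real \<Rightarrow> 'a::{banach, second_countable_topology}"
 shows "(LBINT x. f (a - x)) = (LBINT x. f x)"
 using lborel_integral_real_affine[of "-1" f a] by simp

lemma integrable_lborel_minus:
 fixes f :: "real \<Rightarrow> 'a::{banach, second_countable_topology}"
 assumes "integrable lborel f"
 shows "integrable lborel (\<lambda>x. f (a - x))"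
 using lborel_integrable_real_affine[OF assms, of "-1" a] by simp

lemma integrable_lborel_scale:
 fixes f :: "real \<Rightarrow> 'a::{banach, second_countable_topology}"
 assumes "integrable lborel f" "c \<noteq> 0"
 shows "integrable lborel (\<lambda>x. f (c * x))"
 using lborel_integrable_real_affine[OF assms, of 0] by simp

text \<open>For open \<open>U\<close> the product of the indicators at \<open>x + h\<close> and at
  \<open>x\<close> tends to the indicator at \<open>x\<close> for every \<open>x\<close>, including
  boundary points, which lie outside \<open>U\<close>. The absolute difference is the sum minus
  twice the product, so dominated convergence applies.\<close>

lemma L1_trans_open:
 fixes U :: "real set"
 assumes U: "open U" "emeasure lborel U < \<infinity>" and h: "h \<longlonglongrightarrow> 0"
 shows "(\<lambda>n. LBINT x. \<bar>indicator U (x + h n) - indicator U x\<bar>) \<longlonglongrightarrow> (0::real)"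
proof -
 have [measurable]: "U \<in> sets borel" using U by auto
 have i1: "integrable lborel (indicator U :: real \<Rightarrow> real)"
  by (rule integrable_real_indicator) (use U in simp_all)
 have i2: "integrable lborel (\<lambda>x. indicator U (x + h n) :: real)" for n
  by (rule integrable_lborel_shift[OF i1])
 have im: "integrable lborel (\<lambda>x. indicator U (x + h n) * indicator U x :: real)" for n
  by (rule dominated_integrable[OF i1]) (auto simp: indicator_def)
 have "(\<lambda>n. LBINT x. indicator U (x + h n) * indicator U x) \<longlonglongrightarrow> (LBINT x. (indicator U x::real))"
 proof (rule integral_dominated_convergence[OF _ _ i1])
  show "AE x in lborel. (\<lambda>n. indicator U (x + h n) * indicator U x) \<longlonglongrightarrow> (indicator U x::real)"
  proof (rule AE_I2)
   fix x :: real
   show "(\<lambda>n. indicator U (x + h n) * indicator U x) \<longlonglongrightarrow> (indicator U x::real)"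
   proof (cases "x \<in> U")
    case True
    have "(\<lambda>n. x + h n) \<longlonglongrightarrow> x" using tendsto_add[OF tendsto_const h, of x] by simp
    then have "\<forall>\<^sub>F n in sequentially. x + h n \<in> U"
     using topological_tendstoD[OF _ U(1) True] by blast
    then have "\<forall>\<^sub>F n in sequentially. indicator U (x + h n) * indicator U x = (indicator U x::real)"
     by eventually_elim (use True in auto)
    then show ?thesis by (rule tendsto_eventually)
   qed auto
  qed
 qed (auto simp: indicator_def)
 then have "(\<lambda>n. 2 * (LBINT x. (indicator U x::real)) - 2 * (LBINT x. indicator U (x + h n) * indicator U x)) \<longlonglongrightarrow>
  2 * (LBINT x. (indicator U x::real)) - 2 * (LBINT x. (indicator U x::real))"
  by (intro tendsto_intros)
 moreover have "(LBINT x. \<bar>indicator U (x + h n) - indicator U x\<bar>) =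
  2 * (LBINT x. (indicator U x::real)) - 2 * (LBINT x. indicator U (x + h n) * indicator U x)" for n
 proof -
  have "(LBINT x. \<bar>indicator U (x + h n) - indicator U x\<bar>) =
   (LBINT x. (indicator U (x + h n) + indicator U x) - 2 * (indicator U (x + h n) * indicator U x) :: real)"
   by (intro bochner_cong) (auto simp: indicator_def)
  also have "... = (LBINT x. indicator U (x + h n)) + (LBINT x. indicator U x) - 2 * (LBINT x. indicator U (x + h n) * indicator U x)"
   using i1 i2[of n] im[of n]
   by (subst Bochner_Integration.integral_diff) (auto simp del: indicator_times_eq_if)
  also have "(LBINT x. indicator U (x + h n)) = (LBINT x. (indicator U x::real))"
   by (rule integral_lborel_shift)
  finally show ?thesis by simp
 qed
 ultimately show ?thesis by simp
qed

definition L1_trans :: "(real \<Rightarrow> complex) \<Rightarrow> bool" where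
 "L1_trans f \<longleftrightarrow> (\<forall>h::nat \<Rightarrow> real. h \<longlonglongrightarrow> 0 \<longrightarrow> (\<lambda>n. LBINT x. norm (f (x + h n) - f x)) \<longlonglongrightarrow> 0)"

lemma L1_trans_approx:
 assumes f: "integrable lborel f"
  and g: "\<And>e. e > 0 \<Longrightarrow> \<exists>g. integrable lborel g \<and> L1_trans g \<and> (LBINT x. norm (f x - g x)) < e"
 shows "L1_trans f"
 unfolding L1_trans_def
proof (intro allI impI)
 fix h :: "nat \<Rightarrow> real" assume h: "h \<longlonglongrightarrow> 0"
 show "(\<lambda>n. LBINT x. norm (f (x + h n) - f x)) \<longlonglongrightarrow> 0"
 proof (rule LIMSEQ_I)
  fix r :: real assume r: "r > 0"
  obtain g where gi: "integrable lborel g" and gt: "L1_trans g" and gd: "(LBINT x. norm (f x - g x)) < r/3"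
   using g[of "r/3"] r by auto
  have "(\<lambda>n. LBINT x. norm (g (x + h n) - g x)) \<longlonglongrightarrow> 0"
   using gt h by (auto simp: L1_trans_def)
  from LIMSEQ_D[OF this, of "r/3"] r obtain N where N: "\<And>n. n \<ge> N \<Longrightarrow> \<bar>LBINT x. norm (g (x + h n) - g x)\<bar> < r/3"
   by auto
  have "norm ((LBINT x. norm (f (x + h n) - f x)) - 0) < r" if n: "n \<ge> N" for n
  proof -
   have fs: "integrable lborel (\<lambda>x. f (x + h n))" and gs: "integrable lborel (\<lambda>x. g (x + h n))"
    using f gi integrable_lborel_shift by auto
   have "(LBINT x. norm (f (x + h n) - f x)) \<le> (LBINT x. norm (f (x + h n) - g (x + h n)) + norm (g (x + h n) - g x) + norm (f x - g x))"
    apply (rule integral_mono)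
    using f gi fs gs apply (auto)[2]
    subgoal for x
     using norm_triangle_ineq[of "f (x + h n) - g (x + h n) + (g (x + h n) - g x)" "g x - f x"]
      norm_triangle_ineq[of "f (x + h n) - g (x + h n)" "g (x + h n) - g x"] norm_minus_commute[of "f x" "g x"]
     by (simp)
    done
   also have "... = (LBINT x. norm (f (x + h n) - g (x + h n))) + (LBINT x. norm (g (x + h n) - g x)) + (LBINT x. norm (f x - g x))"
    using f gi fs gs by simp
   also have "(LBINT x. norm (f (x + h n) - g (x + h n))) = (LBINT x. norm (f x - g x))"
    by (rule integral_lborel_shift[of "\<lambda>x. norm (f x - g x)"])
   finally have "(LBINT x. norm (f (x + h n) - f x)) < r"
    using gd N[OF n] by linarith
   then show ?thesis by (simp)
  qed
  then show "\<exists>no. \<forall>n\<ge>no. norm ((LBINT x. norm (f (x + h n) - f x)) - 0) < r" by blast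
 qed
qed

lemma L1_trans_indicator:
 fixes A :: "real set"
 assumes [measurable]: "A \<in> sets borel" and fin: "emeasure lborel A < \<infinity>"
 shows "L1_trans (\<lambda>x. indicator A x *\<^sub>R c)"
proof (rule L1_trans_approx)
 show "integrable lborel (\<lambda>x. indicator A x *\<^sub>R c)"
  by (rule integrable_scaleR_left, rule integrable_real_indicator) (use fin in simp_all)
 fix e :: real assume e: "e > 0"
 define e' where "e' = e / (norm c + 1) / 2"
 have e': "e' > 0" using e by (auto simp: e'_def add_nonneg_pos)
 obtain U where U: "A \<subseteq> U" "open U" "emeasure lborel (U - A) < e'"
  by (rule outer_regular_lborel[OF assms(1) e']) blast
 have [measurable]: "U \<in> sets borel" using U by auto
 have "emeasure lborel U = emeasure lborel A + emeasure lborel (U - A)"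
  by (subst plus_emeasure) (use U in \<open>auto intro!: arg_cong[where f="emeasure lborel"]\<close>)
 also have "... < \<infinity>" using fin U(3) by (auto simp: less_top[symmetric] ennreal_add_eq_top)
 finally have fU: "emeasure lborel U < \<infinity>" .
 show "\<exists>g. integrable lborel g \<and> L1_trans g \<and> (LBINT x. norm (indicator A x *\<^sub>R c - g x)) < e"
 proof (intro exI conjI)
  show "integrable lborel (\<lambda>x. indicator U x *\<^sub>R c)"
   by (rule integrable_scaleR_left, rule integrable_real_indicator) (use fU in simp_all)
  show "L1_trans (\<lambda>x. indicator U x *\<^sub>R c)"
   unfolding L1_trans_def
  proof (intro allI impI)
   fix h :: "nat \<Rightarrow> real" assume h: "h \<longlonglongrightarrow> 0"
   have "(\<lambda>n. (LBINT x. \<bar>indicator U (x + h n) - indicator U x\<bar>) * norm c) \<longlonglongrightarrow> 0 * norm c"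
    by (intro tendsto_intros L1_trans_open U fU h)
   then show "(\<lambda>n. LBINT x. norm (indicator U (x + h n) *\<^sub>R c - indicator U x *\<^sub>R c)) \<longlonglongrightarrow> 0"
    by (simp flip: scaleR_diff_left)
  qed
  have "(LBINT x. norm (indicator A x *\<^sub>R c - indicator U x *\<^sub>R c)) = (LBINT x. indicator (U - A) x * norm c)"
   by (rule bochner_cong) (use U in \<open>auto simp: indicator_def\<close>)
  also have "... = measure lborel (U - A) * norm c" by simp
  also have "... \<le> e' * norm c"
   using U(3) e' by (intro mult_right_mono) (auto simp: measure_def intro!: enn2real_leI)
  also have "... \<le> e' * (norm c + 1)" using e' by simp
  also have "... = e / 2" unfolding e'_def by (simp add: field_simps add_nonneg_eq_0_iff)
  finally show "(LBINT x. norm (indicator A x *\<^sub>R c - indicator U x *\<^sub>R c)) < e" using e by linarith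
 qed
qed

lemma L1_trans_integrable:
 assumes "integrable lborel f"
 shows "L1_trans f"
 using assms
proof (induction rule: integrable_induct)
 case (base A c)
 then show ?case by (intro L1_trans_indicator) auto
next
 case (add f g)
 show ?case unfolding L1_trans_def
 proof (intro allI impI)
  fix h :: "nat \<Rightarrow> real" assume h: "h \<longlonglongrightarrow> 0"
  have L: "(\<lambda>n. (LBINT x. norm (f (x + h n) - f x)) + (LBINT x. norm (g (x + h n) - g x))) \<longlonglongrightarrow> 0 + 0"
   using add h by (intro tendsto_add) (auto simp: L1_trans_def)
  show "(\<lambda>n. LBINT x. norm (f (x + h n) + g (x + h n) - (f x + g x))) \<longlonglongrightarrow> 0"
  proof (rule Lim_null_comparison[OF _ L[simplified]], rule always_eventually, rule allI)
   fix n
   have fs: "integrable lborel (\<lambda>x. f (x + h n))" and gs: "integrable lborel (\<lambda>x. g (x + h n))"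
    using add integrable_lborel_shift by auto
   have "norm (LBINT x. norm (f (x + h n) + g (x + h n) - (f x + g x))) = (LBINT x. norm (f (x + h n) + g (x + h n) - (f x + g x)))"
    by simp
   also have "... \<le> (LBINT x. norm (f (x + h n) - f x) + norm (g (x + h n) - g x))"
    apply (rule integral_mono)
    using add fs gs apply auto[2]
    by (metis add_diff_add norm_triangle_ineq)
   also have "... = (LBINT x. norm (f (x + h n) - f x)) + (LBINT x. norm (g (x + h n) - g x))"
    using add fs gs by simp
   finally show "norm (LBINT x. norm (f (x + h n) + g (x + h n) - (f x + g x))) \<le> (LBINT x. norm (f (x + h n) - f x)) + (LBINT x. norm (g (x + h n) - g x))" .
  qed
 qed
next
 case (lim f s)
 show ?case
 proof (rule L1_trans_approx)
  show "integrable lborel f" by fact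
  fix e :: real assume e: "e > 0"
  have [measurable]: "f \<in> borel_measurable lborel" "\<And>i. s i \<in> borel_measurable lborel"
   using lim by auto
  have "(\<lambda>i. LBINT x. norm (f x - s i x)) \<longlonglongrightarrow> (\<integral>x. 0 \<partial>(lborel::real measure))"
  proof (rule integral_dominated_convergence[where w="\<lambda>x. 3 * norm (f x)"])
   show "integrable lborel (\<lambda>x. 3 * norm (f x))" using lim by auto
   show "AE x in lborel. (\<lambda>i. norm (f x - s i x)) \<longlonglongrightarrow> 0"
   proof (rule AE_I2)
    fix x :: real
    have "(\<lambda>i. s i x) \<longlonglongrightarrow> f x" using lim by auto
    then have "(\<lambda>i. norm (f x - s i x)) \<longlonglongrightarrow> norm (f x - f x)" by (intro tendsto_intros)
    then show "(\<lambda>i. norm (f x - s i x)) \<longlonglongrightarrow> 0" by simp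
   qed
   fix i
   show "AE x in lborel. norm (norm (f x - s i x)) \<le> 3 * norm (f x)"
   proof (rule AE_I2)
    fix x :: real
    have "norm (s i x) \<le> 2 * norm (f x)" using lim by auto
    then show "norm (norm (f x - s i x)) \<le> 3 * norm (f x)"
     using norm_triangle_ineq4[of "f x" "s i x"] by simp
   qed
  qed measurable
  from LIMSEQ_D[OF this e] obtain i where "(LBINT x. norm (f x - s i x)) < e"
   by auto
  then show "\<exists>g. integrable lborel g \<and> L1_trans g \<and> (LBINT x. norm (f x - g x)) < e"
   using lim by (intro exI[of _ "s i"]) auto
 qed
qed

text \<open>Truncation in height and in support leaves an error small in L2. For a function bounded
  by \<open>N\<close> the squared difference is at most \<open>2 N\<close> times the difference, so
  the L1 statement settles the truncated part.\<close>

lemma L2_trans: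
 fixes f :: "real \<Rightarrow> complex"
 assumes [measurable]: "f \<in> bm" and f2: "sq_integrable f"
  and h: "h \<longlonglongrightarrow> (0::real)"
 shows "(\<lambda>n. LBINT x. (norm (f (x + h n) - f x))^2) \<longlonglongrightarrow> 0"
proof -
 define B where "B N = {x. norm (f x) \<le> real N \<and> \<bar>x\<bar> \<le> real N}" for N
 define g where "g N x = indicator (B N) x *\<^sub>R f x" for N x
 have [measurable]: "B N \<in> sets borel" for N unfolding B_def by measurable
 have [measurable]: "g N \<in> bm" for N unfolding g_def by measurable
 have gb: "norm (g N x) \<le> real N" for N x by (auto simp: g_def B_def indicator_def)
 have gi: "integrable lborel (g N)" for N
 proof (rule dominated_integrable[of _ "\<lambda>x. indicator {-real N..real N} x * real N"])
  show "integrable lborel (\<lambda>x. indicator {-real N..real N} x * real N)"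
   by (intro integrable_mult_left integrable_real_indicator) auto
  show "AE x in lborel. norm (g N x) \<le> norm (indicator {-real N..real N} x * real N)"
   by (rule AE_I2) (auto simp: g_def B_def indicator_def)
 qed measurable
 have gs2: "integrable lborel (\<lambda>x. (norm (f x - g N x))^2)" for N
  by (rule dominated_integrable[OF f2]) (auto simp: g_def indicator_def)
 have lim: "(\<lambda>N. LBINT x. (norm (f x - g N x))^2) \<longlonglongrightarrow> (\<integral>x. 0 \<partial>(lborel::real measure))"
 proof (rule integral_dominated_convergence[OF _ _ f2])
  show "AE x in lborel. (\<lambda>N. (norm (f x - g N x))^2) \<longlonglongrightarrow> 0"
  proof (rule AE_I2)
   fix x
   obtain M :: nat where M: "max (norm (f x)) \<bar>x\<bar> \<le> real M" using real_arch_simple by blast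
   have "\<forall>\<^sub>F N in sequentially. (norm (f x - g N x))^2 = 0"
    using eventually_ge_at_top[of M] by eventually_elim (use M in \<open>auto simp: g_def B_def indicator_def\<close>)
   then show "(\<lambda>N. (norm (f x - g N x))^2) \<longlonglongrightarrow> 0" by (rule tendsto_eventually)
  qed
 qed (auto simp: g_def indicator_def)
 show ?thesis
 proof (rule LIMSEQ_I)
  fix r :: real assume r: "r > 0"
  from LIMSEQ_D[OF lim, of "r/9"] r obtain N where N: "(LBINT x. (norm (f x - g N x))^2) < r/9"
   by auto
  have "(\<lambda>n. LBINT x. norm (g N (x + h n) - g N x)) \<longlonglongrightarrow> 0"
   using L1_trans_integrable[OF gi[of N]] h unfolding L1_trans_def by blast
  then have "(\<lambda>n. 2 * real N * (LBINT x. norm (g N (x + h n) - g N x))) \<longlonglongrightarrow> 2 * real N * 0"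
   by (intro tendsto_intros)
  from LIMSEQ_D[OF this, of "r/9"] r obtain n0 where n0: "\<And>n. n \<ge> n0 \<Longrightarrow> 2 * real N * (LBINT x. norm (g N (x + h n) - g N x)) < r/9"
   by auto
  have "norm ((LBINT x. (norm (f (x + h n) - f x))^2) - 0) < r" if n: "n \<ge> n0" for n
  proof -
   have i1: "integrable lborel (\<lambda>x. (norm (f (x + h n) - g N (x + h n)))^2)"
    by (rule integrable_lborel_shift[OF gs2])
   have i2: "integrable lborel (\<lambda>x. 2 * real N * norm (g N (x + h n) - g N x))"
    using gi[of N] integrable_lborel_shift[OF gi[of N], of "h n"] by auto
   have ptw: "(norm (f (x + h n) - f x))^2 \<le> 3 * (norm (f (x + h n) - g N (x + h n)))^2 + 3 * (2 * real N * norm (g N (x + h n) - g N x)) + 3 * (norm (f x - g N x))^2" for x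
   proof -
    define a b c where "a = norm (f (x + h n) - g N (x + h n))" and "b = norm (g N (x + h n) - g N x)" and "c = norm (f x - g N x)"
    have "norm (f (x + h n) - f x) \<le> a + b + c"
     using norm_triangle_ineq[of "f (x + h n) - g N (x + h n) + (g N (x + h n) - g N x)" "g N x - f x"]
      norm_triangle_ineq[of "f (x + h n) - g N (x + h n)" "g N (x + h n) - g N x"] norm_minus_commute[of "f x" "g N x"]
     by (simp add: a_def b_def c_def)
    then have "(norm (f (x + h n) - f x))^2 \<le> (a + b + c)^2" by (intro power_mono) auto
    also have "... \<le> 3 * a^2 + 3 * b^2 + 3 * c^2"
    proof -
     have "0 \<le> (a - b)^2 + (b - c)^2 + (a - c)^2" by simp
     then show ?thesis by (simp add: power2_eq_square algebra_simps)
    qed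
    also have "b^2 \<le> 2 * real N * b"
    proof -
     have "b \<le> 2 * real N" unfolding b_def
      using norm_triangle_ineq4[of "g N (x + h n)" "g N x"] gb[of N x] gb[of N "x + h n"] by linarith
     then show ?thesis unfolding power2_eq_square by (intro mult_right_mono) (auto simp: b_def)
    qed
    finally show ?thesis by (simp add: a_def b_def c_def)
   qed
   have "norm ((LBINT x. (norm (f (x + h n) - f x))^2) - 0) = (LBINT x. (norm (f (x + h n) - f x))^2)" by simp
   also have "... \<le> (LBINT x. 3 * (norm (f (x + h n) - g N (x + h n)))^2 + 3 * (2 * real N * norm (g N (x + h n) - g N x)) + 3 * (norm (f x - g N x))^2)"
    by (rule integral_mono') (use i1 i2 gs2 ptw in auto)
   also have "... = 3 * (LBINT x. (norm (f (x + h n) - g N (x + h n)))^2) + 3 * (LBINT x. 2 * real N * norm (g N (x + h n) - g N x)) + 3 * (LBINT x. (norm (f x - g N x))^2)"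
    using i1 i2 gs2 by (subst Bochner_Integration.integral_add; simp)
   also have "(LBINT x. (norm (f (x + h n) - g N (x + h n)))^2) = (LBINT x. (norm (f x - g N x))^2)"
    by (rule integral_lborel_shift[of "\<lambda>x. (norm (f x - g N x))^2"])
   also have "(LBINT x. 2 * real N * norm (g N (x + h n) - g N x)) = 2 * real N * (LBINT x. norm (g N (x + h n) - g N x))" by simp
   finally show ?thesis using N n0[OF n] by linarith
  qed
  then show "\<exists>no. \<forall>n\<ge>no. norm ((LBINT x. (norm (f (x + h n) - f x))^2) - 0) < r" by blast
 qed
qed

section \<open>Fourier transform and Plancherel\<close>

definition ft :: "(real \<Rightarrow> complex) \<Rightarrow> real \<Rightarrow> complex" where
 "ft g \<xi> = (LBINT x. g x * cis (- (\<xi> * x)))"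

definition conv :: "(real \<Rightarrow> complex) \<Rightarrow> (real \<Rightarrow> complex) \<Rightarrow> real \<Rightarrow> complex" where
 "conv f g x = (LBINT y. f y * g (x - y))"

lemma cis_measurable[measurable]: "cis \<in> bm"
 by (intro borel_measurable_continuous_onI continuous_intros)

lemma cnj_measurable[measurable]: "cnj \<in> bm"
 by (intro borel_measurable_continuous_onI continuous_intros)

lemma integrable_mult_cis:
 fixes g :: "'a \<Rightarrow> complex"
 assumes "integrable M g" and [measurable]: "h \<in> borel_measurable M"
 shows "integrable M (\<lambda>x. g x * cis (h x))"
 by (rule dominated_integrable[OF assms(1)]) (use assms(1) in \<open>auto simp: norm_mult\<close>)

lemma ft_bound: "norm (ft g \<xi>) \<le> (LBINT x. norm (g x))"
 unfolding ft_def using integral_norm_bound[of lborel "\<lambda>x. g x * cis (- (\<xi> * x))"] by (simp add: norm_mult)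

lemma ft_measurable[measurable]:
 assumes [measurable]: "g \<in> bm"
 shows "ft g \<in> bm"
 unfolding ft_def by measurable

lemma conv_measurable[measurable]:
 assumes [measurable]: "f \<in> bm" "g \<in> bm"
 shows "conv f g \<in> bm"
 unfolding conv_def by measurable

lemma integrable_conv_pair:
 assumes f: "integrable lborel f" and g: "integrable lborel g"
 shows "integrable (lborel \<Otimes>\<^sub>M lborel) (\<lambda>(y, x). (f y :: complex) * g (x - y :: real))"
proof (rule lborel_pair.Fubini_integrable)
 have [measurable]: "f \<in> bm" "g \<in> bm" using f g by auto
 show "(\<lambda>(y, x). f y * g (x - y)) \<in> borel_measurable (lborel \<Otimes>\<^sub>M lborel)" by measurable
 have gs: "integrable lborel (\<lambda>x. g (x - y))" for y using integrable_lborel_shift[OF g, of "-y"] by simp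
 have ng: "(LBINT x. norm (g (x - y))) = (LBINT x. norm (g x))" for y
  using integral_lborel_shift[of "\<lambda>x. norm (g x)" "-y"] by simp
 show "integrable lborel (\<lambda>y. LBINT x. norm (case (y, x) of (y, x) \<Rightarrow> f y * g (x - y)))"
  using f by (simp add: norm_mult ng)
 show "AE y in lborel. integrable lborel (\<lambda>x. case (y, x) of (y, x) \<Rightarrow> f y * g (x - y))"
  using gs by simp
qed

lemma conv_integrable:
 assumes f: "integrable lborel f" and g: "integrable lborel g"
 shows "integrable lborel (conv f g)"
 using lborel_pair.integrable_snd[OF integrable_conv_pair[OF f g]] unfolding conv_def .

lemma ft_conv:
 assumes f: "integrable lborel f" and g: "integrable lborel g"
 shows "ft (conv f g) \<xi> = ft f \<xi> * ft g \<xi>"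
proof -
 have [measurable]: "f \<in> bm" "g \<in> bm" using f g by auto
 have "integrable (lborel \<Otimes>\<^sub>M lborel) (\<lambda>p. (case p of (y, x) \<Rightarrow> f y * g (x - y)) * cis (- (\<xi> * snd p)))"
  by (rule integrable_mult_cis[OF integrable_conv_pair[OF f g]]) measurable
 then have I: "integrable (lborel \<Otimes>\<^sub>M lborel) (\<lambda>(y, x). f y * g (x - y) * cis (- (\<xi> * x)))"
  by (simp add: case_prod_unfold)
 have "ft (conv f g) \<xi> = (LBINT x. LBINT y. f y * g (x - y) * cis (- (\<xi> * x)))"
  unfolding ft_def conv_def by simp
 also have "... = (LBINT y. LBINT x. f y * g (x - y) * cis (- (\<xi> * x)))"
  by (rule lborel_pair.Fubini_integral[OF I])
 also have "... = (LBINT y. f y * cis (- (\<xi> * y)) * ft g \<xi>)"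
 proof (rule bochner_cong[OF refl])
  fix y
  have "(LBINT x. f y * g (x - y) * cis (- (\<xi> * x))) = (LBINT x. f y * g x * cis (- (\<xi> * (x + y))))"
   using integral_lborel_shift[of "\<lambda>x. f y * g (x - y) * cis (- (\<xi> * x))" y] by simp
  also have "... = (LBINT x. (f y * cis (- (\<xi> * y))) * (g x * cis (- (\<xi> * x))))"
   by (rule bochner_cong[OF refl]) (simp add: cis_mult algebra_simps)
  also have "... = f y * cis (- (\<xi> * y)) * ft g \<xi>" unfolding ft_def by simp
  finally show "(LBINT x. f y * g (x - y) * cis (- (\<xi> * x))) = f y * cis (- (\<xi> * y)) * ft g \<xi>" .
 qed
 also have "... = ft f \<xi> * ft g \<xi>" by (simp add: ft_def)
 finally show ?thesis .
qed

section \<open>Gaussian summation and the Plancherel identity\<close>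

lemma gauss_ft1:
 "(LBINT x. cx (exp (- (x^2) / 2)) * cis (t * x)) = cx (sqrt (2*pi) * exp (- (t^2) / 2))"
 "integrable lborel (\<lambda>x. exp (- (x^2) / 2) :: real)"
proof -
 have "char std_normal_distribution t = (LBINT x. std_normal_density x *\<^sub>R iexp (t * x))"
  unfolding char_def by (subst integral_density) (auto)
 also have "... = (LBINT x. cx (1 / sqrt (2*pi)) * (cx (exp (- (x^2) / 2)) * cis (t * x)))"
  by (rule bochner_cong[OF refl]) (simp add: std_normal_density_def scaleR_conv_of_real cis_conv_exp)
 also have "... = cx (1 / sqrt (2*pi)) * (LBINT x. cx (exp (- (x^2) / 2)) * cis (t * x))"
  by (rule integral_mult_right_zero)
 finally have *: "cx (1 / sqrt (2*pi)) * (LBINT x. cx (exp (- (x^2) / 2)) * cis (t * x)) = cx (exp (- (t^2) / 2))"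
  by (simp add: char_std_normal_distribution)
 have "(LBINT x. cx (exp (- (x^2) / 2)) * cis (t * x)) = cx (sqrt (2*pi)) * (cx (1 / sqrt (2*pi)) * (LBINT x. cx (exp (- (x^2) / 2)) * cis (t * x)))"
  by (simp del: of_real_divide flip: of_real_mult mult.assoc)
 then show "(LBINT x. cx (exp (- (x^2) / 2)) * cis (t * x)) = cx (sqrt (2*pi) * exp (- (t^2) / 2))"
  unfolding * by simp
 have "integrable lborel (\<lambda>x. sqrt (2*pi) * std_normal_density x)"
  by (intro integrable_mult_right integrable_normal_density) simp
 then show "integrable lborel (\<lambda>x. exp (- (x^2) / 2) :: real)"
  by (simp add: std_normal_density_def)
qed

lemma gauss_ft:
 assumes "d > 0"
 shows "(LBINT x. cx (exp (- ((d * x)^2) / 2)) * cis (- (x * u))) = cx (sqrt (2*pi) / d * exp (- ((u / d)^2) / 2))"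
proof -
 have "(LBINT x. cx (exp (- ((d * x)^2) / 2)) * cis (- (x * u))) =
  (LBINT x. (\<lambda>x. cx (exp (- (x^2) / 2)) * cis ((- u / d) * x)) (d * x))"
  using assms by (intro bochner_cong[OF refl]) (simp add: field_simps)
 also have "... = (LBINT x. cx (exp (- (x^2) / 2)) * cis ((- u / d) * x)) /\<^sub>R \<bar>d\<bar>"
  using assms by (subst integral_lborel_scale) auto
 also have "... = cx (sqrt (2*pi) / d * exp (- ((u / d)^2) / 2))"
  unfolding gauss_ft1(1) using assms by (simp add: scaleR_conv_of_real field_simps)
 finally show ?thesis .
qed

lemma integral_lborel_rescale:
 fixes f :: "real \<Rightarrow> complex"
 assumes "e > 0"
 shows "(LBINT x. f x) = (LBINT x. f (e * x)) * e"
 using assms by (subst integral_lborel_scale) (auto simp: scaleR_conv_of_real)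

text \<open>Moving the transform onto the Gaussian turns the left side into an average of
  \<open>C\<close> over a window of width \<open>d n\<close>, so continuity at 0 decides the limit.
  Inversion at this one point is enough for Plancherel.\<close>

lemma ft_inversion_zero:
 assumes C: "integrable lborel C" and b: "\<And>x. norm (C x) \<le> K"
  and c0: "\<And>h::nat \<Rightarrow> real. h \<longlonglongrightarrow> 0 \<Longrightarrow> (\<lambda>n. C (h n)) \<longlonglongrightarrow> C 0"
  and d: "d \<longlonglongrightarrow> 0" "\<And>n. d n > (0::real)"
 shows "(\<lambda>n. LBINT \<xi>. cx (exp (- ((d n * \<xi>)^2) / 2)) * ft C \<xi>) \<longlonglongrightarrow> cx (2 * pi) * C 0"
proof -
 have [measurable]: "C \<in> bm" using C by auto
 have gi: "integrable lborel (\<lambda>\<xi>. exp (- ((d n * \<xi>)^2) / 2))" for n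
  using integrable_lborel_scale[OF gauss_ft1(2), of "d n"] d(2)[of n] by auto
 have eq: "(LBINT \<xi>. cx (exp (- ((d n * \<xi>)^2) / 2)) * ft C \<xi>) =
  (LBINT z. cx (sqrt (2*pi) * exp (- (z^2) / 2)) * C (d n * z))" for n
 proof -
  define e where "e = d n"
  have e: "e > 0" using d by (simp add: e_def)
  have I: "integrable (lborel \<Otimes>\<^sub>M lborel) (\<lambda>(\<xi>, u). cx (exp (- ((e * \<xi>)^2) / 2)) * (C u * cis (- (\<xi> * u))))"
  proof (rule lborel_pair.Fubini_integrable)
   show "(\<lambda>(\<xi>, u). cx (exp (- ((e * \<xi>)^2) / 2)) * (C u * cis (- (\<xi> * u)))) \<in> borel_measurable (lborel \<Otimes>\<^sub>M lborel)"
    by measurable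
   show "integrable lborel (\<lambda>\<xi>. LBINT u. norm (case (\<xi>, u) of (\<xi>, u) \<Rightarrow> cx (exp (- ((e * \<xi>)^2) / 2)) * (C u * cis (- (\<xi> * u)))))"
    using gi[of n] by (simp add: norm_mult e_def)
   show "AE \<xi> in lborel. integrable lborel (\<lambda>u. case (\<xi>, u) of (\<xi>, u) \<Rightarrow> cx (exp (- ((e * \<xi>)^2) / 2)) * (C u * cis (- (\<xi> * u))))"
    by (simp, intro AE_I2 impI integrable_mult_right integrable_mult_cis C) measurable
  qed
  have "(LBINT \<xi>. cx (exp (- ((e * \<xi>)^2) / 2)) * ft C \<xi>) =
   (LBINT \<xi>. LBINT u. cx (exp (- ((e * \<xi>)^2) / 2)) * (C u * cis (- (\<xi> * u))))"
   unfolding ft_def by simp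
  also have "... = (LBINT u. LBINT \<xi>. cx (exp (- ((e * \<xi>)^2) / 2)) * (C u * cis (- (\<xi> * u))))"
   by (rule lborel_pair.Fubini_integral[OF I, symmetric])
  also have "... = (LBINT u. C u * cx (sqrt (2*pi) / e * exp (- ((u / e)^2) / 2)))"
   unfolding gauss_ft[OF e, symmetric]
   by (simp add: mult.left_commute[of _ "C _"] flip: integral_mult_right_zero)
  also have "... = (LBINT z. C (e * z) * cx (sqrt (2*pi) / e * exp (- ((e * z / e)^2) / 2))) * e"
   by (rule integral_lborel_rescale[OF e])
  also have "... = (LBINT z. C (e * z) * cx (sqrt (2*pi) / e * exp (- ((e * z / e)^2) / 2)) * e)"
   by simp
  also have "... = (LBINT z. cx (sqrt (2*pi) * exp (- (z^2) / 2)) * C (e * z))"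
   using e by (intro bochner_cong[OF refl]) simp
  finally show ?thesis unfolding e_def .
 qed
 have "(\<lambda>n. LBINT z. cx (sqrt (2*pi) * exp (- (z^2) / 2)) * C (d n * z)) \<longlonglongrightarrow>
  (LBINT z. cx (sqrt (2*pi) * exp (- (z^2) / 2)) * C 0)"
 proof (rule integral_dominated_convergence[where w="\<lambda>z. sqrt (2*pi) * exp (- (z^2) / 2) * K"])
  show "integrable lborel (\<lambda>z. sqrt (2*pi) * exp (- (z^2) / 2) * K)" using gauss_ft1(2) by simp
  show "AE z in lborel. (\<lambda>n. cx (sqrt (2*pi) * exp (- (z^2) / 2)) * C (d n * z)) \<longlonglongrightarrow> cx (sqrt (2*pi) * exp (- (z^2) / 2)) * C 0"
  proof (intro AE_I2 tendsto_intros c0)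
   fix z show "(\<lambda>n. d n * z) \<longlonglongrightarrow> 0" using tendsto_mult_right[OF d(1), of z] by simp
  qed
  show "AE z in lborel. norm (cx (sqrt (2*pi) * exp (- (z^2) / 2)) * C (d n * z)) \<le> sqrt (2*pi) * exp (- (z^2) / 2) * K" for n
   by (intro AE_I2) (auto simp: norm_mult abs_mult intro!: mult_left_mono b)
 qed measurable
 also have "(LBINT z. cx (sqrt (2*pi) * exp (- (z^2) / 2)) * C 0) = cx (2 * pi) * C 0"
  using gauss_ft1(1)[of 0] by (simp flip: of_real_mult)
 finally show ?thesis unfolding eq .
qed


lemma ft_refl_cnj: "ft (\<lambda>x. cnj (k (- x))) \<xi> = cnj (ft k \<xi>)"
proof -
 have "ft (\<lambda>x. cnj (k (- x))) \<xi> = (LBINT x. (\<lambda>x. cnj (k x) * cis (\<xi> * x)) (0 - x))"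
  unfolding ft_def by simp
 also have "... = (LBINT x. cnj (k x) * cis (\<xi> * x))" by (rule integral_lborel_minus)
 also have "... = (LBINT x. cnj (k x * cis (- (\<xi> * x))))" by (simp add: cis_cnj)
 also have "... = cnj (ft k \<xi>)" unfolding ft_def by (rule Bochner_Integration.integral_cnj)
 finally show ?thesis .
qed

text \<open>The correlation \<open>C\<close> of \<open>g\<close> and \<open>k\<close> has transform
  \<open>ft g * cnj (ft k)\<close> and value at 0 equal to the inner product, so inversion at 0 is
  Plancherel with a Gaussian weight. Its continuity at 0 is that of translations in L2.\<close>

lemma plancherel_aux:
 assumes g1: "integrable lborel g" and g2: "sq_integrable g"
  and k1: "integrable lborel k" and k2: "sq_integrable k"
  and d: "d \<longlonglongrightarrow> 0" "\<And>n. d n > (0::real)"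
 shows "(\<lambda>n. LBINT \<xi>. cx (exp (- ((d n * \<xi>)^2) / 2)) * (ft g \<xi> * cnj (ft k \<xi>))) \<longlonglongrightarrow>
  cx (2 * pi) * (LBINT x. g x * cnj (k x))"
proof -
 have [measurable]: "g \<in> bm" "k \<in> bm" using g1 k1 by auto
 define k' where "k' x = cnj (k (- x))" for x
 have k'1: "integrable lborel k'" unfolding k'_def using integrable_lborel_minus[OF k1, of 0] by simp
 define C where "C = conv g k'"
 have Cu: "C u = (LBINT y. g y * cnj (k (y - u)))" for u
  unfolding C_def conv_def k'_def by simp
 have ks2: "integrable lborel (\<lambda>x. (norm (cnj (k (x - u))))^2)" for u
  using integrable_lborel_shift[OF k2, of "-u"] by simp
 have "(\<lambda>n. LBINT \<xi>. cx (exp (- ((d n * \<xi>)^2) / 2)) * ft C \<xi>) \<longlonglongrightarrow> cx (2 * pi) * C 0"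
 proof (rule ft_inversion_zero[OF _ _ _ d])
  show "integrable lborel C" unfolding C_def by (rule conv_integrable[OF g1 k'1])
  show "norm (C u) \<le> sqrt (LBINT x. (norm (g x))^2) * sqrt (LBINT x. (norm (k x))^2)" for u
  proof -
   have "norm (C u) \<le> sqrt (LBINT x. (norm (g x))^2) * sqrt (LBINT x. (norm (cnj (k (x - u))))^2)"
    unfolding Cu by (rule CS_integral_norm; ((use g2 ks2 in simp; fail) | measurable))
   also have "(LBINT x. (norm (cnj (k (x - u))))^2) = (LBINT x. (norm (k x))^2)"
    using integral_lborel_shift[of "\<lambda>x. (norm (k x))^2" "-u"] by simp
   finally show ?thesis .
  qed
  fix h :: "nat \<Rightarrow> real" assume h: "h \<longlonglongrightarrow> 0"
  have h': "(\<lambda>n. - h n) \<longlonglongrightarrow> 0" using tendsto_minus[OF h] by simp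
  have "(\<lambda>n. sqrt (LBINT x. (norm (g x))^2) * sqrt (LBINT x. (norm (k (x + - h n) - k x))^2)) \<longlonglongrightarrow> sqrt (LBINT x. (norm (g x))^2) * sqrt 0"
   by (intro tendsto_intros L2_trans k2 h') measurable
  then have lim: "(\<lambda>n. sqrt (LBINT x. (norm (g x))^2) * sqrt (LBINT x. (norm (k (x + - h n) - k x))^2)) \<longlonglongrightarrow> 0" by simp
  have "(\<lambda>n. C (h n) - C 0) \<longlonglongrightarrow> 0"
  proof (rule Lim_null_comparison[OF _ lim], rule always_eventually, rule allI)
   fix n
   have i: "integrable lborel (\<lambda>y. g y * cnj (k (y - u)))" for u
    by (rule integrable_mult_L2; ((use g2 ks2 in simp; fail) | measurable))
   have "C (h n) - C 0 = (LBINT y. g y * cnj (k (y + - h n) - k y))"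
    unfolding Cu using i[of "h n"] i[of 0] by (simp add: algebra_simps)
   also have "norm ... \<le> sqrt (LBINT x. (norm (g x))^2) * sqrt (LBINT x. (norm (cnj (k (x + - h n) - k x)))^2)"
   proof (rule CS_integral_norm)
    show "integrable lborel (\<lambda>x. (norm (cnj (k (x + - h n) - k x)))^2)"
    proof (rule dominated_integrable)
     show "integrable lborel (\<lambda>x. 2 * (norm (cnj (k (x - h n))))^2 + 2 * (norm (k x))^2)" using ks2[of "h n"] k2 by auto
     show "AE x in lborel. norm ((norm (cnj (k (x + - h n) - k x)))^2) \<le> norm (2 * (norm (cnj (k (x - h n))))^2 + 2 * (norm (k x))^2)"
     proof (rule AE_I2)
      fix x
      have "(norm (k (x - h n) - k x))^2 \<le> (norm (k (x - h n)) + norm (k x))^2"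
       by (intro power_mono norm_triangle_ineq4) auto
      also have "... \<le> 2 * (norm (k (x - h n)))^2 + 2 * (norm (k x))^2"
       using sum_squares_bound[of "norm (k (x - h n))" "norm (k x)"] by (simp add: power2_sum)
      finally show "norm ((norm (cnj (k (x + - h n) - k x)))^2) \<le> norm (2 * (norm (cnj (k (x - h n))))^2 + 2 * (norm (k x))^2)"
       by (simp del: complex_cnj_diff)
     qed
    qed measurable
   qed (use g2 in auto)
   finally show "norm (C (h n) - C 0) \<le> sqrt (LBINT x. (norm (g x))^2) * sqrt (LBINT x. (norm (k (x + - h n) - k x))^2)"
    by (simp del: complex_cnj_diff)
  qed
  then show "(\<lambda>n. C (h n)) \<longlonglongrightarrow> C 0" by (simp add: LIM_zero_iff)
 qed
 moreover have "ft C \<xi> = ft g \<xi> * cnj (ft k \<xi>)" for \<xi>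
  unfolding C_def ft_conv[OF g1 k'1] unfolding k'_def ft_refl_cnj ..
 ultimately show ?thesis unfolding Cu by simp
qed

lemma gauss_weight_lim:
 assumes "d \<longlonglongrightarrow> 0"
 shows "(\<lambda>n. exp (- ((d n * \<xi>)^2) / 2)) \<longlonglongrightarrow> (1::real)"
proof -
 have "(\<lambda>n. exp (- ((d n * \<xi>)^2) / 2)) \<longlonglongrightarrow> exp (- ((0 * \<xi>)^2) / (2::real))"
  by (intro tendsto_intros assms) auto
 then show ?thesis by simp
qed

text \<open>The weighted identity with \<open>k = g\<close> serves first as a uniform bound; Fatou's
  lemma then removes the weight and provides the majorant for dominated convergence in
  \<open>plancherel\<close>.\<close>

lemma ft_L2:
 assumes g1: "integrable lborel g" and g2: "sq_integrable g"
 shows "integrable lborel (\<lambda>\<xi>. (norm (ft g \<xi>))^2)"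
proof -
 have [measurable]: "g \<in> bm" using g1 by auto
 define d where "d n = inverse (real (Suc n))" for n
 have d: "d \<longlonglongrightarrow> 0" "\<And>n. d n > 0" unfolding d_def using LIMSEQ_inverse_real_of_nat by auto
 have eq: "cx (exp (- ((d n * \<xi>)^2) / 2)) * (ft g \<xi> * cnj (ft g \<xi>)) = cx (exp (- ((d n * \<xi>)^2) / 2) * (norm (ft g \<xi>))^2)" for n \<xi>
  by (simp add: complex_norm_square[symmetric] del: of_real_exp)
 define I where "I n = (LBINT \<xi>. exp (- ((d n * \<xi>)^2) / 2) * (norm (ft g \<xi>))^2)" for n
 have "(\<lambda>n. cx (I n)) \<longlonglongrightarrow> cx (2 * pi) * (LBINT x. g x * cnj (g x))"
  using plancherel_aux[OF g1 g2 g1 g2 d] unfolding eq integral_complex_of_real I_def[symmetric] .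
 then have "convergent (\<lambda>n. cx (I n))" by (auto simp: convergent_def)
 then have "Bseq (\<lambda>n. cx (I n))" by (rule convergent_imp_Bseq)
 then obtain K where K: "\<And>n. \<bar>I n\<bar> \<le> K" by (auto simp: Bseq_def)
 have ig: "integrable lborel (\<lambda>\<xi>. exp (- ((d n * \<xi>)^2) / 2) * (norm (ft g \<xi>))^2)" for n
 proof (rule dominated_integrable)
  have "integrable lborel (\<lambda>\<xi>. exp (- ((d n * \<xi>)^2) / 2))"
   using integrable_lborel_scale[OF gauss_ft1(2), of "d n"] d(2)[of n] by auto
  then show "integrable lborel (\<lambda>\<xi>. exp (- ((d n * \<xi>)^2) / 2) * (LBINT x. norm (g x))^2)" by simp
  show "AE \<xi> in lborel. norm (exp (- ((d n * \<xi>)^2) / 2) * (norm (ft g \<xi>))^2) \<le> norm (exp (- ((d n * \<xi>)^2) / 2) * (LBINT x. norm (g x))^2)"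
   by (intro AE_I2) (auto simp: abs_mult intro!: power_mono ft_bound)
 qed measurable
 have "(NINT \<xi>. ennreal ((norm (ft g \<xi>))^2)) = (NINT \<xi>. liminf (\<lambda>n. ennreal (exp (- ((d n * \<xi>)^2) / 2) * (norm (ft g \<xi>))^2)))"
 proof (rule nn_integral_cong)
  fix \<xi>
  have "(\<lambda>n. ennreal (exp (- ((d n * \<xi>)^2) / 2) * (norm (ft g \<xi>))^2)) \<longlonglongrightarrow> ennreal (1 * (norm (ft g \<xi>))^2)"
   by (intro tendsto_ennrealI tendsto_mult tendsto_const gauss_weight_lim d)
  from lim_imp_Liminf[OF trivial_limit_sequentially this]
  show "ennreal ((norm (ft g \<xi>))^2) = liminf (\<lambda>n. ennreal (exp (- ((d n * \<xi>)^2) / 2) * (norm (ft g \<xi>))^2))"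
   by (simp only: mult_1)
 qed
 also have "... \<le> liminf (\<lambda>n. (NINT \<xi>. ennreal (exp (- ((d n * \<xi>)^2) / 2) * (norm (ft g \<xi>))^2)))"
  by (rule nn_integral_liminf) measurable
 also have "... \<le> liminf (\<lambda>n::nat. ennreal K)"
 proof (rule Liminf_mono, rule always_eventually, rule allI)
  fix n
  have "(NINT \<xi>. ennreal (exp (- ((d n * \<xi>)^2) / 2) * (norm (ft g \<xi>))^2)) = ennreal (I n)"
   unfolding I_def by (rule nn_integral_eq_integral[OF ig]) auto
  also have "... \<le> ennreal K" using K[of n] by (intro ennreal_leI) auto
  finally show "(NINT \<xi>. ennreal (exp (- ((d n * \<xi>)^2) / 2) * (norm (ft g \<xi>))^2)) \<le> ennreal K" .
 qed
 also have "... < \<infinity>" by (simp add: Liminf_const)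
 finally show ?thesis by (intro integrableI_nonneg) auto
qed

lemma plancherel:
 assumes g1: "integrable lborel g" and g2: "sq_integrable g"
  and k1: "integrable lborel k" and k2: "sq_integrable k"
 shows "integrable lborel (\<lambda>\<xi>. ft g \<xi> * cnj (ft k \<xi>))"
  and "(LBINT \<xi>. ft g \<xi> * cnj (ft k \<xi>)) = cx (2 * pi) * (LBINT x. g x * cnj (k x))"
proof -
 have [measurable]: "g \<in> bm" "k \<in> bm" using g1 k1 by auto
 define d where "d n = inverse (real (Suc n))" for n
 have d: "d \<longlonglongrightarrow> 0" "\<And>n. d n > 0" unfolding d_def using LIMSEQ_inverse_real_of_nat by auto
 show i: "integrable lborel (\<lambda>\<xi>. ft g \<xi> * cnj (ft k \<xi>))"
  by (rule integrable_mult_L2) (use ft_L2[OF g1 g2] ft_L2[OF k1 k2] in auto)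
 have "(\<lambda>n. LBINT \<xi>. cx (exp (- ((d n * \<xi>)^2) / 2)) * (ft g \<xi> * cnj (ft k \<xi>))) \<longlonglongrightarrow> (LBINT \<xi>. ft g \<xi> * cnj (ft k \<xi>))"
 proof (rule integral_dominated_convergence[OF _ _ integrable_norm[OF i]])
  show "AE \<xi> in lborel. (\<lambda>n. cx (exp (- ((d n * \<xi>)^2) / 2)) * (ft g \<xi> * cnj (ft k \<xi>))) \<longlonglongrightarrow> ft g \<xi> * cnj (ft k \<xi>)"
  proof (rule AE_I2)
   fix \<xi>
   have "(\<lambda>n. cx (exp (- ((d n * \<xi>)^2) / 2)) * (ft g \<xi> * cnj (ft k \<xi>))) \<longlonglongrightarrow> cx 1 * (ft g \<xi> * cnj (ft k \<xi>))"
    by (intro tendsto_intros gauss_weight_lim d)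
   then show "(\<lambda>n. cx (exp (- ((d n * \<xi>)^2) / 2)) * (ft g \<xi> * cnj (ft k \<xi>))) \<longlonglongrightarrow> ft g \<xi> * cnj (ft k \<xi>)" by simp
  qed
  show "AE \<xi> in lborel. norm (cx (exp (- ((d n * \<xi>)^2) / 2)) * (ft g \<xi> * cnj (ft k \<xi>))) \<le> norm (ft g \<xi> * cnj (ft k \<xi>))" for n
   by (intro AE_I2) (auto simp: norm_mult intro!: mult_left_le_one_le)
 qed measurable
 from LIMSEQ_unique[OF this plancherel_aux[OF g1 g2 k1 k2 d]]
 show "(LBINT \<xi>. ft g \<xi> * cnj (ft k \<xi>)) = cx (2 * pi) * (LBINT x. g x * cnj (k x))" .
qed

lemma plancherel_norm:
 assumes g1: "integrable lborel g" and g2: "sq_integrable g"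
 shows "(LBINT \<xi>. (norm (ft g \<xi>))^2) = 2 * pi * (LBINT x. (norm (g x))^2)"
proof -
 have "cx (LBINT \<xi>. (norm (ft g \<xi>))^2) = cx (2 * pi * (LBINT x. (norm (g x))^2))"
  using plancherel(2)[OF g1 g2 g1 g2] by (simp flip: complex_norm_square of_real_power)
 then show ?thesis by (simp only: of_real_eq_iff)
qed

section \<open>Wave packets\<close>

lemma norm_cis_diff: "norm (cis a - cis b) \<le> \<bar>a - b\<bar>"
proof -
 have s: "1 - cos (a - b) = 2 * (sin ((a - b) / 2))^2"
  using cos_double_sin[of "(a - b) / 2"] by (simp only: nonzero_mult_div_cancel_left times_divide_eq_right)
 have "(norm (cis a - cis b))^2 = (cos a - cos b)^2 + (sin a - sin b)^2"
  by (simp add: cmod_power2)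
 also have "... = 2 - 2 * cos (a - b)"
  using sin_cos_squared_add[of a] sin_cos_squared_add[of b] unfolding cos_diff power2_eq_square
  by (simp add: algebra_simps)
 also have "... = 4 * (sin ((a - b) / 2))^2" using s by simp
 also have "... \<le> 4 * ((a - b) / 2)^2"
  using abs_le_square_iff[THEN iffD1, OF abs_sin_x_le_abs_x[of "(a - b) / 2"]] by linarith
 also have "... = \<bar>a - b\<bar>^2" by (simp add: power2_eq_square field_simps)
 finally show ?thesis by (rule power2_le_imp_le) simp
qed

lemma integrable_indicator_Icc: "integrable lborel (indicator {a..b} :: real \<Rightarrow> real)"
 by (rule integrable_real_indicator) (simp_all add: emeasure_lborel_Icc_eq)

section \<open>The window \<open>phi\<close> and its Fourier support\<close>

definition chi :: "real \<Rightarrow> complex" where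
 "chi x = indicator {-1/4..1/4} x *\<^sub>R 2"

definition sincq :: "real \<Rightarrow> real" where
 "sincq x = (if x = 0 then 1 else 4 * sin (x / 4) / x)"

lemma chi_measurable[measurable]: "chi \<in> bm"
 unfolding chi_def by measurable

lemma chi_integrable: "integrable lborel chi"
 unfolding chi_def by (intro integrable_scaleR_left integrable_indicator_Icc)

lemma ft_chi: "ft chi x = cx (sincq x)"
proof (cases "x = 0")
 case True
 have "ft chi x = (LBINT y. indicator {-1/4..1/4::real} y *\<^sub>R (2::complex))"
  unfolding ft_def chi_def using True by simp
 also have "... = 1" by (subst Bochner_Integration.integral_scaleR_left) (auto intro: integrable_indicator_Icc simp: scaleR_conv_of_real)
 finally show ?thesis using True by (simp add: sincq_def)
next
 case False
 define F where "F y = (2 * \<i> / x) * cis (- (x * y))" for y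
 have "ft chi x = (LBINT y. indicator {-1/4..1/4::real} y *\<^sub>R (2 * cis (- (x * y))))"
  unfolding ft_def chi_def by simp
 also have "... = F (1/4) - F (-1/4)"
 proof (rule integral_FTC_atLeastAtMost)
  show "(F has_vector_derivative 2 * cis (- (x * y))) (at y within {-1/4..1/4})" for y
  proof -
   have D: "(F has_derivative (\<lambda>t. (2 * \<i> / x) * ((- (x * t)) *\<^sub>R (\<i> * cis (- (x * y)))))) (at y within {-1/4..1/4})"
    unfolding F_def by (intro has_derivative_mult_right has_derivative_cis has_derivative_minus has_derivative_ident)
   have "(\<lambda>t. (2 * \<i> / x) * ((- (x * t)) *\<^sub>R (\<i> * cis (- (x * y))))) = (\<lambda>t. t *\<^sub>R (2 * cis (- (x * y))))"
   proof (rule ext)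
    fix t
    have g: "(2 * \<i> * u) * (- (z * s) * (\<i> * c)) = - (\<i> * \<i>) * (z * u) * (s * (2 * c))" for u z s c :: complex
     by algebra
    have z: "cx x * inverse (cx x) = 1" using False by simp
    show "(2 * \<i> / x) * ((- (x * t)) *\<^sub>R (\<i> * cis (- (x * y)))) = t *\<^sub>R (2 * cis (- (x * y)))"
     unfolding scaleR_conv_of_real of_real_minus of_real_mult divide_inverse g z by (simp del: times_complex.sel)
   qed
   with D show ?thesis unfolding has_vector_derivative_def by simp
  qed
  show "continuous_on {-1/4..1/4} (\<lambda>y. 2 * cis (- (x * y)))" by (intro continuous_intros)
 qed auto
 also have "... = cx (sincq x)"
  unfolding F_def sincq_def using False by (simp add: complex_eq_iff)
 finally show ?thesis .
qed

lemma sincq_measurable[measurable]: "sincq \<in> bm"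
 unfolding sincq_def by measurable

lemma sincq_bound1: "\<bar>sincq x\<bar> \<le> 1"
 using abs_sin_x_le_abs_x[of "x / 4"] by (auto simp: sincq_def abs_mult field_simps)

lemma sincq_bound: "\<bar>sincq x\<bar> \<le> 5 / (1 + \<bar>x\<bar>)"
proof -
 have "\<bar>x\<bar> * \<bar>sincq x\<bar> \<le> 4" by (auto simp: sincq_def abs_mult)
 then have "(1 + \<bar>x\<bar>) * \<bar>sincq x\<bar> \<le> 5" using sincq_bound1[of x] by (simp add: distrib_right)
 then show ?thesis by (simp add: field_simps)
qed

lemma sincq_lip: "\<bar>sincq x - sincq y\<bar> \<le> \<bar>x - y\<bar>"
proof -
 have "\<bar>sincq x - sincq y\<bar> = norm (ft chi x - ft chi y)"
  unfolding ft_chi by (metis norm_of_real of_real_diff)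
 also have "ft chi x - ft chi y = (LBINT u. chi u * (cis (- (x * u)) - cis (- (y * u))))"
  unfolding ft_def right_diff_distrib
  by (subst Bochner_Integration.integral_diff) (auto intro!: integrable_mult_cis chi_integrable)
 also have "norm ... \<le> (LBINT u. norm (chi u * (cis (- (x * u)) - cis (- (y * u)))))" by simp
 also have "... \<le> (LBINT u. indicator {-1/4..1/4::real} u * \<bar>x - y\<bar> * 2)"
 proof (rule integral_mono')
  show "integrable lborel (\<lambda>u. indicator {-1/4..1/4::real} u * \<bar>x - y\<bar> * 2)"
   by (intro integrable_mult_left integrable_indicator_Icc)
  fix u :: real
  show "norm (chi u * (cis (- (x * u)) - cis (- (y * u)))) \<le> indicator {-1/4..1/4::real} u * \<bar>x - y\<bar> * 2"
  proof (cases "u \<in> {-1/4..1/4}")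
   case True
   have "norm (cis (- (x * u)) - cis (- (y * u))) \<le> \<bar>- (x * u) - - (y * u)\<bar>" by (rule norm_cis_diff)
   also have "... = \<bar>x - y\<bar> * \<bar>u\<bar>" unfolding abs_mult[symmetric] by (simp add: algebra_simps abs_minus_commute)
   also have "... \<le> \<bar>x - y\<bar> * 1" by (rule mult_left_mono) (use True in auto)
   finally have le: "norm (cis (- (x * u)) - cis (- (y * u))) \<le> \<bar>x - y\<bar>" by simp
   have c: "norm (chi u) = 2" using True by (simp add: chi_def)
   show ?thesis unfolding norm_mult c using True le by simp
  qed (auto simp: chi_def)
 qed auto
 also have "... = \<bar>x - y\<bar>" by simp
 finally show ?thesis .
qed

text \<open>An even power makes the window nonnegative, hence also the kernel \<open>GG\<close>. The
  exponent four gives decay of order four, which later estimates divide between integrability and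
  separation.\<close>

definition phi :: "real \<Rightarrow> real" where "phi x = (sincq x)^4"

lemma phi_measurable[measurable]: "phi \<in> bm"
 unfolding phi_def by measurable

lemma phi_nonneg: "phi x \<ge> 0" by (simp add: phi_def)
lemma phi_0: "phi 0 = 1" by (simp add: phi_def sincq_def)
lemma phi_minus: "phi (- x) = phi x" by (simp add: phi_def sincq_def)

lemma phi_le: "phi x \<le> 625 / (1 + \<bar>x\<bar>)^4"
proof -
 have "phi x = \<bar>sincq x\<bar>^4" by (simp add: phi_def)
 also have "... \<le> (5 / (1 + \<bar>x\<bar>))^4" by (intro power_mono sincq_bound) auto
 finally show ?thesis by (simp add: power_divide)
qed

lemma phi_le1: "phi x \<le> 1"
proof -
 have "phi x = \<bar>sincq x\<bar>^4" by (simp add: phi_def)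
 also have "... \<le> 1^4" by (intro power_mono sincq_bound1) auto
 finally show ?thesis by simp
qed

lemma pow4_diff: "(a::real)^4 - b^4 = (a - b) * (a^3 + a^2 * b + a * b^2 + b^3)"
 by (simp add: power2_eq_square power3_eq_cube power4_eq_xxxx algebra_simps)

text \<open>In the factorisation of \<open>a^4 - b^4\<close> the linear factor is controlled by the
  Lipschitz bound of \<open>sincq\<close>, the cubic one by decay. The hypothesis makes
  \<open>1 + |x|\<close> and \<open>1 + |z|\<close> comparable, so both values are at most
  \<open>10 / (1 + |z|)\<close>, whence \<open>4 * 10^3\<close>.\<close>

lemma phi_lip:
 assumes "\<bar>x - z\<bar> \<le> (1 + \<bar>z\<bar>) / 2"
 shows "\<bar>phi x - phi z\<bar> \<le> 4000 * \<bar>x - z\<bar> / (1 + \<bar>z\<bar>)^3"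
proof -
 define B where "B = 10 / (1 + \<bar>z\<bar>)"
 have B0: "B \<ge> 0" by (simp add: B_def)
 have "1 + \<bar>z\<bar> \<le> 2 * (1 + \<bar>x\<bar>)" using assms by (auto simp: abs_real_def split: if_splits)
 then have "5 / (1 + \<bar>x\<bar>) \<le> B" unfolding B_def by (simp add: field_simps)
 then have a: "\<bar>sincq x\<bar> \<le> B" using sincq_bound[of x] by linarith
 have "5 / (1 + \<bar>z\<bar>) \<le> B" unfolding B_def by (intro divide_right_mono) auto
 then have b: "\<bar>sincq z\<bar> \<le> B" using sincq_bound[of z] by linarith
 have "\<bar>(sincq x)^3 + (sincq x)^2 * sincq z + sincq x * (sincq z)^2 + (sincq z)^3\<bar> \<le>
  \<bar>sincq x\<bar>^3 + \<bar>sincq x\<bar>^2 * \<bar>sincq z\<bar> + \<bar>sincq x\<bar> * \<bar>sincq z\<bar>^2 + \<bar>sincq z\<bar>^3"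
  by (simp only: power_abs[symmetric] abs_mult[symmetric])
 also have "... \<le> B^3 + B^2 * B + B * B^2 + B^3"
  by (intro add_mono mult_mono power_mono a b) (auto simp: B0)
 also have "... = 4 * B^3" by (simp add: power2_eq_square power3_eq_cube)
 finally have 1: "\<bar>(sincq x)^3 + (sincq x)^2 * sincq z + sincq x * (sincq z)^2 + (sincq z)^3\<bar> \<le> 4 * B^3" .
 have "\<bar>phi x - phi z\<bar> \<le> \<bar>x - z\<bar> * (4 * B^3)"
  unfolding phi_def pow4_diff abs_mult by (intro mult_mono sincq_lip 1) auto
 also have "... = 4000 * \<bar>x - z\<bar> / (1 + \<bar>z\<bar>)^3" by (simp add: B_def power_divide)
 finally show ?thesis .
qed

lemma conv_bound:
 assumes f: "\<And>x. norm (f x) \<le> K" and g: "integrable lborel g" and [measurable]: "f \<in> bm"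
 shows "norm (conv f g x) \<le> K * (LBINT x. norm (g x))"
proof -
 have [measurable]: "g \<in> bm" using g by auto
 have gi: "integrable lborel (\<lambda>y. K * norm (g (x - y)))" using integrable_lborel_minus[OF g, of x] by simp
 have "norm (conv f g x) \<le> (LBINT y. norm (f y * g (x - y)))" unfolding conv_def by simp
 also have "... \<le> (LBINT y. K * norm (g (x - y)))"
  by (rule integral_mono'[OF gi]) (auto simp: norm_mult intro!: mult_right_mono f mult_nonneg_nonneg order_trans[OF norm_ge_zero f])
 also have "... = K * (LBINT y. norm (g (x - y)))" by simp
 also have "(LBINT y. norm (g (x - y))) = (LBINT y. norm (g y))" by (rule integral_lborel_minus)
 finally show ?thesis .
qed

lemma conv_support:
 assumes "\<And>x. \<bar>x\<bar> > a \<Longrightarrow> f x = 0" "\<And>x. \<bar>x\<bar> > b \<Longrightarrow> g x = 0" "\<bar>x\<bar> > a + b"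
 shows "conv f g x = 0"
proof -
 have "f y * g (x - y) = 0" for y
 proof (cases "\<bar>y\<bar> > a")
  case True then show ?thesis using assms(1) by simp
 next
  case False
  then have "\<bar>x - y\<bar> > b" using assms(3) by linarith
  then show ?thesis using assms(2) by simp
 qed
 from this show ?thesis unfolding conv_def by (simp only: Bochner_Integration.integral_zero)
qed

text \<open>Four intervals of half-width 1/4 add up to \<open>[-1, 1]\<close>: the transform of
  \<open>phi\<close> lives there, so packets are exactly, not just approximately, localised in
  frequency, with half-width \<open>1/t\<close>.\<close>

definition chi4 :: "real \<Rightarrow> complex" where "chi4 = conv (conv chi chi) (conv chi chi)"

lemma chi4_integrable: "integrable lborel chi4"
 unfolding chi4_def by (intro conv_integrable chi_integrable)

lemma chi4_measurable[measurable]: "chi4 \<in> bm"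
 using chi4_integrable by auto

lemma ft_chi4: "ft chi4 x = cx (phi x)"
 unfolding chi4_def by (simp add: ft_conv conv_integrable chi_integrable ft_chi phi_def power4_eq_xxxx)

lemma chi4_support: "\<bar>x\<bar> > 1 \<Longrightarrow> chi4 x = 0"
proof -
 assume x: "\<bar>x\<bar> > 1"
 have 0: "chi x = 0" if "\<bar>x\<bar> > 1/4" for x using that by (auto simp: chi_def indicator_def)
 have 1: "conv chi chi x = 0" if "\<bar>x\<bar> > 1/2" for x
  by (rule conv_support[of "1/4" _ "1/4"]) (use that 0 in auto)
 show ?thesis unfolding chi4_def by (rule conv_support[of "1/2" _ "1/2"]) (use x 1 in auto)
qed

lemma chi4_bound: "\<exists>K. \<forall>x. norm (chi4 x) \<le> K"
proof -
 have 1: "norm (chi x) \<le> 2" for x by (auto simp: chi_def indicator_def)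
 have 2: "norm (conv chi chi x) \<le> 2 * (LBINT x. norm (chi x))" for x
  by (rule conv_bound[OF 1 chi_integrable]) auto
 have 3: "conv chi chi \<in> bm" by measurable
 show ?thesis unfolding chi4_def
  using conv_bound[where f="conv chi chi", OF 2 conv_integrable[OF chi_integrable chi_integrable] 3] by blast
qed

lemma bounded_L1_L2:
 fixes f :: "'a \<Rightarrow> complex"
 assumes f: "integrable M f" and b: "\<And>x. norm (f x) \<le> K"
 shows "integrable M (\<lambda>x. (norm (f x))^2)"
proof (rule dominated_integrable)
 show "integrable M (\<lambda>x. K * norm (f x))" using f by simp
 show "AE x in M. norm ((norm (f x))^2) \<le> norm (K * norm (f x))"
  by (intro AE_I2) (auto simp: power2_eq_square abs_mult intro!: mult_right_mono order_trans[OF b])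
qed (use f in measurable)

lemma chi4_L2: "sq_integrable chi4"
 using chi4_bound bounded_L1_L2[OF chi4_integrable] by blast

section \<open>Wave packets, their orthogonality and their correlations\<close>

definition wp :: "real \<Rightarrow> real \<Rightarrow> real \<Rightarrow> real \<Rightarrow> complex" where
 "wp y \<theta> t x = cx (phi ((x - y) / t) / t) * cis (\<theta> * x)"

lemma wp_measurable[measurable]: "wp y \<theta> t \<in> bm"
 unfolding wp_def by measurable

lemma norm_wp: "t > 0 \<Longrightarrow> norm (wp y \<theta> t x) = phi ((x - y) / t) / t"
 unfolding wp_def norm_mult norm_of_real norm_cis by (simp add: phi_nonneg)

lemma integrable_lborel_rescale:
 fixes g :: "real \<Rightarrow> 'a::{banach, second_countable_topology}"
 assumes "integrable lborel g" "t > 0"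
 shows "integrable lborel (\<lambda>x. g ((x - y) / t))"
 using lborel_integrable_real_affine[OF assms(1), of "1/t" "-y/t"] assms(2) by (simp add: diff_divide_distrib)

lemma integral_lborel_rescale_shift:
 fixes g :: "real \<Rightarrow> 'a::{banach, second_countable_topology}"
 assumes "t > 0"
 shows "(LBINT x. g ((x - y) / t)) = t *\<^sub>R (LBINT x. g x)"
 using lborel_integral_real_affine[of "1/t" g "-y/t"] assms by (simp add: diff_divide_distrib)

text \<open>The packet is exhibited as the transform of an explicit function supported in
  \<open>|\<xi> + \<theta>| \<le> 1/t\<close>. Plancherel then turns inner products of packets into
  overlaps of such supports.\<close>

lemma wp_eq_ft:
 fixes y \<theta> t :: real
 assumes t: "t > 0"
 defines "W \<equiv> \<lambda>\<xi>. chi4 ((\<xi> - - \<theta>) / (1/t)) * cis (y * \<xi>)"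
 shows "wp y \<theta> t x = cis (y * \<theta>) * ft W x"
proof -
 have "ft W x = (LBINT \<xi>. (\<lambda>\<zeta>. chi4 \<zeta> * cis ((y - x) * (\<zeta> / t - \<theta>))) ((\<xi> - - \<theta>) / (1/t)))"
  unfolding ft_def W_def
 proof (rule bochner_cong[OF refl])
  fix \<xi>
  have e: "((\<xi> - - \<theta>) / (1/t)) / t - \<theta> = \<xi>" using t by (simp add: field_simps)
  have "y * \<xi> + - (x * \<xi>) = (y - x) * \<xi>" by (simp add: left_diff_distrib)
  then show "chi4 ((\<xi> - - \<theta>) / (1/t)) * cis (y * \<xi>) * cis (- (x * \<xi>)) = chi4 ((\<xi> - - \<theta>) / (1/t)) * cis ((y - x) * ((\<xi> - - \<theta>) / (1/t) / t - \<theta>))"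
   unfolding e mult.assoc cis_mult by (simp only:)
 qed
 also have "... = (1/t) *\<^sub>R (LBINT \<zeta>. chi4 \<zeta> * cis ((y - x) * (\<zeta> / t - \<theta>)))"
  using t by (intro integral_lborel_rescale_shift) auto
 also have "(LBINT \<zeta>. chi4 \<zeta> * cis ((y - x) * (\<zeta> / t - \<theta>))) = (LBINT \<zeta>. cis ((x - y) * \<theta>) * (chi4 \<zeta> * cis (- ((x - y) / t * \<zeta>))))"
 proof (rule bochner_cong[OF refl])
  fix \<zeta>
  have "(y - x) * (\<zeta> / t - \<theta>) = (x - y) * \<theta> + - ((x - y) / t * \<zeta>)" by (simp add: algebra_simps diff_divide_distrib)
  then show "chi4 \<zeta> * cis ((y - x) * (\<zeta> / t - \<theta>)) = cis ((x - y) * \<theta>) * (chi4 \<zeta> * cis (- ((x - y) / t * \<zeta>)))"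
   unfolding mult.left_commute[of "cis ((x - y) * \<theta>)"] cis_mult by (simp only:)
 qed
 also have "... = cis ((x - y) * \<theta>) * cx (phi ((x - y) / t))"
  unfolding ft_chi4[symmetric] ft_def by (rule integral_mult_right_zero)
 finally have f: "ft W x = (1/t) *\<^sub>R (cis ((x - y) * \<theta>) * cx (phi ((x - y) / t)))" .
 have "\<theta> * x = y * \<theta> + (x - y) * \<theta>" by (simp add: algebra_simps)
 then have c: "cis (\<theta> * x) = cis (y * \<theta>) * cis ((x - y) * \<theta>)" unfolding cis_mult by (simp only:)
 show ?thesis unfolding wp_def f c scaleR_conv_of_real of_real_divide of_real_1 by (simp only: divide_inverse mult_1 mult_ac)
qed

lemma wpW_integrable:
 assumes t: "t > (0::real)"
 shows "integrable lborel (\<lambda>\<xi>. chi4 ((\<xi> - - \<theta>) / (1/t)) * cis (y * \<xi>))"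
  "integrable lborel (\<lambda>\<xi>. (norm (chi4 ((\<xi> - - \<theta>) / (1/t)) * cis (y * \<xi>)))^2)"
proof -
 have "integrable lborel (\<lambda>\<xi>. chi4 ((\<xi> - - \<theta>) / (1/t)))"
  by (rule integrable_lborel_rescale[OF chi4_integrable]) (use t in auto)
 then show "integrable lborel (\<lambda>\<xi>. chi4 ((\<xi> - - \<theta>) / (1/t)) * cis (y * \<xi>))"
  by (rule integrable_mult_cis) measurable
 have "integrable lborel (\<lambda>\<xi>. (norm (chi4 ((\<xi> - - \<theta>) / (1/t))))^2)"
  using integrable_lborel_rescale[OF chi4_L2, of "1/t" "-\<theta>"] t by auto
 then show "integrable lborel (\<lambda>\<xi>. (norm (chi4 ((\<xi> - - \<theta>) / (1/t)) * cis (y * \<xi>)))^2)"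
  by (simp add: norm_mult)
qed

lemma wp_orth:
 assumes t: "t > 0" "t' > 0" and sep: "\<bar>\<theta> - \<theta>'\<bar> > 1/t + 1/t'"
 shows "(LBINT x. wp y \<theta> t x * cnj (wp y' \<theta>' t' x)) = 0"
proof -
 define W where "W = (\<lambda>\<theta> y t \<xi>. chi4 ((\<xi> - - \<theta>) / (1/t)) * cis (y * \<xi>))"
 have "(LBINT x. wp y \<theta> t x * cnj (wp y' \<theta>' t' x)) =
  (LBINT x. (cis (y * \<theta>) * cnj (cis (y' * \<theta>'))) * (ft (W \<theta> y t) x * cnj (ft (W \<theta>' y' t') x)))"
  using wp_eq_ft[OF t(1)] wp_eq_ft[OF t(2)] unfolding W_def
  by (intro bochner_cong[OF refl]) simp
 also have "... = (cis (y * \<theta>) * cnj (cis (y' * \<theta>'))) * (cx (2 * pi) * (LBINT \<xi>. W \<theta> y t \<xi> * cnj (W \<theta>' y' t' \<xi>)))"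
  unfolding integral_mult_right_zero
  by (subst plancherel(2)) (use wpW_integrable[OF t(1)] wpW_integrable[OF t(2)] in \<open>simp_all add: W_def\<close>)
 also have "(\<lambda>\<xi>. W \<theta> y t \<xi> * cnj (W \<theta>' y' t' \<xi>)) = (\<lambda>\<xi>. 0)"
 proof (rule ext, rule ccontr)
  fix \<xi>
  assume *: "W \<theta> y t \<xi> * cnj (W \<theta>' y' t' \<xi>) \<noteq> 0"
  then have "chi4 ((\<xi> - - \<theta>) / (1/t)) \<noteq> 0" "chi4 ((\<xi> - - \<theta>') / (1/t')) \<noteq> 0" by (auto simp: W_def)
  then have "\<bar>(\<xi> - - \<theta>) / (1/t)\<bar> \<le> 1" "\<bar>(\<xi> - - \<theta>') / (1/t')\<bar> \<le> 1" using chi4_support not_le by blast+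
  moreover have "(\<xi> - - \<theta>) / (1/t) = (\<xi> + \<theta>) * t" "(\<xi> - - \<theta>') / (1/t') = (\<xi> + \<theta>') * t'" by simp_all
  ultimately have "\<bar>\<xi> + \<theta>\<bar> * t \<le> 1" "\<bar>\<xi> + \<theta>'\<bar> * t' \<le> 1" using t by (simp_all only: abs_mult abs_of_pos)
  then have "\<bar>\<xi> + \<theta>\<bar> \<le> 1/t" "\<bar>\<xi> + \<theta>'\<bar> \<le> 1/t'" using t by (simp_all only: pos_le_divide_eq)
  then show False using sep by linarith
 qed
 finally show ?thesis by simp
qed

lemma nn_inv_sq: "integrable lborel (\<lambda>x. inverse (1 + x^2) :: real)" "(LBINT x. inverse (1 + x^2)) = pi"
proof -
 have e: "einterval (-\<infinity>) \<infinity> = UNIV" by (auto simp: einterval_def)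
 show "integrable lborel (\<lambda>x. inverse (1 + x^2) :: real)"
  using integrable_inverse_1_plus_square unfolding e set_integrable_def by simp
 show "(LBINT x. inverse (1 + x^2)) = pi"
  using LBINT_inverse_1_plus_square unfolding interval_lebesgue_integral_def e set_lebesgue_integral_def by simp
qed

lemma br2_integrable: "integrable lborel (\<lambda>x. 1 / (1 + \<bar>x\<bar>)^2 :: real)"
 and br2_integral: "(LBINT x. 1 / (1 + \<bar>x\<bar>)^2) \<le> pi"
proof -
 have le: "1 / (1 + \<bar>x\<bar>)^2 \<le> inverse (1 + x^2)" for x :: real
 proof -
  have "1 + x^2 \<le> (1 + \<bar>x\<bar>)^2" by (simp add: power2_sum)
  then show ?thesis by (simp add: inverse_eq_divide frac_le add_pos_nonneg)
 qed
 show i: "integrable lborel (\<lambda>x. 1 / (1 + \<bar>x\<bar>)^2 :: real)"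
  by (rule dominated_integrable[OF nn_inv_sq(1)]) (auto intro!: AE_I2 order_trans[OF le])
 have "(LBINT x. 1 / (1 + \<bar>x\<bar>)^2) \<le> (LBINT x. inverse (1 + x^2) :: real)"
  by (rule integral_mono'[OF nn_inv_sq(1)]) (use le in auto)
 then show "(LBINT x. 1 / (1 + \<bar>x\<bar>)^2) \<le> pi" unfolding nn_inv_sq(2) .
qed

lemma phi_le_br: "k \<le> 4 \<Longrightarrow> phi x \<le> 625 / (1 + \<bar>x\<bar>)^k"
 by (rule order_trans[OF phi_le]) (intro divide_left_mono power_increasing mult_pos_pos zero_less_power, auto)

lemma phi_integrable: "integrable lborel phi"
proof (rule dominated_integrable)
 show "integrable lborel (\<lambda>x. 625 * (1 / (1 + \<bar>x\<bar>)^2) :: real)" by (rule integrable_mult_right[OF br2_integrable])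
 show "AE x in lborel. norm (phi x) \<le> norm (625 * (1 / (1 + \<bar>x\<bar>)^2) :: real)"
  using phi_le_br[of 2] by (intro AE_I2) (simp add: phi_nonneg)
qed measurable

lemma phi_sq_integrable: "integrable lborel (\<lambda>x. (phi x)^2)"
proof (rule dominated_integrable[OF phi_integrable])
 show "AE x in lborel. norm ((phi x)^2) \<le> norm (phi x)"
  by (intro AE_I2) (auto simp: power2_eq_square phi_nonneg intro: mult_left_le phi_le1)
qed measurable

lemma wp_L2: "t > 0 \<Longrightarrow> integrable lborel (\<lambda>x. (norm (wp y \<theta> t x))^2)"
 using integrable_lborel_rescale[OF phi_sq_integrable, of t y] by (simp add: norm_wp power_divide)

text \<open>By the triangle inequality and \<open>t' \<le> t\<close> the product of the two brackets
  dominates the bracket of the distance in units of the coarser scale \<open>t\<close>. Two of the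
  four powers of the finer bracket are spent on this, the other two on integrability, which leaves
  the factor \<open>1/t\<close>.\<close>

lemma wp_kernel_bound:
 assumes t: "0 < t'" "t' \<le> t"
 shows "norm (LBINT x. wp y \<theta> t x * cnj (wp y' \<theta>' t' x)) \<le> 625^2 * pi / t / (1 + \<bar>y - y'\<bar> / t)^2"
proof -
 have t0: "t > 0" using t by simp
 define K where "K = 625^2 / t / (1 + \<bar>y - y'\<bar> / t)^2"
 have K0: "K \<ge> 0" using t0 by (simp add: K_def)
 have i: "integrable lborel (\<lambda>x. K * (1 / (1 + \<bar>(x - y') / t'\<bar>)^2 / t'))"
  by (intro integrable_mult_right integrable_divide) (rule integrable_lborel_rescale[OF br2_integrable t(1)])
 have pt: "norm (wp y \<theta> t x * cnj (wp y' \<theta>' t' x)) \<le> K * (1 / (1 + \<bar>(x - y') / t'\<bar>)^2 / t')" for x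
 proof -
  define a b where "a = 1 + \<bar>(x - y) / t\<bar>" and "b = 1 + \<bar>(x - y') / t'\<bar>"
  have ab: "a \<ge> 1" "b \<ge> 1" by (auto simp: a_def b_def)
  have "\<bar>y - y'\<bar> / t \<le> \<bar>x - y\<bar> / t + \<bar>x - y'\<bar> / t"
   using t0 by (simp add: add_divide_distrib[symmetric] divide_right_mono abs_minus_commute)
  also have "\<bar>x - y'\<bar> / t \<le> \<bar>x - y'\<bar> / t'" using t by (intro divide_left_mono) auto
  finally have "1 + \<bar>y - y'\<bar> / t \<le> a + b - 1" using t t0 by (simp add: a_def b_def)
  also have "... \<le> a * b"
   using mult_nonneg_nonneg[of "a - 1" "b - 1"] ab by (simp add: algebra_simps)
  finally have D: "1 + \<bar>y - y'\<bar> / t \<le> a * b" .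
  have "norm (wp y \<theta> t x * cnj (wp y' \<theta>' t' x)) = phi ((x - y) / t) / t * (phi ((x - y') / t') / t')"
   using t t0 by (simp add: norm_mult norm_wp)
  also have "... \<le> (625 / a^2 / t) * (625 / b^4 / t')"
   using phi_le_br[of 2 "(x - y) / t"] phi_le[of "(x - y') / t'"] t t0
   by (intro mult_mono divide_right_mono) (auto simp: a_def b_def phi_nonneg)
  also have "... = 625^2 / t / (a * b)^2 * (1 / b^2 / t')"
   by (simp add: power_mult_distrib power2_eq_square power4_eq_xxxx)
  also have "... \<le> K * (1 / b^2 / t')"
   unfolding K_def using t t0 D ab
   by (intro mult_right_mono divide_left_mono power_mono divide_nonneg_nonneg mult_pos_pos zero_less_power) (auto intro!: add_pos_nonneg)
  finally show ?thesis by (simp add: b_def)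
 qed
 have "norm (LBINT x. wp y \<theta> t x * cnj (wp y' \<theta>' t' x)) \<le> (LBINT x. norm (wp y \<theta> t x * cnj (wp y' \<theta>' t' x)))" by simp
 also have "... \<le> (LBINT x. K * (1 / (1 + \<bar>(x - y') / t'\<bar>)^2 / t'))"
  by (rule integral_mono'[OF i pt]) (use K0 t in auto)
 also have "... = K * ((LBINT x. 1 / (1 + \<bar>(x - y') / t'\<bar>)^2) / t')"
  by (simp only: integral_mult_right_zero integral_divide_zero)
 also have "(LBINT x. 1 / (1 + \<bar>(x - y') / t'\<bar>)^2) = t' * (LBINT x. 1 / (1 + \<bar>x\<bar>)^2)"
  using integral_lborel_rescale_shift[OF t(1), of "\<lambda>x. 1 / (1 + \<bar>x\<bar>)^2 :: real" y'] by simp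
 also have "K * (t' * (LBINT x. 1 / (1 + \<bar>x\<bar>)^2) / t') \<le> K * pi"
  using t br2_integral K0 by (intro mult_left_mono) auto
 finally show ?thesis by (simp add: K_def mult.commute)
qed

definition emb :: "(real \<Rightarrow> complex) \<Rightarrow> real \<Rightarrow> real \<Rightarrow> real \<Rightarrow> complex" where
 "emb f y \<theta> t = (LBINT x. f x * cnj (wp y \<theta> t x))"

text \<open>In the frequency variable the coefficient is the ordinary transform of the windowed
  function; this gives a Plancherel identity at each fixed position and scale.\<close>

lemma emb_eq_ft: "emb f y \<theta> t = ft (\<lambda>x. f x * cx (phi ((x - y) / t) / t)) \<theta>"
 unfolding emb_def ft_def wp_def by (simp add: cis_cnj mult.assoc)

lemma norm_mult_phi: "t > 0 \<Longrightarrow> norm (z * cx (phi u / t)) = norm z * (phi u / t)"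
 unfolding norm_mult norm_of_real by (simp add: phi_nonneg)

lemma emb_integrand:
 assumes [measurable]: "f \<in> bm" and f2: "sq_integrable f" and t: "t > 0"
 shows "integrable lborel (\<lambda>x. f x * cnj (wp y \<theta> t x))"
  "integrable lborel (\<lambda>x. norm (f x) * (phi ((x - y) / t) / t))"
  "integrable lborel (\<lambda>x. f x * cx (phi ((x - y) / t) / t))"
  "integrable lborel (\<lambda>x. (norm (f x * cx (phi ((x - y) / t) / t)))^2)"
proof -
 have w: "integrable lborel (\<lambda>x. (norm (cnj (wp y \<theta> t x)))^2)" using wp_L2[OF t] by simp
 show 1: "integrable lborel (\<lambda>x. f x * cnj (wp y \<theta> t x))"
  by (rule integrable_mult_L2[OF _ _ f2 w]) measurable
 show "integrable lborel (\<lambda>x. norm (f x) * (phi ((x - y) / t) / t))"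
  using integrable_norm[OF 1] t by (simp add: norm_mult norm_wp)
 then show "integrable lborel (\<lambda>x. f x * cx (phi ((x - y) / t) / t))"
  by (rule dominated_integrable) (use t in \<open>auto simp: norm_mult_phi phi_nonneg simp del: of_real_divide times_divide_eq_right\<close>)
 show "integrable lborel (\<lambda>x. (norm (f x * cx (phi ((x - y) / t) / t)))^2)"
 proof (rule dominated_integrable)
  show "integrable lborel (\<lambda>x. (norm (f x))^2 * (1 / t)^2)" using f2 by simp
  show "AE x in lborel. norm ((norm (f x * cx (phi ((x - y) / t) / t)))^2) \<le> norm ((norm (f x))^2 * (1 / t)^2)"
   unfolding norm_mult_phi[OF t] power_mult_distrib
   using t by (intro AE_I2) (auto simp: abs_mult phi_nonneg power_divide simp del: times_divide_eq_right intro!: mult_left_mono divide_right_mono power_le_one phi_le1)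
 qed measurable
qed

lemma emb_bound:
 assumes "f \<in> bm" "sq_integrable f" "t > 0"
 shows "norm (emb f y \<theta> t) \<le> (LBINT x. norm (f x) * (phi ((x - y) / t) / t))"
 unfolding emb_eq_ft using ft_bound[of "\<lambda>x. f x * cx (phi ((x - y) / t) / t)" \<theta>] assms(3)
 unfolding norm_mult_phi[OF assms(3)] by simp

lemma emb_plancherel:
 assumes "f \<in> bm" "sq_integrable f" "t > 0"
 shows "integrable lborel (\<lambda>\<theta>. (norm (emb f y \<theta> t))^2)"
  "(LBINT \<theta>. (norm (emb f y \<theta> t))^2) = 2 * pi * (LBINT x. (norm (f x))^2 * (phi ((x - y) / t) / t)^2)"
 unfolding emb_eq_ft
 using plancherel_norm[OF emb_integrand(3,4)[OF assms, of y]] ft_L2[OF emb_integrand(3,4)[OF assms, of y]]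
 unfolding norm_mult_phi[OF assms(3)] power_mult_distrib by simp_all

section \<open>Overlap sums and a Bessel inequality\<close>

lemma card_int_near:
 fixes N :: "int set"
 assumes L: "L \<ge> 0" and N: "\<And>n. n \<in> N \<Longrightarrow> \<bar>real_of_int n - c\<bar> \<le> L"
 shows "finite N" "real (card N) \<le> 2 * L + 1"
proof -
 have sub: "N \<subseteq> {\<lceil>c - L\<rceil>..\<lfloor>c + L\<rfloor>}"
 proof
  fix n assume "n \<in> N"
  then have "c - L \<le> real_of_int n" "real_of_int n \<le> c + L" using N[of n] by linarith+
  then show "n \<in> {\<lceil>c - L\<rceil>..\<lfloor>c + L\<rfloor>}" by (simp add: ceiling_le_iff le_floor_iff)
 qed
 then show "finite N" by (rule finite_subset) simp
 have "card N \<le> nat (\<lfloor>c + L\<rfloor> - \<lceil>c - L\<rceil> + 1)"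
  using card_mono[OF _ sub] by simp
 then have "real (card N) \<le> real (nat (\<lfloor>c + L\<rfloor> - \<lceil>c - L\<rceil> + 1))" by simp
 also have "... \<le> 2 * L + 1"
 proof (cases "\<lfloor>c + L\<rfloor> - \<lceil>c - L\<rceil> + 1 \<ge> 0")
  case True
  then have "real (nat (\<lfloor>c + L\<rfloor> - \<lceil>c - L\<rceil> + 1)) = real_of_int (\<lfloor>c + L\<rfloor> - \<lceil>c - L\<rceil> + 1)" by simp
  also have "... \<le> (c + L) - (c - L) + 1" by linarith
  finally show ?thesis by simp
 next
  case False then show ?thesis using L by simp
 qed
 finally show "real (card N) \<le> 2 * L + 1" .
qed

lemma sum_integral_overlap:
 fixes g :: "real \<Rightarrow> real"
 assumes A: "finite A" and g: "integrable lborel g" and g0: "\<And>x. g x \<ge> 0"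
  and I: "\<And>a. a \<in> A \<Longrightarrow> I a \<in> sets borel"
  and c: "\<And>x. real (card {a\<in>A. x \<in> I a}) \<le> c"
 shows "(\<Sum>a\<in>A. LBINT x. indicator (I a) x * g x) \<le> c * (LBINT x. g x)"
proof -
 have i: "integrable lborel (\<lambda>x. indicator (I a) x * g x)" if "a \<in> A" for a
  using integrable_mult_indicator[of "I a" lborel g] I[OF that] g by simp
 have "(\<Sum>a\<in>A. LBINT x. indicator (I a) x * g x) = (LBINT x. (\<Sum>a\<in>A. indicator (I a) x * g x))"
  by (rule Bochner_Integration.integral_sum[symmetric]) (rule i)
 also have "... \<le> (LBINT x. c * g x)"
 proof (rule integral_mono)
  show "integrable lborel (\<lambda>x. \<Sum>a\<in>A. indicator (I a) x * g x)" using i by (rule Bochner_Integration.integrable_sum)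
  show "integrable lborel (\<lambda>x. c * g x)" using g by (rule integrable_mult_right)
  fix x
  have "(\<Sum>a\<in>A. indicator (I a) x * g x) = (\<Sum>a\<in>A. indicator (I a) x) * g x" by (rule sum_distrib_right[symmetric])
  also have "(\<Sum>a\<in>A. indicator (I a) x) = real (card {a\<in>A. x \<in> I a})"
   using A by (simp add: indicator_def sum.If_cases Int_def)
  also have "... * g x \<le> c * g x" by (rule mult_right_mono[OF c g0])
  finally show "(\<Sum>a\<in>A. indicator (I a) x * g x) \<le> c * g x" .
 qed
 also have "... = c * (LBINT x. g x)" by (rule integral_mult_right_zero)
 finally show ?thesis .
qed

lemma integral_ge_on_interval:
 fixes g :: "real \<Rightarrow> real"
 assumes g: "integrable lborel g" and ab: "a \<le> b" and le: "\<And>x. a < x \<Longrightarrow> x < b \<Longrightarrow> w \<le> g x"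
 shows "w * (b - a) \<le> (LBINT x. indicator {a<..<b} x * g x)"
proof -
 have "w * (b - a) = (LBINT x. indicator {a<..<b} x * w)" using ab by simp
 also have "... \<le> (LBINT x. indicator {a<..<b} x * g x)"
 proof (rule integral_mono)
  show "integrable lborel (\<lambda>x. indicator {a<..<b} x * w)"
   by (intro integrable_mult_left integrable_real_indicator) (use ab in simp_all)
  show "integrable lborel (\<lambda>x. indicator {a<..<b} x * g x)"
   using integrable_mult_indicator[of "{a<..<b}" lborel g] g by simp
 qed (auto simp: indicator_def le)
 finally show ?thesis .
qed

text \<open>Comparison with an integral: on a unit interval the bracket changes by a factor of at
  most 2, hence its square by at most 4.\<close>

lemma int_br_sum:
 assumes "finite (N :: int set)"
 shows "(\<Sum>n\<in>N. 1 / (1 + \<bar>real_of_int n - x\<bar>)^2) \<le> 4 * pi"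
proof -
 let ?g = "\<lambda>v. 1 / (1 + \<bar>v - x\<bar>)^2 :: real"
 have gi: "integrable lborel ?g" using integrable_lborel_shift[OF br2_integrable, of "-x"] by simp
 have gI: "(LBINT v. ?g v) = (LBINT v. 1 / (1 + \<bar>v\<bar>)^2)"
  using integral_lborel_shift[of "\<lambda>v. 1 / (1 + \<bar>v\<bar>)^2 :: real" "-x"] by simp
 let ?I = "\<lambda>n::int. {real_of_int n<..<real_of_int n + 1}"
 have one: "1 / (1 + \<bar>real_of_int n - x\<bar>)^2 \<le> 4 * (LBINT v. indicator (?I n) v * ?g v)" for n
 proof -
  have "1 / (1 + \<bar>real_of_int n - x\<bar>)^2 / 4 * ((real_of_int n + 1) - real_of_int n) \<le> (LBINT v. indicator (?I n) v * ?g v)"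
  proof (rule integral_ge_on_interval[OF gi])
   fix v assume v: "real_of_int n < v" "v < real_of_int n + 1"
   have "\<bar>v - x\<bar> \<le> \<bar>real_of_int n - x\<bar> + 1" using v by linarith
   then have "1 + \<bar>v - x\<bar> \<le> 2 * (1 + \<bar>real_of_int n - x\<bar>)" 
   proof -
    have "1 + a \<le> 2 * (1 + b)" if "a \<le> b + 1" "0 \<le> b" for a b :: real using that by simp
    then show ?thesis using \<open>\<bar>v - x\<bar> \<le> \<bar>real_of_int n - x\<bar> + 1\<close> abs_ge_zero by blast
   qed
   then have "(1 + \<bar>v - x\<bar>)^2 \<le> (2 * (1 + \<bar>real_of_int n - x\<bar>))^2" by (intro power_mono) auto
   then have "1 / (2 * (1 + \<bar>real_of_int n - x\<bar>))^2 \<le> ?g v" by (intro divide_left_mono) auto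
   moreover have "1 / (2 * (1 + \<bar>real_of_int n - x\<bar>))^2 = 1 / (1 + \<bar>real_of_int n - x\<bar>)^2 / 4"
    by (simp only: power_mult_distrib) simp
   ultimately show "1 / (1 + \<bar>real_of_int n - x\<bar>)^2 / 4 \<le> ?g v" by (simp only:)
  qed simp
  then show ?thesis by simp
 qed
 have "(\<Sum>n\<in>N. 1 / (1 + \<bar>real_of_int n - x\<bar>)^2) \<le> (\<Sum>n\<in>N. 4 * (LBINT v. indicator (?I n) v * ?g v))"
  by (intro sum_mono one)
 also have "... = 4 * (\<Sum>n\<in>N. (LBINT v. indicator (?I n) v * ?g v))" by (rule sum_distrib_left[symmetric])
 also have "(\<Sum>n\<in>N. (LBINT v. indicator (?I n) v * ?g v)) \<le> 1 * (LBINT v. ?g v)"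
 proof (rule sum_integral_overlap[OF assms gi])
  fix v :: real
  have "{n\<in>N. v \<in> ?I n} \<subseteq> {\<lfloor>v\<rfloor>}"
   by (auto simp: floor_eq_iff[symmetric]) (metis floor_unique less_imp_le)
  then have "card {n\<in>N. v \<in> ?I n} \<le> card {\<lfloor>v\<rfloor>}" by (rule card_mono[rotated]) simp
  then show "real (card {n\<in>N. v \<in> ?I n}) \<le> 1" by simp
 qed auto
 finally show ?thesis using br2_integral unfolding gI by simp
qed

lemma sum_powi_le:
 fixes D :: real
 assumes D: "D \<ge> 4" and K: "finite K" and m: "\<And>k. k \<in> K \<Longrightarrow> k \<le> m"
 shows "(\<Sum>k\<in>K. D powi k) \<le> 2 * D powi m"
 using K m
proof (induction K arbitrary: m rule: finite_linorder_max_induct)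
 case empty
 then show ?case using D by simp
next
 case (insert b A)
 have "(\<Sum>k\<in>insert b A. D powi k) = D powi b + (\<Sum>k\<in>A. D powi k)"
  using insert by (subst sum.insert) auto
 also have "(\<Sum>k\<in>A. D powi k) \<le> 2 * D powi (b - 1)" using insert by (intro insert.IH) fastforce
 also have "D powi (b - 1) = D powi b / D" using D by (simp add: power_int_diff)
 also have "D powi b + 2 * (D powi b / D) \<le> 2 * D powi b"
  using D by (simp add: field_simps mult_right_mono)
 also have "D powi b \<le> D powi m" using insert D by (intro power_int_increasing) auto
 finally show ?case by simp
qed

text \<open>With \<open>h = \<Sum> w c v\<close> the sum on the left is the inner product of
  \<open>f\<close> and \<open>h\<close>. Cauchy-Schwarz leaves the norm of \<open>h\<close>, whose
  expansion is the Gram matrix of the \<open>v\<close>. Absolute values are taken entry by entry, so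
  all gain must come from small or vanishing Gram entries.\<close>

lemma bessel_general:
 fixes v :: "'i \<Rightarrow> real \<Rightarrow> complex"
 assumes A: "finite A" and [measurable]: "f \<in> bm" "\<And>i. v i \<in> bm"
  and f2: "sq_integrable f" and v2: "\<And>i. i \<in> A \<Longrightarrow> integrable lborel (\<lambda>x. (norm (v i x))^2)"
  and c: "\<And>i. c i = (LBINT x. f x * cnj (v i x))" and w: "\<And>i. i \<in> A \<Longrightarrow> w i \<ge> 0"
 shows "(\<Sum>i\<in>A. w i * (norm (c i))^2)^2 \<le> (LBINT x. (norm (f x))^2) *
  (\<Sum>i\<in>A. \<Sum>j\<in>A. w i * w j * norm (c i) * norm (c j) * norm (LBINT x. v i x * cnj (v j x)))"
proof -
 define h where "h x = (\<Sum>i\<in>A. cx (w i) * c i * v i x)" for x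
 have [measurable]: "h \<in> bm" unfolding h_def by measurable
 have vc2: "integrable lborel (\<lambda>x. (norm (cnj (v j x)))^2)" if "j \<in> A" for j using v2[OF that] by simp
 have iv: "integrable lborel (\<lambda>x. v i x * cnj (v j x))" if "i \<in> A" "j \<in> A" for i j
  by (rule integrable_mult_L2[OF _ _ v2[OF that(1)] vc2[OF that(2)]]) measurable
 have ifv: "integrable lborel (\<lambda>x. f x * cnj (v j x))" if "j \<in> A" for j
  by (rule integrable_mult_L2[OF _ _ f2 vc2[OF that]]) measurable
 have hh: "h x * cnj (h x) = (\<Sum>i\<in>A. \<Sum>j\<in>A. (cx (w i) * c i * (cx (w j) * cnj (c j))) * (v i x * cnj (v j x)))" for x
  unfolding h_def cnj_sum sum_product by (intro sum.cong refl) simp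
 have ihh: "integrable lborel (\<lambda>x. h x * cnj (h x))"
  unfolding hh by (intro Bochner_Integration.integrable_sum integrable_mult_right iv)
 have h2: "sq_integrable h"
  using integrable_norm[OF ihh] by (simp add: norm_mult power2_eq_square)
 have hn: "cx (LBINT x. (norm (h x))^2) = (LBINT x. h x * cnj (h x))"
  by (simp only: complex_norm_square[symmetric] integral_complex_of_real[symmetric] of_real_power)
 have "(LBINT x. (norm (h x))^2) \<le> norm (LBINT x. h x * cnj (h x))"
  unfolding hn[symmetric] by simp
 also have "(LBINT x. h x * cnj (h x)) = (\<Sum>i\<in>A. \<Sum>j\<in>A. (cx (w i) * c i * (cx (w j) * cnj (c j))) * (LBINT x. v i x * cnj (v j x)))"
  unfolding hh
  by (subst Bochner_Integration.integral_sum, intro Bochner_Integration.integrable_sum integrable_mult_right iv, assumption+,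
    intro sum.cong refl, subst Bochner_Integration.integral_sum, intro integrable_mult_right iv, assumption+, simp)
 also have "norm ... \<le> (\<Sum>i\<in>A. \<Sum>j\<in>A. w i * w j * norm (c i) * norm (c j) * norm (LBINT x. v i x * cnj (v j x)))"
  by (intro sum_norm_le order_trans[OF norm_sum] sum_mono) (simp add: norm_mult w)
 finally have H: "(LBINT x. (norm (h x))^2) \<le> (\<Sum>i\<in>A. \<Sum>j\<in>A. w i * w j * norm (c i) * norm (c j) * norm (LBINT x. v i x * cnj (v j x)))" .
 have fh: "f x * cnj (h x) = (\<Sum>i\<in>A. (cx (w i) * cnj (c i)) * (f x * cnj (v i x)))" for x
  unfolding h_def cnj_sum sum_distrib_left by (intro sum.cong refl) simp
 have "(LBINT x. f x * cnj (h x)) = (\<Sum>i\<in>A. (cx (w i) * cnj (c i)) * (LBINT x. f x * cnj (v i x)))"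
  unfolding fh by (subst Bochner_Integration.integral_sum, intro integrable_mult_right ifv, assumption+, simp)
 also have "... = (\<Sum>i\<in>A. cx (w i * (norm (c i))^2))"
  unfolding c[symmetric] of_real_mult complex_norm_square by (simp only: mult_ac)
 also have "... = cx (\<Sum>i\<in>A. w i * (norm (c i))^2)" by simp
 finally have "(\<Sum>i\<in>A. w i * (norm (c i))^2)^2 = (norm (LBINT x. f x * cnj (h x)))^2" by (simp only: norm_of_real power2_abs)
 also have "... \<le> (sqrt (LBINT x. (norm (f x))^2) * sqrt (LBINT x. (norm (cnj (h x)))^2))^2"
 proof (intro power_mono)
  have "integrable lborel (\<lambda>x. (norm (cnj (h x)))^2)" using h2 by simp
  from CS_integral_norm[OF _ _ f2 this]
  show "norm (LBINT x. f x * cnj (h x)) \<le> sqrt (LBINT x. (norm (f x))^2) * sqrt (LBINT x. (norm (cnj (h x)))^2)"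
   by simp
 qed simp
 also have "... = (LBINT x. (norm (f x))^2) * (LBINT x. (norm (h x))^2)"
  by (simp add: power_mult_distrib)
 also have "... \<le> (LBINT x. (norm (f x))^2) *
  (\<Sum>i\<in>A. \<Sum>j\<in>A. w i * w j * norm (c i) * norm (c j) * norm (LBINT x. v i x * cnj (v j x)))"
  by (rule mult_left_mono[OF H]) simp
 finally show ?thesis .
qed

section \<open>Trees in the discretised phase space\<close>

type_synonym point = "int \<times> int \<times> int"

lemma sum_triple: "(\<Sum>q\<in>{k} \<times> N \<times> M. h (fst (snd q))) = (\<Sum>n\<in>N. \<Sum>m\<in>M. h n :: real)"
proof -
 have "{k} \<times> N \<times> M = Pair k ` (N \<times> M)" by auto
 then have "(\<Sum>q\<in>{k} \<times> N \<times> M. h (fst (snd q))) = (\<Sum>z\<in>N \<times> M. h (fst z))"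
  by (simp only:) (subst sum.reindex, auto simp: inj_on_def)
 also have "... = (\<Sum>n\<in>N. \<Sum>m\<in>M. h n)"
  unfolding sum.cartesian_product by (simp only: case_prod_unfold)
 finally show ?thesis .
qed

text \<open>A point \<open>(k, n, m)\<close> stands for the scale \<open>t = rho D^k\<close>, the position \<open>t (n + r1)\<close> and the frequency parameter \<open>(m + r2) / t\<close>;
 \<open>rho, r1, r2\<close> are the averaging parameters of the lattice. The predicate \<open>inT x \<xi> s\<close> is the tree with top \<open>(x, \<xi>)\<close> and length
 \<open>s\<close>, and \<open>uu d b \<xi> p\<close> is the signed distance of the packet frequency from \<open>d \<xi>\<close> in units of \<open>1/t\<close>.\<close>

locale grid =
 fixes D rho r1 r2 R :: real
 assumes D4: "D \<ge> 4" and rho: "rho > 0" and R0: "R \<ge> 0"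
begin

definition tt :: "point \<Rightarrow> real" where "tt p = rho * D powi (fst p)"
definition yy :: "point \<Rightarrow> real" where "yy p = tt p * (real_of_int (fst (snd p)) + r1)"
definition ee :: "point \<Rightarrow> real" where "ee p = (real_of_int (snd (snd p)) + r2) / tt p"
definition th :: "real \<Rightarrow> real \<Rightarrow> point \<Rightarrow> real" where "th d b p = d * ee p + b / tt p"
definition FF :: "(real \<Rightarrow> complex) \<Rightarrow> real \<Rightarrow> real \<Rightarrow> point \<Rightarrow> complex" where
 "FF f d b p = emb f (yy p) (th d b p) (tt p)"
definition inT :: "real \<Rightarrow> real \<Rightarrow> real \<Rightarrow> point \<Rightarrow> bool" where
 "inT x \<xi> s p \<longleftrightarrow> \<bar>yy p - x\<bar> \<le> s \<and> tt p \<le> s \<and> \<bar>ee p - \<xi>\<bar> * tt p \<le> R"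
definition uu :: "real \<Rightarrow> real \<Rightarrow> real \<Rightarrow> point \<Rightarrow> real" where
 "uu d b \<xi> p = tt p * (th d b p - d * \<xi>)"
text \<open>Calibrates the aperture \<open>R\<close> of trees and the ratio \<open>D\<close> of
  scales: a packet with \<open>|uu| \<le> 4\<close> still meets the frequency condition of
  \<open>inT\<close>, and inside a tree \<open>|uu|\<close> never exceeds \<open>D\<close>, so that
  in the units of the next finer scale it is at most 1.\<close>

definition adm :: "real \<Rightarrow> real \<Rightarrow> bool" where
 "adm d b \<longleftrightarrow> d \<noteq> 0 \<and> 4 + \<bar>b\<bar> \<le> R * \<bar>d\<bar> \<and> \<bar>d\<bar> * R + \<bar>b\<bar> \<le> D"
definition KK :: "real \<Rightarrow> real \<Rightarrow> point \<Rightarrow> point \<Rightarrow> real" where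
 "KK d b p q = norm (LBINT x. wp (yy p) (th d b p) (tt p) x * cnj (wp (yy q) (th d b q) (tt q) x))"

lemma tt_pos: "tt p > 0" using D4 rho by (simp add: tt_def)

lemma tt_gap: "tt q < tt p \<Longrightarrow> tt q * D \<le> tt p"
proof -
 assume "tt q < tt p"
 then have "D powi (fst q) < D powi (fst p)" using rho by (simp add: tt_def)
 then have "fst q < fst p" using D4 power_int_increasing[of "fst p" "fst q" D] by force
 then have "D powi (fst q + 1) \<le> D powi (fst p)" using D4 by (intro power_int_increasing) auto
 then show ?thesis using rho D4 by (simp add: tt_def power_int_add mult.assoc)
qed

lemma tt_eq_iff: "tt p = tt q \<longleftrightarrow> fst p = fst q"
proof
 assume e: "tt p = tt q"
 have "\<not> fst p < fst q" "\<not> fst q < fst p"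
  using power_int_strict_increasing[of "fst p" "fst q" D] power_int_strict_increasing[of "fst q" "fst p" D] e D4 rho
  by (auto simp: tt_def)
 then show "fst p = fst q" by simp
qed (simp add: tt_def)

lemma uu_eq: "uu d b \<xi> p = d * (tt p * (ee p - \<xi>)) + b"
 using tt_pos[of p] by (simp add: uu_def th_def field_simps)

lemma uu_bound:
 assumes "inT x \<xi> s p" "adm d b"
 shows "\<bar>uu d b \<xi> p\<bar> \<le> D"
proof -
 have "\<bar>uu d b \<xi> p\<bar> \<le> \<bar>d * (tt p * (ee p - \<xi>))\<bar> + \<bar>b\<bar>" unfolding uu_eq by (rule abs_triangle_ineq)
 also have "\<bar>d * (tt p * (ee p - \<xi>))\<bar> = \<bar>d\<bar> * (\<bar>ee p - \<xi>\<bar> * tt p)"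
  using tt_pos[of p] by (simp add: abs_mult)
 also have "\<bar>d\<bar> * (\<bar>ee p - \<xi>\<bar> * tt p) \<le> \<bar>d\<bar> * R" using assms(1) by (intro mult_left_mono) (auto simp: inT_def)
 finally show ?thesis using assms(2) by (simp add: adm_def)
qed

lemma KK_sym: "KK d b p q = KK d b q p"
proof -
 have "(LBINT x. wp (yy p) (th d b p) (tt p) x * cnj (wp (yy q) (th d b q) (tt q) x)) =
  (LBINT x. cnj (wp (yy q) (th d b q) (tt q) x * cnj (wp (yy p) (th d b p) (tt p) x)))"
  by (intro bochner_cong refl) simp
 then show ?thesis unfolding KK_def by (simp only: Bochner_Integration.integral_cnj complex_mod_cnj)
qed

lemma KK_nonneg: "KK d b p q \<ge> 0" by (simp add: KK_def)

lemma KK_bound: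
 assumes "tt q \<le> tt p"
 shows "KK d b p q \<le> 625^2 * pi / tt p / (1 + \<bar>yy p - yy q\<bar> / tt p)^2"
 unfolding KK_def by (rule wp_kernel_bound[OF tt_pos assms])

lemma KK_orth: "KK d b p q \<noteq> 0 \<Longrightarrow> \<bar>th d b p - th d b q\<bar> \<le> 1 / tt p + 1 / tt q"
 using wp_orth[OF tt_pos tt_pos, of p q "th d b p" "th d b q"] unfolding KK_def by (auto simp: not_le[symmetric])

lemma wpp_L2: "integrable lborel (\<lambda>x. (norm (wp (yy p) (th d b p) (tt p) x))^2)"
 by (rule wp_L2[OF tt_pos])

lemma bessel_grid:
 assumes A: "finite A" and f: "f \<in> bm" "sq_integrable f"
 shows "(\<Sum>p\<in>A. tt p * (norm (FF f d b p))^2)^2 \<le> (LBINT x. (norm (f x))^2) *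
  (\<Sum>p\<in>A. \<Sum>q\<in>A. tt p * tt q * norm (FF f d b p) * norm (FF f d b q) * KK d b p q)"
 unfolding KK_def
 by (rule bessel_general[where v="\<lambda>p. wp (yy p) (th d b p) (tt p)"])
  (use A f wpp_L2 tt_pos in \<open>auto simp: FF_def emb_def less_imp_le\<close>)

definition C0 :: "real \<Rightarrow> real" where "C0 d = 625^2 * pi * (4 * pi) * (4 / \<bar>d\<bar> + 1)"

text \<open>One row of a Schur test. At a common scale orthogonality leaves at most
  \<open>4 / |d| + 1\<close> frequencies, and the kernel bound is summable over integer
  positions.\<close>

lemma same_scale_sum:
 assumes A: "finite A" and d: "d \<noteq> 0"
 shows "(\<Sum>q\<in>{q\<in>A. tt q = tt p}. tt q * KK d b p q) \<le> C0 d"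
proof -
 define Q where "Q = {q\<in>A. tt q = tt p \<and> KK d b p q \<noteq> 0}"
 define N where "N = (\<lambda>q. fst (snd q)) ` Q"
 define M where "M = (\<lambda>q. snd (snd q)) ` Q"
 define np where "np = real_of_int (fst (snd p))"
 have fin: "finite Q" "finite N" "finite M" using A by (auto simp: Q_def N_def M_def)
 have sub: "Q \<subseteq> {fst p} \<times> N \<times> M" by (auto simp: Q_def N_def M_def tt_eq_iff image_iff)
 have cM: "real (card M) \<le> 2 * (2 / \<bar>d\<bar>) + 1"
 proof (rule card_int_near(2)[where c="real_of_int (snd (snd p))"])
  fix m assume "m \<in> M"
  then obtain q where q: "q \<in> Q" "m = snd (snd q)" by (auto simp: M_def)
  then have t: "tt q = tt p" and "KK d b p q \<noteq> 0" by (simp_all add: Q_def)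
  then have "\<bar>th d b p - th d b q\<bar> \<le> 1 / tt p + 1 / tt q" by (intro KK_orth)
  then have "\<bar>th d b p - th d b q\<bar> * tt p \<le> 2" using tt_pos[of p] t by (simp add: field_simps)
  also have "\<bar>th d b p - th d b q\<bar> * tt p = \<bar>(th d b p - th d b q) * tt p\<bar>" using tt_pos[of p] by (simp add: abs_mult)
  also have "(th d b p - th d b q) * tt p = d * (real_of_int (snd (snd p)) - real_of_int m)"
   using tt_pos[of p] t q by (simp add: th_def ee_def field_simps)
  finally have "\<bar>d\<bar> * \<bar>real_of_int m - real_of_int (snd (snd p))\<bar> \<le> 2" by (simp add: abs_mult abs_minus_commute)
  then show "\<bar>real_of_int m - real_of_int (snd (snd p))\<bar> \<le> 2 / \<bar>d\<bar>" using d by (simp add: pos_le_divide_eq mult.commute)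
 qed simp
 have "(\<Sum>q\<in>{q\<in>A. tt q = tt p}. tt q * KK d b p q) = (\<Sum>q\<in>Q. tt q * KK d b p q)"
  using A by (intro sum.mono_neutral_right) (auto simp: Q_def)
 also have "... \<le> (\<Sum>q\<in>Q. 625^2 * pi * (1 / (1 + \<bar>real_of_int (fst (snd q)) - np\<bar>)^2))"
 proof (rule sum_mono)
  fix q assume "q \<in> Q"
  then have t: "tt q = tt p" by (simp add: Q_def)
  have "yy p - yy q = tt p * (np - real_of_int (fst (snd q)))" using t by (simp add: yy_def np_def algebra_simps)
  then have "\<bar>yy p - yy q\<bar> / tt p = \<bar>real_of_int (fst (snd q)) - np\<bar>" using tt_pos[of p] by (simp add: abs_mult abs_minus_commute)
  then have "KK d b p q \<le> 625^2 * pi / tt p / (1 + \<bar>real_of_int (fst (snd q)) - np\<bar>)^2"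
   using KK_bound[of q p d b] t by simp
  from mult_left_mono[OF this, of "tt q"] show "tt q * KK d b p q \<le> 625^2 * pi * (1 / (1 + \<bar>real_of_int (fst (snd q)) - np\<bar>)^2)"
   using tt_pos[of p] t by simp
 qed
 also have "... \<le> (\<Sum>q\<in>{fst p} \<times> N \<times> M. 625^2 * pi * (1 / (1 + \<bar>real_of_int (fst (snd q)) - np\<bar>)^2))"
  by (rule sum_mono2) (use fin sub in auto)
 also have "... = 625^2 * pi * (\<Sum>n\<in>N. \<Sum>m\<in>M. 1 / (1 + \<bar>real_of_int n - np\<bar>)^2)"
  unfolding sum_distrib_left by (rule sum_triple)
 also have "... = 625^2 * pi * (real (card M) * (\<Sum>n\<in>N. 1 / (1 + \<bar>real_of_int n - np\<bar>)^2))"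
  by (simp add: sum_distrib_left)
 also have "... \<le> 625^2 * pi * ((4 / \<bar>d\<bar> + 1) * (4 * pi))"
  using cM int_br_sum[OF fin(2)] by (intro mult_left_mono mult_mono) (auto intro!: sum_nonneg)
 finally show ?thesis by (simp add: C0_def mult_ac)
qed

text \<open>The Schur test itself: \<open>F p * F q\<close> is split by the arithmetic-geometric
  mean, and the symmetric weights \<open>H\<close> have rows bounded by
  \<open>C0 d * tt p\<close>.\<close>

lemma same_scale_total:
 assumes A: "finite A" and d: "d \<noteq> 0"
 shows "(\<Sum>p\<in>A. \<Sum>q\<in>{q\<in>A. tt q = tt p}. tt p * tt q * F p * F q * KK d b p q) \<le> C0 d * (\<Sum>p\<in>A. tt p * (F p)^2)"
proof -
 define H where "H p q = (if tt q = tt p then tt p * tt q * KK d b p q else 0)" for p q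
 have H0: "H p q \<ge> 0" for p q using tt_pos[of p] tt_pos[of q] KK_nonneg by (simp add: H_def)
 have Hs: "H p q = H q p" for p q unfolding H_def KK_sym[of d b p q] by simp
 have row: "(\<Sum>q\<in>A. H p q) \<le> C0 d * tt p" for p
 proof -
  have "(\<Sum>q\<in>A. H p q) = tt p * (\<Sum>q\<in>{q\<in>A. tt q = tt p}. tt q * KK d b p q)"
   unfolding sum.inter_filter[OF A] sum_distrib_left by (intro sum.cong refl) (simp add: H_def)
  also have "... \<le> tt p * C0 d" using same_scale_sum[OF A d] tt_pos[of p] by (intro mult_left_mono) auto
  finally show ?thesis by (simp add: mult.commute)
 qed
 have "(\<Sum>p\<in>A. \<Sum>q\<in>{q\<in>A. tt q = tt p}. tt p * tt q * F p * F q * KK d b p q) = (\<Sum>p\<in>A. \<Sum>q\<in>A. H p q * (F p * F q))"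
  unfolding sum.inter_filter[OF A] by (intro sum.cong refl) (simp add: H_def)
 also have "... \<le> (\<Sum>p\<in>A. \<Sum>q\<in>A. H p q * ((F p)^2 / 2) + H p q * ((F q)^2 / 2))"
 proof (intro sum_mono)
  fix p q
  have "F p * F q \<le> (F p)^2 / 2 + (F q)^2 / 2" using sum_squares_bound[of "F p" "F q"] by simp
  from mult_left_mono[OF this H0[of p q]]
  show "H p q * (F p * F q) \<le> H p q * ((F p)^2 / 2) + H p q * ((F q)^2 / 2)" by (simp only: distrib_left)
 qed
 also have "... = (\<Sum>p\<in>A. \<Sum>q\<in>A. H p q * ((F p)^2 / 2)) + (\<Sum>p\<in>A. \<Sum>q\<in>A. H p q * ((F q)^2 / 2))"
  by (simp only: sum.distrib)
 also have "(\<Sum>p\<in>A. \<Sum>q\<in>A. H p q * ((F q)^2 / 2)) = (\<Sum>p\<in>A. \<Sum>q\<in>A. H p q * ((F p)^2 / 2))"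
  by (subst sum.swap) (simp only: Hs)
 also have "(\<Sum>p\<in>A. \<Sum>q\<in>A. H p q * ((F p)^2 / 2)) + (\<Sum>p\<in>A. \<Sum>q\<in>A. H p q * ((F p)^2 / 2)) = (\<Sum>p\<in>A. (\<Sum>q\<in>A. H p q) * (F p)^2)"
  by (simp only: sum_distrib_right sum.distrib[symmetric]) (intro sum.cong refl, simp)
 also have "... \<le> (\<Sum>p\<in>A. C0 d * tt p * (F p)^2)" by (intro sum_mono mult_right_mono row) auto
 finally show ?thesis by (simp add: sum_distrib_left mult.assoc)
qed

lemma split_scales:
 assumes A: "finite (A :: point set)" and sym: "\<And>p q. G p q = (G q p :: real)"
 shows "(\<Sum>p\<in>A. \<Sum>q\<in>A. G p q) = (\<Sum>p\<in>A. \<Sum>q\<in>{q\<in>A. tt q = tt p}. G p q) + 2 * (\<Sum>p\<in>A. \<Sum>q\<in>{q\<in>A. tt q < tt p}. G p q)"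
proof -
 have "(\<Sum>p\<in>A. \<Sum>q\<in>A. G p q) = (\<Sum>p\<in>A. (\<Sum>q\<in>A. if tt q = tt p then G p q else 0) + (\<Sum>q\<in>A. if tt q < tt p then G p q else 0) + (\<Sum>q\<in>A. if tt p < tt q then G p q else 0))"
  unfolding sum.distrib[symmetric] by (intro sum.cong refl) auto
 also have "... = (\<Sum>p\<in>A. \<Sum>q\<in>A. if tt q = tt p then G p q else 0) + (\<Sum>p\<in>A. \<Sum>q\<in>A. if tt q < tt p then G p q else 0) + (\<Sum>p\<in>A. \<Sum>q\<in>A. if tt p < tt q then G p q else 0)"
  by (simp only: sum.distrib)
 also have "(\<Sum>p\<in>A. \<Sum>q\<in>A. if tt p < tt q then G p q else 0) = (\<Sum>p\<in>A. \<Sum>q\<in>A. if tt q < tt p then G p q else 0)"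
  by (subst sum.swap) (simp only: sym)
 finally show ?thesis unfolding sum.inter_filter[OF A] by (simp only: mult_2 add.assoc)
qed

text \<open>The Bessel inequality bounds \<open>S^2\<close>, while both the same-scale part and, by
  \<open>X\<close>, the cross-scale part are linear in \<open>S\<close>; one factor is cancelled.
  All later work goes into verifying \<open>X\<close>.\<close>

lemma bessel_split:
 assumes A: "finite A" and f: "f \<in> bm" "sq_integrable f" and d: "d \<noteq> 0"
  and X: "(\<Sum>p\<in>A. \<Sum>q\<in>{q\<in>A. tt q < tt p}. tt p * tt q * norm (FF f d b p) * norm (FF f d b q) * KK d b p q) \<le> c * (\<Sum>p\<in>A. tt p * (norm (FF f d b p))^2)"
  and c: "c \<ge> 0"
 shows "(\<Sum>p\<in>A. tt p * (norm (FF f d b p))^2) \<le> (C0 d + 2 * c) * (LBINT x. (norm (f x))^2)"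
proof -
 define S where "S = (\<Sum>p\<in>A. tt p * (norm (FF f d b p))^2)"
 have S0: "S \<ge> 0" unfolding S_def using tt_pos by (intro sum_nonneg mult_nonneg_nonneg) (auto simp: less_imp_le)
 have "S^2 \<le> (LBINT x. (norm (f x))^2) * (\<Sum>p\<in>A. \<Sum>q\<in>A. tt p * tt q * norm (FF f d b p) * norm (FF f d b q) * KK d b p q)"
  unfolding S_def by (rule bessel_grid[OF A f])
 also have "(\<Sum>p\<in>A. \<Sum>q\<in>A. tt p * tt q * norm (FF f d b p) * norm (FF f d b q) * KK d b p q) \<le> C0 d * S + 2 * (c * S)"
 proof -
  have "(\<Sum>p\<in>A. \<Sum>q\<in>A. tt p * tt q * norm (FF f d b p) * norm (FF f d b q) * KK d b p q) =
   (\<Sum>p\<in>A. \<Sum>q\<in>{q\<in>A. tt q = tt p}. tt p * tt q * norm (FF f d b p) * norm (FF f d b q) * KK d b p q) +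
   2 * (\<Sum>p\<in>A. \<Sum>q\<in>{q\<in>A. tt q < tt p}. tt p * tt q * norm (FF f d b p) * norm (FF f d b q) * KK d b p q)"
   by (rule split_scales[OF A]) (subst (1) KK_sym, simp only: mult_ac)
  then show ?thesis using X same_scale_total[OF A d, of "\<lambda>p. norm (FF f d b p)" b] unfolding S_def by linarith
 qed
 finally have "S^2 \<le> (LBINT x. (norm (f x))^2) * (C0 d * S + 2 * (c * S))" by (simp add: mult_left_mono)
 then have *: "S * S \<le> ((C0 d + 2 * c) * (LBINT x. (norm (f x))^2)) * S" by (simp add: power2_eq_square algebra_simps)
 have C00: "C0 d \<ge> 0" by (simp add: C0_def)
 show ?thesis
 proof (cases "S > 0")
  case True then show ?thesis using * unfolding S_def by simp
 next
  case False
  then have "S = 0" using S0 by simp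
  then show ?thesis using c C00 unfolding S_def by simp
 qed
qed

definition C2 :: real where "C2 = 6 * (2 * R + 1)"

text \<open>The slice of a tree at scale \<open>t\<close> has at most \<open>3 s / t\<close>
  positions and \<open>2 R + 1\<close> frequencies, hence contributes a multiple of
  \<open>s t\<close>. The sum over scales is geometric and dominated by the largest one, which is at
  most \<open>s\<close>.\<close>

lemma tree_count:
 assumes A: "finite A" and T: "\<And>p. p \<in> A \<Longrightarrow> inT x \<xi> s p" and s: "s > 0"
 shows "(\<Sum>p\<in>A. (tt p)^2) \<le> C2 * s^2"
proof -
 define K where "K = fst ` A"
 have fK: "finite K" using A by (simp add: K_def)
 have kt: "rho * D powi k \<le> s" if "k \<in> K" for k using that T by (auto simp: K_def inT_def tt_def)
 have slice: "(\<Sum>p\<in>{p\<in>A. fst p = k}. (tt p)^2) \<le> (3 * s * (2 * R + 1)) * (rho * D powi k)" if "k \<in> K" for k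
 proof -
  define t where "t = rho * D powi k"
  have t0: "t > 0" using D4 rho by (simp add: t_def)
  define N where "N = (\<lambda>q. fst (snd q)) ` {p\<in>A. fst p = k}"
  define M where "M = (\<lambda>q. snd (snd q)) ` {p\<in>A. fst p = k}"
  have sub: "{p\<in>A. fst p = k} \<subseteq> {k} \<times> N \<times> M" by (auto simp: N_def M_def image_iff)
  have fin: "finite N" "finite M" using A by (auto simp: N_def M_def)
  have ttk: "tt p = t" if "fst p = k" for p using that by (simp add: tt_def t_def)
  have cN: "real (card N) \<le> 2 * (s / t) + 1"
  proof (rule card_int_near(2)[where c="x / t - r1"])
   fix n assume "n \<in> N"
   then obtain q where q: "q \<in> A" "fst q = k" "n = fst (snd q)" by (auto simp: N_def)
   then have "\<bar>t * (real_of_int n + r1) - x\<bar> \<le> s" using T[of q] ttk[of q] by (simp add: inT_def yy_def)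
   moreover have "t * (real_of_int n + r1) - x = t * (real_of_int n - (x / t - r1))" using t0 by (simp add: field_simps)
   ultimately have "t * \<bar>real_of_int n - (x / t - r1)\<bar> \<le> s" using t0 by (simp only: abs_mult abs_of_pos)
   then show "\<bar>real_of_int n - (x / t - r1)\<bar> \<le> s / t" using t0 by (simp only: pos_le_divide_eq mult.commute)
  qed (use s t0 in auto)
  have cM: "real (card M) \<le> 2 * R + 1"
  proof (rule card_int_near(2)[where c="t * \<xi> - r2"])
   fix m assume "m \<in> M"
   then obtain q where q: "q \<in> A" "fst q = k" "m = snd (snd q)" by (auto simp: M_def)
   then have "\<bar>(real_of_int m + r2) / t - \<xi>\<bar> * t \<le> R" using T[of q] ttk[of q] by (simp add: inT_def ee_def)
   moreover have "\<bar>(real_of_int m + r2) / t - \<xi>\<bar> * t = \<bar>((real_of_int m + r2) / t - \<xi>) * t\<bar>" using t0 by (simp add: abs_mult)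
   moreover have "((real_of_int m + r2) / t - \<xi>) * t = real_of_int m - (t * \<xi> - r2)" using t0 by (simp add: field_simps)
   ultimately show "\<bar>real_of_int m - (t * \<xi> - r2)\<bar> \<le> R" by simp
  qed (rule R0)
  have "card {p\<in>A. fst p = k} \<le> card ({k} \<times> N \<times> M)" by (rule card_mono) (use fin sub in auto)
  then have "real (card {p\<in>A. fst p = k}) \<le> real (card N) * real (card M)" by (simp add: card_cartesian_product flip: of_nat_mult)
  also have "... \<le> (3 * (s / t)) * (2 * R + 1)"
  proof (rule mult_mono)
   have "1 \<le> s / t" using kt[OF that] t0 by (simp add: t_def)
   then show "real (card N) \<le> 3 * (s / t)" using cN by linarith
  qed (use cM s t0 in auto)
  finally have "real (card {p\<in>A. fst p = k}) * t^2 \<le> (3 * (s / t)) * (2 * R + 1) * t^2" by (intro mult_right_mono) auto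
  also have "... = (3 * s * (2 * R + 1)) * t" using t0 by (simp add: power2_eq_square)
  finally show ?thesis using ttk by (simp add: t_def)
 qed
 have "(\<Sum>p\<in>A. (tt p)^2) = (\<Sum>k\<in>K. \<Sum>p\<in>{p\<in>A. fst p = k}. (tt p)^2)"
  unfolding K_def by (rule sum.image_gen[OF A])
 also have "... \<le> (\<Sum>k\<in>K. (3 * s * (2 * R + 1)) * (rho * D powi k))" by (intro sum_mono slice)
 also have "... = (3 * s * (2 * R + 1)) * (rho * (\<Sum>k\<in>K. D powi k))" by (simp add: sum_distrib_left mult.assoc)
 also have "... \<le> (3 * s * (2 * R + 1)) * (2 * s)"
 proof (rule mult_left_mono)
  show "rho * (\<Sum>k\<in>K. D powi k) \<le> 2 * s"
  proof (cases "K = {}")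
   case False
   have "(\<Sum>k\<in>K. D powi k) \<le> 2 * D powi (Max K)" by (rule sum_powi_le[OF D4 fK]) (use fK in auto)
   then have "rho * (\<Sum>k\<in>K. D powi k) \<le> rho * (2 * D powi (Max K))" using rho by (intro mult_left_mono) auto
   also have "... \<le> 2 * s" using kt[of "Max K"] Max_in[OF fK False] by simp
   finally show ?thesis .
  qed (use s in auto)
 qed (use s R0 in auto)
 finally show ?thesis by (simp add: C2_def power2_eq_square algebra_simps)
qed

end

section \<open>Selection of trees\<close>

context grid
begin

lemma inT_mono: "inT x \<xi> s p \<Longrightarrow> s \<le> s' \<Longrightarrow> inT x \<xi> s' p"
 by (auto simp: inT_def)

text \<open>The lacunary part of a tree, on the side \<open>uu \<ge> 4\<close> only, because the
  greedy order by \<open>d \<xi>\<close> is one-sided. The other side is reached by reversing the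
  signs of \<open>d\<close> and \<open>b\<close> and conjugating the function.\<close>

definition lac :: "real \<Rightarrow> real \<Rightarrow> point set \<Rightarrow> real \<Rightarrow> real \<Rightarrow> real \<Rightarrow> point set" where
 "lac d b P x \<xi> s = {p\<in>P. inT x \<xi> s p \<and> 4 \<le> uu d b \<xi> p}"

lemma lac_mono: "P \<subseteq> P' \<Longrightarrow> lac d b P x \<xi> s \<subseteq> lac d b P' x \<xi> s"
 by (auto simp: lac_def)

lemma lac_finite: "finite P \<Longrightarrow> finite (lac d b P x \<xi> s)" by (simp add: lac_def)

text \<open>Greedy choice: the next tree is a heavy one whose top frequency \<open>d \<xi>\<close> is within \<open>\<epsilon>\<close> of the supremum of all heavy ones, and
 twice its length is removed. This order is what separates the packets of different trees in \<open>forest_bessel\<close>.\<close>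

lemma selection:
 assumes P: "finite P" and g0: "\<And>p. g p \<ge> (0::real)" and c: "c > 0" and \<epsilon>: "\<epsilon> > 0"
 shows "\<exists>(n::nat) x \<xi> s A. (\<forall>i<n. s i > 0 \<and> A i \<subseteq> lac d b P (x i) (\<xi> i) (s i) \<and> c * s i < (\<Sum>p\<in>A i. g p)) \<and>
  (\<forall>i<n. \<forall>k<n. i < k \<longrightarrow> d * \<xi> k < d * \<xi> i + \<epsilon> \<and> (\<forall>q\<in>A k. \<not> inT (x i) (\<xi> i) (2 * s i) q)) \<and>
  (\<forall>y \<zeta> r. r > 0 \<longrightarrow> (\<Sum>p\<in>lac d b {p\<in>P. \<forall>i<n. \<not> inT (x i) (\<xi> i) (2 * s i) p} y \<zeta> r. g p) \<le> c * r)"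
 using P
proof (induction P rule: finite_psubset_induct)
 case (psubset P)
 define X where "X = {d * \<zeta> |y \<zeta> r. r > 0 \<and> c * r < (\<Sum>p\<in>lac d b P y \<zeta> r. g p)}"
 show ?case
 proof (cases "X = {}")
  case True
  then have H: "(\<Sum>p\<in>lac d b P y \<zeta> r. g p) \<le> c * r" if "r > 0" for y \<zeta> r
   using that by (auto simp: X_def not_less[symmetric])
  show ?thesis by (rule exI[of _ "0::nat"]) (use H in simp)
 next
  case False
  have mem: "\<exists>p\<in>P. inT y \<zeta> r p" if "r > 0" "c * r < (\<Sum>p\<in>lac d b P y \<zeta> r. g p)" for y \<zeta> r
  proof (rule ccontr)
   assume "\<not> ?thesis"
   then have "lac d b P y \<zeta> r = {}" by (auto simp: lac_def)
   then have "c * r < 0" using that(2) by (simp only: sum.empty)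
   then show False using mult_pos_pos[OF c that(1)] by linarith
  qed
  \<comment> \<open>A heavy tree contains a point of the finite set \<open>P\<close>, and this
    confines its top frequency; so the supremum over heavy trees is finite.\<close>
  define B where "B = (\<Sum>p\<in>P. \<bar>d\<bar> * (\<bar>ee p\<bar> + R / tt p))"
  have "z \<le> B" if z: "z \<in> X" for z
  proof -
   obtain y \<zeta> r where z: "z = d * \<zeta>" "r > 0" "c * r < (\<Sum>p\<in>lac d b P y \<zeta> r. g p)" using z by (auto simp: X_def)
   obtain p where p: "p \<in> P" "inT y \<zeta> r p" using mem[OF z(2,3)] by auto
   have "\<bar>ee p - \<zeta>\<bar> \<le> R / tt p" using p tt_pos[of p] by (simp add: inT_def pos_le_divide_eq)
   then have "\<bar>\<zeta>\<bar> \<le> \<bar>ee p\<bar> + R / tt p" by linarith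
   then have "\<bar>d\<bar> * \<bar>\<zeta>\<bar> \<le> \<bar>d\<bar> * (\<bar>ee p\<bar> + R / tt p)" by (rule mult_left_mono) simp
   also have "... \<le> B" unfolding B_def
    by (rule member_le_sum[OF p(1)]) (use psubset.hyps R0 tt_pos in \<open>auto simp: less_imp_le\<close>)
   finally show ?thesis unfolding z abs_mult[symmetric] by linarith
  qed
  then have bdd: "bdd_above X" by (auto simp: bdd_above_def)
  obtain z0 where z0: "z0 \<in> X" "Sup X - \<epsilon> < z0"
   using less_cSup_iff[OF False bdd, of "Sup X - \<epsilon>"] \<epsilon> by auto
  have z0max: "z < z0 + \<epsilon>" if "z \<in> X" for z using cSup_upper[OF that bdd] z0(2) by linarith
  obtain x0 \<xi>0 s0 where t0: "z0 = d * \<xi>0" "s0 > 0" "c * s0 < (\<Sum>p\<in>lac d b P x0 \<xi>0 s0. g p)" using z0(1) by (auto simp: X_def)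
  \<comment> \<open>The removed tree contains a point of \<open>P\<close>, so the recursion
    terminates. The doubled length later gives distance in position between the removed tree and
    every packet chosen afterwards.\<close>
  define P' where "P' = {p\<in>P. \<not> inT x0 \<xi>0 (2 * s0) p}"
  obtain p0 where "p0 \<in> P" "inT x0 \<xi>0 s0 p0" using mem[OF t0(2,3)] by auto
  then have "P' \<subset> P" using inT_mono[of x0 \<xi>0 s0 p0 "2 * s0"] t0(2) by (auto simp: P'_def)
  from psubset.IH[OF this] obtain n :: nat and x \<xi> s A where
   1: "\<forall>i<n. s i > 0 \<and> A i \<subseteq> lac d b P' (x i) (\<xi> i) (s i) \<and> c * s i < (\<Sum>p\<in>A i. g p)" and
   2: "\<forall>i<n. \<forall>k<n. i < k \<longrightarrow> d * \<xi> k < d * \<xi> i + \<epsilon> \<and> (\<forall>q\<in>A k. \<not> inT (x i) (\<xi> i) (2 * s i) q)" and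
   3: "\<forall>y \<zeta> r. r > 0 \<longrightarrow> (\<Sum>p\<in>lac d b {p\<in>P'. \<forall>i<n. \<not> inT (x i) (\<xi> i) (2 * s i) p} y \<zeta> r. g p) \<le> c * r"
   by (elim exE conjE) (rule that; assumption)
  have sub: "P' \<subseteq> P" by (auto simp: P'_def)
  have inX: "d * \<xi> k \<in> X" if "k < n" for k
  proof -
   have "c * s k < (\<Sum>p\<in>A k. g p)" using 1 that by auto
   also have "... \<le> (\<Sum>p\<in>lac d b P (x k) (\<xi> k) (s k). g p)"
    by (rule sum_mono2) (use 1 that g0 lac_mono[OF sub] lac_finite psubset.hyps in fastforce)+
   finally show ?thesis using 1 that unfolding X_def by auto
  qed
  define x' where "x' = case_nat x0 x"
  define \<xi>' where "\<xi>' = case_nat \<xi>0 \<xi>"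
  define s' where "s' = case_nat s0 s"
  define A' where "A' = case_nat (lac d b P x0 \<xi>0 s0) A"
  note defs = x'_def \<xi>'_def s'_def A'_def
  have a1: "\<forall>i<Suc n. s' i > 0 \<and> A' i \<subseteq> lac d b P (x' i) (\<xi>' i) (s' i) \<and> c * s' i < (\<Sum>p\<in>A' i. g p)"
   unfolding All_less_Suc2 defs using t0 1 lac_mono[OF sub] by (auto; blast)
  have notin: "\<not> inT x0 \<xi>0 (2 * s0) q" if "k < n" "q \<in> A k" for k q
   using 1 that by (auto simp: lac_def P'_def)
  have a2: "\<forall>i<Suc n. \<forall>k<Suc n. i < k \<longrightarrow> d * \<xi>' k < d * \<xi>' i + \<epsilon> \<and> (\<forall>q\<in>A' k. \<not> inT (x' i) (\<xi>' i) (2 * s' i) q)"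
   unfolding All_less_Suc2 defs using 2 notin z0max[OF inX] t0(1) by auto
  have eq: "{p\<in>P. \<forall>i<Suc n. \<not> inT (x' i) (\<xi>' i) (2 * s' i) p} = {p\<in>P'. \<forall>i<n. \<not> inT (x i) (\<xi> i) (2 * s i) p}"
   unfolding All_less_Suc2 defs P'_def by auto
  show ?thesis
   by (intro exI[of _ "Suc n"] exI[of _ x'] exI[of _ \<xi>'] exI[of _ s'] exI[of _ A'] conjI a1 a2) (use 3 in \<open>simp only: eq\<close>)
 qed
qed

section \<open>Bessel inequality for a selected forest\<close>

definition C1 :: "real \<Rightarrow> real" where "C1 d = 625^2 * pi * (7 * pi * (8 / \<bar>d\<bar> + 1))"

text \<open>Each term is compared with the integral of a bracket of width \<open>s\<close> over the
  interval \<open>I q\<close> of length \<open>tt q\<close> around \<open>yy q\<close>. By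
  \<open>dis\<close> intervals of different scales are disjoint; at a common scale overlapping
  intervals coincide in position, and \<open>ort\<close> admits at most \<open>8 / |d| + 1\<close>
  frequencies there.\<close>

lemma far_sum:
 assumes Q: "finite Q" and d: "d \<noteq> 0" and s: "tt p \<le> s"
  and ort: "\<And>q. q \<in> Q \<Longrightarrow> \<bar>th d b p - th d b q\<bar> \<le> 1 / tt p + 1 / tt q"
  and lt: "\<And>q. q \<in> Q \<Longrightarrow> tt q < tt p"
  and far: "\<And>q. q \<in> Q \<Longrightarrow> \<bar>yy q - yy p\<bar> \<ge> s"
  and dis: "\<And>q q'. q \<in> Q \<Longrightarrow> q' \<in> Q \<Longrightarrow> tt q' < tt q \<Longrightarrow> \<bar>yy q - yy q'\<bar> \<ge> tt q"
 shows "(\<Sum>q\<in>Q. tt q * KK d b p q) \<le> C1 d * tt p / s"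
proof -
 have s0: "s > 0" using s tt_pos[of p] by linarith
 define I where "I q = {yy q - tt q / 2 <..< yy q + tt q / 2}" for q
 define g where "g x = 1 / (1 + \<bar>(x - yy p) / s\<bar>)^2" for x :: real
 have gi: "integrable lborel g" unfolding g_def by (rule integrable_lborel_rescale[OF br2_integrable s0])
 have gI: "(LBINT x. g x) = s * (LBINT x. 1 / (1 + \<bar>x\<bar>)^2)"
  unfolding g_def using integral_lborel_rescale_shift[OF s0, of "\<lambda>x. 1 / (1 + \<bar>x\<bar>)^2 :: real"] by simp
 have trm: "tt q * KK d b p q \<le> 625^2 * pi * (tt p / s^2 * (7 * (LBINT x. indicator (I q) x * g x)))" if q: "q \<in> Q" for q
 proof -
  define v where "v = \<bar>yy q - yy p\<bar>"
  have v: "v \<ge> s" using far[OF q] by (simp add: v_def)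
  have tqs: "tt q \<le> s" using lt[OF q] s by linarith
  have "s^2 / (7 * v^2) * ((yy q + tt q / 2) - (yy q - tt q / 2)) \<le> (LBINT x. indicator (I q) x * g x)"
   unfolding I_def
  proof (rule integral_ge_on_interval[OF gi])
   fix x assume x: "yy q - tt q / 2 < x" "x < yy q + tt q / 2"
   have "\<bar>x - yy p\<bar> \<le> v + tt q / 2" using x unfolding v_def by linarith
   then have "\<bar>x - yy p\<bar> \<le> 3 / 2 * v" using tqs v by linarith
   then have "s + \<bar>x - yy p\<bar> \<le> 5 / 2 * v" using v by linarith
   then have "(s + \<bar>x - yy p\<bar>)^2 \<le> (5 / 2 * v)^2" using s0 by (intro power_mono) auto
   also have "... \<le> 7 * v^2" by (simp add: power_mult_distrib power2_eq_square)
   finally have le: "(s + \<bar>x - yy p\<bar>)^2 \<le> 7 * v^2" .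
   have "1 + \<bar>(x - yy p) / s\<bar> = (s + \<bar>x - yy p\<bar>) / s" using s0 by (simp add: field_simps)
   then have "g x = s^2 / (s + \<bar>x - yy p\<bar>)^2" unfolding g_def by (simp add: power_divide)
   moreover have "s^2 / (7 * v^2) \<le> s^2 / (s + \<bar>x - yy p\<bar>)^2"
    by (rule divide_left_mono[OF le]) (use s0 v in auto)
   ultimately show "s^2 / (7 * v^2) \<le> g x" by simp
  qed (use tt_pos[of q] in linarith)
  then have 1: "tt q * s^2 / v^2 \<le> 7 * (LBINT x. indicator (I q) x * g x)" by (simp add: mult.commute)
  have "KK d b p q \<le> 625^2 * pi / tt p / (1 + v / tt p)^2"
   using KK_bound[OF less_imp_le[OF lt[OF q]], of d b] unfolding v_def by (simp add: abs_minus_commute)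
  also have "... \<le> 625^2 * pi / tt p / (v / tt p)^2"
  proof (rule divide_left_mono)
   have "0 < v / tt p" using v s0 tt_pos[of p] by simp
   then show "(v / tt p)^2 \<le> (1 + v / tt p)^2" "0 < (1 + v / tt p)^2 * (v / tt p)^2" by (auto intro!: power_mono mult_pos_pos)
  qed (use tt_pos[of p] in simp)
  also have "... = 625^2 * pi * (tt p / v^2)" using tt_pos[of p] by (simp add: power_divide power2_eq_square)
  finally have "tt q * KK d b p q \<le> tt q * (625^2 * pi * (tt p / v^2))" using tt_pos[of q] by (intro mult_left_mono) auto
  also have "... = 625^2 * pi * (tt p / s^2 * (tt q * s^2 / v^2))" using s0 by simp
  also have "... \<le> 625^2 * pi * (tt p / s^2 * (7 * (LBINT x. indicator (I q) x * g x)))"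
   using 1 tt_pos[of p] by (intro mult_left_mono) auto
  finally show ?thesis .
 qed
 have mult: "real (card {q\<in>Q. x \<in> I q}) \<le> 8 / \<bar>d\<bar> + 1" for x
 proof (cases "{q\<in>Q. x \<in> I q} = {}")
  case False
  define E where "E = {q\<in>Q. x \<in> I q}"
  obtain q0 where q0: "q0 \<in> E" using False by (auto simp: E_def)
  have near: "fst q = fst q0 \<and> fst (snd q) = fst (snd q0) \<and> \<bar>real_of_int (snd (snd q)) - real_of_int (snd (snd q0))\<bar> \<le> 4 / \<bar>d\<bar>" if q: "q \<in> E" for q
  proof -
   have y: "\<bar>yy q - yy q0\<bar> < (tt q + tt q0) / 2" 
   proof -
    have "yy q - tt q / 2 < x" "x < yy q + tt q / 2" "yy q0 - tt q0 / 2 < x" "x < yy q0 + tt q0 / 2"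
     using q q0 unfolding E_def I_def by auto
    then show ?thesis unfolding abs_less_iff add_divide_distrib by linarith
   qed
   have t: "tt q = tt q0"
   proof (rule ccontr)
    assume "tt q \<noteq> tt q0"
    then have "tt q < tt q0 \<or> tt q0 < tt q" by linarith
    then show False using dis[of q q0] dis[of q0 q] y q q0 by (auto simp: E_def abs_minus_commute)
   qed
   have f: "fst q = fst q0" using t by (simp add: tt_eq_iff)
   have "yy q - yy q0 = tt q0 * (real_of_int (fst (snd q)) - real_of_int (fst (snd q0)))" using t by (simp add: yy_def algebra_simps)
   then have "tt q0 * \<bar>real_of_int (fst (snd q)) - real_of_int (fst (snd q0))\<bar> < tt q0 * 1" using y t tt_pos[of q0] by (simp add: abs_mult)
   then have "\<bar>real_of_int (fst (snd q)) - real_of_int (fst (snd q0))\<bar> < 1" using tt_pos[of q0] by (simp only: mult_less_cancel_left_pos)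
   then have n: "fst (snd q) = fst (snd q0)" by linarith
   have "\<bar>th d b q - th d b q0\<bar> \<le> (1 / tt p + 1 / tt q) + (1 / tt p + 1 / tt q0)"
    using ort[of q] ort[of q0] q q0 unfolding E_def by auto
   also have "... \<le> 4 / tt q0"
   proof -
    have "1 / tt p \<le> 1 / tt q0" using lt[of q0] q0 tt_pos[of q0] by (intro divide_left_mono) (auto simp: E_def intro: mult_pos_pos tt_pos)
    then show ?thesis using t by simp
   qed
   finally have "\<bar>th d b q - th d b q0\<bar> * tt q0 \<le> 4" using tt_pos[of q0] by (simp add: pos_le_divide_eq)
   moreover have "\<bar>th d b q - th d b q0\<bar> * tt q0 = \<bar>(th d b q - th d b q0) * tt q0\<bar>" using tt_pos[of q0] by (simp add: abs_mult)
   moreover have "(th d b q - th d b q0) * tt q0 = d * (real_of_int (snd (snd q)) - real_of_int (snd (snd q0)))"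
    using tt_pos[of q0] t by (simp add: th_def ee_def field_simps)
   ultimately have "\<bar>d\<bar> * \<bar>real_of_int (snd (snd q)) - real_of_int (snd (snd q0))\<bar> \<le> 4" by (simp add: abs_mult)
   then show ?thesis using f n d by (simp add: pos_le_divide_eq mult.commute)
  qed
  define M where "M = (\<lambda>q. snd (snd q)) ` E"
  have fE: "finite E" using Q by (simp add: E_def)
  have "inj_on (\<lambda>q. snd (snd q)) E" 
  proof (rule inj_onI)
   fix q q' assume "q \<in> E" "q' \<in> E" "snd (snd q) = snd (snd q')"
   then show "q = q'" using near[of q] near[of q'] by (simp add: prod_eq_iff)
  qed
  then have "card E = card M" unfolding M_def by (rule card_image[symmetric])
  moreover have "real (card M) \<le> 2 * (4 / \<bar>d\<bar>) + 1"
   by (rule card_int_near(2)[where c="real_of_int (snd (snd q0))"]) (use near in \<open>auto simp: M_def\<close>)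
  ultimately show ?thesis by (simp add: E_def)
 next
  case True
  show ?thesis unfolding True by simp
 qed
 have "(\<Sum>q\<in>Q. tt q * KK d b p q) \<le> (\<Sum>q\<in>Q. 625^2 * pi * (tt p / s^2 * (7 * (LBINT x. indicator (I q) x * g x))))"
  by (rule sum_mono[OF trm])
 also have "... = 625^2 * pi * (tt p / s^2 * (7 * (\<Sum>q\<in>Q. LBINT x. indicator (I q) x * g x)))"
  by (simp only: sum_distrib_left)
 also have "... \<le> 625^2 * pi * (tt p / s^2 * (7 * ((8 / \<bar>d\<bar> + 1) * (s * pi))))"
 proof (intro mult_left_mono)
  have "(\<Sum>q\<in>Q. LBINT x. indicator (I q) x * g x) \<le> (8 / \<bar>d\<bar> + 1) * (LBINT x. g x)"
   by (rule sum_integral_overlap[OF Q gi _ _ mult]) (auto simp: g_def I_def)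
  also have "... \<le> (8 / \<bar>d\<bar> + 1) * (s * pi)" unfolding gI using br2_integral s0 by (intro mult_left_mono) auto
  finally show "(\<Sum>q\<in>Q. LBINT x. indicator (I q) x * g x) \<le> (8 / \<bar>d\<bar> + 1) * (s * pi)" .
 qed (use s0 tt_pos[of p] in auto)
 also have "... = C1 d * tt p / s" using s0 by (simp add: C1_def power2_eq_square)
 finally show ?thesis .
qed

lemma C_nonneg: "C0 d \<ge> 0" "C1 d \<ge> 0" "C2 \<ge> 0"
 using R0 by (simp_all add: C0_def C1_def C2_def)

definition C3 :: "real \<Rightarrow> real" where "C3 d = C0 d + 2 * (8 * C1 d * C2)"

text \<open>The difficulty is correlation across scales. A finer packet correlated with a packet of
  tree \<open>i\<close> must lie outside the doubled interval of that tree (\<open>sep\<close>), so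
  its contribution decays. As products of coefficients are at most \<open>8 c\<close>, the cross
  terms are at most a multiple of \<open>c * \<Sum> s i\<close>, and heaviness bounds this by the
  very sum that is being estimated.\<close>

lemma forest_bessel:
 fixes n :: nat and x \<xi> s :: "nat \<Rightarrow> real" and A :: "nat \<Rightarrow> point set"
 assumes f: "f \<in> bm" "sq_integrable f" and ad: "adm d b" and c: "c > 0"
  and P: "finite P" and \<epsilon>: "\<And>p. p \<in> P \<Longrightarrow> \<epsilon> * tt p \<le> 1" "\<epsilon> > 0"
  and tree: "\<And>i. i < n \<Longrightarrow> s i > 0 \<and> A i \<subseteq> lac d b P (x i) (\<xi> i) (s i) \<and> c * s i < (\<Sum>p\<in>A i. tt p * (norm (FF f d b p))^2)"
  and ord: "\<And>i k. i < n \<Longrightarrow> k < n \<Longrightarrow> i < k \<Longrightarrow> d * \<xi> k < d * \<xi> i + \<epsilon> \<and> (\<forall>q\<in>A k. \<not> inT (x i) (\<xi> i) (2 * s i) q)"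
  and M: "\<And>p. p \<in> P \<Longrightarrow> (norm (FF f d b p))^2 \<le> 8 * c"
 shows "c * (\<Sum>i<n. s i) \<le> C3 d * (LBINT x. (norm (f x))^2)"
proof -
 have d: "d \<noteq> 0" using ad by (simp add: adm_def)
 define U where "U = (\<Union>i<n. A i)"
 have AP: "A i \<subseteq> P" if "i < n" for i using tree[OF that] by (auto simp: lac_def)
 have fA: "finite (A i)" if "i < n" for i using finite_subset[OF AP[OF that] P] .
 have fU: "finite U" using fA by (auto simp: U_def)
 have inA: "inT (x i) (\<xi> i) (s i) p \<and> 4 \<le> uu d b (\<xi> i) p" if "i < n" "p \<in> A i" for i p
  using tree[OF that(1)] that(2) by (auto simp: lac_def)
 have disj: "A i \<inter> A k = {}" if "i < n" "k < n" "i < k" for i k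
 proof (rule ccontr)
  assume "A i \<inter> A k \<noteq> {}"
  then obtain q where "q \<in> A i" "q \<in> A k" by auto
  then show False using ord[OF that] inA[OF that(1)] inT_mono[of "x i" "\<xi> i" "s i" q "2 * s i"] tree[OF that(1)] by auto
 qed
 then have disj': "A i \<inter> A k = {}" if "i < n" "k < n" "i \<noteq> k" for i k
  using that by (metis Int_commute linorder_neqE_nat)
 have sumU: "(\<Sum>p\<in>U. G p) = (\<Sum>i<n. \<Sum>p\<in>A i. G p)" for G :: "point \<Rightarrow> real"
  unfolding U_def using fA disj' by (intro sum.UNION_disjoint) auto
 \<comment> \<open>The scale gap \<open>D\<close> puts the frequency of \<open>p\<close> within
   \<open>1 / tt q\<close> of \<open>d * \<xi> i\<close>, whereas \<open>q\<close> lies at least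
   \<open>4 / tt q\<close> above its own top. Near frequencies of \<open>p\<close> and
   \<open>q\<close> thus force \<open>d * \<xi> k\<close> below \<open>d * \<xi> i\<close> by at
   least \<open>\<epsilon>\<close>, so tree \<open>k\<close> was chosen after tree \<open>i\<close>.
   Since \<open>q\<close> survived the removal of the doubled tree and meets its scale and frequency
   conditions, the spatial one must fail.\<close>
 have sep: "\<bar>yy q - x i\<bar> > 2 * s i"
  if i: "i < n" "k < n" "p \<in> A i" "q \<in> A k" and t: "tt q < tt p" and o: "\<bar>th d b p - th d b q\<bar> \<le> 2 / tt q" for i k p q
 proof -
  have tp: "tt p > 0" "tt q > 0" by (rule tt_pos)+
  have gap: "tt q * D \<le> tt p" by (rule tt_gap[OF t])
  have up: "\<bar>uu d b (\<xi> i) p\<bar> \<le> D" using uu_bound inA[OF i(1,3)] ad by blast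
  have "\<bar>uu d b (\<xi> i) p\<bar> / tt p \<le> D / tt p" using up tp by (intro divide_right_mono) auto
  also have "... \<le> 1 / tt q" using gap tp by (simp add: field_simps)
  finally have a: "\<bar>th d b p - d * \<xi> i\<bar> \<le> 1 / tt q" using tp by (simp add: uu_def abs_mult)
  have "4 \<le> tt q * (th d b q - d * \<xi> k)" using inA[OF i(2,4)] by (simp add: uu_def)
  then have b: "4 / tt q \<le> th d b q - d * \<xi> k" using tp by (simp add: pos_divide_le_eq mult.commute)
  have "4 / tt q = 1 / tt q + 2 / tt q + 1 / tt q" using tp by (simp add: field_simps)
  then have gapxi: "1 / tt q \<le> d * \<xi> i - d * \<xi> k" using a b o by linarith
  have "\<epsilon> \<le> 1 / tt q" using \<epsilon>(1)[of q] AP[OF i(2)] i(4) tp by (auto simp: pos_le_divide_eq)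
  then have e: "d * \<xi> k + \<epsilon> \<le> d * \<xi> i" using gapxi by linarith
  have "\<not> k < i" using ord[OF i(2,1)] e by auto
  moreover have "k \<noteq> i" using e \<epsilon>(2) by auto
  ultimately have ik: "i < k" by simp
  have nin: "\<not> inT (x i) (\<xi> i) (2 * s i) q" using ord[OF i(1,2) ik] i(4) by auto
  have "tt q \<le> 2 * s i" using inA[OF i(1,3)] t tree[OF i(1)] by (auto simp: inT_def)
  moreover have "\<bar>ee q - \<xi> i\<bar> * tt q \<le> R"
  proof -
   have "\<bar>th d b q - d * \<xi> i\<bar> \<le> 3 / tt q" 
   proof -
    have "3 / tt q = 2 / tt q + 1 / tt q" by (simp add: add_divide_distrib[symmetric])
    then show ?thesis using a o by linarith
   qed
   then have 1: "\<bar>th d b q - d * \<xi> i\<bar> * tt q \<le> 3" using tp by (simp add: pos_le_divide_eq)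
   have "d * ((ee q - \<xi> i) * tt q) = (th d b q - d * \<xi> i) * tt q - b" using tp by (simp add: th_def field_simps)
   then have "\<bar>d\<bar> * (\<bar>ee q - \<xi> i\<bar> * tt q) = \<bar>(th d b q - d * \<xi> i) * tt q - b\<bar>" using tp by (metis abs_mult abs_of_pos)
   also have "... \<le> \<bar>(th d b q - d * \<xi> i) * tt q\<bar> + \<bar>b\<bar>" by (rule abs_triangle_ineq4)
   also have "... \<le> 3 + \<bar>b\<bar>" using 1 tp by (simp add: abs_mult)
   also have "... \<le> \<bar>d\<bar> * R" using ad by (simp add: adm_def mult.commute)
   finally show ?thesis using d by simp
  qed
  ultimately show ?thesis using nin by (auto simp: inT_def)
 qed
 have row: "(\<Sum>q\<in>{q\<in>U. tt q < tt p}. tt q * KK d b p q) \<le> C1 d * tt p / s i" if i: "i < n" "p \<in> A i" for i p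
 proof -
  define Q where "Q = {q\<in>U. tt q < tt p \<and> KK d b p q \<noteq> 0}"
  have Qo: "\<bar>th d b p - th d b q\<bar> \<le> 1 / tt p + 1 / tt q" if "q \<in> Q" for q using that KK_orth[of d b p q] by (simp add: Q_def)
  have Qt: "tt q < tt p" if "q \<in> Q" for q using that by (simp add: Q_def)
  have ts: "tt p \<le> s i" using inA[OF i] by (simp add: inT_def)
  have "(\<Sum>q\<in>{q\<in>U. tt q < tt p}. tt q * KK d b p q) = (\<Sum>q\<in>Q. tt q * KK d b p q)"
   by (rule sum.mono_neutral_right) (use fU in \<open>auto simp: Q_def\<close>)
  also have "... \<le> C1 d * tt p / s i"
  proof (rule far_sum[OF _ d ts])
   show "finite Q" using fU by (simp add: Q_def)
   fix q assume q: "q \<in> Q"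
   show "\<bar>th d b p - th d b q\<bar> \<le> 1 / tt p + 1 / tt q" by (rule Qo[OF q])
   show "tt q < tt p" by (rule Qt[OF q])
   have inv: "1 / tt p \<le> 1 / tt q" using Qt[OF q] tt_pos[of q] tt_pos[of p] by (simp add: frac_le)
   obtain k where k: "k < n" "q \<in> A k" using q by (auto simp: Q_def U_def)
   have "\<bar>yy q - x i\<bar> > 2 * s i"
    by (rule sep[OF i(1) k(1) i(2) k(2) Qt[OF q]]) (use Qo[OF q] inv in simp)
   moreover have "\<bar>yy p - x i\<bar> \<le> s i" using inA[OF i] by (simp add: inT_def)
   ultimately show "s i \<le> \<bar>yy q - yy p\<bar>" by linarith
   fix q' assume q': "q' \<in> Q" and tq: "tt q' < tt q"
   obtain k' where k': "k' < n" "q' \<in> A k'" using q' by (auto simp: Q_def U_def)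
   have "tt q' * 4 \<le> tt q' * D" using D4 tt_pos[of q'] by simp
   also have "... \<le> tt q" by (rule tt_gap[OF tq])
   finally have t4: "1 / tt q \<le> 1 / tt q' / 4" using tt_pos[of q'] tt_pos[of q] by (simp add: field_simps)
   \<comment> \<open>The same separation for two finer packets correlated with a common
     \<open>p\<close>: through \<open>p\<close> their frequencies are still within
     \<open>2 / tt q'\<close>, because their scales differ by a factor of at least 4.\<close>
   have "\<bar>yy q' - x k\<bar> > 2 * s k"
   proof (rule sep[OF k(1) k'(1) k(2) k'(2) tq])
    have "\<bar>th d b q - th d b q'\<bar> \<le> (1 / tt p + 1 / tt q) + (1 / tt p + 1 / tt q')" using Qo[OF q] Qo[OF q'] by linarith
    also have "... \<le> 2 / tt q'"
    proof -
     have "a + b + (a + c) \<le> 2 * c" if "a \<le> b" "b \<le> c / 4" "0 < c" for a b c :: real using that by linarith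
     from this[OF inv t4] show ?thesis using tt_pos[of q'] by simp
    qed
    finally show "\<bar>th d b q - th d b q'\<bar> \<le> 2 / tt q'" .
   qed
   moreover have "\<bar>yy q - x k\<bar> \<le> s k" "tt q \<le> s k" using inA[OF k] by (auto simp: inT_def)
   ultimately show "tt q \<le> \<bar>yy q - yy q'\<bar>" by linarith
  qed
  finally show ?thesis .
 qed
 define N where "N p = norm (FF f d b p)" for p
 have N8: "N p * N q \<le> 8 * c" if "p \<in> U" "q \<in> U" for p q
 proof -
  have "p \<in> P" "q \<in> P" using that AP by (auto simp: U_def)
  then have "(N p)^2 \<le> 8 * c" "(N q)^2 \<le> 8 * c" using M by (auto simp: N_def)
  then show ?thesis using sum_squares_bound[of "N p" "N q"] by simp
 qed
 have "(\<Sum>p\<in>U. \<Sum>q\<in>{q\<in>U. tt q < tt p}. tt p * tt q * N p * N q * KK d b p q) \<le>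
   (\<Sum>p\<in>U. \<Sum>q\<in>{q\<in>U. tt q < tt p}. 8 * c * (tt p * (tt q * KK d b p q)))"
 proof (intro sum_mono)
  fix p q assume p: "p \<in> U" and q: "q \<in> {q\<in>U. tt q < tt p}"
  have "(N p * N q) * (tt p * (tt q * KK d b p q)) \<le> 8 * c * (tt p * (tt q * KK d b p q))"
   using N8[of p q] p q tt_pos[of p] tt_pos[of q] KK_nonneg[of d b p q] by (intro mult_right_mono) auto
  then show "tt p * tt q * N p * N q * KK d b p q \<le> 8 * c * (tt p * (tt q * KK d b p q))" by (simp only: mult_ac)
 qed
 also have "... = 8 * c * (\<Sum>i<n. \<Sum>p\<in>A i. tt p * (\<Sum>q\<in>{q\<in>U. tt q < tt p}. tt q * KK d b p q))"
  unfolding sumU by (simp only: sum_distrib_left)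
 also have "... \<le> 8 * c * (\<Sum>i<n. C1 d * C2 * s i)"
 proof (intro mult_left_mono sum_mono)
  fix i assume "i \<in> {..<n}"
  then have i: "i < n" by simp
  have si: "s i > 0" using tree[OF i] by simp
  have "(\<Sum>p\<in>A i. tt p * (\<Sum>q\<in>{q\<in>U. tt q < tt p}. tt q * KK d b p q)) \<le> (\<Sum>p\<in>A i. tt p * (C1 d * tt p / s i))"
   using tt_pos by (intro sum_mono mult_left_mono row i) (auto simp: less_imp_le)
  also have "... = C1 d / s i * (\<Sum>p\<in>A i. (tt p)^2)"
   unfolding sum_distrib_left by (intro sum.cong refl) (simp add: power2_eq_square)
  also have "... \<le> C1 d / s i * (C2 * (s i)^2)"
   using tree_count[OF fA[OF i], of "x i" "\<xi> i" "s i"] inA[OF i] si C_nonneg by (intro mult_left_mono) auto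
  also have "... = C1 d * C2 * s i" using si by (simp add: power2_eq_square)
  finally show "(\<Sum>p\<in>A i. tt p * (\<Sum>q\<in>{q\<in>U. tt q < tt p}. tt q * KK d b p q)) \<le> C1 d * C2 * s i" .
 qed (use c in auto)
 also have "... = 8 * C1 d * C2 * (c * (\<Sum>i<n. s i))" by (simp add: sum_distrib_left mult_ac)
 also have "... \<le> 8 * C1 d * C2 * (\<Sum>p\<in>U. tt p * (N p)^2)"
 proof (intro mult_left_mono)
  show "c * (\<Sum>i<n. s i) \<le> (\<Sum>p\<in>U. tt p * (N p)^2)"
   unfolding sumU sum_distrib_left N_def using tree by (intro sum_mono) (auto simp: less_imp_le)
 qed (use C_nonneg in auto)
 finally have X: "(\<Sum>p\<in>U. \<Sum>q\<in>{q\<in>U. tt q < tt p}. tt p * tt q * N p * N q * KK d b p q) \<le> 8 * C1 d * C2 * (\<Sum>p\<in>U. tt p * (N p)^2)" .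
 have "c * (\<Sum>i<n. s i) \<le> (\<Sum>p\<in>U. tt p * (N p)^2)"
  unfolding sumU sum_distrib_left N_def using tree by (intro sum_mono) (auto simp: less_imp_le)
 also have "... \<le> C3 d * (LBINT x. (norm (f x))^2)"
  unfolding N_def C3_def by (rule bessel_split[OF fU f d X[unfolded N_def]]) (use C_nonneg in auto)
 finally show ?thesis .
qed

end

section \<open>Size and the tree estimate\<close>

context grid
begin

text \<open>The size of a collection, stated as an upper bound valid for all tops instead of as a
  supremum: the square density of the one-sided lacunary part of every tree.\<close>

definition sz :: "real \<Rightarrow> real \<Rightarrow> (point \<Rightarrow> real) \<Rightarrow> real \<Rightarrow> point set \<Rightarrow> bool" where
 "sz d b G \<sigma> P \<longleftrightarrow> (\<forall>x \<xi> s. s > 0 \<longrightarrow> (\<Sum>p\<in>lac d b P x \<xi> s. tt p * (G p)^2) \<le> \<sigma>^2 * s)"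

definition sz2 :: "real \<Rightarrow> real \<Rightarrow> (point \<Rightarrow> real) \<Rightarrow> real \<Rightarrow> point set \<Rightarrow> bool" where
 "sz2 d b G \<sigma> P \<longleftrightarrow> sz d b G \<sigma> P \<and> sz (- d) (- b) G \<sigma> P"

lemma sz_mono:
 assumes "sz d b G \<sigma> P" "P' \<subseteq> P" "finite P" "0 \<le> \<sigma>" "\<sigma> \<le> \<sigma>'"
 shows "sz d b G \<sigma>' P'"
 unfolding sz_def
proof (intro allI impI)
 fix x \<xi> s :: real assume s: "s > 0"
 have "(\<Sum>p\<in>lac d b P' x \<xi> s. tt p * (G p)^2) \<le> (\<Sum>p\<in>lac d b P x \<xi> s. tt p * (G p)^2)"
  by (rule sum_mono2) (use lac_mono[OF assms(2)] lac_finite[OF assms(3)] tt_pos in \<open>auto simp: less_imp_le\<close>)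
 also have "... \<le> \<sigma>^2 * s" using assms(1) s by (simp add: sz_def)
 also have "... \<le> \<sigma>'^2 * s" using s assms by (intro mult_right_mono power_mono) auto
 finally show "(\<Sum>p\<in>lac d b P' x \<xi> s. tt p * (G p)^2) \<le> \<sigma>'^2 * s" .
qed

lemma sz2_mono:
 assumes "sz2 d b G \<sigma> P" "P' \<subseteq> P" "finite P" "0 \<le> \<sigma>" "\<sigma> \<le> \<sigma>'"
 shows "sz2 d b G \<sigma>' P'"
 using assms sz_mono unfolding sz2_def by meson

lemma adm_uminus: "adm (- d) (- b) \<longleftrightarrow> adm d b"
 by (simp add: adm_def)

lemma uu_uminus: "uu (- d) (- b) \<xi> p = - uu d b \<xi> p"
 by (simp add: uu_def th_def algebra_simps)

text \<open>For a single point the top frequency can be placed so that \<open>uu\<close> is exactly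
  4, and \<open>adm\<close> keeps the point inside that tree. Size therefore dominates individual
  coefficients.\<close>

lemma sz_point:
 assumes sz: "sz d b G \<sigma> P" and P: "finite P" "p \<in> P" and ad: "adm d b" and \<sigma>: "\<sigma> \<ge> 0" and G: "G p \<ge> 0"
 shows "G p \<le> \<sigma>"
proof -
 define \<xi> where "\<xi> = ee p - (4 - b) / (d * tt p)"
 have t: "tt p > 0" by (rule tt_pos)
 have d: "d \<noteq> 0" using ad by (simp add: adm_def)
 have e: "tt p * (ee p - \<xi>) = (4 - b) / d" using t d by (simp add: \<xi>_def field_simps)
 have "uu d b \<xi> p = 4" unfolding uu_eq e using d by simp
 moreover have "\<bar>ee p - \<xi>\<bar> * tt p \<le> R"
 proof -
  have "\<bar>ee p - \<xi>\<bar> * tt p = \<bar>tt p * (ee p - \<xi>)\<bar>" using t by (simp add: abs_mult)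
  also have "... = \<bar>4 - b\<bar> / \<bar>d\<bar>" unfolding e by simp
  also have "... \<le> (4 + \<bar>b\<bar>) / \<bar>d\<bar>" by (rule divide_right_mono) auto
  also have "... \<le> R" using ad d by (simp add: adm_def pos_divide_le_eq)
  finally show ?thesis .
 qed
 ultimately have p: "p \<in> lac d b P (yy p) \<xi> (tt p)" using P t by (simp add: lac_def inT_def)
 have "tt p * (G p)^2 \<le> (\<Sum>p\<in>lac d b P (yy p) \<xi> (tt p). tt p * (G p)^2)"
  by (rule member_le_sum[OF p]) (use lac_finite[OF P(1)] tt_pos in \<open>auto simp: less_imp_le\<close>)
 also have "... \<le> \<sigma>^2 * tt p" using sz t by (simp add: sz_def)
 finally have "(G p)^2 \<le> \<sigma>^2" using t by (simp add: mult.commute)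
 then show ?thesis using \<sigma> by (rule power2_le_imp_le)
qed

section \<open>Covering the large part of a collection by trees of bounded total length\<close>

definition tcov :: "(real \<times> real \<times> real) list \<Rightarrow> point \<Rightarrow> bool" where
 "tcov T p \<longleftrightarrow> (\<exists>(x, \<xi>, s)\<in>set T. inT x \<xi> s p)"
definition twt :: "(real \<times> real \<times> real) list \<Rightarrow> real" where
 "twt T = (\<Sum>(x, \<xi>, s)\<leftarrow>T. s)"
definition tpos :: "(real \<times> real \<times> real) list \<Rightarrow> bool" where
 "tpos T \<longleftrightarrow> (\<forall>(x, \<xi>, s)\<in>set T. s > 0)"

lemma tcov_simps: "tcov [] p = False" "tcov (T @ T') p = (tcov T p \<or> tcov T' p)"
 by (auto simp: tcov_def)
lemma twt_simps: "twt [] = 0" "twt (T @ T') = twt T + twt T'"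
 by (auto simp: twt_def)
lemma tpos_simps: "tpos []" "tpos (T @ T') = (tpos T \<and> tpos T')"
 by (simp_all add: tpos_def ball_Un)

lemma decompose_one:
 assumes P: "finite P" and f: "f \<in> bm" "sq_integrable f"
  and E: "(LBINT x. (norm (f x))^2) \<le> E" and ad: "adm d b" and \<sigma>: "\<sigma> > 0"
  and G: "\<And>p. norm (FF f d b p) = G p" and G2: "\<And>p. p \<in> P \<Longrightarrow> G p \<le> 2 * \<sigma>"
 shows "\<exists>T. tpos T \<and> twt T \<le> 2 * C3 d * E / \<sigma>^2 \<and> sz d b G \<sigma> {p\<in>P. \<not> tcov T p}"
proof -
 \<comment> \<open>Chosen below every \<open>1 / tt p\<close>, the amount by which correlated
   packets of two trees separate the top frequencies.\<close>
 define \<epsilon> where "\<epsilon> = 1 / (1 + (\<Sum>p\<in>P. tt p))"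
 have S0: "(\<Sum>p\<in>P. tt p) \<ge> 0" using tt_pos by (intro sum_nonneg) (auto simp: less_imp_le)
 then have \<epsilon>0: "\<epsilon> > 0" by (simp add: \<epsilon>_def)
 have \<epsilon>1: "\<epsilon> * tt p \<le> 1" if "p \<in> P" for p
 proof -
  have "tt p \<le> (\<Sum>p\<in>P. tt p)" by (rule member_le_sum[OF that]) (use P tt_pos in \<open>auto simp: less_imp_le\<close>)
  then show ?thesis using S0 unfolding \<epsilon>_def by simp
 qed
 have g0: "0 \<le> tt p * (G p)^2" for p using tt_pos[of p] by simp
 have c: "\<sigma>^2 > 0" using \<sigma> by simp
 from selection[OF P, where g="\<lambda>p. tt p * (G p)^2" and c="\<sigma>^2" and \<epsilon>=\<epsilon> and d=d and b=b, OF g0 c \<epsilon>0]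
 obtain n :: nat and x \<xi> s A where
  1: "\<forall>i<n. s i > 0 \<and> A i \<subseteq> lac d b P (x i) (\<xi> i) (s i) \<and> \<sigma>^2 * s i < (\<Sum>p\<in>A i. tt p * (G p)^2)" and
  2: "\<forall>i<n. \<forall>k<n. i < k \<longrightarrow> d * \<xi> k < d * \<xi> i + \<epsilon> \<and> (\<forall>q\<in>A k. \<not> inT (x i) (\<xi> i) (2 * s i) q)" and
  3: "\<forall>y \<zeta> r. r > 0 \<longrightarrow> (\<Sum>p\<in>lac d b {p\<in>P. \<forall>i<n. \<not> inT (x i) (\<xi> i) (2 * s i) p} y \<zeta> r. tt p * (G p)^2) \<le> \<sigma>^2 * r"
  by (elim exE conjE) (rule that; assumption)
 have "\<sigma>^2 * (\<Sum>i<n. s i) \<le> C3 d * (LBINT x. (norm (f x))^2)"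
 proof (rule forest_bessel[OF f ad c P \<epsilon>1 \<epsilon>0])
  show "s i > 0 \<and> A i \<subseteq> lac d b P (x i) (\<xi> i) (s i) \<and> \<sigma>^2 * s i < (\<Sum>p\<in>A i. tt p * (norm (FF f d b p))^2)" if "i < n" for i
   using 1 that unfolding G by blast
  show "d * \<xi> k < d * \<xi> i + \<epsilon> \<and> (\<forall>q\<in>A k. \<not> inT (x i) (\<xi> i) (2 * s i) q)" if "i < n" "k < n" "i < k" for i k
   using 2 that by blast
  show "(norm (FF f d b p))^2 \<le> 8 * \<sigma>^2" if "p \<in> P" for p
  proof -
   have "0 \<le> G p" using G[of p] norm_ge_zero by metis
   then have "(G p)^2 \<le> (2 * \<sigma>)^2" using G2[OF that] by (intro power_mono) auto
   then have "(G p)^2 \<le> 4 * \<sigma>^2" by (simp add: power_mult_distrib)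
   then show ?thesis unfolding G using c by linarith
  qed
 qed
 also have "... \<le> C3 d * E" using E C_nonneg by (intro mult_left_mono) (auto simp: C3_def)
 finally have W: "(\<Sum>i<n. s i) \<le> C3 d * E / \<sigma>^2" using c by (simp add: pos_le_divide_eq mult.commute)
 \<comment> \<open>The selection removes trees of doubled length, so the cover has to use
   \<open>2 * s i\<close>; this doubles the total length.\<close>
 define T where "T = map (\<lambda>i. (x i, \<xi> i, 2 * s i)) [0..<n]"
 have "twt T = 2 * (\<Sum>i<n. s i)"
  by (simp add: twt_def T_def comp_def sum_list_const_mult sum_list_upt lessThan_atLeast0 interv_sum_list_conv_sum_set_nat sum_distrib_left)
 then have "twt T \<le> 2 * C3 d * E / \<sigma>^2" using W by simp
 moreover have "tpos T" using 1 by (auto simp: tpos_def T_def)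
 moreover have "tcov T p \<longleftrightarrow> \<not> (\<forall>i<n. \<not> inT (x i) (\<xi> i) (2 * s i) p)" for p by (auto simp: tcov_def T_def)
 then have "sz d b G \<sigma> {p\<in>P. \<not> tcov T p}" using 3 by (simp add: sz_def)
 ultimately show ?thesis by blast
qed

lemma emb_cnj: "emb (\<lambda>x. cnj (f x)) y (- \<theta>) t = cnj (emb f y \<theta> t)"
proof -
 have "emb (\<lambda>x. cnj (f x)) y (- \<theta>) t = (LBINT x. cnj (f x * cnj (wp y \<theta> t x)))"
  unfolding emb_def by (intro bochner_cong refl) (simp add: wp_def cis_cnj)
 then show ?thesis unfolding emb_def by (simp only: Bochner_Integration.integral_cnj)
qed

lemma FF_cnj: "norm (FF (\<lambda>x. cnj (f x)) (- d) (- b) p) = norm (FF f d b p)"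
proof -
 have "th (- d) (- b) p = - th d b p" by (simp add: th_def)
 then show ?thesis unfolding FF_def by (simp only: emb_cnj complex_mod_cnj)
qed

lemma C3_uminus: "C3 (- d) = C3 d" by (simp add: C3_def C0_def C1_def)
lemma C3_nonneg: "C3 d \<ge> 0" using C_nonneg by (simp add: C3_def)

text \<open>The side \<open>uu \<le> -4\<close> is the side \<open>uu \<ge> 4\<close> for the
  conjugate function with both signs reversed, and the moduli of the coefficients agree. The same
  selection is therefore run a second time on what the first one left.\<close>

lemma decompose_two:
 assumes P: "finite P" and f: "f \<in> bm" "sq_integrable f"
  and E: "(LBINT x. (norm (f x))^2) \<le> E" and ad: "adm d b" and \<sigma>: "\<sigma> > 0"
  and G: "\<And>p. norm (FF f d b p) = G p" and G2: "\<And>p. p \<in> P \<Longrightarrow> G p \<le> 2 * \<sigma>"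
 shows "\<exists>T. tpos T \<and> twt T \<le> 4 * C3 d * E / \<sigma>^2 \<and> sz2 d b G \<sigma> {p\<in>P. \<not> tcov T p}"
proof -
 obtain T where T: "tpos T" "twt T \<le> 2 * C3 d * E / \<sigma>^2" "sz d b G \<sigma> {p\<in>P. \<not> tcov T p}"
  using decompose_one[OF P f E ad \<sigma> G G2] by blast
 have f': "(\<lambda>x. cnj (f x)) \<in> bm" using f(1) by measurable
 have "\<exists>T'. tpos T' \<and> twt T' \<le> 2 * C3 (- d) * E / \<sigma>^2 \<and> sz (- d) (- b) G \<sigma> {p\<in>{p\<in>P. \<not> tcov T p}. \<not> tcov T' p}"
  by (rule decompose_one[OF _ f' _ _ _ \<sigma>]) (use P f E ad G G2 in \<open>auto simp: adm_uminus FF_cnj\<close>)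
 then obtain T' where T': "tpos T'" "twt T' \<le> 2 * C3 d * E / \<sigma>^2" "sz (- d) (- b) G \<sigma> {p\<in>{p\<in>P. \<not> tcov T p}. \<not> tcov T' p}"
  unfolding C3_uminus by blast
 have eq: "{p\<in>{p\<in>P. \<not> tcov T p}. \<not> tcov T' p} = {p\<in>P. \<not> tcov (T @ T') p}" by (auto simp: tcov_simps)
 have "sz d b G \<sigma> {p\<in>P. \<not> tcov (T @ T') p}"
  by (rule sz_mono[OF T(3)]) (use P \<sigma> in \<open>auto simp: tcov_simps\<close>)
 then have "sz2 d b G \<sigma> {p\<in>P. \<not> tcov (T @ T') p}" using T'(3) unfolding eq sz2_def by simp
 moreover have "4 * C3 d * E / \<sigma>^2 = 2 * C3 d * E / \<sigma>^2 + 2 * C3 d * E / \<sigma>^2" by (simp add: add_divide_distrib[symmetric])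
 then have "twt (T @ T') \<le> 4 * C3 d * E / \<sigma>^2" 
  using add_mono[OF T(2) T'(2)] unfolding twt_simps by (simp only:)
 ultimately show ?thesis using T(1) T'(1) by (intro exI[of _ "T @ T'"]) (simp add: tpos_simps)
qed

text \<open>The two lacunary factors enter through their square sums over the tree, the third
  through its supremum. The weight \<open>r\<close> in the arithmetic-geometric mean balances the
  two sizes, so that their product appears.\<close>

lemma tree_pair:
 assumes P: "finite P" "\<And>p. p \<in> P \<Longrightarrow> inT x \<xi> s p" and s: "s > 0"
  and u: "\<And>p. p \<in> P \<Longrightarrow> 4 \<le> \<bar>uu d1 b1 \<xi> p\<bar> \<and> 4 \<le> \<bar>uu d2 b2 \<xi> p\<bar>"
  and sz: "sz2 d1 b1 G1 \<sigma>1 P" "sz2 d2 b2 G2 \<sigma>2 P" and \<sigma>: "\<sigma>1 > 0" "\<sigma>2 > 0"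
  and G: "\<And>p. G1 p \<ge> 0" "\<And>p. G2 p \<ge> 0" "\<And>p. G3 p \<ge> 0" "\<And>p. p \<in> P \<Longrightarrow> G3 p \<le> \<sigma>3" and s3: "\<sigma>3 > 0"
 shows "(\<Sum>p\<in>P. tt p * (G1 p * G2 p * G3 p)) \<le> 2 * s * (\<sigma>1 * \<sigma>2 * \<sigma>3)"
proof -
 have one: "(\<Sum>p\<in>P. tt p * (G p)^2) \<le> 2 * \<sigma>^2 * s"
  if u: "\<And>p. p \<in> P \<Longrightarrow> 4 \<le> \<bar>uu d b \<xi> p\<bar>" and sz: "sz2 d b G \<sigma> P" for d b \<sigma> and G :: "point \<Rightarrow> real"
 proof -
  have "(\<Sum>p\<in>P. tt p * (G p)^2) \<le> (\<Sum>p\<in>lac d b P x \<xi> s \<union> lac (- d) (- b) P x \<xi> s. tt p * (G p)^2)"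
  proof (rule sum_mono2)
   show "P \<subseteq> lac d b P x \<xi> s \<union> lac (- d) (- b) P x \<xi> s"
   proof
    fix p assume p: "p \<in> P"
    have "4 \<le> uu d b \<xi> p \<or> 4 \<le> - uu d b \<xi> p" using u[OF p] by linarith
    then show "p \<in> lac d b P x \<xi> s \<union> lac (- d) (- b) P x \<xi> s" using p P(2) by (auto simp: lac_def uu_uminus)
   qed
  qed (use P lac_finite tt_pos in \<open>auto simp: less_imp_le\<close>)
  also have "... \<le> (\<Sum>p\<in>lac d b P x \<xi> s. tt p * (G p)^2) + (\<Sum>p\<in>lac (- d) (- b) P x \<xi> s. tt p * (G p)^2)"
   by (subst sum_Un) (use P lac_finite tt_pos in \<open>auto intro!: sum_nonneg simp: less_imp_le\<close>)
  also have "... \<le> \<sigma>^2 * s + \<sigma>^2 * s" using sz s unfolding sz2_def sz_def by (intro add_mono) auto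
  finally show ?thesis by (simp add: mult_ac)
 qed
 show ?thesis
 proof (cases "P = {}")
  case True
  then show ?thesis using s \<sigma> s3 by simp
 next
  case False
  then obtain p0 where "p0 \<in> P" by auto
  have pt: "tt p * (G1 p * G2 p * G3 p) \<le> \<sigma>3 * (\<sigma>2 / \<sigma>1 / 2 * (tt p * (G1 p)^2) + \<sigma>1 / \<sigma>2 / 2 * (tt p * (G2 p)^2))" if p: "p \<in> P" for p
  proof -
   define r where "r = sqrt (\<sigma>2 / \<sigma>1)"
   have r: "r > 0" "r^2 = \<sigma>2 / \<sigma>1" using \<sigma> by (auto simp: r_def)
   have "G1 p * G2 p = (r * G1 p) * (G2 p / r)" using r by simp
   also have "... \<le> (r * G1 p)^2 / 2 + (G2 p / r)^2 / 2" 
   proof -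
    have "u * w \<le> u^2 / 2 + w^2 / 2" for u w :: real using sum_squares_bound[of u w] by simp
    then show ?thesis .
   qed
   also have "... = \<sigma>2 / \<sigma>1 / 2 * (G1 p)^2 + \<sigma>1 / \<sigma>2 / 2 * (G2 p)^2"
    using \<sigma> unfolding power_mult_distrib power_divide r(2) by simp
   finally have a: "G1 p * G2 p \<le> \<sigma>2 / \<sigma>1 / 2 * (G1 p)^2 + \<sigma>1 / \<sigma>2 / 2 * (G2 p)^2" .
   have "tt p * (G1 p * G2 p * G3 p) \<le> tt p * (G1 p * G2 p * \<sigma>3)"
    using tt_pos[of p] G p by (intro mult_left_mono) (auto simp: less_imp_le)
   also have "... = (tt p * \<sigma>3) * (G1 p * G2 p)" by simp
   also have "... \<le> (tt p * \<sigma>3) * (\<sigma>2 / \<sigma>1 / 2 * (G1 p)^2 + \<sigma>1 / \<sigma>2 / 2 * (G2 p)^2)"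
    using tt_pos[of p] s3 a by (intro mult_left_mono) (auto simp: less_imp_le)
   finally show ?thesis by (simp add: algebra_simps)
  qed
  have "(\<Sum>p\<in>P. tt p * (G1 p * G2 p * G3 p)) \<le> (\<Sum>p\<in>P. \<sigma>3 * (\<sigma>2 / \<sigma>1 / 2 * (tt p * (G1 p)^2) + \<sigma>1 / \<sigma>2 / 2 * (tt p * (G2 p)^2)))"
   by (intro sum_mono pt)
  also have "... = \<sigma>3 * (\<sigma>2 / \<sigma>1 / 2 * (\<Sum>p\<in>P. tt p * (G1 p)^2) + \<sigma>1 / \<sigma>2 / 2 * (\<Sum>p\<in>P. tt p * (G2 p)^2))"
   by (simp only: sum_distrib_left sum.distrib[symmetric])
  also have "... \<le> \<sigma>3 * (\<sigma>2 / \<sigma>1 / 2 * (2 * \<sigma>1^2 * s) + \<sigma>1 / \<sigma>2 / 2 * (2 * \<sigma>2^2 * s))"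
   using s3 \<sigma> u sz by (intro mult_left_mono add_mono one) auto
  also have "... = 2 * s * (\<sigma>1 * \<sigma>2 * \<sigma>3)" using \<sigma> by (simp add: power2_eq_square)
  finally show ?thesis .
 qed
qed

text \<open>The combination \<open>d' * uu d b - d * uu d' b'\<close> equals
  \<open>d' * b - d * b'\<close> at every point, and the determinant hypotheses make this too large
  for both values of \<open>uu\<close> to be below 4. Hence at least two of the three functions are
  lacunary at each point; the three possible pairs give \<open>3 * 2 = 6\<close>.\<close>

lemma tree_estimate:
 assumes P: "finite P" "\<And>p. p \<in> P \<Longrightarrow> inT x \<xi> s p" and s: "s > 0"
  and ad: "adm d1 b1" "adm d2 b2" "adm d3 b3"
  and nd: "4 * (\<bar>d1\<bar> + \<bar>d2\<bar>) \<le> \<bar>d2 * b1 - d1 * b2\<bar>" "4 * (\<bar>d1\<bar> + \<bar>d3\<bar>) \<le> \<bar>d3 * b1 - d1 * b3\<bar>" "4 * (\<bar>d2\<bar> + \<bar>d3\<bar>) \<le> \<bar>d3 * b2 - d2 * b3\<bar>"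
  and sz: "sz2 d1 b1 G1 \<sigma>1 P" "sz2 d2 b2 G2 \<sigma>2 P" "sz2 d3 b3 G3 \<sigma>3 P" and \<sigma>: "\<sigma>1 > 0" "\<sigma>2 > 0" "\<sigma>3 > 0"
  and G: "\<And>p. G1 p \<ge> 0" "\<And>p. G2 p \<ge> 0" "\<And>p. G3 p \<ge> 0"
 shows "(\<Sum>p\<in>P. tt p * (G1 p * G2 p * G3 p)) \<le> 6 * s * (\<sigma>1 * \<sigma>2 * \<sigma>3)"
proof -
 have sup: "G1 p \<le> \<sigma>1" "G2 p \<le> \<sigma>2" "G3 p \<le> \<sigma>3" if "p \<in> P" for p
  using sz_point[OF _ P(1) that] sz ad \<sigma> G unfolding sz2_def by (meson less_imp_le)+
 have nd2: "\<not> (\<bar>uu d b \<xi> p\<bar> < 4 \<and> \<bar>uu d' b' \<xi> p\<bar> < 4)" if "4 * (\<bar>d\<bar> + \<bar>d'\<bar>) \<le> \<bar>d' * b - d * b'\<bar>" "d \<noteq> 0" "d' \<noteq> 0" for d b d' b' p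
 proof
  assume a: "\<bar>uu d b \<xi> p\<bar> < 4 \<and> \<bar>uu d' b' \<xi> p\<bar> < 4"
  have "d' * b - d * b' = d' * uu d b \<xi> p - d * uu d' b' \<xi> p" by (simp add: uu_eq algebra_simps)
  then have "\<bar>d' * b - d * b'\<bar> \<le> \<bar>d' * uu d b \<xi> p\<bar> + \<bar>d * uu d' b' \<xi> p\<bar>" by (simp only: abs_triangle_ineq4)
  also have "... = \<bar>d'\<bar> * \<bar>uu d b \<xi> p\<bar> + \<bar>d\<bar> * \<bar>uu d' b' \<xi> p\<bar>" by (simp only: abs_mult)
  also have "... < \<bar>d'\<bar> * 4 + \<bar>d\<bar> * 4" using a that by (intro add_strict_mono mult_strict_left_mono) auto
  finally show False using that(1) by simp
 qed
 have d: "d1 \<noteq> 0" "d2 \<noteq> 0" "d3 \<noteq> 0" using ad by (auto simp: adm_def)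
 define L where "L d b = {p\<in>P. 4 \<le> \<bar>uu d b \<xi> p\<bar>}" for d b
 have sub: "L d b \<inter> L d' b' \<subseteq> P" for d b d' b' by (auto simp: L_def)
 have fin: "finite (L d b \<inter> L d' b')" for d b d' b' using finite_subset[OF sub P(1)] .
 have szs: "sz2 d1 b1 G1 \<sigma>1 (L d b \<inter> L d' b')" "sz2 d2 b2 G2 \<sigma>2 (L d b \<inter> L d' b')" "sz2 d3 b3 G3 \<sigma>3 (L d b \<inter> L d' b')" for d b d' b'
  using sz2_mono[OF sz(1) sub P(1)] sz2_mono[OF sz(2) sub P(1)] sz2_mono[OF sz(3) sub P(1)] \<sigma> by (auto simp: less_imp_le)
 define g where "g p = tt p * (G1 p * G2 p * G3 p)" for p
 have g0: "g p \<ge> 0" for p using tt_pos[of p] G by (simp add: g_def less_imp_le)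
 have cover: "P \<subseteq> (L d1 b1 \<inter> L d2 b2) \<union> (L d1 b1 \<inter> L d3 b3) \<union> (L d2 b2 \<inter> L d3 b3)"
 proof
  fix p assume "p \<in> P"
  then show "p \<in> (L d1 b1 \<inter> L d2 b2) \<union> (L d1 b1 \<inter> L d3 b3) \<union> (L d2 b2 \<inter> L d3 b3)"
   using nd2[OF nd(1) d(1,2), of p] nd2[OF nd(2) d(1,3), of p] nd2[OF nd(3) d(2,3), of p]
   unfolding L_def by (simp add: not_less) argo
 qed
 have 1: "(\<Sum>p\<in>L d1 b1 \<inter> L d2 b2. g p) \<le> 2 * s * (\<sigma>1 * \<sigma>2 * \<sigma>3)"
  unfolding g_def by (rule tree_pair[OF fin _ s _ szs(1,2) \<sigma>(1,2) G]) (use P sup \<sigma> in \<open>auto simp: L_def\<close>)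
 have "(\<Sum>p\<in>L d1 b1 \<inter> L d3 b3. tt p * (G1 p * G3 p * G2 p)) \<le> 2 * s * (\<sigma>1 * \<sigma>3 * \<sigma>2)"
  by (rule tree_pair[OF fin _ s _ szs(1,3) \<sigma>(1,3) G(1,3,2)]) (use P sup \<sigma> in \<open>auto simp: L_def\<close>)
 then have 2: "(\<Sum>p\<in>L d1 b1 \<inter> L d3 b3. g p) \<le> 2 * s * (\<sigma>1 * \<sigma>2 * \<sigma>3)" unfolding g_def by (simp only: mult_ac)
 have "(\<Sum>p\<in>L d2 b2 \<inter> L d3 b3. tt p * (G2 p * G3 p * G1 p)) \<le> 2 * s * (\<sigma>2 * \<sigma>3 * \<sigma>1)"
  by (rule tree_pair[OF fin _ s _ szs(2,3) \<sigma>(2,3) G(2,3,1)]) (use P sup \<sigma> in \<open>auto simp: L_def\<close>)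
 then have 3: "(\<Sum>p\<in>L d2 b2 \<inter> L d3 b3. g p) \<le> 2 * s * (\<sigma>1 * \<sigma>2 * \<sigma>3)" unfolding g_def by (simp only: mult_ac)
 have un: "(\<Sum>p\<in>X \<union> Y. g p) \<le> (\<Sum>p\<in>X. g p) + (\<Sum>p\<in>Y. g p)" if "finite X" "finite Y" for X Y
  by (subst sum_Un) (use that g0 in \<open>auto intro!: sum_nonneg\<close>)
 have "(\<Sum>p\<in>P. g p) \<le> (\<Sum>p\<in>(L d1 b1 \<inter> L d2 b2) \<union> (L d1 b1 \<inter> L d3 b3) \<union> (L d2 b2 \<inter> L d3 b3). g p)"
  by (rule sum_mono2) (use fin cover g0 in auto)
 also have "... \<le> ((\<Sum>p\<in>L d1 b1 \<inter> L d2 b2. g p) + (\<Sum>p\<in>L d1 b1 \<inter> L d3 b3. g p)) + (\<Sum>p\<in>L d2 b2 \<inter> L d3 b3. g p)"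
  by (intro order_trans[OF un] add_right_mono un) (use fin in auto)
 also have "... \<le> 6 * s * (\<sigma>1 * \<sigma>2 * \<sigma>3)" using 1 2 3 by linarith
 finally show ?thesis unfolding g_def .
qed

end

section \<open>Iteration over dyadic size levels for three functions\<close>

locale trigrid = grid D rho r1 r2 R for D rho r1 r2 R :: real +
 fixes f1 f2 f3 :: "real \<Rightarrow> complex" and d1 d2 d3 b1 b2 b3 E1 E2 E3 :: real
 assumes f1: "f1 \<in> bm" "sq_integrable f1" "(LBINT x. (norm (f1 x))^2) \<le> E1^2"
  and f2: "f2 \<in> bm" "sq_integrable f2" "(LBINT x. (norm (f2 x))^2) \<le> E2^2"
  and f3: "f3 \<in> bm" "sq_integrable f3" "(LBINT x. (norm (f3 x))^2) \<le> E3^2"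
  and E: "E1 > 0" "E2 > 0" "E3 > 0"
  and ad: "adm d1 b1" "adm d2 b2" "adm d3 b3"
  and nd: "4 * (\<bar>d1\<bar> + \<bar>d2\<bar>) \<le> \<bar>d2 * b1 - d1 * b2\<bar>" "4 * (\<bar>d1\<bar> + \<bar>d3\<bar>) \<le> \<bar>d3 * b1 - d1 * b3\<bar>" "4 * (\<bar>d2\<bar> + \<bar>d3\<bar>) \<le> \<bar>d3 * b2 - d2 * b3\<bar>"
begin

definition "N1 p = norm (FF f1 d1 b1 p)"
definition "N2 p = norm (FF f2 d2 b2 p)"
definition "N3 p = norm (FF f3 d3 b3 p)"
definition "gg p = tt p * (N1 p * N2 p * N3 p)"
definition "K0 = 4 * (C3 d1 + C3 d2 + C3 d3)"
definition "sz3 \<sigma>1 \<sigma>2 \<sigma>3 P \<longleftrightarrow> sz2 d1 b1 N1 \<sigma>1 P \<and> sz2 d2 b2 N2 \<sigma>2 P \<and> sz2 d3 b3 N3 \<sigma>3 P"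

lemma N_nonneg: "N1 p \<ge> 0" "N2 p \<ge> 0" "N3 p \<ge> 0" by (simp_all add: N1_def N2_def N3_def)

lemma gg_nonneg: "gg p \<ge> 0" using tt_pos[of p] N_nonneg[of p] by (simp add: gg_def less_imp_le)

lemma sz3_mono:
 assumes "sz3 \<sigma>1 \<sigma>2 \<sigma>3 P" "P' \<subseteq> P" "finite P" "0 \<le> \<sigma>1" "0 \<le> \<sigma>2" "0 \<le> \<sigma>3"
 shows "sz3 \<sigma>1 \<sigma>2 \<sigma>3 P'"
 using assms sz2_mono[OF _ assms(2,3)] unfolding sz3_def by blast

text \<open>All three sizes are halved simultaneously. Measured in units of \<open>E1\<close>,
  \<open>E2\<close>, \<open>E3\<close>, each decomposition costs a tree length proportional to the
  same \<open>1 / v^2\<close>, so the three covers can be joined.\<close>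

lemma level:
 assumes P: "finite P" and v: "v > 0" and sz: "sz3 (2 * (v * E1)) (2 * (v * E2)) (2 * (v * E3)) P"
 shows "\<exists>T. tpos T \<and> twt T \<le> K0 / v^2 \<and> sz3 (v * E1) (v * E2) (v * E3) {p\<in>P. \<not> tcov T p}"
proof -
 have sup: "N1 p \<le> 2 * (v * E1)" "N2 p \<le> 2 * (v * E2)" "N3 p \<le> 2 * (v * E3)" if "p \<in> P" for p
  using sz_point[OF _ P that] sz ad E v N_nonneg unfolding sz3_def sz2_def by (meson less_imp_le mult_pos_pos zero_less_numeral)+
 have ve: "v * E1 > 0" "v * E2 > 0" "v * E3 > 0" using v E by auto
 obtain T1 where T1: "tpos T1" "twt T1 \<le> 4 * C3 d1 * E1^2 / (v * E1)^2" "sz2 d1 b1 N1 (v * E1) {p\<in>P. \<not> tcov T1 p}"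
  using decompose_two[OF P f1 ad(1) ve(1), of N1] sup by (auto simp: N1_def)
 obtain T2 where T2: "tpos T2" "twt T2 \<le> 4 * C3 d2 * E2^2 / (v * E2)^2" "sz2 d2 b2 N2 (v * E2) {p\<in>P. \<not> tcov T2 p}"
  using decompose_two[OF P f2 ad(2) ve(2), of N2] sup by (auto simp: N2_def)
 obtain T3 where T3: "tpos T3" "twt T3 \<le> 4 * C3 d3 * E3^2 / (v * E3)^2" "sz2 d3 b3 N3 (v * E3) {p\<in>P. \<not> tcov T3 p}"
  using decompose_two[OF P f3 ad(3) ve(3), of N3] sup by (auto simp: N3_def)
 define T where "T = T1 @ T2 @ T3"
 have sc: "4 * c * e^2 / (v * e)^2 = 4 * c / v^2" if "e > 0" for c e :: real using that v by (simp add: power_mult_distrib)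
 have "twt T \<le> 4 * C3 d1 / v^2 + (4 * C3 d2 / v^2 + 4 * C3 d3 / v^2)"
  using T1(2) T2(2) T3(2) unfolding T_def twt_simps sc[OF E(1)] sc[OF E(2)] sc[OF E(3)] by linarith
 also have "... = K0 / v^2" by (simp add: K0_def add_divide_distrib[symmetric] distrib_left)
 finally have W: "twt T \<le> K0 / v^2" .
 have "sz3 (v * E1) (v * E2) (v * E3) {p\<in>P. \<not> tcov T p}"
  unfolding sz3_def
  by (intro conjI; rule sz2_mono[OF T1(3)] sz2_mono[OF T2(3)] sz2_mono[OF T3(3)])
   (use P ve in \<open>auto simp: T_def tcov_simps less_imp_le\<close>)
 then show ?thesis using W T1(1) T2(1) T3(1) by (intro exI[of _ T]) (simp add: T_def tpos_simps)
qed

lemma covered_sum: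
 assumes P: "finite P" and \<sigma>: "\<sigma>1 > 0" "\<sigma>2 > 0" "\<sigma>3 > 0" and sz: "sz3 \<sigma>1 \<sigma>2 \<sigma>3 P" and T: "tpos T"
 shows "(\<Sum>p\<in>{p\<in>P. tcov T p}. gg p) \<le> 6 * twt T * (\<sigma>1 * \<sigma>2 * \<sigma>3)"
 using T
proof (induction T)
 case Nil
 then show ?case by (simp add: tcov_simps twt_simps)
next
 case (Cons a T)
 obtain x \<xi> s where a: "a = (x, \<xi>, s)" by (cases a) auto
 have s: "s > 0" and T: "tpos T" using Cons.prems by (auto simp: tpos_def a)
 have "(\<Sum>p\<in>{p\<in>P. tcov (a # T) p}. gg p) \<le> (\<Sum>p\<in>{p\<in>P. inT x \<xi> s p} \<union> {p\<in>P. tcov T p}. gg p)"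
  by (rule sum_mono2) (use P gg_nonneg in \<open>auto simp: tcov_def a\<close>)
 also have "... \<le> (\<Sum>p\<in>{p\<in>P. inT x \<xi> s p}. gg p) + (\<Sum>p\<in>{p\<in>P. tcov T p}. gg p)"
  by (subst sum_Un) (use P gg_nonneg in \<open>auto intro!: sum_nonneg\<close>)
 also have "(\<Sum>p\<in>{p\<in>P. inT x \<xi> s p}. gg p) \<le> 6 * s * (\<sigma>1 * \<sigma>2 * \<sigma>3)"
 proof -
  have sz': "sz3 \<sigma>1 \<sigma>2 \<sigma>3 {p\<in>P. inT x \<xi> s p}" by (rule sz3_mono[OF sz]) (use P \<sigma> in auto)
  show ?thesis unfolding gg_def
   by (rule tree_estimate[OF _ _ s ad nd _ _ _ \<sigma> N_nonneg]) (use P sz' in \<open>auto simp: sz3_def\<close>)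
 qed
 also have "(\<Sum>p\<in>{p\<in>P. tcov T p}. gg p) \<le> 6 * twt T * (\<sigma>1 * \<sigma>2 * \<sigma>3)" by (rule Cons.IH[OF T])
 finally show ?case by (simp add: twt_def a algebra_simps)
qed

text \<open>At each step two bounds for the sizes are available, the initial one and that of the
  current level. Every summand keeps the minimum of both: the initial bound is what makes the sum
  converge at the large levels, the current one at the small levels.\<close>

lemma iterate:
 assumes P: "finite P" and l: "la1 > 0" "la2 > 0" "la3 > 0" and szl: "sz3 la1 la2 la3 P"
  and v0: "v0 > 0" and szv: "sz3 (2 * (v0 * E1)) (2 * (v0 * E2)) (2 * (v0 * E3)) P"
 shows "\<exists>P'\<subseteq>P. sz3 (2 * (v0 / 2^N * E1)) (2 * (v0 / 2^N * E2)) (2 * (v0 / 2^N * E3)) P' \<and>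
  (\<Sum>p\<in>P. gg p) \<le> (\<Sum>n<N. 6 * (K0 / (v0 / 2^n)^2) * (min la1 (2 * (v0 / 2^n * E1)) * min la2 (2 * (v0 / 2^n * E2)) * min la3 (2 * (v0 / 2^n * E3)))) + (\<Sum>p\<in>P'. gg p)"
proof (induction N)
 case 0
 then show ?case using szv by (intro exI[of _ P]) auto
next
 case (Suc N)
 then obtain P' where P': "P' \<subseteq> P" "sz3 (2 * (v0 / 2^N * E1)) (2 * (v0 / 2^N * E2)) (2 * (v0 / 2^N * E3)) P'"
  and IH: "(\<Sum>p\<in>P. gg p) \<le> (\<Sum>n<N. 6 * (K0 / (v0 / 2^n)^2) * (min la1 (2 * (v0 / 2^n * E1)) * min la2 (2 * (v0 / 2^n * E2)) * min la3 (2 * (v0 / 2^n * E3)))) + (\<Sum>p\<in>P'. gg p)"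
  by blast
 define v where "v = v0 / 2^N"
 have v: "v > 0" using v0 by (simp add: v_def)
 have fP': "finite P'" using P'(1) P finite_subset by blast
 obtain T where T: "tpos T" "twt T \<le> K0 / v^2" "sz3 (v * E1) (v * E2) (v * E3) {p\<in>P'. \<not> tcov T p}"
  using level[OF fP' v] P'(2) unfolding v_def by blast
 define m1 m2 m3 where "m1 = min la1 (2 * (v * E1))" and "m2 = min la2 (2 * (v * E2))" and "m3 = min la3 (2 * (v * E3))"
 have m0: "m1 > 0" "m2 > 0" "m3 > 0" using l v E by (auto simp: m1_def m2_def m3_def)
 have "sz3 la1 la2 la3 P'" by (rule sz3_mono[OF szl P'(1) P]) (use l in auto)
 then have "sz3 m1 m2 m3 P'"
  using P'(2) unfolding v_def[symmetric] sz3_def m1_def m2_def m3_def min_def by auto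
 from covered_sum[OF fP' m0 this T(1)]
 have "(\<Sum>p\<in>{p\<in>P'. tcov T p}. gg p) \<le> 6 * twt T * (m1 * m2 * m3)" .
 also have "... \<le> 6 * (K0 / v^2) * (m1 * m2 * m3)"
  using T(2) m0 by (intro mult_right_mono mult_left_mono) auto
 finally have c: "(\<Sum>p\<in>{p\<in>P'. tcov T p}. gg p) \<le> 6 * (K0 / v^2) * (m1 * m2 * m3)" .
 have "(\<Sum>p\<in>P'. gg p) = (\<Sum>p\<in>{p\<in>P'. tcov T p} \<union> {p\<in>P'. \<not> tcov T p}. gg p)"
  by (rule sum.cong) auto
 also have "... = (\<Sum>p\<in>{p\<in>P'. tcov T p}. gg p) + (\<Sum>p\<in>{p\<in>P'. \<not> tcov T p}. gg p)"
  by (rule sum.union_disjoint) (use fP' in auto)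
 finally have "(\<Sum>p\<in>P. gg p) \<le> (\<Sum>n<Suc N. 6 * (K0 / (v0 / 2^n)^2) * (min la1 (2 * (v0 / 2^n * E1)) * min la2 (2 * (v0 / 2^n * E2)) * min la3 (2 * (v0 / 2^n * E3)))) + (\<Sum>p\<in>{p\<in>P'. \<not> tcov T p}. gg p)"
  using IH c unfolding sum.lessThan_Suc m1_def m2_def m3_def v_def by linarith
 moreover have "2 * (v0 / 2 ^ Suc N * e) = v * e" for e by (simp add: v_def)
 ultimately show ?case using T(3) P'(1) by (intro exI[of _ "{p\<in>P'. \<not> tcov T p}"]) auto
qed

text \<open>After \<open>N\<close> steps all three coefficients on the remaining points are at most
  a multiple of \<open>2^-N\<close>. The points belong to the fixed finite set \<open>P\<close>, so
  the remainder tends to 0.\<close>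

lemma sum_bound:
 assumes P: "finite P" and l: "la1 > 0" "la2 > 0" "la3 > 0" and szl: "sz3 la1 la2 la3 P"
  and v0: "v0 > 0" and lv: "la1 \<le> 2 * (v0 * E1)" "la2 \<le> 2 * (v0 * E2)" "la3 \<le> 2 * (v0 * E3)"
  and B: "\<And>N. (\<Sum>n<N. 6 * (K0 / (v0 / 2^n)^2) * (min la1 (2 * (v0 / 2^n * E1)) * min la2 (2 * (v0 / 2^n * E2)) * min la3 (2 * (v0 / 2^n * E3)))) \<le> B"
 shows "(\<Sum>p\<in>P. gg p) \<le> B"
proof -
 have szv: "sz3 (2 * (v0 * E1)) (2 * (v0 * E2)) (2 * (v0 * E3)) P"
  using szl sz2_mono[OF _ subset_refl P] l lv unfolding sz3_def by (meson less_imp_le)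
 define e where "e N = (\<Sum>p\<in>P. tt p) * ((2 * (v0 / 2^N * E1)) * (2 * (v0 / 2^N * E2)) * (2 * (v0 / 2^N * E3)))" for N :: nat
 have le: "(\<Sum>p\<in>P. gg p) \<le> B + e N" for N
 proof -
  define v where "v = v0 / 2^N"
  have v: "v > 0" using v0 by (simp add: v_def)
  obtain P' where P': "P' \<subseteq> P" "sz3 (2 * (v * E1)) (2 * (v * E2)) (2 * (v * E3)) P'"
   and I: "(\<Sum>p\<in>P. gg p) \<le> (\<Sum>n<N. 6 * (K0 / (v0 / 2^n)^2) * (min la1 (2 * (v0 / 2^n * E1)) * min la2 (2 * (v0 / 2^n * E2)) * min la3 (2 * (v0 / 2^n * E3)))) + (\<Sum>p\<in>P'. gg p)"
   using iterate[OF P l szl v0 szv, of N] unfolding v_def by blast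
  have fP': "finite P'" using P'(1) P finite_subset by blast
  have sup: "N1 p \<le> 2 * (v * E1)" "N2 p \<le> 2 * (v * E2)" "N3 p \<le> 2 * (v * E3)" if "p \<in> P'" for p
   using sz_point[OF _ fP' that] P'(2) ad E v N_nonneg unfolding sz3_def sz2_def by (meson less_imp_le mult_pos_pos zero_less_numeral)+
  have "(\<Sum>p\<in>P'. gg p) \<le> (\<Sum>p\<in>P'. tt p * ((2 * (v * E1)) * (2 * (v * E2)) * (2 * (v * E3))))"
   unfolding gg_def using tt_pos N_nonneg v E by (intro sum_mono mult_left_mono mult_mono sup) (auto simp: less_imp_le)
  also have "... = (\<Sum>p\<in>P'. tt p) * ((2 * (v * E1)) * (2 * (v * E2)) * (2 * (v * E3)))" by (rule sum_distrib_right[symmetric])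
  also have "... \<le> e N" unfolding e_def v_def[symmetric]
   using P' P tt_pos v E by (intro mult_right_mono sum_mono2) (auto simp: less_imp_le)
  finally show ?thesis using I B[of N] by linarith
 qed
 have z: "(\<lambda>N. v0 / 2^N) \<longlonglongrightarrow> 0"
  by (rule LIMSEQ_divide_realpow_zero) simp
 have "e \<longlonglongrightarrow> (\<Sum>p\<in>P. tt p) * ((2 * (0 * E1)) * (2 * (0 * E2)) * (2 * (0 * E3)))"
  unfolding e_def by (intro tendsto_intros z)
 then have "(\<lambda>N. B + e N) \<longlonglongrightarrow> B + 0" by (intro tendsto_intros) simp
 then show ?thesis using le by (intro LIMSEQ_le_const) auto
qed

end

lemma geom_half_sum: "(\<Sum>n\<in>S. (1/2::real)^n) \<le> 2 * (1/2)^m" if "finite S" "\<And>n. n \<in> S \<Longrightarrow> m \<le> n"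
proof -
 have s: "(\<lambda>n. (1/2::real)^(n + m)) sums (2 * (1/2)^m)"
  using sums_mult2[OF geometric_sums[of "1/2::real"], of "(1/2)^m"] by (simp add: power_add)
 have "(\<Sum>n\<in>S. (1/2::real)^n) = (\<Sum>k\<in>(\<lambda>n. n - m) ` S. (1/2::real)^(k + m))"
  by (subst sum.reindex) (use that in \<open>auto simp: inj_on_def intro!: sum.cong\<close>, metis le_add_diff_inverse2)
 also have "... \<le> 2 * (1/2)^m"
  using sum_le_suminf[OF sums_summable[OF s], of "(\<lambda>n. n - m) ` S"] that sums_unique[OF s] by simp
 finally show ?thesis .
qed

lemma geom_decay_sum:
 assumes "finite S" "w0 > (0::real)" "\<And>n. n \<in> S \<Longrightarrow> w0 / 2^n \<le> c" "c \<ge> 0"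
 shows "(\<Sum>n\<in>S. w0 / 2^n) \<le> 2 * c"
proof (cases "S = {}")
 case True
 then show ?thesis using assms by simp
next
 case False
 define m where "m = Min S"
 have m: "m \<in> S" "\<And>n. n \<in> S \<Longrightarrow> m \<le> n" using False assms(1) by (auto simp: m_def)
 have "(\<Sum>n\<in>S. w0 / 2^n) = w0 * (\<Sum>n\<in>S. (1/2)^n)" by (simp add: sum_distrib_left power_divide)
 also have "... \<le> w0 * (2 * (1/2)^m)" using geom_half_sum[OF assms(1) m(2)] assms(2) by (intro mult_left_mono) auto
 also have "... = 2 * (w0 / 2^m)" by (simp add: power_divide)
 also have "... \<le> 2 * c" using assms(3)[OF m(1)] by simp
 finally show ?thesis .
qed

section \<open>Sizes are controlled by averages\<close>

lemma L2_mult_indicator: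
 fixes f :: "real \<Rightarrow> complex"
 assumes [measurable]: "f \<in> bm" and f2: "sq_integrable f"
 shows "integrable lborel (\<lambda>x. indicator {a..b} x * norm (f x))"
proof -
 have "integrable lborel (\<lambda>x. indicator {a..b::real} x * norm (f x) :: real)"
 proof (rule integrable_mult_L2)
  have "integrable lborel (indicator {a..b} :: real \<Rightarrow> real)" by (rule integrable_indicator_Icc)
  moreover have "(\<lambda>x. (norm (indicator {a..b} x :: real))^2) = (indicator {a..b} :: real \<Rightarrow> real)" by (auto simp: indicator_def)
  ultimately show "integrable lborel (\<lambda>x. (norm (indicator {a..b} x :: real))^2)" by simp
  show "integrable lborel (\<lambda>x. (norm (norm (f x)))^2)" using f2 by simp
 qed measurable
 then show ?thesis .
qed

section \<open>Weighted averages and mollification at a variable scale\<close>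

lemma br2_dyadic:
 fixes u :: real
 assumes u: "u \<ge> 0"
 shows "ennreal (1 / (1 + u)^2) \<le> (\<Sum>k. ennreal (4 * (1/4)^k * (if u \<le> 2^k then 1 else 0)))"
proof -
 obtain k where k: "u \<le> 2^k" "\<And>j. j < k \<Longrightarrow> \<not> u \<le> 2^j"
  using exists_least_iff[of "\<lambda>k. u \<le> 2^k"] real_arch_pow[of 2 u] by (auto intro: less_imp_le)
 have "(2^k / 2)^2 \<le> (1 + u)^2"
 proof (rule power_mono)
  show "2^k / 2 \<le> 1 + u"
  proof (cases k)
   case (Suc j)
   then have "2^j < u" using k(2)[of j] by simp
   then show ?thesis using Suc by simp
  qed (use u in simp)
 qed simp
 then have "1 / (1 + u)^2 \<le> 1 / (2^k / 2)^2" using u by (intro divide_left_mono) auto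
 also have "... = 4 * (1/4)^k"
 proof -
  have "((2::real)^k / 2)^2 = 4^k / 4" by (simp add: power_divide power_mult[symmetric] mult.commute[of k] power_mult)
  then show ?thesis by (simp add: power_divide)
 qed
 finally have "ennreal (1 / (1 + u)^2) \<le> ennreal (4 * (1/4)^k * (if u \<le> 2^k then 1 else 0))" using k by (intro ennreal_leI) simp
 also have "... \<le> (\<Sum>k. ennreal (4 * (1/4)^k * (if u \<le> 2^k then 1 else 0)))"
 proof -
  have "F k \<le> (\<Sum>k. F k)" for F :: "nat \<Rightarrow> ennreal"
   using sum_le_suminf[of F "{k}"] by simp
  then show ?thesis .
 qed
 finally show ?thesis .
qed

text \<open>The bracket is dominated by indicators of intervals of radius \<open>2^k * t\<close>
  with weights \<open>4 * (1/4)^k\<close>. The average over such an interval costs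
  \<open>2^k\<close>, which leaves a geometric series with sum \<open>8 * la * t\<close>.\<close>

lemma annuli_gen:
 fixes h :: "real \<Rightarrow> real"
 assumes [measurable]: "h \<in> bm" and h0: "\<And>x. h x \<ge> 0"
  and hi: "\<And>r. integrable lborel (\<lambda>x. indicator {y - r..y + r} x * h x)" and t: "t > 0" and la: "la \<ge> 0"
  and avg: "\<And>r. r \<ge> t \<Longrightarrow> (LBINT x. indicator {y - r..y + r} x * h x) \<le> la * r"
 shows "integrable lborel (\<lambda>x. h x * (1 / (1 + \<bar>x - y\<bar> / t)^2))"
  "(LBINT x. h x * (1 / (1 + \<bar>x - y\<bar> / t)^2)) \<le> 8 * la * t"
proof -
 have nn: "(NINT x. ennreal (h x * (1 / (1 + \<bar>x - y\<bar> / t)^2))) \<le> ennreal (8 * la * t)"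
 proof -
  have "(NINT x. ennreal (h x * (1 / (1 + \<bar>x - y\<bar> / t)^2))) \<le>
   (NINT x. (\<Sum>k. ennreal (4 * (1/4)^k * (indicator {y - 2^k * t..y + 2^k * t} x * h x))))"
  proof (rule nn_integral_mono)
   fix x
   have e: "(if \<bar>x - y\<bar> / t \<le> 2^k then 1 else 0 :: real) = indicator {y - 2^k * t..y + 2^k * t} x" for k :: nat
    using t by (auto simp: indicator_def pos_divide_le_eq abs_le_iff)
   have "ennreal (h x * (1 / (1 + \<bar>x - y\<bar> / t)^2)) = ennreal (h x) * ennreal (1 / (1 + \<bar>x - y\<bar> / t)^2)"
    by (rule ennreal_mult) (auto simp: h0)
   also have "... \<le> ennreal (h x) * (\<Sum>k. ennreal (4 * (1/4)^k * (if \<bar>x - y\<bar> / t \<le> 2^k then 1 else 0)))"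
    by (intro mult_left_mono br2_dyadic) (use t in auto)
   also have "... = (\<Sum>k. ennreal (h x) * ennreal (4 * (1/4)^k * indicator {y - 2^k * t..y + 2^k * t} x))"
    unfolding e by (rule ennreal_suminf_cmult[symmetric])
   also have "... = (\<Sum>k. ennreal (4 * (1/4)^k * (indicator {y - 2^k * t..y + 2^k * t} x * h x)))"
   proof (rule suminf_cong)
    fix k :: nat
    show "ennreal (h x) * ennreal (4 * (1/4)^k * indicator {y - 2^k * t..y + 2^k * t} x) = ennreal (4 * (1/4)^k * (indicator {y - 2^k * t..y + 2^k * t} x * h x))"
     by (subst ennreal_mult[symmetric]) (simp_all only: mult_ac h0, auto simp: indicator_def)
   qed
   finally show "ennreal (h x * (1 / (1 + \<bar>x - y\<bar> / t)^2)) \<le> (\<Sum>k. ennreal (4 * (1/4)^k * (indicator {y - 2^k * t..y + 2^k * t} x * h x)))" .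
  qed
  also have "... = (\<Sum>k. NINT x. ennreal (4 * (1/4)^k * (indicator {y - 2^k * t..y + 2^k * t} x * h x)))"
   by (rule nn_integral_suminf) measurable
  also have "... \<le> (\<Sum>k. ennreal (4 * la * t * (1/2)^k))"
  proof (rule suminf_le)
   fix k :: nat
   have "(NINT x. ennreal (4 * (1/4)^k * (indicator {y - 2^k * t..y + 2^k * t} x * h x)))
    = ennreal (LBINT x. 4 * (1/4)^k * (indicator {y - 2^k * t..y + 2^k * t} x * h x))"
   proof (rule nn_integral_eq_integral)
    show "integrable lborel (\<lambda>x. 4 * (1/4)^k * (indicator {y - 2^k * t..y + 2^k * t} x * h x))"
     by (rule integrable_mult_right, rule hi)
   qed (auto intro!: AE_I2 simp: h0)
   also have "(LBINT x. 4 * (1/4)^k * (indicator {y - 2^k * t..y + 2^k * t} x * h x)) = 4 * (1/4)^k * (LBINT x. indicator {y - 2^k * t..y + 2^k * t} x * h x)"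
    by (rule integral_mult_right_zero)
   also have "ennreal ... \<le> ennreal (4 * (1/4)^k * (la * (2^k * t)))"
    by (intro ennreal_leI mult_left_mono avg) (use t in auto)
   also have "4 * (1/4)^k * (la * (2^k * t)) = 4 * la * t * (1/2)^k"
    by (simp add: power_divide field_simps power_mult_distrib[symmetric])
   finally show "(NINT x. ennreal (4 * (1/4)^k * (indicator {y - 2^k * t..y + 2^k * t} x * h x))) \<le> ennreal (4 * la * t * (1/2)^k)" .
  qed auto
  also have "... = ennreal (8 * la * t)"
  proof -
   have "(\<lambda>k. 4 * la * t * (1/2)^k) sums (4 * la * t * (1 / (1 - 1/2)))"
    by (intro sums_mult geometric_sums) simp
   then show ?thesis using t la by (intro suminf_ennreal_eq) (simp_all add: mult.assoc)
  qed
  finally show ?thesis .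
 qed
 show i: "integrable lborel (\<lambda>x. h x * (1 / (1 + \<bar>x - y\<bar> / t)^2))"
 proof (rule integrableI_nonneg)
  show "(NINT x. ennreal (h x * (1 / (1 + \<bar>x - y\<bar> / t)^2))) < \<infinity>"
   using le_less_trans[OF nn ennreal_less_top] by (simp only: infinity_ennreal_def)
 qed (auto intro!: AE_I2 simp: h0)
 have "ennreal (LBINT x. h x * (1 / (1 + \<bar>x - y\<bar> / t)^2)) \<le> ennreal (8 * la * t)"
  using nn by (subst nn_integral_eq_integral[OF i, symmetric]) (auto intro!: AE_I2 divide_nonneg_nonneg simp: h0)
 then show "(LBINT x. h x * (1 / (1 + \<bar>x - y\<bar> / t)^2)) \<le> 8 * la * t"
  using t la by (subst (asm) ennreal_le_iff) auto
qed

lemma annuli: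
 fixes f :: "real \<Rightarrow> complex"
 assumes f: "f \<in> bm" "sq_integrable f" and t: "t > 0" and la: "la \<ge> 0"
  and avg: "\<And>r. r \<ge> t \<Longrightarrow> (LBINT x. indicator {y - r..y + r} x * norm (f x)) \<le> la * r"
 shows "integrable lborel (\<lambda>x. norm (f x) * (1 / (1 + \<bar>x - y\<bar> / t)^2))"
  "(LBINT x. norm (f x) * (1 / (1 + \<bar>x - y\<bar> / t)^2)) \<le> 8 * la * t"
 by (rule annuli_gen[OF _ _ _ t la avg]; (rule L2_mult_indicator[OF f] | use f(1) in measurable | simp))+

text \<open>Averaging at a scale \<open>\<tau>\<close> that depends on the point; the tree sum of the mollified function is a plain \<open>L2\<close> quantity.\<close>

definition moll :: "(real \<Rightarrow> complex) \<Rightarrow> (real \<Rightarrow> real) \<Rightarrow> real \<Rightarrow> complex" where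
 "moll g \<tau> x = (LBINT z. (if \<bar>x - z\<bar> \<le> \<tau> z / 2 then g z / cx (\<tau> z) else 0))"

lemma moll_measurable[measurable]:
 assumes [measurable]: "g \<in> bm" "\<tau> \<in> bm"
 shows "moll g \<tau> \<in> bm"
 unfolding moll_def by measurable

text \<open>The mollification spreads each value \<open>g z\<close> evenly over an interval of
  length \<open>\<tau> z\<close> around \<open>z\<close>. After exchanging the integrals the error
  is \<open>g z\<close> times the mean of \<open>w z - w x\<close> over that interval, which is at
  most \<open>\<kappa> z\<close>.\<close>

lemma moll_error:
 fixes g w :: "real \<Rightarrow> complex"
 assumes g: "integrable lborel g" and [measurable]: "\<tau> \<in> bm" "w \<in> bm"
  and \<tau>: "\<And>z. \<tau> z > 0" and w: "\<And>x. norm (w x) \<le> B"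
  and \<kappa>: "\<And>z x. \<bar>x - z\<bar> \<le> \<tau> z / 2 \<Longrightarrow> norm (w z - w x) \<le> \<kappa> z"
  and g\<kappa>: "integrable lborel (\<lambda>z. norm (g z) * \<kappa> z)"
 shows "norm ((LBINT z. g z * w z) - (LBINT x. moll g \<tau> x * w x)) \<le> (LBINT z. norm (g z) * \<kappa> z)"
proof -
 have [measurable]: "g \<in> bm" using g by auto
 define m where "m z x = (if \<bar>x - z\<bar> \<le> \<tau> z / 2 then g z / cx (\<tau> z) else 0)" for z x
 have [measurable]: "(\<lambda>(z, x). m z x) \<in> borel_measurable (lborel \<Otimes>\<^sub>M lborel)" unfolding m_def by measurable
 have B0: "B \<ge> 0" using order_trans[OF norm_ge_zero w[of 0]] .
 have mi: "m z x = indicator {z - \<tau> z / 2..z + \<tau> z / 2} x *\<^sub>R (g z / cx (\<tau> z))" for z x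
 proof -
  have "\<bar>x - z\<bar> \<le> \<tau> z / 2 \<longleftrightarrow> x \<in> {z - \<tau> z / 2..z + \<tau> z / 2}" unfolding atLeastAtMost_iff by linarith
  then show ?thesis by (simp add: m_def indicator_def)
 qed
 have int_ind: "(LBINT x. indicator {z - \<tau> z / 2..z + \<tau> z / 2} x) = \<tau> z" for z
  using \<tau>[of z] by simp
 have mw_i: "integrable lborel (\<lambda>x. m z x * v x)" if [measurable]: "v \<in> bm" and v: "\<And>x. norm (v x) \<le> C" for z v C
 proof (rule dominated_integrable)
  show "integrable lborel (\<lambda>x. indicator {z - \<tau> z / 2..z + \<tau> z / 2} x * (norm (g z / cx (\<tau> z)) * C))"
   by (intro integrable_mult_left integrable_indicator_Icc)
  show "AE x in lborel. norm (m z x * v x) \<le> norm (indicator {z - \<tau> z / 2..z + \<tau> z / 2} x * (norm (g z / cx (\<tau> z)) * C))"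
  proof (rule AE_I2)
   fix x
   have "norm (g z / cx (\<tau> z)) * norm (v x) \<le> norm (g z / cx (\<tau> z)) * \<bar>C\<bar>"
    using v[of x] by (intro mult_left_mono) auto
   then show "norm (m z x * v x) \<le> norm (indicator {z - \<tau> z / 2..z + \<tau> z / 2} x * (norm (g z / cx (\<tau> z)) * C))"
    unfolding mi norm_mult norm_scaleR by (simp add: indicator_def abs_mult)
  qed
 qed (unfold m_def, measurable)
 have nb: "(LBINT x. norm (m z x * v x)) \<le> norm (g z) * C"
  if [measurable]: "v \<in> bm" and v: "\<And>x. \<bar>x - z\<bar> \<le> \<tau> z / 2 \<Longrightarrow> norm (v x) \<le> C" and C: "C \<ge> 0" for z v C
 proof -
  have "(LBINT x. norm (m z x * v x)) \<le> (LBINT x. indicator {z - \<tau> z / 2..z + \<tau> z / 2} x * (norm (g z) / \<tau> z * C))"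
  proof (rule integral_mono')
   show "integrable lborel (\<lambda>x. indicator {z - \<tau> z / 2..z + \<tau> z / 2} x * (norm (g z) / \<tau> z * C))"
    by (intro integrable_mult_left integrable_indicator_Icc)
   show "0 \<le> indicator {z - \<tau> z / 2..z + \<tau> z / 2} x * (norm (g z) / \<tau> z * C)" for x
    using \<tau>[of z] C by (auto simp: indicator_def)
   fix x
   show "norm (m z x * v x) \<le> indicator {z - \<tau> z / 2..z + \<tau> z / 2} x * (norm (g z) / \<tau> z * C)"
   proof (cases "\<bar>x - z\<bar> \<le> \<tau> z / 2")
    case True
    have "norm (m z x * v x) = norm (g z) / \<tau> z * norm (v x)" using True \<tau>[of z] by (simp add: m_def norm_mult norm_divide)
    also have "... \<le> norm (g z) / \<tau> z * C" using v[OF True] \<tau>[of z] by (intro mult_left_mono) auto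
    finally have le: "norm (m z x * v x) \<le> norm (g z) / \<tau> z * C" .
    have "x \<in> {z - \<tau> z / 2..z + \<tau> z / 2}" using True unfolding atLeastAtMost_iff by linarith
    then show ?thesis using le by simp
   qed (use \<tau>[of z] C in \<open>auto simp: m_def indicator_def\<close>)
  qed
  also have "... = (LBINT x. indicator {z - \<tau> z / 2..z + \<tau> z / 2} x) * (norm (g z) / \<tau> z * C)" by (rule integral_mult_left_zero)
  also have "... = norm (g z) * C" unfolding int_ind using \<tau>[of z] by simp
  finally show ?thesis .
 qed
 have I: "integrable (lborel \<Otimes>\<^sub>M lborel) (\<lambda>(z, x). m z x * w x)"
 proof (rule lborel_pair.Fubini_integrable)
  show "(\<lambda>(z, x). m z x * w x) \<in> borel_measurable (lborel \<Otimes>\<^sub>M lborel)" by measurable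
  show "integrable lborel (\<lambda>z. LBINT x. norm (case (z, x) of (z, x) \<Rightarrow> m z x * w x))"
  proof (rule dominated_integrable)
   show "integrable lborel (\<lambda>z. norm (g z) * B)" using g by simp
   show "AE z in lborel. norm (LBINT x. norm (case (z, x) of (z, x) \<Rightarrow> m z x * w x)) \<le> norm (norm (g z) * B)"
    using nb[where v=w and C=B] w B0 by (intro AE_I2) (auto intro!: order_trans[OF _ abs_ge_self])
  qed measurable
  show "AE z in lborel. integrable lborel (\<lambda>x. case (z, x) of (z, x) \<Rightarrow> m z x * w x)"
   using mw_i[OF _ w] by (intro AE_I2) simp
 qed
 have "(LBINT x. moll g \<tau> x * w x) = (LBINT x. LBINT z. m z x * w x)"
  unfolding moll_def m_def by simp
 also have "... = (LBINT z. LBINT x. m z x * w x)"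
  by (rule lborel_pair.Fubini_integral[OF I])
 finally have 1: "(LBINT x. moll g \<tau> x * w x) = (LBINT z. LBINT x. m z x * w x)" .
 have 2: "g z * w z = (LBINT x. m z x * w z)" for z
 proof -
  have "(LBINT x. m z x * w z) = (LBINT x. indicator {z - \<tau> z / 2..z + \<tau> z / 2} x *\<^sub>R (g z / cx (\<tau> z) * w z))"
   unfolding mi by simp
  also have "... = (LBINT x. indicator {z - \<tau> z / 2..z + \<tau> z / 2} x) *\<^sub>R (g z / cx (\<tau> z) * w z)"
   by (rule Bochner_Integration.integral_scaleR_left) (rule integrable_indicator_Icc)
  also have "... = g z * w z" unfolding int_ind using \<tau>[of z] by (simp add: scaleR_conv_of_real)
  finally show ?thesis by (rule sym)
 qed
 have gw: "integrable lborel (\<lambda>z. g z * w z)"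
 proof (rule dominated_integrable)
  show "integrable lborel (\<lambda>z. norm (g z) * B)" using g by simp
  show "AE z in lborel. norm (g z * w z) \<le> norm (norm (g z) * B)"
   using w B0 by (intro AE_I2) (auto simp: norm_mult abs_mult intro!: mult_left_mono)
 qed measurable
 have "(LBINT z. g z * w z) - (LBINT x. moll g \<tau> x * w x) = (LBINT z. g z * w z - (LBINT x. m z x * w x))"
  unfolding 1 using gw lborel_pair.integrable_fst[OF I] by (simp)
 also have "... = (LBINT z. (LBINT x. m z x * (w z - w x)))"
  unfolding 2 right_diff_distrib
  by (intro bochner_cong refl, subst Bochner_Integration.integral_diff, rule mw_i[where C=B], simp add: w, simp add: w, rule mw_i[where C=B], simp, simp add: w, simp)
 also have "norm ... \<le> (LBINT z. norm (LBINT x. m z x * (w z - w x)))" by (rule integral_norm_bound)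
 also have "... \<le> (LBINT z. norm (g z) * \<kappa> z)"
 proof (rule integral_mono'[OF g\<kappa>])
  fix z
  have k0: "\<kappa> z \<ge> 0" using \<kappa>[of z z] \<tau>[of z] by (auto intro: order_trans[OF norm_ge_zero])
  then show "0 \<le> norm (g z) * \<kappa> z" by simp
  have "norm (LBINT x. m z x * (w z - w x)) \<le> (LBINT x. norm (m z x * (w z - w x)))" by (rule integral_norm_bound)
  also have "... \<le> norm (g z) * \<kappa> z" by (rule nb[OF _ \<kappa> k0]) auto
  finally show "norm (LBINT x. m z x * (w z - w x)) \<le> norm (g z) * \<kappa> z" .
 qed
 finally show ?thesis .
qed

lemma sum_powi_two_sided:
 fixes D rho \<tau> :: real
 assumes D: "D \<ge> 4" and rho: "rho > 0" and \<tau>: "\<tau> > 0" and K: "finite K"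
 shows "(\<Sum>k\<in>K. min (\<tau> / (rho * D powi k)) (rho * D powi k / \<tau>)) \<le> 4"
proof -
 define K1 K2 where "K1 = {k\<in>K. rho * D powi k \<le> \<tau>}" and "K2 = {k\<in>K. \<not> rho * D powi k \<le> \<tau>}"
 have fin: "finite K1" "finite K2" using K by (auto simp: K1_def K2_def)
 have pos: "D powi k > 0" for k using D by simp
 have "(\<Sum>k\<in>K. min (\<tau> / (rho * D powi k)) (rho * D powi k / \<tau>)) = (\<Sum>k\<in>K1 \<union> K2. min (\<tau> / (rho * D powi k)) (rho * D powi k / \<tau>))"
  by (rule sum.cong) (auto simp: K1_def K2_def)
 also have "... = (\<Sum>k\<in>K1. min (\<tau> / (rho * D powi k)) (rho * D powi k / \<tau>)) + (\<Sum>k\<in>K2. min (\<tau> / (rho * D powi k)) (rho * D powi k / \<tau>))"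
  by (rule sum.union_disjoint[OF fin]) (auto simp: K1_def K2_def)
 also have "(\<Sum>k\<in>K1. min (\<tau> / (rho * D powi k)) (rho * D powi k / \<tau>)) \<le> 2"
 proof (cases "K1 = {}")
  case False
  have "(\<Sum>k\<in>K1. min (\<tau> / (rho * D powi k)) (rho * D powi k / \<tau>)) \<le> (\<Sum>k\<in>K1. rho / \<tau> * D powi k)"
   by (intro sum_mono) simp
  also have "... = rho / \<tau> * (\<Sum>k\<in>K1. D powi k)" by (rule sum_distrib_left[symmetric])
  also have "... \<le> rho / \<tau> * (2 * D powi (Max K1))"
   using sum_powi_le[OF D fin(1), of "Max K1"] fin(1) rho \<tau> by (intro mult_left_mono) auto
  also have "... \<le> 2"
   using Max_in[OF fin(1) False] \<tau> rho by (simp add: K1_def pos_divide_le_eq)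
  finally show ?thesis .
 qed simp
 also have "(\<Sum>k\<in>K2. min (\<tau> / (rho * D powi k)) (rho * D powi k / \<tau>)) \<le> 2"
 proof (cases "K2 = {}")
  case False
  have "(\<Sum>k\<in>K2. min (\<tau> / (rho * D powi k)) (rho * D powi k / \<tau>)) \<le> (\<Sum>k\<in>K2. \<tau> / rho * D powi (- k))"
   by (intro sum_mono) (simp add: power_int_minus divide_inverse min_le_iff_disj)
  also have "... = \<tau> / rho * (\<Sum>k\<in>K2. D powi (- k))" by (rule sum_distrib_left[symmetric])
  also have "(\<Sum>k\<in>K2. D powi (- k)) = (\<Sum>k\<in>uminus ` K2. D powi k)" by (subst sum.reindex) auto
  also have "\<tau> / rho * ... \<le> \<tau> / rho * (2 * D powi (- Min K2))"
  proof (rule mult_left_mono)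
   have "k \<le> - Min K2" if "k \<in> uminus ` K2" for k using that fin(2) by (auto intro: Min_le)
   then show "(\<Sum>k\<in>uminus ` K2. D powi k) \<le> 2 * D powi (- Min K2)"
    by (intro sum_powi_le[OF D]) (use fin(2) in auto)
  qed (use rho \<tau> in auto)
  also have "... \<le> 2"
   using Min_in[OF fin(2) False] \<tau> rho pos[of "Min K2"] by (simp add: K2_def power_int_minus field_simps)
  finally show ?thesis .
 qed simp
 finally show ?thesis by simp
qed

text \<open>The two terms of the minimum come from two regimes. For \<open>\<tau> \<le> t\<close>
  the packet varies on scale \<open>t\<close>, as \<open>phi\<close> is Lipschitz and the frequency
  is at most \<open>D / t\<close>. For \<open>\<tau> > t\<close> smoothness gives nothing, but then
  \<open>z\<close> is at least \<open>\<tau> - t\<close> away from \<open>y\<close>, and two spare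
  powers of decay yield the factor \<open>t / \<tau>\<close>.\<close>

lemma wp_diff:
 assumes t: "t > 0" and \<theta>: "\<bar>\<theta>\<bar> * t \<le> D" and \<tau>: "\<tau> > 0" "\<tau> \<le> t + \<bar>z - y\<bar>" and x: "\<bar>x - z\<bar> \<le> \<tau> / 2"
 shows "norm (wp y \<theta> t z - wp y \<theta> t x) \<le> (15000 + 625 * D) / t * (min (\<tau> / t) (t / \<tau>) * (1 / (1 + \<bar>z - y\<bar> / t)^2))"
proof -
 define Z X w where "Z = (z - y) / t" and "X = (x - y) / t" and "w = 1 + \<bar>z - y\<bar> / t"
 have wZ: "w = 1 + \<bar>Z\<bar>" using t by (simp add: w_def Z_def)
 have w1: "w \<ge> 1" by (simp add: wZ)
 have D0: "D \<ge> 0" using order_trans[OF mult_nonneg_nonneg \<theta>] t by simp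
 have "X - Z = (x - z) / t" by (simp add: X_def Z_def diff_divide_distrib)
 then have XZ: "\<bar>X - Z\<bar> = \<bar>x - z\<bar> / t" using t by simp
 have tw: "\<tau> / t \<le> w" using \<tau> t by (simp add: w_def field_simps)
 have "\<bar>X - Z\<bar> \<le> \<tau> / 2 / t" unfolding XZ using x t by (intro divide_right_mono) auto
 then have XZ1: "\<bar>X - Z\<bar> \<le> \<tau> / t" "\<bar>X - Z\<bar> \<le> w / 2" using tw \<tau> t by auto
 show ?thesis
 proof (cases "\<tau> \<le> t")
  case True
  have m: "min (\<tau> / t) (t / \<tau>) = \<tau> / t"
  proof -
   have "\<tau> / t \<le> 1" "1 \<le> t / \<tau>" using True \<tau> t by auto
   then show ?thesis by simp
  qed
  have p: "\<bar>phi X - phi Z\<bar> \<le> 4000 * (\<tau> / t) / w^2"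
  proof -
   have "\<bar>phi X - phi Z\<bar> \<le> 4000 * \<bar>X - Z\<bar> / w^3" using phi_lip[of X Z] XZ1(2) unfolding wZ by simp
   also have "... \<le> 4000 * (\<tau> / t) / w^2"
    using XZ1(1) w1 t \<tau> by (intro frac_le mult_left_mono power_increasing) auto
   finally show ?thesis .
  qed
  have c: "phi Z * norm (cis (\<theta> * z) - cis (\<theta> * x)) \<le> 625 / w^2 * (D * (\<tau> / t))"
  proof (rule mult_mono)
   show "phi Z \<le> 625 / w^2" using phi_le_br[of 2 Z] unfolding wZ by simp
   have "norm (cis (\<theta> * z) - cis (\<theta> * x)) \<le> \<bar>\<theta> * z - \<theta> * x\<bar>" by (rule norm_cis_diff)
   also have "... = (\<bar>\<theta>\<bar> * t) * \<bar>X - Z\<bar>" using t unfolding XZ by (simp add: right_diff_distrib[symmetric] abs_mult abs_minus_commute)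
   also have "... \<le> D * (\<tau> / t)" by (rule mult_mono[OF \<theta> XZ1(1) D0]) simp
   finally show "norm (cis (\<theta> * z) - cis (\<theta> * x)) \<le> D * (\<tau> / t)" .
  qed (use w1 in auto)
  have e: "wp y \<theta> t z - wp y \<theta> t x = cx (1 / t) * (cx (phi Z) * (cis (\<theta> * z) - cis (\<theta> * x)) - cx (phi X - phi Z) * cis (\<theta> * x))"
   unfolding wp_def Z_def[symmetric] X_def[symmetric] by (simp add: algebra_simps diff_divide_distrib)
  have "norm (wp y \<theta> t z - wp y \<theta> t x) \<le> 1 / t * (phi Z * norm (cis (\<theta> * z) - cis (\<theta> * x)) + \<bar>phi X - phi Z\<bar>)"
   unfolding e norm_mult norm_of_real
   using norm_triangle_ineq4[of "cx (phi Z) * (cis (\<theta> * z) - cis (\<theta> * x))" "cx (phi X - phi Z) * cis (\<theta> * x)"] t phi_nonneg[of Z]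
   unfolding norm_mult norm_of_real norm_cis by (auto intro!: divide_right_mono)
  also have "... \<le> 1 / t * (625 / w^2 * (D * (\<tau> / t)) + 4000 * (\<tau> / t) / w^2)"
   using t by (intro mult_left_mono add_mono c p) auto
  also have "... = (4000 + 625 * D) / t * (\<tau> / t * (1 / w^2))" using t w1 by (simp add: field_simps)
  also have "... \<le> (15000 + 625 * D) / t * (\<tau> / t * (1 / w^2))"
   using t \<tau> D0 by (intro mult_right_mono divide_right_mono) auto
  finally show ?thesis unfolding m w_def .
 next
  case False
  have m: "min (\<tau> / t) (t / \<tau>) = t / \<tau>"
  proof -
   have "1 \<le> \<tau> / t" "t / \<tau> \<le> 1" using False \<tau> t by auto
   then show ?thesis by simp
  qed
  have "w \<le> 2 * (1 + \<bar>X\<bar>)" 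
  proof -
   have "1 + a \<le> 2 * (1 + c)" if "a \<le> c + e" "e \<le> (1 + a) / 2" for a c e :: real using that by argo
   moreover have "\<bar>Z\<bar> \<le> \<bar>X\<bar> + \<bar>X - Z\<bar>" using abs_triangle_ineq[of X "Z - X"] by (simp add: abs_minus_commute)
   ultimately show ?thesis using XZ1(2) unfolding wZ by blast
  qed
  then have "w^4 \<le> (2 * (1 + \<bar>X\<bar>))^4" using w1 by (intro power_mono) auto
  then have w4: "w^4 \<le> 16 * (1 + \<bar>X\<bar>)^4" by (simp only: power_mult_distrib) simp
  have "phi X \<le> 625 / (1 + \<bar>X\<bar>)^4" by (rule phi_le)
  also have "... \<le> 625 / (w^4 / 16)" using w4 w1 by (intro divide_left_mono) auto
  finally have pX: "phi X \<le> 10000 / w^4" by simp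
  have pZ: "phi Z \<le> 625 / w^4" using phi_le[of Z] unfolding wZ .
  have "norm (wp y \<theta> t z - wp y \<theta> t x) \<le> norm (wp y \<theta> t z) + norm (wp y \<theta> t x)" by (rule norm_triangle_ineq4)
  also have "... = (phi Z + phi X) / t" using t by (simp add: norm_wp Z_def X_def add_divide_distrib)
  also have "... \<le> 10625 / w^4 / t" using pX pZ t by (intro divide_right_mono) auto
  also have "... \<le> 10625 * (t / \<tau> / w^2) / t"
  proof -
   have "\<tau> / t * 1 \<le> w * w" using tw w1 by (intro mult_mono) auto
   then have "1 / w^2 \<le> 1 / (\<tau> / t)" using \<tau> t w1 by (intro divide_left_mono) (auto simp: power2_eq_square)
   then have "1 / w^2 * (1 / w^2) \<le> 1 / (\<tau> / t) * (1 / w^2)" by (rule mult_right_mono) simp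
   then have "1 / w^4 \<le> t / \<tau> / w^2" by (simp add: power2_eq_square power4_eq_xxxx)
   then show ?thesis using t by (intro divide_right_mono) auto
  qed
  also have "... \<le> (15000 + 625 * D) * (t / \<tau> / w^2) / t"
   using t \<tau> D0 by (intro divide_right_mono mult_right_mono) auto
  also have "... = (15000 + 625 * D) / t * (t / \<tau> * (1 / w^2))" by simp
  finally show ?thesis unfolding m w_def .
 qed
qed

section \<open>The size of a tree in terms of averages of the function\<close>

context grid
begin

definition LL :: real where "LL = 15000 + 625 * D"
definition C5 :: "real \<Rightarrow> real" where
 "C5 d = 3 * (5000^2 * C2 + 72 * C0 d + 24 * LL^2 * ((2 * R + 1) * (16 * pi)))"

text \<open>Within one lacunary tree packets of different scales are exactly orthogonal: the coarser
  frequency is within \<open>1 / tt q\<close> of the top and the finer packet \<open>q\<close> at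
  least \<open>4 / tt q\<close> above it. Only the same-scale sum remains.\<close>

lemma tree_bessel:
 assumes A: "finite A" and f: "f \<in> bm" "sq_integrable f" and ad: "adm d b"
  and T: "\<And>p. p \<in> A \<Longrightarrow> inT x0 \<xi> s p \<and> 4 \<le> uu d b \<xi> p"
 shows "(\<Sum>p\<in>A. tt p * (norm (FF f d b p))^2) \<le> C0 d * (LBINT x. (norm (f x))^2)"
proof -
 have K0: "KK d b p q = 0" if p: "p \<in> A" "q \<in> A" "tt q < tt p" for p q
 proof (rule ccontr)
  assume "KK d b p q \<noteq> 0"
  then have o: "\<bar>th d b p - th d b q\<bar> \<le> 1 / tt p + 1 / tt q" by (rule KK_orth)
  have tp: "tt p > 0" "tt q > 0" by (rule tt_pos)+
  have gap: "tt q * D \<le> tt p" by (rule tt_gap[OF p(3)])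
  have up: "\<bar>uu d b \<xi> p\<bar> \<le> D" using uu_bound T[OF p(1)] ad by blast
  have "\<bar>uu d b \<xi> p\<bar> / tt p \<le> D / tt p" using up tp by (intro divide_right_mono) auto
  also have "... \<le> 1 / tt q" using gap tp by (simp add: field_simps)
  finally have a: "\<bar>th d b p - d * \<xi>\<bar> \<le> 1 / tt q" using tp by (simp add: uu_def abs_mult)
  have "4 \<le> tt q * (th d b q - d * \<xi>)" using T[OF p(2)] by (simp add: uu_def)
  then have b: "4 / tt q \<le> th d b q - d * \<xi>" using tp by (simp add: pos_divide_le_eq mult.commute)
  have e: "4 / tt q = 4 * (1 / tt q)" by simp
  have "1 / tt p < 1 / tt q" using p(3) tp by (simp add: frac_less2)
  moreover have "1 / tt q > 0" using tp by simp
  ultimately show False using a b o unfolding e by linarith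
 qed
 have "(\<Sum>p\<in>A. \<Sum>q\<in>{q\<in>A. tt q < tt p}. tt p * tt q * norm (FF f d b p) * norm (FF f d b q) * KK d b p q) = 0"
  by (intro sum.neutral ballI) (auto simp: K0)
 then have "(\<Sum>p\<in>A. tt p * (norm (FF f d b p))^2) \<le> (C0 d + 2 * 0) * (LBINT x. (norm (f x))^2)"
  using ad by (intro bessel_split[OF A f]) (auto simp: adm_def)
 then show ?thesis by simp
qed

text \<open>At one scale the positions are summable and there are at most \<open>2 R + 1\<close>
  frequencies. Across scales the minimum decays geometrically on both sides of the scale
  \<open>\<tau>\<close>.\<close>

lemma kernel_sum:
 assumes A: "finite A" and T: "\<And>p. p \<in> A \<Longrightarrow> inT x0 \<xi> s p" and \<tau>: "\<tau> > 0"
 shows "(\<Sum>p\<in>A. min (\<tau> / tt p) (tt p / \<tau>) * (1 / (1 + \<bar>z - yy p\<bar> / tt p)^2)) \<le> (2 * R + 1) * (16 * pi)"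
proof -
 define K where "K = fst ` A"
 have fK: "finite K" using A by (simp add: K_def)
 let ?h = "\<lambda>p. min (\<tau> / tt p) (tt p / \<tau>) * (1 / (1 + \<bar>z - yy p\<bar> / tt p)^2)"
 have slice: "(\<Sum>p\<in>{p\<in>A. fst p = k}. ?h p) \<le> min (\<tau> / (rho * D powi k)) (rho * D powi k / \<tau>) * ((2 * R + 1) * (4 * pi))" if "k \<in> K" for k
 proof -
  define t where "t = rho * D powi k"
  have t0: "t > 0" using D4 rho by (simp add: t_def)
  define N where "N = (\<lambda>q. fst (snd q)) ` {p\<in>A. fst p = k}"
  define M where "M = (\<lambda>q. snd (snd q)) ` {p\<in>A. fst p = k}"
  have sub: "{p\<in>A. fst p = k} \<subseteq> {k} \<times> N \<times> M" by (auto simp: N_def M_def image_iff)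
  have fin: "finite N" "finite M" using A by (auto simp: N_def M_def)
  have ttk: "tt p = t" if "fst p = k" for p using that by (simp add: tt_def t_def)
  have cM: "real (card M) \<le> 2 * R + 1"
  proof (rule card_int_near(2)[where c="t * \<xi> - r2"])
   fix m assume "m \<in> M"
   then obtain q where q: "q \<in> A" "fst q = k" "m = snd (snd q)" by (auto simp: M_def)
   then have "\<bar>(real_of_int m + r2) / t - \<xi>\<bar> * t \<le> R" using T[of q] ttk[of q] by (simp add: inT_def ee_def)
   moreover have "\<bar>(real_of_int m + r2) / t - \<xi>\<bar> * t = \<bar>((real_of_int m + r2) / t - \<xi>) * t\<bar>" using t0 by (simp add: abs_mult)
   moreover have "((real_of_int m + r2) / t - \<xi>) * t = real_of_int m - (t * \<xi> - r2)" using t0 by (simp add: field_simps)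
   ultimately show "\<bar>real_of_int m - (t * \<xi> - r2)\<bar> \<le> R" by simp
  qed (rule R0)
  define mn where "mn = min (\<tau> / t) (t / \<tau>)"
  have mn0: "mn \<ge> 0" using \<tau> t0 by (simp add: mn_def)
  have "(\<Sum>p\<in>{p\<in>A. fst p = k}. ?h p) = (\<Sum>p\<in>{p\<in>A. fst p = k}. mn * (1 / (1 + \<bar>real_of_int (fst (snd p)) - (z / t - r1)\<bar>)^2))"
  proof (rule sum.cong[OF refl])
   fix p assume "p \<in> {p\<in>A. fst p = k}"
   then have tp: "tt p = t" using ttk by simp
   have "z - yy p = - (t * (real_of_int (fst (snd p)) - (z / t - r1)))" using t0 by (simp add: yy_def tp field_simps)
   then have "\<bar>z - yy p\<bar> = t * \<bar>real_of_int (fst (snd p)) - (z / t - r1)\<bar>" using t0 by (simp only: abs_minus_cancel abs_mult abs_of_pos)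
   then show "?h p = mn * (1 / (1 + \<bar>real_of_int (fst (snd p)) - (z / t - r1)\<bar>)^2)" using t0 by (simp add: tp mn_def)
  qed
  also have "... \<le> (\<Sum>p\<in>{k} \<times> N \<times> M. mn * (1 / (1 + \<bar>real_of_int (fst (snd p)) - (z / t - r1)\<bar>)^2))"
   by (rule sum_mono2) (use fin sub mn0 in auto)
  also have "... = (\<Sum>n\<in>N. \<Sum>m\<in>M. mn * (1 / (1 + \<bar>real_of_int n - (z / t - r1)\<bar>)^2))" by (rule sum_triple)
  also have "... = mn * (real (card M) * (\<Sum>n\<in>N. 1 / (1 + \<bar>real_of_int n - (z / t - r1)\<bar>)^2))"
   by (simp add: sum_distrib_left mult_ac)
  also have "... \<le> mn * ((2 * R + 1) * (4 * pi))"
   using cM int_br_sum[OF fin(1)] mn0 R0 by (intro mult_left_mono mult_mono) (auto intro!: sum_nonneg)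
  finally show ?thesis by (simp add: mn_def t_def)
 qed
 have "(\<Sum>p\<in>A. ?h p) = (\<Sum>k\<in>K. \<Sum>p\<in>{p\<in>A. fst p = k}. ?h p)"
  unfolding K_def by (rule sum.image_gen[OF A])
 also have "... \<le> (\<Sum>k\<in>K. min (\<tau> / (rho * D powi k)) (rho * D powi k / \<tau>) * ((2 * R + 1) * (4 * pi)))" by (intro sum_mono slice)
 also have "... = (\<Sum>k\<in>K. min (\<tau> / (rho * D powi k)) (rho * D powi k / \<tau>)) * ((2 * R + 1) * (4 * pi))" by (rule sum_distrib_right[symmetric])
 also have "... \<le> 4 * ((2 * R + 1) * (4 * pi))"
  using sum_powi_two_sided[OF D4 rho \<tau> fK] R0 by (intro mult_right_mono) auto
 finally show ?thesis by simp
qed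

lemma wp_shift: "wp y \<theta> t x = wp y (\<theta> - \<eta>) t x * cis (\<eta> * x)"
 by (simp add: wp_def cis_mult mult.assoc left_diff_distrib)

lemma emb_shift: "emb f y \<theta> t = emb (\<lambda>x. f x * cis (- (\<eta> * x))) y (\<theta> - \<eta>) t"
 unfolding emb_def wp_shift[of y \<theta> t _ \<eta>] by (simp add: cis_cnj mult_ac)

text \<open>Only L1 averages of \<open>f\<close> are controlled, whereas \<open>tree_bessel\<close>
  asks for an L2 norm. Near the tree \<open>f\<close> is therefore replaced by its average over
  intervals whose length \<open>\<tau>\<close> adapts to the tree. The average is bounded by
  \<open>3 * la\<close>, and the replacement error is both uniformly bounded and summable over the
  tree, hence square summable. This takes the place of a John-Nirenberg argument.\<close>

lemma tree_size:
 assumes A: "finite A" "A \<noteq> {}" and f [measurable]: "f \<in> bm" and f2: "sq_integrable f" and ad: "adm d b"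
  and T: "\<And>p. p \<in> A \<Longrightarrow> inT x0 \<xi> s p \<and> 4 \<le> uu d b \<xi> p" and s: "s > 0" and la: "la \<ge> 0"
  and avg: "\<And>p r. p \<in> A \<Longrightarrow> r \<ge> tt p \<Longrightarrow> (LBINT x. indicator {yy p - r..yy p + r} x * norm (f x)) \<le> la * r"
 shows "(\<Sum>p\<in>A. tt p * (norm (FF f d b p))^2) \<le> C5 d * la^2 * s"
proof -
 have Ty: "\<bar>yy p - x0\<bar> \<le> s" "tt p \<le> s" "\<bar>uu d b \<xi> p\<bar> \<le> D" if "p \<in> A" for p
  using T[OF that] uu_bound[OF _ ad, of x0 \<xi> s p] by (simp_all add: inT_def)
 define B where "B = {x0 - 2 * s..x0 + 2 * s}"
 have [measurable]: "B \<in> sets borel" by (simp add: B_def)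
 define fn where "fn x = indicator B x * f x" for x
 define ff where "ff x = (1 - indicator B x) * f x" for x
 have [measurable]: "fn \<in> bm" "ff \<in> bm" unfolding fn_def ff_def by measurable
 have fnle: "norm (fn x) \<le> norm (f x)" "norm (ff x) \<le> norm (f x)" for x by (auto simp: fn_def ff_def indicator_def)
 have fn2: "sq_integrable fn" and ff2: "sq_integrable ff"
  using fnle by (auto intro!: dominated_integrable[OF f2] AE_I2 power_mono)
 have FFsplit: "FF f d b p = FF fn d b p + FF ff d b p" for p
 proof -
  have "f x * cnj (wp y \<theta> t x) = fn x * cnj (wp y \<theta> t x) + ff x * cnj (wp y \<theta> t x)" for x y \<theta> t
   by (simp add: fn_def ff_def algebra_simps)
  then show ?thesis unfolding FF_def emb_def
   by (simp only:) (rule Bochner_Integration.integral_add; rule emb_integrand(1)[OF _ _ tt_pos]; (rule fn2 ff2 | measurable))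
 qed
 have an: "integrable lborel (\<lambda>x. norm (f x) * (1 / (1 + \<bar>x - yy p\<bar> / tt p)^2))"
  "(LBINT x. norm (f x) * (1 / (1 + \<bar>x - yy p\<bar> / tt p)^2)) \<le> 8 * la * tt p" if "p \<in> A" for p
  using annuli[OF f f2 tt_pos la avg[OF that]] by blast+
 \<comment> \<open>Off \<open>B\<close> the bracket \<open>w\<close> satisfies
   \<open>w * tt p \<ge> s\<close>. One of three powers of decay gains \<open>tt p / s\<close>, the
   other two are averaged by \<open>annuli\<close>; \<open>5000 = 8 * 625\<close>.\<close>
 have far: "norm (FF ff d b p) \<le> 5000 * la * (tt p / s)" if p: "p \<in> A" for p
 proof -
  have "norm (FF ff d b p) \<le> (LBINT x. norm (ff x) * (phi ((x - yy p) / tt p) / tt p))"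
   unfolding FF_def by (rule emb_bound[OF _ ff2 tt_pos]) measurable
  also have "... \<le> (LBINT x. (norm (f x) * (1 / (1 + \<bar>x - yy p\<bar> / tt p)^2)) * (625 / s))"
  proof (rule integral_mono')
   show "integrable lborel (\<lambda>x. (norm (f x) * (1 / (1 + \<bar>x - yy p\<bar> / tt p)^2)) * (625 / s))"
    by (rule integrable_mult_left[OF an(1)[OF p]])
   show "0 \<le> (norm (f x) * (1 / (1 + \<bar>x - yy p\<bar> / tt p)^2)) * (625 / s)" for x using s by simp
   fix x
   show "norm (ff x) * (phi ((x - yy p) / tt p) / tt p) \<le> (norm (f x) * (1 / (1 + \<bar>x - yy p\<bar> / tt p)^2)) * (625 / s)"
   proof (cases "x \<in> B")
    case True
    then have "ff x = 0" by (simp add: ff_def)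
    then show ?thesis using s by simp
   next
    case False
    then have "\<bar>x - x0\<bar> > 2 * s" unfolding B_def atLeastAtMost_iff by linarith
    then have xs: "\<bar>x - yy p\<bar> \<ge> s" using Ty(1)[OF p] by linarith
    define w where "w = 1 + \<bar>x - yy p\<bar> / tt p"
    have t: "tt p > 0" by (rule tt_pos)
    have w: "w \<ge> 1" "s \<le> w * tt p" using xs t by (simp_all add: w_def distrib_right)
    have "phi ((x - yy p) / tt p) \<le> 625 / (1 + \<bar>(x - yy p) / tt p\<bar>)^3" by (rule phi_le_br) simp
    then have "phi ((x - yy p) / tt p) / tt p \<le> 625 / w^3 / tt p" using t by (intro divide_right_mono) (auto simp: w_def)
    also have "... = 625 / w^2 * (1 / (w * tt p))" by (simp add: power2_eq_square power3_eq_cube)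
    also have "... \<le> 625 / w^2 * (1 / s)" using w s t by (intro mult_left_mono divide_left_mono) auto
    finally have "norm (ff x) * (phi ((x - yy p) / tt p) / tt p) \<le> norm (f x) * (625 / w^2 * (1 / s))"
     using fnle phi_nonneg t by (intro mult_mono) auto
    then show ?thesis by (simp add: w_def)
   qed
  qed
  also have "... = (LBINT x. (norm (f x) * (1 / (1 + \<bar>x - yy p\<bar> / tt p)^2))) * (625 / s)" by (rule integral_mult_left_zero)
  also have "... \<le> (8 * la * tt p) * (625 / s)" by (intro mult_right_mono an(2)[OF p]) (use s in auto)
  finally show ?thesis by simp
 qed
 \<comment> \<open>Up to a constant the smallest radius around \<open>x\<close> at which averages
   are controlled through some point of the tree. As a minimum of functions with Lipschitz constant
   1 it has the same constant, so overlapping averaging intervals have comparable lengths.\<close>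
 define \<tau> where "\<tau> x = Min ((\<lambda>p. tt p + \<bar>x - yy p\<bar>) ` A)" for x
 have [measurable]: "\<tau> \<in> bm" unfolding \<tau>_def using A(1) by measurable
 have \<tau>le: "\<tau> x \<le> tt p + \<bar>x - yy p\<bar>" if "p \<in> A" for x p unfolding \<tau>_def using A(1) that by (intro Min_le) auto
 have \<tau>ex: "\<exists>p\<in>A. \<tau> x = tt p + \<bar>x - yy p\<bar>" for x
 proof -
  have "Min ((\<lambda>p. tt p + \<bar>x - yy p\<bar>) ` A) \<in> (\<lambda>p. tt p + \<bar>x - yy p\<bar>) ` A"
   by (rule Min_in) (use A in auto)
  then show ?thesis unfolding \<tau>_def by (simp only: image_iff)
 qed
 have \<tau>pos: "\<tau> x > 0" for x using \<tau>ex[of x] tt_pos by (metis abs_ge_zero add_pos_nonneg)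
 have \<tau>lip: "\<tau> x \<le> \<tau> z + \<bar>x - z\<bar>" for x z
 proof -
  obtain p where p: "p \<in> A" "\<tau> z = tt p + \<bar>z - yy p\<bar>" using \<tau>ex by blast
  show ?thesis using \<tau>le[OF p(1), of x] p(2) by linarith
 qed
 have local: "(LBINT z. indicator {x - r..x + r} z * norm (f z)) \<le> la * (r + \<tau> x)" if r: "r \<ge> 0" for x r
 proof -
  obtain p where p: "p \<in> A" "\<tau> x = tt p + \<bar>x - yy p\<bar>" using \<tau>ex by blast
  have "(LBINT z. indicator {x - r..x + r} z * norm (f z)) \<le> (LBINT z. indicator {yy p - (r + \<tau> x)..yy p + (r + \<tau> x)} z * norm (f z))"
  proof (rule integral_mono')
   show "integrable lborel (\<lambda>z. indicator {yy p - (r + \<tau> x)..yy p + (r + \<tau> x)} z * norm (f z))" by (rule L2_mult_indicator[OF f f2])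
   fix z
   have "z \<in> {yy p - (r + \<tau> x)..yy p + (r + \<tau> x)}" if "z \<in> {x - r..x + r}"
    using that p(2) tt_pos[of p] unfolding atLeastAtMost_iff by linarith
   then show "indicator {x - r..x + r} z * norm (f z) \<le> indicator {yy p - (r + \<tau> x)..yy p + (r + \<tau> x)} z * norm (f z)"
    by (intro mult_right_mono) (auto simp: indicator_def)
  qed simp
  also have "... \<le> la * (r + \<tau> x)" by (rule avg[OF p(1)]) (use p(2) r in linarith)
  finally show ?thesis .
 qed
 \<comment> \<open>Removing the top frequency before averaging: relative to it all packets of the
   tree have frequency at most \<open>D / tt p\<close>, as \<open>wp_diff\<close> requires.\<close>
 define \<eta> where "\<eta> = d * \<xi>"
 define g where "g x = fn x * cis (- (\<eta> * x))" for x
 have [measurable]: "g \<in> bm" unfolding g_def by measurable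
 have ng: "norm (g x) = norm (fn x)" for x by (simp add: g_def norm_mult)
 have nfn: "norm (fn x) = indicator B x * norm (f x)" for x by (simp add: fn_def norm_mult indicator_def)
 have gi: "integrable lborel g"
  by (rule dominated_integrable[OF L2_mult_indicator[OF f f2, of "x0 - 2 * s" "x0 + 2 * s"]])
   (auto simp: ng nfn B_def)
 define h0 where "h0 = moll g \<tau>"
 define h where "h x = h0 x * cis (\<eta> * x)" for x
 have [measurable]: "h0 \<in> bm" "h \<in> bm" unfolding h_def h0_def by measurable
 have nh: "norm (h x) = norm (h0 x)" for x by (simp add: h_def norm_mult)
 have h0b: "norm (h0 x) \<le> 3 * la" for x
 proof -
  have "norm (h0 x) \<le> (LBINT z. norm (if \<bar>x - z\<bar> \<le> \<tau> z / 2 then g z / cx (\<tau> z) else 0))"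
   unfolding h0_def moll_def by (rule integral_norm_bound)
  also have "... \<le> (LBINT z. 3 / 2 / \<tau> x * (indicator {x - \<tau> x..x + \<tau> x} z * norm (f z)))"
  proof (rule integral_mono')
   show "integrable lborel (\<lambda>z. 3 / 2 / \<tau> x * (indicator {x - \<tau> x..x + \<tau> x} z * norm (f z)))"
    by (intro integrable_mult_right L2_mult_indicator f f2)
   show "0 \<le> 3 / 2 / \<tau> x * (indicator {x - \<tau> x..x + \<tau> x} z * norm (f z))" for z using \<tau>pos[of x] by simp
   fix z
   show "norm (if \<bar>x - z\<bar> \<le> \<tau> z / 2 then g z / cx (\<tau> z) else 0) \<le> 3 / 2 / \<tau> x * (indicator {x - \<tau> x..x + \<tau> x} z * norm (f z))"
   proof (cases "\<bar>x - z\<bar> \<le> \<tau> z / 2")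
    case True
    have a: "\<tau> z \<le> 2 * \<tau> x" "2 * \<tau> x \<le> 3 * \<tau> z" using \<tau>lip[of z x] \<tau>lip[of x z] True by linarith+
    then have "z \<in> {x - \<tau> x..x + \<tau> x}" using True unfolding atLeastAtMost_iff by linarith
    then have i: "indicator {x - \<tau> x..x + \<tau> x} z = (1::real)" by simp
    have "norm (if \<bar>x - z\<bar> \<le> \<tau> z / 2 then g z / cx (\<tau> z) else 0) = norm (fn z) / \<tau> z"
     using True \<tau>pos[of z] by (simp add: norm_divide ng)
    also have "... \<le> norm (f z) / (2 * \<tau> x / 3)" using a fnle(1)[of z] \<tau>pos[of x] by (intro frac_le) auto
    also have "... = 3 / 2 / \<tau> x * (indicator {x - \<tau> x..x + \<tau> x} z * norm (f z))" unfolding i by simp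
    finally show ?thesis .
   next
    case False
    then show ?thesis using \<tau>pos[of x] by simp
   qed
  qed
  also have "... = 3 / 2 / \<tau> x * (LBINT z. indicator {x - \<tau> x..x + \<tau> x} z * norm (f z))" by (rule integral_mult_right_zero)
  also have "... \<le> 3 / 2 / \<tau> x * (la * (\<tau> x + \<tau> x))"
   using \<tau>pos[of x] by (intro mult_left_mono local) auto
  also have "... = 3 * la" using \<tau>pos[of x] by simp
  finally show ?thesis .
 qed
 obtain p0 where p0: "p0 \<in> A" using A(2) by auto
 have h0s: "h0 x = 0" if "x \<notin> {x0 - 4 * s..x0 + 4 * s}" for x
 proof -
  have "(if \<bar>x - z\<bar> \<le> \<tau> z / 2 then g z / cx (\<tau> z) else 0) = 0" for z
  proof (cases "z \<in> B \<and> \<bar>x - z\<bar> \<le> \<tau> z / 2")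
   case True
   have "\<bar>z - x0\<bar> \<le> 2 * s" using True unfolding B_def atLeastAtMost_iff by linarith
   moreover have "\<tau> z \<le> s + \<bar>z - yy p0\<bar>" using \<tau>le[OF p0, of z] Ty(2)[OF p0] by linarith
   ultimately have "\<bar>x - x0\<bar> \<le> 4 * s" using True Ty(1)[OF p0] by linarith
   then show ?thesis using that unfolding atLeastAtMost_iff by linarith
  qed (auto simp: g_def fn_def)
  from this show ?thesis unfolding h0_def moll_def by (simp only: Bochner_Integration.integral_zero)
 qed
 have hle: "(norm (h x))^2 \<le> indicator {x0 - 4 * s..x0 + 4 * s} x * (3 * la)^2" for x
 proof (cases "x \<in> {x0 - 4 * s..x0 + 4 * s}")
  case True then show ?thesis unfolding nh using power_mono[OF h0b norm_ge_zero, of x 2] by simp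
 qed (simp add: nh h0s)
 have hbi: "integrable lborel (\<lambda>x. indicator {x0 - 4 * s..x0 + 4 * s} x * (3 * la)^2)"
  by (intro integrable_mult_left integrable_indicator_Icc)
 have h2: "sq_integrable h"
 proof (rule dominated_integrable[OF hbi])
  show "AE x in lborel. norm ((norm (h x))^2) \<le> norm (indicator {x0 - 4 * s..x0 + 4 * s} x * (3 * la)^2)"
   using hle by (intro AE_I2) simp
 qed measurable
 have hI: "(LBINT x. (norm (h x))^2) \<le> 72 * la^2 * s"
 proof -
  have "(LBINT x. (norm (h x))^2) \<le> (LBINT x. indicator {x0 - 4 * s..x0 + 4 * s} x * (3 * la)^2)"
   by (rule integral_mono'[OF hbi hle]) (simp add: indicator_def)
  also have "... = 72 * la^2 * s" using s by (simp add: power_mult_distrib)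
  finally show ?thesis .
 qed
 have hB: "(\<Sum>p\<in>A. tt p * (norm (FF h d b p))^2) \<le> C0 d * (72 * la^2 * s)"
  by (rule order_trans[OF tree_bessel[OF A(1) _ h2 ad T]]) (use hI C_nonneg in \<open>auto intro!: mult_left_mono\<close>)
 define e where "e p = norm (FF fn d b p - FF h d b p)" for p
 define ker where "ker p z = min (\<tau> z / tt p) (tt p / \<tau> z) * (1 / (1 + \<bar>z - yy p\<bar> / tt p)^2)" for p z
 have [measurable]: "ker p \<in> bm" for p unfolding ker_def by measurable
 have ker0: "ker p z \<ge> 0" for p z using \<tau>pos[of z] tt_pos[of p] by (simp add: ker_def)
 have ker1: "ker p z \<le> 1 / (1 + \<bar>z - yy p\<bar> / tt p)^2" for p z
 proof -
  have "min (\<tau> z / tt p) (tt p / \<tau> z) \<le> 1" using \<tau>pos[of z] tt_pos[of p] by (cases "\<tau> z \<le> tt p") (auto simp: min_le_iff_disj)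
  then have "ker p z \<le> 1 * (1 / (1 + \<bar>z - yy p\<bar> / tt p)^2)" unfolding ker_def by (intro mult_right_mono) auto
  then show ?thesis by simp
 qed
 have LL0: "LL \<ge> 0" using D4 by (simp add: LL_def)
 have gk: "integrable lborel (\<lambda>z. norm (g z) * ker p z)" if p: "p \<in> A" for p
 proof (rule dominated_integrable[OF an(1)[OF p]])
  show "AE z in lborel. norm (norm (g z) * ker p z) \<le> norm (norm (f z) * (1 / (1 + \<bar>z - yy p\<bar> / tt p)^2))"
  proof (rule AE_I2)
   fix z
   have "norm (fn z) * ker p z \<le> norm (f z) * (1 / (1 + \<bar>z - yy p\<bar> / tt p)^2)"
    by (intro mult_mono ker1 fnle ker0) simp
   moreover have "0 \<le> norm (fn z) * ker p z" using ker0 by simp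
   ultimately show "norm (norm (g z) * ker p z) \<le> norm (norm (f z) * (1 / (1 + \<bar>z - yy p\<bar> / tt p)^2))"
    unfolding ng real_norm_def by linarith
  qed
 qed measurable
 have gkI: "(LBINT z. norm (g z) * ker p z) \<le> 8 * la * tt p" if p: "p \<in> A" for p
 proof -
  have "(LBINT z. norm (g z) * ker p z) \<le> (LBINT x. norm (f x) * (1 / (1 + \<bar>x - yy p\<bar> / tt p)^2))"
   unfolding ng
  proof (rule integral_mono'[OF an(1)[OF p]])
   fix z
   show "norm (fn z) * ker p z \<le> norm (f z) * (1 / (1 + \<bar>z - yy p\<bar> / tt p)^2)"
    by (intro mult_mono ker1 fnle ker0) simp
   show "0 \<le> norm (f z) * (1 / (1 + \<bar>z - yy p\<bar> / tt p)^2)" by (intro mult_nonneg_nonneg divide_nonneg_nonneg) auto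
  qed
  then show ?thesis using an(2)[OF p] by linarith
 qed
 have eb: "e p \<le> LL / tt p * (LBINT z. norm (g z) * ker p z)" if p: "p \<in> A" for p
 proof -
  define \<theta> where "\<theta> = th d b p - \<eta>"
  have t: "tt p > 0" by (rule tt_pos)
  have \<theta>t: "\<bar>\<theta>\<bar> * tt p \<le> D" using Ty(3)[OF p] t by (simp add: uu_def \<theta>_def \<eta>_def abs_mult mult.commute)
  have F1: "FF fn d b p = (LBINT z. g z * cnj (wp (yy p) \<theta> (tt p) z))"
   unfolding FF_def emb_shift[of fn _ _ _ \<eta>] by (simp add: emb_def g_def \<theta>_def)
  have "h x * cis (- (\<eta> * x)) = h0 x" for x by (simp add: h_def mult.assoc cis_mult)
  then have F2: "FF h d b p = (LBINT z. moll g \<tau> z * cnj (wp (yy p) \<theta> (tt p) z))"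
   unfolding FF_def emb_shift[of h _ _ _ \<eta>] by (simp add: emb_def h0_def \<theta>_def)
  have "e p \<le> (LBINT z. norm (g z) * (LL / tt p * ker p z))"
   unfolding e_def F1 F2
  proof (rule moll_error[OF gi])
   show "\<tau> z > 0" for z by (rule \<tau>pos)
   show "norm (cnj (wp (yy p) \<theta> (tt p) x)) \<le> 1 / tt p" for x
    using t phi_le1 by (simp add: norm_wp divide_right_mono)
   show "norm (cnj (wp (yy p) \<theta> (tt p) z) - cnj (wp (yy p) \<theta> (tt p) x)) \<le> LL / tt p * ker p z" if "\<bar>x - z\<bar> \<le> \<tau> z / 2" for z x
    using wp_diff[OF t \<theta>t \<tau>pos \<tau>le[OF p] that] unfolding LL_def ker_def by (simp flip: complex_cnj_diff)
   show "integrable lborel (\<lambda>z. norm (g z) * (LL / tt p * ker p z))"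
    using integrable_mult_right[OF gk[OF p], of "LL / tt p"] by (simp only: mult_ac)
  qed measurable
  also have "... = (LBINT z. LL / tt p * (norm (g z) * ker p z))" by (intro bochner_cong refl) (simp only: mult_ac)
  also have "... = LL / tt p * (LBINT z. norm (g z) * ker p z)" by (rule integral_mult_right_zero)
  finally show ?thesis .
 qed
 have e1: "e p \<le> 8 * LL * la" if p: "p \<in> A" for p
 proof -
  have "e p \<le> LL / tt p * (8 * la * tt p)" using eb[OF p] gkI[OF p] LL0 tt_pos[of p] by (intro order_trans[OF eb[OF p]] mult_left_mono) auto
  then show ?thesis using tt_pos[of p] by simp
 qed
 have eS: "(\<Sum>p\<in>A. tt p * e p) \<le> LL * ((2 * R + 1) * (16 * pi)) * (3 * la * s)"
 proof -
  have "(\<Sum>p\<in>A. tt p * e p) \<le> (\<Sum>p\<in>A. LL * (LBINT z. norm (g z) * ker p z))"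
  proof (rule sum_mono)
   fix p assume p: "p \<in> A"
   have "tt p * e p \<le> tt p * (LL / tt p * (LBINT z. norm (g z) * ker p z))"
    using tt_pos[of p] by (intro mult_left_mono eb p) auto
   then show "tt p * e p \<le> LL * (LBINT z. norm (g z) * ker p z)" using tt_pos[of p] by simp
  qed
  also have "... = LL * (LBINT z. (\<Sum>p\<in>A. norm (g z) * ker p z))"
   using gk by (subst Bochner_Integration.integral_sum) (auto simp: sum_distrib_left)
  also have "... \<le> LL * (LBINT z. norm (g z) * ((2 * R + 1) * (16 * pi)))"
  proof (intro mult_left_mono integral_mono)
   show "integrable lborel (\<lambda>z. \<Sum>p\<in>A. norm (g z) * ker p z)" using gk by (intro Bochner_Integration.integrable_sum)
   show "integrable lborel (\<lambda>z. norm (g z) * ((2 * R + 1) * (16 * pi)))" using gi by (intro integrable_mult_left integrable_norm)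
   fix z
   show "(\<Sum>p\<in>A. norm (g z) * ker p z) \<le> norm (g z) * ((2 * R + 1) * (16 * pi))"
    unfolding sum_distrib_left[symmetric] ker_def
    by (intro mult_left_mono kernel_sum[OF A(1)] \<tau>pos) (use T in auto)
  qed (rule LL0)
  also have "(LBINT z. norm (g z) * ((2 * R + 1) * (16 * pi))) = (LBINT z. norm (g z)) * ((2 * R + 1) * (16 * pi))" by (rule integral_mult_left_zero)
  also have "(LBINT z. norm (g z)) \<le> la * (3 * s)"
  proof -
   have "(LBINT z. norm (g z)) \<le> (LBINT z. indicator {yy p0 - 3 * s..yy p0 + 3 * s} z * norm (f z))"
   proof (rule integral_mono')
    show "integrable lborel (\<lambda>z. indicator {yy p0 - 3 * s..yy p0 + 3 * s} z * norm (f z))" by (rule L2_mult_indicator[OF f f2])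
    fix z
    have "z \<in> {yy p0 - 3 * s..yy p0 + 3 * s}" if "z \<in> B"
     using that Ty(1)[OF p0] unfolding B_def atLeastAtMost_iff by linarith
    then show "norm (g z) \<le> indicator {yy p0 - 3 * s..yy p0 + 3 * s} z * norm (f z)"
     unfolding ng nfn by (intro mult_right_mono) (auto simp: indicator_def)
   qed simp
   also have "... \<le> la * (3 * s)" by (rule avg[OF p0]) (use Ty(2)[OF p0] s in linarith)
   finally show ?thesis .
  qed
  finally have "(\<Sum>p\<in>A. tt p * e p) \<le> LL * (la * (3 * s) * ((2 * R + 1) * (16 * pi)))" using LL0 R0 by (simp add: mult_left_mono mult_right_mono)
  then show ?thesis by (simp only: mult_ac)
 qed
 have e0: "e p \<ge> 0" for p by (simp add: e_def)
 have tri: "(norm (FF f d b p))^2 \<le> 3 * ((5000 * la * (tt p / s))^2 + (norm (FF h d b p))^2 + (e p)^2)" if p: "p \<in> A" for p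
 proof -
  define u v w where "u = 5000 * la * (tt p / s)" and "v = norm (FF h d b p)" and "w = e p"
  have "norm (FF f d b p) \<le> norm (FF fn d b p) + norm (FF ff d b p)" unfolding FFsplit by (rule norm_triangle_ineq)
  also have "norm (FF fn d b p) \<le> norm (FF h d b p) + e p" unfolding e_def using norm_triangle_ineq[of "FF h d b p" "FF fn d b p - FF h d b p"] by simp
  finally have "norm (FF f d b p) \<le> u + v + w" using far[OF p] by (simp add: u_def v_def w_def)
  then have "(norm (FF f d b p))^2 \<le> (u + v + w)^2" by (intro power_mono) auto
  also have "... \<le> 3 * (u^2 + v^2 + w^2)"
  proof -
   have "0 \<le> (u - v)^2 + (v - w)^2 + (u - w)^2" by simp
   then show ?thesis by (simp add: power2_eq_square algebra_simps)
  qed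
  finally show ?thesis by (simp add: u_def v_def w_def)
 qed
 have "(\<Sum>p\<in>A. tt p * (norm (FF f d b p))^2) \<le> (\<Sum>p\<in>A. 3 * (tt p * (5000 * la * (tt p / s))^2 + tt p * (norm (FF h d b p))^2 + tt p * (e p)^2))"
 proof (rule sum_mono)
  fix p assume p: "p \<in> A"
  show "tt p * (norm (FF f d b p))^2 \<le> 3 * (tt p * (5000 * la * (tt p / s))^2 + tt p * (norm (FF h d b p))^2 + tt p * (e p)^2)"
   using mult_left_mono[OF tri[OF p], of "tt p"] tt_pos[of p] by (simp add: algebra_simps)
 qed
 also have "... = 3 * ((\<Sum>p\<in>A. tt p * (5000 * la * (tt p / s))^2) + (\<Sum>p\<in>A. tt p * (norm (FF h d b p))^2) + (\<Sum>p\<in>A. tt p * (e p)^2))"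
  by (simp only: sum_distrib_left sum.distrib[symmetric])
 finally have S: "(\<Sum>p\<in>A. tt p * (norm (FF f d b p))^2) \<le> 3 * ((\<Sum>p\<in>A. tt p * (5000 * la * (tt p / s))^2) + (\<Sum>p\<in>A. tt p * (norm (FF h d b p))^2) + (\<Sum>p\<in>A. tt p * (e p)^2))" .
 have S1: "(\<Sum>p\<in>A. tt p * (5000 * la * (tt p / s))^2) \<le> 5000^2 * C2 * la^2 * s"
 proof -
  have "(\<Sum>p\<in>A. tt p * (5000 * la * (tt p / s))^2) \<le> (\<Sum>p\<in>A. 5000^2 * la^2 / s * (tt p)^2)"
  proof (rule sum_mono)
   fix p assume p: "p \<in> A"
   have "tt p / s \<le> 1" using Ty(2)[OF p] s by simp
   then have "(5000^2 * la^2 / s * (tt p)^2) * (tt p / s) \<le> (5000^2 * la^2 / s * (tt p)^2) * 1" using s by (intro mult_left_mono) auto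
   moreover have "tt p * (5000 * la * (tt p / s))^2 = (5000^2 * la^2 / s * (tt p)^2) * (tt p / s)"
    by (simp add: power2_eq_square)
   ultimately show "tt p * (5000 * la * (tt p / s))^2 \<le> 5000^2 * la^2 / s * (tt p)^2" by simp
  qed
  also have "... = 5000^2 * la^2 / s * (\<Sum>p\<in>A. (tt p)^2)" by (rule sum_distrib_left[symmetric])
  also have "... \<le> 5000^2 * la^2 / s * (C2 * s^2)" using s T by (intro mult_left_mono tree_count[OF A(1)]) auto
  also have "... = 5000^2 * C2 * la^2 * s" using s by (simp add: power2_eq_square)
  finally show ?thesis .
 qed
 \<comment> \<open>One factor of the squared error is taken from the uniform bound
   \<open>e1\<close>, the other from the weighted sum \<open>eS\<close>.\<close>
 have S3: "(\<Sum>p\<in>A. tt p * (e p)^2) \<le> 24 * LL^2 * ((2 * R + 1) * (16 * pi)) * la^2 * s"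
 proof -
  have "(\<Sum>p\<in>A. tt p * (e p)^2) \<le> (\<Sum>p\<in>A. 8 * LL * la * (tt p * e p))"
  proof (rule sum_mono)
   fix p assume p: "p \<in> A"
   have "(tt p * e p) * e p \<le> (tt p * e p) * (8 * LL * la)" using e1[OF p] e0 tt_pos[of p] by (intro mult_left_mono) auto
   then show "tt p * (e p)^2 \<le> 8 * LL * la * (tt p * e p)" by (simp add: power2_eq_square mult_ac)
  qed
  also have "... = 8 * LL * la * (\<Sum>p\<in>A. tt p * e p)" by (rule sum_distrib_left[symmetric])
  also have "... \<le> 8 * LL * la * (LL * ((2 * R + 1) * (16 * pi)) * (3 * la * s))" using LL0 la by (intro mult_left_mono eS) auto
  also have "... = 24 * LL^2 * ((2 * R + 1) * (16 * pi)) * la^2 * s" by (simp add: power2_eq_square)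
  finally show ?thesis .
 qed
 have "(\<Sum>p\<in>A. tt p * (norm (FF f d b p))^2) \<le> 3 * (5000^2 * C2 * la^2 * s + C0 d * (72 * la^2 * s) + 24 * LL^2 * ((2 * R + 1) * (16 * pi)) * la^2 * s)"
  by (rule order_trans[OF S], intro mult_left_mono add_mono S1 hB S3) simp
 also have "... = C5 d * la^2 * s" by (simp add: C5_def algebra_simps)
 finally show ?thesis .
qed

lemma C5_nonneg: "C5 d \<ge> 0" using C_nonneg R0 by (simp add: C5_def)

definition C4 :: "real \<Rightarrow> real" where "C4 d = sqrt (C5 d)"

lemma size_bound:
 assumes P: "finite P" and f: "f \<in> bm" "sq_integrable f" and ad: "adm d b" and la: "la \<ge> 0"
  and avg: "\<And>p r. p \<in> P \<Longrightarrow> r \<ge> tt p \<Longrightarrow> (LBINT x. indicator {yy p - r..yy p + r} x * norm (f x)) \<le> la * r"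
  and G: "\<And>p. norm (FF f d b p) = G p"
 shows "sz d b G (C4 d * la) P"
 unfolding sz_def
proof (intro allI impI)
 fix x \<xi> s :: real assume s: "s > 0"
 have e: "(C4 d * la)^2 = C5 d * la^2" using C5_nonneg by (simp add: C4_def power_mult_distrib)
 show "(\<Sum>p\<in>lac d b P x \<xi> s. tt p * (G p)^2) \<le> (C4 d * la)^2 * s"
 proof (cases "lac d b P x \<xi> s = {}")
  case True
  then show ?thesis using s by simp
 next
  case False
  show ?thesis unfolding e G[symmetric]
   by (rule tree_size[OF lac_finite[OF P] False f ad _ s la]) (use avg in \<open>auto simp: lac_def\<close>)
 qed
qed

lemma C4_uminus: "C4 (- d) = C4 d" by (simp add: C4_def C5_def C0_def)

lemma size_bound2:
 assumes P: "finite P" and f: "f \<in> bm" "sq_integrable f" and ad: "adm d b" and la: "la \<ge> 0"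
  and avg: "\<And>p r. p \<in> P \<Longrightarrow> r \<ge> tt p \<Longrightarrow> (LBINT x. indicator {yy p - r..yy p + r} x * norm (f x)) \<le> la * r"
  and G: "\<And>p. norm (FF f d b p) = G p"
 shows "sz2 d b G (C4 d * la) P"
proof -
 have f': "(\<lambda>x. cnj (f x)) \<in> bm" using f(1) by measurable
 have "sz (- d) (- b) G (C4 (- d) * la) P"
  by (rule size_bound[OF P f' _ _ la]) (use f ad avg G in \<open>auto simp: adm_uminus FF_cnj\<close>)
 then show ?thesis using size_bound[OF P f ad la avg G] by (simp add: sz2_def C4_uminus)
qed

end

section \<open>The discrete model sum\<close>

lemma sum_pow2_le:
 assumes "finite S" "\<And>n. n \<in> S \<Longrightarrow> n \<le> m"
 shows "(\<Sum>n\<in>S. 2^n) \<le> (2 * 2^m :: real)"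
proof -
 have "(\<Sum>n\<in>S. 2^n) \<le> (\<Sum>n\<in>{..<Suc m}. 2^n :: real)"
  by (rule sum_mono2) (use assms in \<open>auto simp: less_Suc_eq_le\<close>)
 also have "... = 2^Suc m - 1" by (subst geometric_sum) auto
 finally show ?thesis by simp
qed

text \<open>For levels \<open>w \<ge> 1\<close> the bounds independent of the level are used and
  \<open>1 / w^2\<close> sums geometrically; below \<open>sqrt a\<close> the bounds proportional to
  the level are used and the terms decay like \<open>w\<close>. In the window
  \<open>sqrt a \<le> w < 1\<close> each level is bounded by the same \<open>4 * c * a\<close>, and
  the number of these levels is the source of the logarithm.\<close>

lemma level_sum:
 fixes a c w0 :: real
 assumes a: "a > 0" and c: "c > 0" and w0: "w0 > 0"
 shows "(\<Sum>n<N. 1 / (w0 / 2^n)^2 * (min (c * a) (2 * (w0 / 2^n) * sqrt a) * min c (2 * (w0 / 2^n)) * min c (2 * (w0 / 2^n))))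
  \<le> (2 * c^3 + 16 + 8 * c) * (a * ln (exp 1 + 1 / a))"
proof -
 define w where "w n = w0 / 2^n" for n :: nat
 have w: "w n > 0" for n using w0 by (simp add: w_def)
 define g where "g n = 1 / (w n)^2 * (min (c * a) (2 * w n * sqrt a) * min c (2 * w n) * min c (2 * w n))" for n
 define L where "L = ln (exp 1 + 1 / a)"
 have L1: "L \<ge> 1"
 proof -
  have "ln (exp 1) \<le> L" unfolding L_def using a by (intro ln_mono) (auto intro: add_pos_pos)
  then show ?thesis by simp
 qed
 have sa: "sqrt a > 0" "sqrt a * sqrt a = a" using a by auto
 define S1 S2 S3 where "S1 = {n\<in>{..<N}. 1 \<le> w n}" and "S2 = {n\<in>{..<N}. w n < 1 \<and> w n < sqrt a}" and "S3 = {n\<in>{..<N}. w n < 1 \<and> sqrt a \<le> w n}"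
 have fin: "finite S1" "finite S2" "finite S3" by (auto simp: S1_def S2_def S3_def)
 have un: "{..<N} = (S1 \<union> S2) \<union> S3" by (auto simp: S1_def S2_def S3_def)
 have split: "(\<Sum>n<N. g n) = (\<Sum>n\<in>S1. g n) + (\<Sum>n\<in>S2. g n) + (\<Sum>n\<in>S3. g n)"
  unfolding un using fin by (subst sum.union_disjoint, simp, simp, (auto simp: S1_def S2_def S3_def)[1], subst sum.union_disjoint) (auto simp: S1_def S2_def S3_def)
 have m0: "0 \<le> min (c * a) (2 * w n * sqrt a)" "0 \<le> min c (2 * w n)" for n using a c w[of n] by auto
 have s1: "(\<Sum>n\<in>S1. g n) \<le> 2 * c^3 * a"
 proof (cases "S1 = {}")
  case False
  have "(\<Sum>n\<in>S1. g n) \<le> (\<Sum>n\<in>S1. c^3 * a / w0 * 2^n)"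
  proof (rule sum_mono)
   fix n assume n: "n \<in> S1"
   then have w1: "w n \<ge> 1" by (simp add: S1_def)
   have "min (c * a) (2 * w n * sqrt a) * min c (2 * w n) * min c (2 * w n) \<le> (c * a) * c * c"
    by (intro mult_mono m0 mult_nonneg_nonneg) (use a c in auto)
   then have "g n \<le> 1 / (w n)^2 * ((c * a) * c * c)" unfolding g_def by (intro mult_left_mono) auto
   also have "... \<le> 1 / w n * ((c * a) * c * c)"
   proof (rule mult_right_mono)
    have "w n * 1 \<le> w n * w n" using w1 by (intro mult_left_mono) auto
    then show "1 / (w n)^2 \<le> 1 / w n" using w[of n] by (intro divide_left_mono) (auto simp: power2_eq_square)
   qed (use a c in auto)
   also have "... = c^3 * a / w0 * 2^n" using w0 by (simp add: w_def power3_eq_cube)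
   finally show "g n \<le> c^3 * a / w0 * 2^n" .
  qed
  also have "... = c^3 * a / w0 * (\<Sum>n\<in>S1. 2^n)" by (rule sum_distrib_left[symmetric])
  also have "... \<le> c^3 * a / w0 * (2 * 2^(Max S1))"
   using a c w0 fin by (intro mult_left_mono sum_pow2_le) auto
  also have "... \<le> c^3 * a / w0 * (2 * w0)"
  proof (intro mult_left_mono)
   have "1 \<le> w (Max S1)" using Max_in[OF fin(1) False] by (simp add: S1_def)
   then show "2^(Max S1) \<le> w0" by (simp add: w_def)
  qed (use a c w0 in auto)
  also have "... = 2 * c^3 * a" using w0 by simp
  finally show ?thesis .
 qed (use a c in simp)
 have s2: "(\<Sum>n\<in>S2. g n) \<le> 16 * a"
 proof -
  have "(\<Sum>n\<in>S2. g n) \<le> (\<Sum>n\<in>S2. 8 * sqrt a * (w0 / 2^n))"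
  proof (rule sum_mono)
   fix n assume n: "n \<in> S2"
   have "min (c * a) (2 * w n * sqrt a) * min c (2 * w n) * min c (2 * w n) \<le> (2 * w n * sqrt a) * (2 * w n) * (2 * w n)"
    by (intro mult_mono m0 mult_nonneg_nonneg) (use a c w[of n] in auto)
   then have "g n \<le> 1 / (w n)^2 * ((2 * w n * sqrt a) * (2 * w n) * (2 * w n))" unfolding g_def by (intro mult_left_mono) auto
   also have "... = 8 * sqrt a * w n" using w[of n] by (simp add: power2_eq_square)
   finally show "g n \<le> 8 * sqrt a * (w0 / 2^n)" by (simp add: w_def)
  qed
  also have "... = 8 * sqrt a * (\<Sum>n\<in>S2. w0 / 2^n)" by (rule sum_distrib_left[symmetric])
  also have "... \<le> 8 * sqrt a * (2 * sqrt a)"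
   using sa w0 fin by (intro mult_left_mono geom_decay_sum) (auto simp: S2_def w_def)
  also have "... = 16 * a" using sa by simp
  finally show ?thesis .
 qed
 have s3: "(\<Sum>n\<in>S3. g n) \<le> 8 * c * (a * L)"
 proof (cases "S3 = {}")
  case False
  have "(\<Sum>n\<in>S3. g n) \<le> (\<Sum>n\<in>S3. 4 * c * a)"
  proof (rule sum_mono)
   fix n assume n: "n \<in> S3"
   have "min (c * a) (2 * w n * sqrt a) * min c (2 * w n) * min c (2 * w n) \<le> (c * a) * (2 * w n) * (2 * w n)"
    by (intro mult_mono m0 mult_nonneg_nonneg) (use a c w[of n] in auto)
   then have "g n \<le> 1 / (w n)^2 * ((c * a) * (2 * w n) * (2 * w n))" unfolding g_def by (intro mult_left_mono) auto
   also have "... = 4 * c * a" using w[of n] by (simp add: power2_eq_square)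
   finally show "g n \<le> 4 * c * a" .
  qed
  also have "... = real (card S3) * (4 * c * a)" by simp
  also have "real (card S3) \<le> 2 * L"
  proof -
   define i j where "i = Min S3" and "j = Max S3"
   have ij: "i \<in> S3" "j \<in> S3" "i \<le> j" using False fin by (auto simp: i_def j_def)
   have "S3 \<subseteq> {i..j}" using fin by (auto simp: i_def j_def)
   then have "card S3 \<le> Suc j - i" using card_mono[of "{i..j}" S3] by simp
   then have cd: "real (card S3) \<le> real (j - i) + 1" using ij(3) by linarith
   have "w i = 2^(j - i) * w j" using ij(3) by (simp add: w_def power_diff)
   then have "2^(j - i) * w j < 1" using ij(1) by (simp add: S3_def)
   moreover have "2^(j - i) * sqrt a \<le> 2^(j - i) * w j" using ij(2) by (simp add: S3_def)
   ultimately have "2^(j - i) * sqrt a < 1" by linarith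
   then have "(2^(j - i) * sqrt a)^2 < 1" using sa by (simp add: power_less_one_iff abs_square_less_1)
   then have "(2^(j - i))^2 * a < 1" using a by (simp add: power_mult_distrib)
   then have "(2^(j - i))^2 < 1 / a" using a by (simp add: pos_less_divide_eq)
   also have "... \<le> exp 1 + 1 / a" by simp
   finally have "ln ((2^(j - i))^2) \<le> L" unfolding L_def by (intro ln_mono) auto
   then have "2 * (real (j - i) * ln 2) \<le> L" by (simp add: ln_realpow)
   moreover have "real (j - i) * 1 \<le> real (j - i) * (2 * ln 2)" using ln2_ge_two_thirds by (intro mult_left_mono) auto
   ultimately show ?thesis using cd L1 by simp
  qed
  then have "real (card S3) * (4 * c * a) \<le> 2 * L * (4 * c * a)" using a c by (intro mult_right_mono) auto
  finally show ?thesis by (simp add: mult_ac)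
 qed (use a c L1 in simp)
 have "(\<Sum>n<N. g n) \<le> 2 * c^3 * a + 16 * a + 8 * c * (a * L)" using split s1 s2 s3 by linarith
 also have "... \<le> 2 * c^3 * (a * L) + 16 * (a * L) + 8 * c * (a * L)"
 proof -
  have "a * 1 \<le> a * L" using a L1 by (intro mult_left_mono) auto
  then have "2 * c^3 * a \<le> 2 * c^3 * (a * L)" "16 * a \<le> 16 * (a * L)" using c by (auto intro!: mult_left_mono)
  then show ?thesis by linarith
 qed
 also have "... = (2 * c^3 + 16 + 8 * c) * (a * L)" by (simp add: algebra_simps)
 finally show ?thesis unfolding g_def w_def L_def .
qed

context trigrid
begin

lemma K0_nonneg: "K0 \<ge> 0" using C3_nonneg by (simp add: K0_def)

definition "cc k = k * (C4 d1 + C4 d2 + C4 d3) + 1"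
definition "KM k = 6 * K0 * (2 * (cc k)^3 + 16 + 8 * cc k)"

text \<open>With the level written as \<open>w / sqrt M\<close> the level bounds become
  \<open>2 w\<close> times \<open>sqrt a\<close>, \<open>E2 / sqrt M\<close> and 1, while the
  averages give \<open>c\<close> times \<open>a\<close>, \<open>E2 / sqrt M\<close> and 1. After
  extracting \<open>sqrt M * E2\<close> the sum is the one in \<open>level_sum\<close>.\<close>

lemma model_bound:
 assumes P: "finite P" and a: "a > 0" and M: "M > 0" and E13: "E1 = sqrt a * sqrt M" "E3 = sqrt M" and k: "k \<ge> 0"
  and avg1: "\<And>p r. p \<in> P \<Longrightarrow> r \<ge> tt p \<Longrightarrow> (LBINT x. indicator {yy p - r..yy p + r} x * norm (f1 x)) \<le> k * a * r"
  and avg2: "\<And>p r. p \<in> P \<Longrightarrow> r \<ge> tt p \<Longrightarrow> (LBINT x. indicator {yy p - r..yy p + r} x * norm (f2 x)) \<le> k * (E2 / sqrt M) * r"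
  and avg3: "\<And>p r. p \<in> P \<Longrightarrow> r \<ge> tt p \<Longrightarrow> (LBINT x. indicator {yy p - r..yy p + r} x * norm (f3 x)) \<le> k * r"
 shows "(\<Sum>p\<in>P. gg p) \<le> KM k * (sqrt M * E2 * (a * ln (exp 1 + 1 / a)))"
proof -
 define c where "c = cc k"
 have C40: "C4 d \<ge> 0" for d by (simp add: C4_def C5_nonneg)
 have c: "c > 0" "k * C4 d1 \<le> c" "k * C4 d2 \<le> c" "k * C4 d3 \<le> c"
  using k C40 mult_nonneg_nonneg[OF k C40[of d1]] mult_nonneg_nonneg[OF k C40[of d2]] mult_nonneg_nonneg[OF k C40[of d3]]
  by (auto simp: c_def cc_def distrib_left intro!: add_nonneg_pos add_nonneg_nonneg)
 have sM: "sqrt M > 0" "sqrt a > 0" using M a by auto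
 define la1 la2 la3 where "la1 = c * a" and "la2 = c * (E2 / sqrt M)" and "la3 = c"
 have lp: "la1 > 0" "la2 > 0" "la3 > 0" using c a E sM by (auto simp: la1_def la2_def la3_def)
 have z1: "sz2 d1 b1 N1 la1 P"
 proof (rule sz2_mono[OF size_bound2[OF P f1(1,2) ad(1) _ avg1] subset_refl P])
  show "C4 d1 * (k * a) \<le> la1" using mult_right_mono[OF c(2), of a] a by (simp add: la1_def mult_ac)
 qed (use k a C40 in \<open>auto simp: N1_def\<close>)
 have z2: "sz2 d2 b2 N2 la2 P"
 proof (rule sz2_mono[OF size_bound2[OF P f2(1,2) ad(2) _ avg2] subset_refl P])
  show "C4 d2 * (k * (E2 / sqrt M)) \<le> la2" using mult_right_mono[OF c(3), of "E2 / sqrt M"] E sM by (simp add: la2_def mult_ac)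
 qed (use k E sM C40 in \<open>auto simp: N2_def\<close>)
 have z3: "sz2 d3 b3 N3 la3 P"
 proof (rule sz2_mono[OF size_bound2[OF P f3(1,2) ad(3) _ avg3] subset_refl P])
  show "C4 d3 * k \<le> la3" using c(4) by (simp add: la3_def mult_ac)
 qed (use k C40 in \<open>auto simp: N3_def\<close>)
 \<comment> \<open>The starting level has to lie above all initial sizes; the factor
   \<open>1 + sqrt a\<close> takes care of small and large \<open>a\<close> alike.\<close>
 define w0 where "w0 = c * (1 + sqrt a)"
 have w0: "w0 > 0" using c sM by (simp add: w0_def add_pos_pos)
 define v0 where "v0 = w0 / sqrt M"
 show ?thesis
 proof (rule sum_bound[OF P lp, where ?v0.0 = v0])
  show "sz3 la1 la2 la3 P" using z1 z2 z3 by (simp add: sz3_def)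
  show "v0 > 0" using w0 sM by (simp add: v0_def)
  have "a = sqrt a * sqrt a" using a by simp
  also have "... \<le> 2 * (1 + sqrt a) * sqrt a" using sM by (intro mult_right_mono) auto
  finally have "c * a \<le> c * (2 * (1 + sqrt a) * sqrt a)" using c by (intro mult_left_mono) auto
  then show "la1 \<le> 2 * (v0 * E1)" using sM by (simp add: la1_def v0_def E13 w0_def mult_ac)
  have cw: "c \<le> 2 * w0" using c sM by (simp add: w0_def)
  then have "c * (E2 / sqrt M) \<le> 2 * w0 * (E2 / sqrt M)" using E sM by (intro mult_right_mono) auto
  then show "la2 \<le> 2 * (v0 * E2)" by (simp add: la2_def v0_def)
  show "la3 \<le> 2 * (v0 * E3)" using cw sM by (simp add: la3_def v0_def E13)
  fix N
  have eq: "6 * (K0 / (v0 / 2^n)^2) * (min la1 (2 * (v0 / 2^n * E1)) * min la2 (2 * (v0 / 2^n * E2)) * min la3 (2 * (v0 / 2^n * E3))) =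
   6 * K0 * (sqrt M * E2) * (1 / (w0 / 2^n)^2 * (min (c * a) (2 * (w0 / 2^n) * sqrt a) * min c (2 * (w0 / 2^n)) * min c (2 * (w0 / 2^n))))" for n :: nat
  proof -
   define w where "w = w0 / 2^n"
   have w: "w > 0" using w0 by (simp add: w_def)
   have v: "v0 / 2^n = w / sqrt M" by (simp add: v0_def w_def)
   have e1: "2 * (w / sqrt M * E1) = 2 * w * sqrt a" using sM by (simp add: E13)
   have e3: "2 * (w / sqrt M * E3) = 2 * w" using sM by (simp add: E13)
   have e2: "min la2 (2 * (w / sqrt M * E2)) = min c (2 * w) * (E2 / sqrt M)"
   proof -
    have n0: "0 \<le> E2 / sqrt M" using E sM by simp
    have "2 * (w / sqrt M * E2) = 2 * w * (E2 / sqrt M)" by simp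
    then show ?thesis unfolding la2_def using n0 by (simp only: min_mult_distrib_right if_True)
   qed
   have e4: "K0 / (w / sqrt M)^2 = K0 * (sqrt M * sqrt M) * (1 / w^2)" by (simp add: power_divide power2_eq_square)
   have "q * q * (e / q) = q * e" if "q > 0" for q e :: real using that by simp
   from this[OF sM(1)] have Q: "sqrt M * sqrt M * (E2 / sqrt M) = sqrt M * E2" .
   have gen: "6 * (K * S * u) * (A * (B * Q) * Z) = 6 * K * (S * Q) * (u * (A * B * Z))" for K S u A B Q Z :: real
    by (simp only: mult_ac)
   show ?thesis unfolding w_def[symmetric] v e1 e3 e2 e4 la1_def la3_def gen Q ..
  qed
  have "(\<Sum>n<N. 6 * (K0 / (v0 / 2^n)^2) * (min la1 (2 * (v0 / 2^n * E1)) * min la2 (2 * (v0 / 2^n * E2)) * min la3 (2 * (v0 / 2^n * E3)))) =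
   6 * K0 * (sqrt M * E2) * (\<Sum>n<N. 1 / (w0 / 2^n)^2 * (min (c * a) (2 * (w0 / 2^n) * sqrt a) * min c (2 * (w0 / 2^n)) * min c (2 * (w0 / 2^n))))"
   unfolding eq by (rule sum_distrib_left[symmetric])
  also have "... \<le> 6 * K0 * (sqrt M * E2) * ((2 * c^3 + 16 + 8 * c) * (a * ln (exp 1 + 1 / a)))"
   using K0_nonneg sM E by (intro mult_left_mono level_sum a c w0) auto
  also have "... = KM k * (sqrt M * E2 * (a * ln (exp 1 + 1 / a)))" by (simp add: KM_def c_def mult_ac)
  finally show "(\<Sum>n<N. 6 * (K0 / (v0 / 2^n)^2) * (min la1 (2 * (v0 / 2^n * E1)) * min la2 (2 * (v0 / 2^n * E2)) * min la3 (2 * (v0 / 2^n * E3)))) \<le> KM k * (sqrt M * E2 * (a * ln (exp 1 + 1 / a)))" .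
 qed
qed

end

section \<open>From the continuous model to lattices\<close>

lemma borel_measurable_nn_integral_int[measurable (raw)]:
 fixes f :: "'a \<Rightarrow> int \<Rightarrow> ennreal"
 assumes [measurable (raw)]: "\<And>m. (\<lambda>x. f x m) \<in> borel_measurable M"
 shows "(\<lambda>x. NSUM m. f x m) \<in> borel_measurable M"
proof -
 have bij: "bij_betw (from_nat_into (UNIV :: int set)) UNIV UNIV"
  by (rule bij_betw_from_nat_into) (auto simp: infinite_UNIV_int)
 have "(NSUM m. f x m) = (\<Sum>n. f x (from_nat_into UNIV n))" for x
  unfolding nn_integral_count_space_nat[symmetric] by (rule nn_integral_bij_count_space[OF bij, symmetric])
 then show ?thesis by simp
qed

lemma nn_integral_periodize:
 fixes g :: "real \<Rightarrow> ennreal"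
 assumes [measurable]: "g \<in> bm" and c: "c > 0"
 shows "(NINT x. g x) = (NINT r. indicator {0..<1} r * (NSUM n. ennreal c * g (c * (real_of_int n + r))))"
proof -
 have "(NINT x. g x) = (NINT x. (NSUM n. indicator {c * real_of_int n..<c * (real_of_int n + 1)} x * g x))"
 proof (rule nn_integral_cong)
  fix x :: real
  have e: "indicator {c * real_of_int n..<c * (real_of_int n + 1)} x = (indicator {\<lfloor>x / c\<rfloor>} n :: ennreal)" for n :: int
  proof -
   have "x \<in> {c * real_of_int n..<c * (real_of_int n + 1)} \<longleftrightarrow> \<lfloor>x / c\<rfloor> = n"
    using c by (simp add: floor_eq_iff pos_le_divide_eq pos_divide_less_eq mult.commute)
   then show ?thesis by (auto simp: indicator_def)
  qed
  have "(NSUM n. indicator {c * real_of_int n..<c * (real_of_int n + 1)} x * g x) = (NSUM n. g x * indicator {\<lfloor>x / c\<rfloor>} n)"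
   unfolding e by (simp only: mult.commute)
  also have "... = g x" by (subst nn_integral_cmult_indicator) auto
  finally show "g x = (NSUM n. indicator {c * real_of_int n..<c * (real_of_int n + 1)} x * g x)" by simp
 qed
 also have "... = (NSUM n. (NINT x. indicator {c * real_of_int n..<c * (real_of_int n + 1)} x * g x))"
  by (rule nn_integral_count_space_nn_integral) auto
 also have "... = (NSUM n. (NINT r. indicator {0..<1} r * (ennreal c * g (c * (real_of_int n + r)))))"
 proof (rule nn_integral_cong)
  fix n :: int
  have "(NINT x. indicator {c * real_of_int n..<c * (real_of_int n + 1)} x * g x) =
   ennreal \<bar>c\<bar> * (NINT r. indicator {c * real_of_int n..<c * (real_of_int n + 1)} (c * real_of_int n + c * r) * g (c * real_of_int n + c * r))"
   by (rule nn_integral_real_affine) (use c in auto)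
  also have "... = (NINT r. ennreal \<bar>c\<bar> * (indicator {c * real_of_int n..<c * (real_of_int n + 1)} (c * real_of_int n + c * r) * g (c * real_of_int n + c * r)))"
   by (rule nn_integral_cmult[symmetric]) measurable
  also have "... = (NINT r. indicator {0..<1} r * (ennreal c * g (c * (real_of_int n + r))))"
  proof (rule nn_integral_cong)
   fix r
   have "c * real_of_int n + c * r \<in> {c * real_of_int n..<c * (real_of_int n + 1)} \<longleftrightarrow> r \<in> {0..<1}"
    using c by (simp add: distrib_left zero_le_mult_iff)
   then have "indicator {c * real_of_int n..<c * (real_of_int n + 1)} (c * real_of_int n + c * r) = (indicator {0..<1} r :: ennreal)" by (simp add: indicator_def)
   then show "ennreal \<bar>c\<bar> * (indicator {c * real_of_int n..<c * (real_of_int n + 1)} (c * real_of_int n + c * r) * g (c * real_of_int n + c * r)) = indicator {0..<1} r * (ennreal c * g (c * (real_of_int n + r)))"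
    using c by (simp only: abs_of_pos distrib_left mult_ac)
  qed
  finally show "(NINT x. indicator {c * real_of_int n..<c * (real_of_int n + 1)} x * g x) = (NINT r. indicator {0..<1} r * (ennreal c * g (c * (real_of_int n + r))))" .
 qed
 also have "... = (NINT r. (NSUM n. indicator {0..<1} r * (ennreal c * g (c * (real_of_int n + r)))))"
  by (rule nn_integral_count_space_nn_integral[symmetric]) auto
 also have "... = (NINT r. indicator {0..<1} r * (NSUM n. ennreal c * g (c * (real_of_int n + r))))"
  by (intro nn_integral_cong nn_integral_cmult) auto
 finally show ?thesis .
qed

lemma nn_integral_scales:
 fixes g :: "real \<Rightarrow> ennreal"
 assumes [measurable]: "g \<in> bm" and D: "D > 1"
 shows "(NINT t. indicator {0<..} t * g t) = (NINT \<rho>. indicator {1..<D} \<rho> * (NSUM k. ennreal (D powi k) * g (\<rho> * D powi k)))"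
proof -
 have pos: "D powi k > 0" for k using D by simp
 have "(NINT t. indicator {0<..} t * g t) = (NINT t. (NSUM k. indicator {D powi k..<D powi (k + 1)} t * g t))"
 proof (rule nn_integral_cong)
  fix t :: real
  show "indicator {0<..} t * g t = (NSUM k. indicator {D powi k..<D powi (k + 1)} t * g t)"
  proof (cases "t > 0")
   case False
   have "t \<notin> {D powi k..<D powi (k + 1)}" for k using False pos[of k] by auto
   then show ?thesis using False by simp
  next
   case True
   have e: "indicator {D powi k..<D powi (k + 1)} t = (indicator {\<lfloor>log D t\<rfloor>} k :: ennreal)" for k :: int
   proof -
    have "D powi k = D powr real_of_int k" for k :: int using D by (simp add: powr_real_of_int')
    then have "t \<in> {D powi k..<D powi (k + 1)} \<longleftrightarrow> real_of_int k \<le> log D t \<and> log D t < real_of_int (k + 1)"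
     using D True by (simp add: le_log_iff log_less_iff)
    also have "... \<longleftrightarrow> \<lfloor>log D t\<rfloor> = k" by (simp add: floor_eq_iff)
    finally show ?thesis by (auto simp: indicator_def)
   qed
   have "(NSUM k. indicator {D powi k..<D powi (k + 1)} t * g t) = (NSUM k. g t * indicator {\<lfloor>log D t\<rfloor>} k)"
    unfolding e by (simp only: mult.commute)
   also have "... = g t" by (subst nn_integral_cmult_indicator) auto
   finally show ?thesis using True by simp
  qed
 qed
 also have "... = (NSUM k. (NINT t. indicator {D powi k..<D powi (k + 1)} t * g t))"
  by (rule nn_integral_count_space_nn_integral) auto
 also have "... = (NSUM k. (NINT \<rho>. indicator {1..<D} \<rho> * (ennreal (D powi k) * g (\<rho> * D powi k))))"
 proof (rule nn_integral_cong)
  fix k :: int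
  have "(NINT t. indicator {D powi k..<D powi (k + 1)} t * g t) =
   ennreal \<bar>D powi k\<bar> * (NINT \<rho>. indicator {D powi k..<D powi (k + 1)} (0 + D powi k * \<rho>) * g (0 + D powi k * \<rho>))"
   by (rule nn_integral_real_affine[OF _ less_imp_neq[OF pos, symmetric]]) measurable
  also have "... = (NINT \<rho>. ennreal \<bar>D powi k\<bar> * (indicator {D powi k..<D powi (k + 1)} (0 + D powi k * \<rho>) * g (0 + D powi k * \<rho>)))"
   by (rule nn_integral_cmult[symmetric]) measurable
  also have "... = (NINT \<rho>. indicator {1..<D} \<rho> * (ennreal (D powi k) * g (\<rho> * D powi k)))"
  proof (rule nn_integral_cong)
   fix \<rho>
   have "D powi k * \<rho> \<in> {D powi k..<D powi (k + 1)} \<longleftrightarrow> \<rho> \<in> {1..<D}"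
   proof -
    have e: "D powi (k + 1) = D powi k * D" using D by (simp add: power_int_add)
    have "D powi k * 1 \<le> D powi k * \<rho> \<longleftrightarrow> 1 \<le> \<rho>" "D powi k * \<rho> < D powi k * D \<longleftrightarrow> \<rho> < D"
     using pos[of k] by (simp_all only: mult_le_cancel_left_pos mult_less_cancel_left_pos)
    then show ?thesis unfolding e by simp
   qed
   then have "indicator {D powi k..<D powi (k + 1)} (D powi k * \<rho>) = (indicator {1..<D} \<rho> :: ennreal)" by (simp add: indicator_def)
   then show "ennreal \<bar>D powi k\<bar> * (indicator {D powi k..<D powi (k + 1)} (0 + D powi k * \<rho>) * g (0 + D powi k * \<rho>)) = indicator {1..<D} \<rho> * (ennreal (D powi k) * g (\<rho> * D powi k))"
    using pos[of k] by (simp only: abs_of_pos add_0 mult_ac)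
  qed
  finally show "(NINT t. indicator {D powi k..<D powi (k + 1)} t * g t) = (NINT \<rho>. indicator {1..<D} \<rho> * (ennreal (D powi k) * g (\<rho> * D powi k)))" .
 qed
 also have "... = (NINT \<rho>. (NSUM k. indicator {1..<D} \<rho> * (ennreal (D powi k) * g (\<rho> * D powi k))))"
  by (rule nn_integral_count_space_nn_integral[symmetric]) auto
 also have "... = (NINT \<rho>. indicator {1..<D} \<rho> * (NSUM k. ennreal (D powi k) * g (\<rho> * D powi k)))"
  by (intro nn_integral_cong nn_integral_cmult) auto
 finally show ?thesis .
qed

lemma nn_integral_count_space_le:
 fixes f :: "'a::countable \<Rightarrow> ennreal"
 assumes "infinite (UNIV :: 'a set)" and B: "\<And>P. finite P \<Longrightarrow> (\<Sum>p\<in>P. f p) \<le> B"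
 shows "(NSUM p. f p) \<le> B"
proof -
 have bij: "bij_betw (from_nat_into (UNIV :: 'a set)) UNIV UNIV"
  by (rule bij_betw_from_nat_into) (use assms in auto)
 have "(NSUM p. f p) = (NSUM n. f (from_nat_into UNIV n))"
  by (rule nn_integral_bij_count_space[OF bij, symmetric])
 also have "... = (\<Sum>n. f (from_nat_into UNIV n))" by (rule nn_integral_count_space_nat)
 also have "... \<le> B"
 proof (rule suminf_le_const)
  fix n
  have "(\<Sum>i<n. f (from_nat_into UNIV i)) = (\<Sum>p\<in>from_nat_into UNIV ` {..<n}. f p)"
   using bij by (subst sum.reindex) (auto simp: bij_betw_def inj_on_def)
  also have "... \<le> B" by (rule B) simp
  finally show "(\<Sum>i<n. f (from_nat_into UNIV i)) \<le> B" .
 qed auto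
 finally show ?thesis .
qed

text \<open>The integral is an average of lattice sums over a base scale in \<open>[1, D)\<close>
  and two offsets in \<open>[0, 1)\<close>, so a bound uniform in the lattice passes to it, with the
  mass \<open>D - 1\<close> of the parameters. Cells in position and frequency have area
  \<open>t * (1 / t) = 1\<close>; only the factor \<open>D powi k\<close> of the scale variable
  stays.\<close>

lemma disc_bound:
 fixes H :: "real \<Rightarrow> real \<Rightarrow> real \<Rightarrow> ennreal"
 assumes H[measurable]: "(\<lambda>(t, y, \<eta>). H t y \<eta>) \<in> borel_measurable (borel \<Otimes>\<^sub>M borel \<Otimes>\<^sub>M borel)" and D: "D > 1"
  and B: "\<And>\<rho> r1 r2 P. 1 \<le> \<rho> \<Longrightarrow> finite (P :: (int \<times> int \<times> int) set) \<Longrightarrow>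
   (\<Sum>p\<in>P. ennreal (D powi fst p) * H (\<rho> * D powi fst p) (\<rho> * D powi fst p * (real_of_int (fst (snd p)) + r1)) ((real_of_int (snd (snd p)) + r2) / (\<rho> * D powi fst p))) \<le> B"
 shows "(NINT t. indicator {0<..} t * (NINT y. NINT \<eta>. H t y \<eta>)) \<le> ennreal (D - 1) * B"
proof -
 have pos: "D powi k > 0" for k using D by simp
 have Hc[measurable (raw)]: "(\<lambda>x. H (f x) (g x) (h x)) \<in> borel_measurable N"
  if "f \<in> borel_measurable N" "g \<in> borel_measurable N" "h \<in> borel_measurable N" for f g h and N :: "'z measure"
  using measurable_compose[OF measurable_Pair[OF that(1) measurable_Pair[OF that(2,3)]] H] by simp
 have inner: "(NINT y. NINT \<eta>. H t y \<eta>) =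
  (NINT r1. indicator {0..<1} r1 * (NINT r2. indicator {0..<1} r2 * (NSUM n. NSUM m. H t (t * (real_of_int n + r1)) ((real_of_int m + r2) / t))))"
  if t: "t > 0" for t
 proof -
  have "(NINT y. NINT \<eta>. H t y \<eta>) = (NINT r1. indicator {0..<1} r1 * (NSUM n. ennreal t * (NINT \<eta>. H t (t * (real_of_int n + r1)) \<eta>)))"
   by (rule nn_integral_periodize[OF _ t]) measurable
  also have "... = (NINT r1. indicator {0..<1} r1 * (NINT r2. indicator {0..<1} r2 * (NSUM n. NSUM m. H t (t * (real_of_int n + r1)) ((real_of_int m + r2) / t))))"
  proof (intro nn_integral_cong arg_cong2[where f="(*)"] refl)
   fix r1 :: real
   have one: "ennreal t * (NINT \<eta>. H t y \<eta>) = (NINT r2. indicator {0..<1} r2 * (NSUM m. H t y ((real_of_int m + r2) / t)))" for y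
   proof -
    have "(NINT \<eta>. H t y \<eta>) = (NINT r2. indicator {0..<1} r2 * (NSUM m. ennreal (1 / t) * H t y (1 / t * (real_of_int m + r2))))"
     by (rule nn_integral_periodize) (use t in auto)
    then have "ennreal t * (NINT \<eta>. H t y \<eta>) = (NINT r2. ennreal t * (indicator {0..<1} r2 * (NSUM m. ennreal (1 / t) * H t y (1 / t * (real_of_int m + r2)))))"
     by (simp only:) (rule nn_integral_cmult[symmetric], measurable)
    also have "... = (NINT r2. indicator {0..<1} r2 * (NSUM m. H t y ((real_of_int m + r2) / t)))"
    proof (rule nn_integral_cong)
     fix r2
     have tt: "ennreal t * ennreal (1 / t) = 1" using t by (simp flip: ennreal_mult)
     have "ennreal t * (indicator {0..<1} r2 * (NSUM m. ennreal (1 / t) * H t y (1 / t * (real_of_int m + r2)))) =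
      indicator {0..<1} r2 * (ennreal t * (ennreal (1 / t) * (NSUM m. H t y (1 / t * (real_of_int m + r2)))))"
      by (subst nn_integral_cmult) (simp_all only: mult_ac measurable_count_space_eq1, auto)
     then show "ennreal t * (indicator {0..<1} r2 * (NSUM m. ennreal (1 / t) * H t y (1 / t * (real_of_int m + r2)))) = indicator {0..<1} r2 * (NSUM m. H t y ((real_of_int m + r2) / t))"
      by (simp only: mult.assoc[symmetric, of "ennreal t"] tt mult_1 times_divide_eq_left)
    qed
    finally show ?thesis .
   qed
   have "(NSUM n. ennreal t * (NINT \<eta>. H t (t * (real_of_int n + r1)) \<eta>)) =
    (NSUM n. (NINT r2. indicator {0..<1} r2 * (NSUM m. H t (t * (real_of_int n + r1)) ((real_of_int m + r2) / t))))"
    unfolding one ..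
   also have "... = (NINT r2. (NSUM n. indicator {0..<1} r2 * (NSUM m. H t (t * (real_of_int n + r1)) ((real_of_int m + r2) / t))))"
    by (rule nn_integral_count_space_nn_integral[symmetric]) auto
   also have "... = (NINT r2. indicator {0..<1} r2 * (NSUM n. NSUM m. H t (t * (real_of_int n + r1)) ((real_of_int m + r2) / t)))"
    by (intro nn_integral_cong nn_integral_cmult) auto
   finally show "(NSUM n. ennreal t * (NINT \<eta>. H t (t * (real_of_int n + r1)) \<eta>)) = (NINT r2. indicator {0..<1} r2 * (NSUM n. NSUM m. H t (t * (real_of_int n + r1)) ((real_of_int m + r2) / t)))" .
  qed
  finally show ?thesis .
 qed
 define W where "W \<rho> r1 r2 k n m = ennreal (D powi k) * H (\<rho> * D powi k) (\<rho> * D powi k * (real_of_int n + r1)) ((real_of_int m + r2) / (\<rho> * D powi k))" for \<rho> r1 r2 and k n m :: int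
 have [measurable]: "(\<lambda>(\<rho>, r1, r2). W \<rho> r1 r2 k n m) \<in> borel_measurable (borel \<Otimes>\<^sub>M borel \<Otimes>\<^sub>M borel)" for k n m unfolding W_def by measurable
 have WB: "(NSUM k. NSUM n. NSUM m. W \<rho> r1 r2 k n m) \<le> B" if "1 \<le> \<rho>" for \<rho> r1 r2
 proof -
  have "(NSUM k. NSUM n. NSUM m. W \<rho> r1 r2 k n m) =
   (NSUM k. NSUM q. W \<rho> r1 r2 k (fst q) (snd q))"
   using nn_integral_fst_count_space[of "\<lambda>q. W \<rho> r1 r2 k (fst q) (snd q)" for k] by simp
  also have "... = (NSUM p. W \<rho> r1 r2 (fst p) (fst (snd p)) (snd (snd p)))"
   using nn_integral_fst_count_space[of "\<lambda>p. W \<rho> r1 r2 (fst p) (fst (snd p)) (snd (snd p))"] by simp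
  also have "... \<le> B"
   by (rule nn_integral_count_space_le) (use B[OF that] in \<open>auto simp: W_def finite_prod\<close>)
  finally show ?thesis .
 qed
 have swap: "(NSUM k. indicator {0..<1::real} r * G k) = indicator {0..<1} r * (NSUM k. G k)" for r and G :: "int \<Rightarrow> ennreal"
  by (rule nn_integral_cmult) auto
 have "(NINT t. indicator {0<..} t * (NINT y. NINT \<eta>. H t y \<eta>)) =
  (NINT \<rho>. indicator {1..<D} \<rho> * (NSUM k. ennreal (D powi k) * (NINT y. NINT \<eta>. H (\<rho> * D powi k) y \<eta>)))"
  by (rule nn_integral_scales[OF _ D]) measurable
 also have "... \<le> (NINT \<rho>. indicator {1..<D} \<rho> * B)"
 proof (rule nn_integral_mono)
  fix \<rho> :: real
  show "indicator {1..<D} \<rho> * (NSUM k. ennreal (D powi k) * (NINT y. NINT \<eta>. H (\<rho> * D powi k) y \<eta>)) \<le> indicator {1..<D} \<rho> * B"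
  proof (cases "\<rho> \<in> {1..<D}")
   case False
   then show ?thesis by simp
  next
   case True
   then have \<rho>: "\<rho> \<ge> 1" by simp
   have "(NSUM k. ennreal (D powi k) * (NINT y. NINT \<eta>. H (\<rho> * D powi k) y \<eta>)) =
    (NSUM k. (NINT r1. indicator {0..<1} r1 * (NINT r2. indicator {0..<1} r2 * (NSUM n. NSUM m. W \<rho> r1 r2 k n m))))"
   proof (rule nn_integral_cong)
    fix k :: int
    have t: "\<rho> * D powi k > 0" using \<rho> pos[of k] by simp
    have c1: "(NSUM m. W \<rho> r1 r2 k n m) = ennreal (D powi k) * (NSUM m. H (\<rho> * D powi k) (\<rho> * D powi k * (real_of_int n + r1)) ((real_of_int m + r2) / (\<rho> * D powi k)))" for r1 r2 n
     unfolding W_def by (rule nn_integral_cmult) auto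
    have c2: "(NSUM n. NSUM m. W \<rho> r1 r2 k n m) = ennreal (D powi k) * (NSUM n. NSUM m. H (\<rho> * D powi k) (\<rho> * D powi k * (real_of_int n + r1)) ((real_of_int m + r2) / (\<rho> * D powi k)))" for r1 r2
     unfolding c1 by (rule nn_integral_cmult) auto
    have "ennreal (D powi k) * (NINT y. NINT \<eta>. H (\<rho> * D powi k) y \<eta>) =
     (NINT r1. ennreal (D powi k) * (indicator {0..<1} r1 * (NINT r2. indicator {0..<1} r2 * (NSUM n. NSUM m. H (\<rho> * D powi k) (\<rho> * D powi k * (real_of_int n + r1)) ((real_of_int m + r2) / (\<rho> * D powi k))))))"
     unfolding inner[OF t] by (rule nn_integral_cmult[symmetric]) measurable
    also have "... = (NINT r1. indicator {0..<1} r1 * (NINT r2. indicator {0..<1} r2 * (NSUM n. NSUM m. W \<rho> r1 r2 k n m)))"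
    proof (rule nn_integral_cong)
     fix r1
     have "(NINT r2. indicator {0..<1} r2 * (NSUM n. NSUM m. W \<rho> r1 r2 k n m)) =
      (NINT r2. ennreal (D powi k) * (indicator {0..<1} r2 * (NSUM n. NSUM m. H (\<rho> * D powi k) (\<rho> * D powi k * (real_of_int n + r1)) ((real_of_int m + r2) / (\<rho> * D powi k)))))"
      unfolding c2 by (simp only: mult_ac)
     also have "... = ennreal (D powi k) * (NINT r2. indicator {0..<1} r2 * (NSUM n. NSUM m. H (\<rho> * D powi k) (\<rho> * D powi k * (real_of_int n + r1)) ((real_of_int m + r2) / (\<rho> * D powi k))))"
      by (rule nn_integral_cmult) measurable
     finally show "ennreal (D powi k) * (indicator {0..<1} r1 * (NINT r2. indicator {0..<1} r2 * (NSUM n. NSUM m. H (\<rho> * D powi k) (\<rho> * D powi k * (real_of_int n + r1)) ((real_of_int m + r2) / (\<rho> * D powi k))))) =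
      indicator {0..<1} r1 * (NINT r2. indicator {0..<1} r2 * (NSUM n. NSUM m. W \<rho> r1 r2 k n m))"
      by (simp only: mult_ac)
    qed
    finally show "ennreal (D powi k) * (NINT y. NINT \<eta>. H (\<rho> * D powi k) y \<eta>) = (NINT r1. indicator {0..<1} r1 * (NINT r2. indicator {0..<1} r2 * (NSUM n. NSUM m. W \<rho> r1 r2 k n m)))" .
   qed
   also have "... = (NINT r1. (NSUM k. indicator {0..<1} r1 * (NINT r2. indicator {0..<1} r2 * (NSUM n. NSUM m. W \<rho> r1 r2 k n m))))"
    by (rule nn_integral_count_space_nn_integral[symmetric]) (auto)
   also have "... = (NINT r1. indicator {0..<1} r1 * (NINT r2. (NSUM k. indicator {0..<1} r2 * (NSUM n. NSUM m. W \<rho> r1 r2 k n m))))"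
    unfolding swap by (intro nn_integral_cong arg_cong2[where f="(*)"] refl, subst nn_integral_count_space_nn_integral[symmetric]) (auto simp: swap)
   also have "... = (NINT r1. indicator {0..<1} r1 * (NINT r2. indicator {0..<1} r2 * (NSUM k. NSUM n. NSUM m. W \<rho> r1 r2 k n m)))"
    unfolding swap ..
   also have "... \<le> (NINT r1. indicator {0..<1::real} r1 * (NINT r2. indicator {0..<1::real} r2 * B))"
    by (intro nn_integral_mono mult_left_mono WB[OF \<rho>]) auto
   also have "... = B"
    by (simp add: nn_integral_multc)
   finally show ?thesis using True by simp
  qed
 qed
 also have "... = ennreal (D - 1) * B" using D by (simp add: nn_integral_multc)
 finally show ?thesis .
qed

section \<open>The weak-type bound behind the exceptional set\<close>

lemma emeasure_UN_le:
 fixes B :: "'a \<Rightarrow> real set"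
 assumes C: "countable C" and B: "\<And>i. B i \<in> sets borel"
 shows "emeasure lborel (\<Union>i\<in>C. B i) \<le> (\<integral>\<^sup>+i. emeasure lborel (B i) \<partial>count_space C)"
proof -
 have [measurable]: "(\<Union>i\<in>C. B i) \<in> sets borel" using C B by (intro sets.countable_UN') auto
 have "emeasure lborel (\<Union>i\<in>C. B i) = (NINT x. indicator (\<Union>i\<in>C. B i) x)" by simp
 also have "... \<le> (NINT x. \<integral>\<^sup>+i. indicator (B i) x \<partial>count_space C)"
 proof (rule nn_integral_mono)
  fix x :: real
  show "indicator (\<Union>i\<in>C. B i) x \<le> (\<integral>\<^sup>+i. indicator (B i) x \<partial>count_space C)"
  proof (cases "x \<in> (\<Union>i\<in>C. B i)")
   case True
   then obtain i0 where i0: "i0 \<in> C" "x \<in> B i0" by blast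
   have "(1::ennreal) = (\<integral>\<^sup>+i. indicator {i0} i \<partial>count_space C)" using i0 by (subst nn_integral_indicator) auto
   also have "... \<le> (\<integral>\<^sup>+i. indicator (B i) x \<partial>count_space C)"
    by (intro nn_integral_mono) (use i0 in \<open>auto simp: indicator_def\<close>)
   finally show ?thesis using True by simp
  qed simp
 qed
 also have "... = (\<integral>\<^sup>+i. (NINT x. indicator (B i) x) \<partial>count_space C)"
  by (rule nn_integral_count_space_nn_integral[OF C]) (use B in auto)
 also have "... = (\<integral>\<^sup>+i. emeasure lborel (B i) \<partial>count_space C)" using B by simp
 finally show ?thesis .
qed

text \<open>The set where averages are large is written as a union of open balls, so that it is
  open. In a disjoint Vitali subfamily each ball of radius \<open>r\<close> carries mass above
  \<open>la * r\<close>, and its fivefold enlargement has length \<open>10 * r\<close>, which gives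
  the constant 10.\<close>

lemma hl_weak:
 fixes h :: "real \<Rightarrow> real"
 assumes h: "integrable lborel h" and h0: "\<And>x. h x \<ge> 0" and la: "la > 0"
 defines "W \<equiv> (\<Union>(y, r)\<in>{(y, r). r > 0 \<and> la * r < (LBINT x. indicator {y - r..y + r} x * h x)}. ball y r)"
 shows "open W" "emeasure lborel W \<le> ennreal (10 * (LBINT x. h x) / la)"
  "\<And>z r. z \<notin> W \<Longrightarrow> r > 0 \<Longrightarrow> (LBINT x. indicator {z - r..z + r} x * h x) \<le> la * r"
proof -
 have [measurable]: "h \<in> bm" using h by auto
 have hi: "integrable lborel (\<lambda>x. indicator {y - r..y + r} x * h x)" for y r
  using integrable_mult_indicator[of "{y - r..y + r}" lborel h] h by simp
 show oW: "open W" unfolding W_def by (intro open_UN ballI) auto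
 show "(LBINT x. indicator {z - r..z + r} x * h x) \<le> la * r" if "z \<notin> W" "r > 0" for z r
 proof (rule ccontr)
  assume "\<not> ?thesis"
  then have "z \<in> W" unfolding W_def using that(2) by (intro UN_I[of "(z, r)"]) auto
  then show False using that(1) by simp
 qed
 define I where "I = (LBINT x. h x)"
 define K where "K = {(y, r). r > 0 \<and> la * r < (LBINT x. indicator {y - r..y + r} x * h x)}"
 have rB: "0 < snd i \<and> snd i \<le> I / la" if "i \<in> K" for i
 proof -
  have "la * snd i < (LBINT x. indicator {fst i - snd i..fst i + snd i} x * h x)" using that by (auto simp: K_def)
  also have "... \<le> I" unfolding I_def by (rule integral_mono[OF hi h]) (auto simp: indicator_def h0)
  finally show ?thesis using that la by (auto simp: K_def pos_le_divide_eq mult.commute)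
 qed
 have sub: "W \<subseteq> (\<Union>i\<in>K. ball (fst i) (snd i))" unfolding W_def K_def by auto
 obtain C where C: "countable C" "C \<subseteq> K"
  "pairwise (\<lambda>i j. disjnt (ball (fst i) (snd i)) (ball (fst j) (snd j))) C"
  "W \<subseteq> (\<Union>i\<in>C. ball (fst i) (5 * snd i))"
  by (rule Vitali_covering_lemma_balls[OF sub rB]; (assumption | (rule that; assumption)))
 have bm: "emeasure lborel (ball y (5 * r)) = ennreal (10 * r)" if "r > 0" for y r :: real
  using that by (simp add: ball_eq_greaterThanLessThan)
 have "emeasure lborel W \<le> emeasure lborel (\<Union>i\<in>C. ball (fst i) (5 * snd i))"
  by (rule emeasure_mono[OF C(4)]) (simp, intro borel_open open_UN ballI open_ball)
 also have "... \<le> (\<integral>\<^sup>+i. emeasure lborel (ball (fst i) (5 * snd i)) \<partial>count_space C)"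
  by (rule emeasure_UN_le[OF C(1)]) auto
 also have "... \<le> (\<integral>\<^sup>+i. ennreal (10 / la) * (NINT x. ennreal (h x) * indicator (ball (fst i) (snd i)) x) \<partial>count_space C)"
 proof (rule nn_integral_mono)
  fix i assume "i \<in> space (count_space C)"
  then have i: "i \<in> K" using C by auto
  define y r where "y = fst i" and "r = snd i"
  have r: "r > 0" and lt: "la * r < (LBINT x. indicator {y - r..y + r} x * h x)" using i by (auto simp: K_def y_def r_def)
  have "ennreal (10 * r) \<le> ennreal (10 / la * (LBINT x. indicator {y - r..y + r} x * h x))"
   using lt la by (intro ennreal_leI) (simp add: field_simps)
  also have "... = ennreal (10 / la) * ennreal (LBINT x. indicator {y - r..y + r} x * h x)"
   using la by (intro ennreal_mult) (auto intro!: integral_nonneg_AE AE_I2 simp: h0)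
  also have "ennreal (LBINT x. indicator {y - r..y + r} x * h x) = (NINT x. ennreal (indicator {y - r..y + r} x * h x))"
   by (rule nn_integral_eq_integral[symmetric, OF hi]) (auto simp: h0)
  also have "... = (NINT x. ennreal (h x) * indicator (ball y r) x)"
  proof (rule nn_integral_cong_AE)
   have "AE x in lborel. x \<noteq> y - r" "AE x in lborel. x \<noteq> y + r" by (auto intro: AE_lborel_singleton)
   then show "AE x in lborel. ennreal (indicator {y - r..y + r} x * h x) = ennreal (h x) * indicator (ball y r) x"
   proof eventually_elim
    case (elim x)
    then show ?case unfolding ball_eq_greaterThanLessThan by (auto simp: indicator_def)
   qed
  qed
  finally show "emeasure lborel (ball (fst i) (5 * snd i)) \<le> ennreal (10 / la) * (NINT x. ennreal (h x) * indicator (ball (fst i) (snd i)) x)"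
   using bm[OF r] by (simp add: y_def r_def)
 qed
 also have "... = ennreal (10 / la) * (\<integral>\<^sup>+i. (NINT x. ennreal (h x) * indicator (ball (fst i) (snd i)) x) \<partial>count_space C)"
  by (rule nn_integral_cmult) auto
 also have "(\<integral>\<^sup>+i. (NINT x. ennreal (h x) * indicator (ball (fst i) (snd i)) x) \<partial>count_space C) = (NINT x. (\<integral>\<^sup>+i. ennreal (h x) * indicator (ball (fst i) (snd i)) x \<partial>count_space C))"
  by (intro nn_integral_count_space_nn_integral[symmetric] C(1) borel_measurable_times_ennreal borel_measurable_indicator) (use h in measurable)
 also have "... \<le> (NINT x. ennreal (h x))"
 proof (rule nn_integral_mono)
  fix x :: real
  show "(\<integral>\<^sup>+i. ennreal (h x) * indicator (ball (fst i) (snd i)) x \<partial>count_space C) \<le> ennreal (h x)"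
  proof (cases "\<exists>i\<in>C. x \<in> ball (fst i) (snd i)")
   case False
   then have "(\<integral>\<^sup>+i. ennreal (h x) * indicator (ball (fst i) (snd i)) x \<partial>count_space C) = (\<integral>\<^sup>+i. 0 \<partial>count_space C)"
    by (intro nn_integral_cong) auto
   then show ?thesis by simp
  next
   case True
   then obtain i0 where i0: "i0 \<in> C" "x \<in> ball (fst i0) (snd i0)" by blast
   have "(\<integral>\<^sup>+i. ennreal (h x) * indicator (ball (fst i) (snd i)) x \<partial>count_space C) = (\<integral>\<^sup>+i. ennreal (h x) * indicator {i0} i \<partial>count_space C)"
   proof (intro nn_integral_cong arg_cong2[where f="(*)"] refl)
    fix i assume "i \<in> space (count_space C)"
    then have i: "i \<in> C" by simp
    have "x \<in> ball (fst i) (snd i) \<longleftrightarrow> i = i0"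
    proof
     assume "x \<in> ball (fst i) (snd i)"
     then show "i = i0" using C(3) i i0 unfolding pairwise_def disjnt_iff by blast
    qed (use i0 in simp)
    then show "indicator (ball (fst i) (snd i)) x = (indicator {i0} i :: ennreal)" by (simp add: indicator_def)
   qed
   also have "... = ennreal (h x) * emeasure (count_space C) {i0}" by (rule nn_integral_cmult_indicator) (use i0 in auto)
   also have "... = ennreal (h x)" using i0 by simp
   finally show ?thesis by simp
  qed
 qed
 also have "... = ennreal I" unfolding I_def by (rule nn_integral_eq_integral[OF h]) (simp add: h0)
 finally have "emeasure lborel W \<le> ennreal (10 / la) * ennreal I" by (simp add: mult_left_mono)
 also have "... = ennreal (10 * I / la)"
  using la by (subst ennreal_mult[symmetric]) (auto simp: I_def intro!: integral_nonneg_AE AE_I2 h0)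
 finally show "emeasure lborel W \<le> ennreal (10 * (LBINT x. h x) / la)" by (simp add: I_def)
qed

lemma emb_eta:
 assumes f: "f \<in> bm" "sq_integrable f" and t: "t > 0" and d: "d \<noteq> 0"
 shows "integrable lborel (\<lambda>\<eta>. (norm (emb f y (d * \<eta> + b) t))^2)"
  "(LBINT \<eta>. (norm (emb f y (d * \<eta> + b) t))^2) = 2 * pi / \<bar>d\<bar> * (LBINT x. (norm (f x))^2 * (phi ((x - y) / t) / t)^2)"
proof -
 have "integrable lborel (\<lambda>\<eta>. (norm (emb f y (b + d * \<eta>) t))^2)"
  by (rule lborel_integrable_real_affine[OF emb_plancherel(1)[OF f t] d])
 then show "integrable lborel (\<lambda>\<eta>. (norm (emb f y (d * \<eta> + b) t))^2)" by (simp add: add.commute)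
 have "(LBINT \<theta>. (norm (emb f y \<theta> t))^2) = \<bar>d\<bar> *\<^sub>R (LBINT \<eta>. (norm (emb f y (b + d * \<eta>) t))^2)"
  by (rule lborel_integral_real_affine[OF d])
 then show "(LBINT \<eta>. (norm (emb f y (d * \<eta> + b) t))^2) = 2 * pi / \<bar>d\<bar> * (LBINT x. (norm (f x))^2 * (phi ((x - y) / t) / t)^2)"
 proof -
  assume "(LBINT \<theta>. (norm (emb f y \<theta> t))^2) = \<bar>d\<bar> *\<^sub>R (LBINT \<eta>. (norm (emb f y (b + d * \<eta>) t))^2)"
  then have e: "2 * pi * (LBINT x. (norm (f x))^2 * (phi ((x - y) / t) / t)^2) = \<bar>d\<bar> * (LBINT \<eta>. (norm (emb f y (d * \<eta> + b) t))^2)"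
   unfolding emb_plancherel(2)[OF f t] by (simp only: real_scaleR_def add.commute)
  have "v = u / \<bar>d\<bar>" if "u = \<bar>d\<bar> * v" for u v :: real using that d by simp
  from this[OF e] show ?thesis by (simp only: times_divide_eq_left)
 qed
qed

lemma emb_measurable3[measurable (raw)]:
 assumes [measurable]: "f \<in> bm" "y \<in> borel_measurable N" "\<theta> \<in> borel_measurable N" "t \<in> borel_measurable N"
 shows "(\<lambda>u. emb f (y u) (\<theta> u) (t u)) \<in> borel_measurable N"
 unfolding emb_def wp_def by measurable

definition CU :: "real \<Rightarrow> real \<Rightarrow> real \<Rightarrow> real" where
 "CU k d2 d3 = 10000 * k * (sqrt (2 * pi / \<bar>d2\<bar> * (10000 * k)) * sqrt (2 * pi / \<bar>d3\<bar> * (625^2 * pi)))"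

text \<open>The averages of \<open>f1\<close> and \<open>f2\<close> around \<open>y\<close> are
  controlled only on scale \<open>\<delta>\<close>, which loses powers of
  \<open>\<delta> / t\<close>. But \<open>f3\<close> vanishes within \<open>\<delta>\<close> of
  \<open>y\<close>, and the decay of \<open>phi\<close> there wins powers of
  \<open>t / \<delta>\<close>. The function \<open>f1\<close> enters through its supremum,
  \<open>f2\<close> and \<open>f3\<close> through Plancherel in \<open>\<eta>\<close>. The net bound
  is constant in \<open>t\<close>, so that integrating it over \<open>0 < t \<le> \<delta>\<close>
  cancels \<open>1 / \<delta>\<close>.\<close>

lemma far_fiber:
 assumes f1: "f1 \<in> bm" "sq_integrable f1"
  and f2: "f2 \<in> bm" "sq_integrable f2"
  and f3: "f3 \<in> bm" "sq_integrable f3"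
  and d: "d2 \<noteq> 0" "d3 \<noteq> 0" and t: "0 < t" "t \<le> \<delta>" and z: "\<bar>y - z\<bar> \<le> \<delta>" and k: "k \<ge> 0" "a \<ge> 0" "l \<ge> 0"
  and h1: "\<And>r. r > 0 \<Longrightarrow> (LBINT x. indicator {z - r..z + r} x * norm (f1 x)) \<le> k * a * r"
  and h2: "\<And>r. r > 0 \<Longrightarrow> (LBINT x. indicator {z - r..z + r} x * (norm (f2 x))^2) \<le> k * l^2 * r"
  and h3: "\<And>x. norm (f3 x) \<le> 1" "\<And>x. \<bar>x - y\<bar> < \<delta> \<Longrightarrow> f3 x = 0"
 shows "(NINT \<eta>. ennreal (norm (emb f1 y (d1 * \<eta> + b1) t) * norm (emb f2 y (d2 * \<eta> + b2) t) * norm (emb f3 y (d3 * \<eta> + b3) t)))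
  \<le> ennreal (CU k d2 d3 * (a * l / \<delta>))"
proof -
 have \<delta>: "\<delta> > 0" using t by simp
 have [measurable]: "f1 \<in> bm" "f2 \<in> bm" "f3 \<in> bm" using f1 f2 f3 by auto
 have move: "(LBINT x. indicator {y - r..y + r} x * h x) \<le> c * (2 * r)"
  if r: "r \<ge> \<delta>" and hz: "(LBINT x. indicator {z - 2 * r..z + 2 * r} x * h x) \<le> c * (2 * r)" and hi: "integrable lborel (\<lambda>x. indicator {z - 2 * r..z + 2 * r} x * h x)" and h0: "\<And>x. h x \<ge> 0" for h :: "real \<Rightarrow> real" and r c
 proof -
  have "(LBINT x. indicator {y - r..y + r} x * h x) \<le> (LBINT x. indicator {z - 2 * r..z + 2 * r} x * h x)"
  proof (rule integral_mono'[OF hi])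
   fix x
   have "x \<in> {z - 2 * r..z + 2 * r}" if "x \<in> {y - r..y + r}"
    using that z r unfolding atLeastAtMost_iff by linarith
   then show "indicator {y - r..y + r} x * h x \<le> indicator {z - 2 * r..z + 2 * r} x * h x"
    by (intro mult_right_mono h0) (auto simp: indicator_def)
  qed (simp add: h0)
  then show ?thesis using hz by linarith
 qed
 have i2: "integrable lborel (\<lambda>x. indicator {u..v} x * (norm (f2 x))^2)" for u v
  using integrable_mult_indicator[of "{u..v}" lborel "\<lambda>x. (norm (f2 x))^2"] f2 by simp
 have a1: "(LBINT x. norm (f1 x) * (1 / (1 + \<bar>x - y\<bar> / \<delta>)^2)) \<le> 8 * (2 * k * a) * \<delta>"
  "integrable lborel (\<lambda>x. norm (f1 x) * (1 / (1 + \<bar>x - y\<bar> / \<delta>)^2))"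
 proof -
  have "(LBINT x. indicator {y - r..y + r} x * norm (f1 x)) \<le> 2 * k * a * r" if "r \<ge> \<delta>" for r
   using move[OF that h1 L2_mult_indicator[OF f1]] that \<delta> by (simp add: mult_ac)
  from annuli[OF f1 \<delta> _ this] show "(LBINT x. norm (f1 x) * (1 / (1 + \<bar>x - y\<bar> / \<delta>)^2)) \<le> 8 * (2 * k * a) * \<delta>"
   "integrable lborel (\<lambda>x. norm (f1 x) * (1 / (1 + \<bar>x - y\<bar> / \<delta>)^2))" using k by auto
 qed
 have a2: "(LBINT x. (norm (f2 x))^2 * (1 / (1 + \<bar>x - y\<bar> / \<delta>)^2)) \<le> 8 * (2 * k * l^2) * \<delta>"
  "integrable lborel (\<lambda>x. (norm (f2 x))^2 * (1 / (1 + \<bar>x - y\<bar> / \<delta>)^2))"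
 proof -
  have "(LBINT x. indicator {y - r..y + r} x * (norm (f2 x))^2) \<le> 2 * k * l^2 * r" if "r \<ge> \<delta>" for r
   using move[OF that h2 i2] that \<delta> by (simp add: mult_ac)
  from annuli_gen[OF _ _ i2 \<delta> _ this] show "(LBINT x. (norm (f2 x))^2 * (1 / (1 + \<bar>x - y\<bar> / \<delta>)^2)) \<le> 8 * (2 * k * l^2) * \<delta>"
   "integrable lborel (\<lambda>x. (norm (f2 x))^2 * (1 / (1 + \<bar>x - y\<bar> / \<delta>)^2))" using k by auto
 qed
 have phd: "phi ((x - y) / t) \<le> 625 * (1 / (1 + \<bar>x - y\<bar> / \<delta>)^2)" for x
 proof -
  have "phi ((x - y) / t) \<le> 625 / (1 + \<bar>(x - y) / t\<bar>)^2" by (rule phi_le_br) simp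
  also have "... \<le> 625 / (1 + \<bar>x - y\<bar> / \<delta>)^2"
  proof (intro divide_left_mono power_mono)
   show "1 + \<bar>x - y\<bar> / \<delta> \<le> 1 + \<bar>(x - y) / t\<bar>" using t by (simp add: frac_le)
   have "0 \<le> \<bar>x - y\<bar> / \<delta>" using \<delta> by simp
   then show "0 < (1 + \<bar>(x - y) / t\<bar>)^2 * (1 + \<bar>x - y\<bar> / \<delta>)^2" by (intro mult_pos_pos zero_less_power add_pos_nonneg) auto
  qed (use \<delta> in auto)
  finally show ?thesis by simp
 qed
 have F1: "norm (emb f1 y \<theta> t) \<le> 10000 * k * a * (\<delta> / t)" for \<theta>
 proof -
  have "norm (emb f1 y \<theta> t) \<le> (LBINT x. norm (f1 x) * (phi ((x - y) / t) / t))" by (rule emb_bound[OF f1 t(1)])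
  also have "... \<le> (LBINT x. (norm (f1 x) * (1 / (1 + \<bar>x - y\<bar> / \<delta>)^2)) * (625 / t))"
  proof (rule integral_mono')
   show "integrable lborel (\<lambda>x. (norm (f1 x) * (1 / (1 + \<bar>x - y\<bar> / \<delta>)^2)) * (625 / t))" by (rule integrable_mult_left[OF a1(2)])
   fix x
   have "norm (f1 x) * (phi ((x - y) / t) / t) \<le> norm (f1 x) * (625 * (1 / (1 + \<bar>x - y\<bar> / \<delta>)^2) / t)"
    using phd t by (intro mult_left_mono divide_right_mono) auto
   then show "norm (f1 x) * (phi ((x - y) / t) / t) \<le> (norm (f1 x) * (1 / (1 + \<bar>x - y\<bar> / \<delta>)^2)) * (625 / t)" by simp
   show "0 \<le> (norm (f1 x) * (1 / (1 + \<bar>x - y\<bar> / \<delta>)^2)) * (625 / t)" using t by (intro mult_nonneg_nonneg divide_nonneg_nonneg) auto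
  qed
  also have "... = (LBINT x. norm (f1 x) * (1 / (1 + \<bar>x - y\<bar> / \<delta>)^2)) * (625 / t)" by (rule integral_mult_left_zero)
  also have "... \<le> 8 * (2 * k * a) * \<delta> * (625 / t)" using a1(1) t by (intro mult_right_mono) auto
  finally show ?thesis by simp
 qed
 define G2 G3 where "G2 \<eta> = norm (emb f2 y (d2 * \<eta> + b2) t)" and "G3 \<eta> = norm (emb f3 y (d3 * \<eta> + b3) t)" for \<eta>
 have [measurable]: "G2 \<in> bm" "G3 \<in> bm" unfolding G2_def G3_def by measurable
 have g2i: "integrable lborel (\<lambda>\<eta>. (G2 \<eta>)^2)" and g3i: "integrable lborel (\<lambda>\<eta>. (G3 \<eta>)^2)"
  unfolding G2_def G3_def using emb_eta(1)[OF f2 t(1) d(1)] emb_eta(1)[OF f3 t(1) d(2)] by auto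
 have g2: "(LBINT \<eta>. (G2 \<eta>)^2) \<le> 2 * pi / \<bar>d2\<bar> * (10000 * k) * (l^2 * \<delta> / t^2)"
 proof -
  have "(LBINT x. (norm (f2 x))^2 * (phi ((x - y) / t) / t)^2) \<le> (LBINT x. ((norm (f2 x))^2 * (1 / (1 + \<bar>x - y\<bar> / \<delta>)^2)) * (625 / t^2))"
  proof (rule integral_mono')
   show "integrable lborel (\<lambda>x. ((norm (f2 x))^2 * (1 / (1 + \<bar>x - y\<bar> / \<delta>)^2)) * (625 / t^2))" by (rule integrable_mult_left[OF a2(2)])
   fix x
   have "(phi ((x - y) / t))^2 \<le> phi ((x - y) / t) * 1" unfolding power2_eq_square by (intro mult_left_mono phi_le1 phi_nonneg)
   then have "(phi ((x - y) / t))^2 \<le> 625 * (1 / (1 + \<bar>x - y\<bar> / \<delta>)^2)" using phd[of x] by linarith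
   then have "(norm (f2 x))^2 * ((phi ((x - y) / t))^2 / t^2) \<le> (norm (f2 x))^2 * (625 * (1 / (1 + \<bar>x - y\<bar> / \<delta>)^2) / t^2)"
    by (intro mult_left_mono divide_right_mono) auto
   then show "(norm (f2 x))^2 * (phi ((x - y) / t) / t)^2 \<le> ((norm (f2 x))^2 * (1 / (1 + \<bar>x - y\<bar> / \<delta>)^2)) * (625 / t^2)" by (simp add: power_divide)
   show "0 \<le> ((norm (f2 x))^2 * (1 / (1 + \<bar>x - y\<bar> / \<delta>)^2)) * (625 / t^2)" by (intro mult_nonneg_nonneg divide_nonneg_nonneg) auto
  qed
  also have "... = (LBINT x. (norm (f2 x))^2 * (1 / (1 + \<bar>x - y\<bar> / \<delta>)^2)) * (625 / t^2)" by (rule integral_mult_left_zero)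
  also have "... \<le> 8 * (2 * k * l^2) * \<delta> * (625 / t^2)" using a2(1) by (intro mult_right_mono) auto
  finally have b: "(LBINT x. (norm (f2 x))^2 * (phi ((x - y) / t) / t)^2) \<le> 8 * (2 * k * l^2) * \<delta> * (625 / t^2)" .
  have "(LBINT \<eta>. (G2 \<eta>)^2) \<le> 2 * pi / \<bar>d2\<bar> * (8 * (2 * k * l^2) * \<delta> * (625 / t^2))"
   unfolding G2_def emb_eta(2)[OF f2 t(1) d(1)] by (intro mult_left_mono b) auto
  then show ?thesis by (simp add: mult_ac)
 qed
 \<comment> \<open>Of the eight powers of decay in the square of \<open>phi\<close> two are kept for
   integrating in \<open>x\<close>; the other six become \<open>(t / \<delta>)^6\<close>.\<close>
 have g3: "(LBINT \<eta>. (G3 \<eta>)^2) \<le> 2 * pi / \<bar>d3\<bar> * (625^2 * pi) * (t^4 / \<delta>^5)"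
 proof -
  have bi: "integrable lborel (\<lambda>x. 1 / (1 + \<bar>(x - y) / t\<bar>)^2 :: real)" by (rule integrable_lborel_rescale[OF br2_integrable t(1)])
  have "(LBINT x. (norm (f3 x))^2 * (phi ((x - y) / t) / t)^2) \<le> (LBINT x. (1 / (1 + \<bar>(x - y) / t\<bar>)^2) * (625^2 * (t / \<delta>)^6 / t^2))"
  proof (rule integral_mono')
   show "integrable lborel (\<lambda>x. (1 / (1 + \<bar>(x - y) / t\<bar>)^2) * (625^2 * (t / \<delta>)^6 / t^2))" by (rule integrable_mult_left[OF bi])
   fix x
   show "0 \<le> (1 / (1 + \<bar>(x - y) / t\<bar>)^2) * (625^2 * (t / \<delta>)^6 / t^2)" using t \<delta> by (intro mult_nonneg_nonneg divide_nonneg_nonneg) auto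
   show "(norm (f3 x))^2 * (phi ((x - y) / t) / t)^2 \<le> (1 / (1 + \<bar>(x - y) / t\<bar>)^2) * (625^2 * (t / \<delta>)^6 / t^2)"
   proof (cases "\<bar>x - y\<bar> < \<delta>")
    case True
    then have "f3 x = 0" by (rule h3(2))
    then show ?thesis using t \<delta> by simp
   next
    case False
    define w where "w = 1 + \<bar>(x - y) / t\<bar>"
    have w1: "w \<ge> 1" by (simp add: w_def)
    have "\<delta> / t \<le> w" using False t by (simp add: w_def abs_divide field_simps)
    then have "1 / w \<le> 1 / (\<delta> / t)" using \<delta> t w1 by (intro divide_left_mono) auto
    then have iw: "1 / w \<le> t / \<delta>" by simp
    have "(norm (f3 x))^2 * (phi ((x - y) / t) / t)^2 \<le> 1 * (625 / w^4 / t)^2"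
     using h3(1) phi_le[of "(x - y) / t"] t phi_nonneg w1
     by (intro mult_mono power_mono divide_right_mono) (auto simp: w_def power_le_one)
    also have "... = 625^2 * (1 / w)^2 * (1 / w)^6 / t^2" by (simp add: power_divide power_mult_distrib power_mult[symmetric] power_add[symmetric])
    also have "... \<le> 625^2 * (1 / w)^2 * (t / \<delta>)^6 / t^2"
     using iw w1 by (intro divide_right_mono mult_left_mono power_mono) auto
    also have "... = (1 / w^2) * (625^2 * (t / \<delta>)^6 / t^2)" by (simp add: power_divide)
    finally show ?thesis by (simp add: w_def)
   qed
  qed
  also have "... = (LBINT x. 1 / (1 + \<bar>(x - y) / t\<bar>)^2) * (625^2 * (t / \<delta>)^6 / t^2)" by (rule integral_mult_left_zero)
  also have "(LBINT x. 1 / (1 + \<bar>(x - y) / t\<bar>)^2) = t * (LBINT x. 1 / (1 + \<bar>x\<bar>)^2)"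
   using integral_lborel_rescale_shift[OF t(1), of "\<lambda>x. 1 / (1 + \<bar>x\<bar>)^2 :: real" y] by simp
  also have "t * (LBINT x. 1 / (1 + \<bar>x\<bar>)^2) * (625^2 * (t / \<delta>)^6 / t^2) \<le> t * pi * (625^2 * (t / \<delta>)^6 / t^2)"
   using br2_integral t \<delta> by (intro mult_right_mono mult_left_mono) auto
  also have "... = 625^2 * pi * (t^5 / \<delta>^6)" using t by (simp add: power_divide power2_eq_square eval_nat_numeral)
  also have "... \<le> 625^2 * pi * (t^4 / \<delta>^5)"
  proof (intro mult_left_mono)
   have "t^4 * t / (\<delta>^5 * \<delta>) \<le> t^4 * \<delta> / (\<delta>^5 * \<delta>)" using t \<delta> by (intro divide_right_mono mult_left_mono) auto
   then show "t^5 / \<delta>^6 \<le> t^4 / \<delta>^5" using \<delta> by (simp add: eval_nat_numeral mult_ac)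
  qed auto
  finally have b: "(LBINT x. (norm (f3 x))^2 * (phi ((x - y) / t) / t)^2) \<le> 625^2 * pi * (t^4 / \<delta>^5)" .
  have "(LBINT \<eta>. (G3 \<eta>)^2) \<le> 2 * pi / \<bar>d3\<bar> * (625^2 * pi * (t^4 / \<delta>^5))"
   unfolding G3_def emb_eta(2)[OF f3 t(1) d(2)] by (intro mult_left_mono b) auto
  then show ?thesis by (simp only: mult.assoc)
 qed
 have gg: "integrable lborel (\<lambda>\<eta>. G2 \<eta> * G3 \<eta>)"
  by (rule integrable_mult_L2) (use g2i g3i in auto)
 have gg0: "0 \<le> G2 \<eta> * G3 \<eta>" for \<eta> by (simp add: G2_def G3_def)
 have "(LBINT \<eta>. G2 \<eta> * G3 \<eta>) \<le> (LBINT \<eta>. \<bar>G2 \<eta> * G3 \<eta>\<bar>)" using gg by (intro integral_mono) auto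
 also have "... \<le> sqrt (LBINT \<eta>. (G2 \<eta>)^2) * sqrt (LBINT \<eta>. (G3 \<eta>)^2)"
  by (rule CS_integral) (use g2i g3i in auto)
 also have "... \<le> sqrt (2 * pi / \<bar>d2\<bar> * (10000 * k) * (l^2 * \<delta> / t^2)) * sqrt (2 * pi / \<bar>d3\<bar> * (625^2 * pi) * (t^4 / \<delta>^5))"
  using g2 g3 k \<delta> t by (intro mult_mono real_sqrt_le_mono real_sqrt_ge_zero) (auto intro!: integral_nonneg_AE)
 also have "... = sqrt (2 * pi / \<bar>d2\<bar> * (10000 * k)) * sqrt (2 * pi / \<bar>d3\<bar> * (625^2 * pi)) * sqrt ((l^2 * \<delta> / t^2) * (t^4 / \<delta>^5))"
  unfolding real_sqrt_mult by (simp only: mult_ac)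
 also have "sqrt ((l^2 * \<delta> / t^2) * (t^4 / \<delta>^5)) = l * t / \<delta>^2"
 proof -
  have "(l^2 * \<delta> / t^2) * (t^4 / \<delta>^5) = (l * t / \<delta>^2)^2"
   using t \<delta> by (simp add: power_divide power_mult_distrib eval_nat_numeral) (simp add: mult_ac)
  then show ?thesis using k t \<delta> by (simp add: real_sqrt_abs)
 qed
 finally have GG: "(LBINT \<eta>. G2 \<eta> * G3 \<eta>) \<le> sqrt (2 * pi / \<bar>d2\<bar> * (10000 * k)) * sqrt (2 * pi / \<bar>d3\<bar> * (625^2 * pi)) * (l * t / \<delta>^2)" .
 have "(NINT \<eta>. ennreal (norm (emb f1 y (d1 * \<eta> + b1) t) * norm (emb f2 y (d2 * \<eta> + b2) t) * norm (emb f3 y (d3 * \<eta> + b3) t)))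
  \<le> (NINT \<eta>. ennreal (10000 * k * a * (\<delta> / t) * (G2 \<eta> * G3 \<eta>)))"
 proof (intro nn_integral_mono ennreal_leI)
  fix \<eta>
  have "norm (emb f1 y (d1 * \<eta> + b1) t) * (G2 \<eta> * G3 \<eta>) \<le> 10000 * k * a * (\<delta> / t) * (G2 \<eta> * G3 \<eta>)"
   by (intro mult_right_mono F1 gg0)
  then show "norm (emb f1 y (d1 * \<eta> + b1) t) * norm (emb f2 y (d2 * \<eta> + b2) t) * norm (emb f3 y (d3 * \<eta> + b3) t) \<le> 10000 * k * a * (\<delta> / t) * (G2 \<eta> * G3 \<eta>)"
   by (simp add: G2_def G3_def mult.assoc)
 qed
 also have "... = ennreal (LBINT \<eta>. 10000 * k * a * (\<delta> / t) * (G2 \<eta> * G3 \<eta>))"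
  by (rule nn_integral_eq_integral[OF integrable_mult_right[OF gg]]) (use k t \<delta> gg0 in auto)
 also have "(LBINT \<eta>. 10000 * k * a * (\<delta> / t) * (G2 \<eta> * G3 \<eta>)) = 10000 * k * a * (\<delta> / t) * (LBINT \<eta>. G2 \<eta> * G3 \<eta>)" by (rule integral_mult_right_zero)
 also have "ennreal ... \<le> ennreal (10000 * k * a * (\<delta> / t) * (sqrt (2 * pi / \<bar>d2\<bar> * (10000 * k)) * sqrt (2 * pi / \<bar>d3\<bar> * (625^2 * pi)) * (l * t / \<delta>^2)))"
  using k t \<delta> by (intro ennreal_leI mult_left_mono GG) auto
 also have "10000 * k * a * (\<delta> / t) * (sqrt (2 * pi / \<bar>d2\<bar> * (10000 * k)) * sqrt (2 * pi / \<bar>d3\<bar> * (625^2 * pi)) * (l * t / \<delta>^2)) = CU k d2 d3 * (a * l / \<delta>)"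
 proof -
  have "10000 * k * a * (\<delta> / t) * (u * v * (l * t / \<delta>^2)) = 10000 * k * (u * v) * (a * l / \<delta>)" for u v
   using t \<delta> by (simp add: power2_eq_square)
  then show ?thesis unfolding CU_def .
 qed
 finally show ?thesis .
qed

definition trip :: "(real \<Rightarrow> complex) \<Rightarrow> (real \<Rightarrow> complex) \<Rightarrow> (real \<Rightarrow> complex) \<Rightarrow> real \<Rightarrow> real \<Rightarrow> real \<Rightarrow> real \<Rightarrow> real \<Rightarrow> real \<Rightarrow> real \<Rightarrow> real \<Rightarrow> real \<Rightarrow> complex" where
 "trip f1 f2 f3 d1 d2 d3 b1 b2 b3 t y \<eta> = emb f1 y (d1 * \<eta> + b1 / t) t * emb f2 y (d2 * \<eta> + b2 / t) t * emb f3 y (d3 * \<eta> + b3 / t) t"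

lemma trip_measurable[measurable (raw)]:
 assumes "f1 \<in> bm" "f2 \<in> bm" "f3 \<in> bm"
  "t \<in> borel_measurable N" "y \<in> borel_measurable N" "\<eta> \<in> borel_measurable N"
 shows "(\<lambda>u. trip f1 f2 f3 d1 d2 d3 b1 b2 b3 (t u) (y u) (\<eta> u)) \<in> borel_measurable N"
 using assms unfolding trip_def by measurable

lemma norm_trip: "norm (trip f1 f2 f3 d1 d2 d3 b1 b2 b3 t y \<eta>) = norm (emb f1 y (d1 * \<eta> + b1 / t) t) * norm (emb f2 y (d2 * \<eta> + b2 / t) t) * norm (emb f3 y (d3 * \<eta> + b3 / t) t)"
 by (simp add: trip_def norm_mult)

text \<open>The maximal control of \<open>f2\<close> is on its square, while the size estimate takes
  averages of the modulus; Cauchy-Schwarz on an interval of length \<open>2 r\<close> connects the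
  two.\<close>

lemma L1_from_L2_avg:
 fixes f :: "real \<Rightarrow> complex"
 assumes f[measurable]: "f \<in> bm" and f2: "sq_integrable f"
  and r: "r > 0" and c: "c \<ge> 0" and avg: "(LBINT x. indicator {z - r..z + r} x * (norm (f x))^2) \<le> c * r"
 shows "(LBINT x. indicator {z - r..z + r} x * norm (f x)) \<le> sqrt (2 * c) * r"
proof -
 let ?I = "indicator {z - r..z + r} :: real \<Rightarrow> real"
 have sq: "(?I x)^2 = ?I x" for x by (simp add: indicator_def)
 have "(LBINT x. ?I x * norm (f x)) = (LBINT x. \<bar>?I x * (?I x * norm (f x))\<bar>)"
  by (intro bochner_cong refl) (simp add: indicator_def)
 also have "... \<le> sqrt (LBINT x. (?I x)^2) * sqrt (LBINT x. (?I x * norm (f x))^2)"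
 proof (rule CS_integral)
  show "integrable lborel (\<lambda>x. (?I x)^2)" unfolding sq by (rule integrable_indicator_Icc)
  show "integrable lborel (\<lambda>x. (?I x * norm (f x))^2)" unfolding power_mult_distrib sq
   using integrable_mult_indicator[of "{z - r..z + r}" lborel "\<lambda>x. (norm (f x))^2"] f2 by simp
 qed measurable
 also have "... \<le> sqrt (2 * r) * sqrt (c * r)"
  unfolding power_mult_distrib sq using r avg by (intro mult_mono real_sqrt_le_mono) (auto intro!: integral_nonneg_AE AE_I2)
 also have "... = sqrt ((2 * c) * (r * r))" by (simp add: real_sqrt_mult mult_ac)
 also have "... = sqrt (2 * c) * r" using r by (simp add: real_sqrt_mult)
 finally show ?thesis .
qed

text \<open>The situation once the exceptional set is removed: \<open>Z\<close> is its complement,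
  \<open>M\<close> stands for the measure of \<open>F3\<close> and \<open>a\<close> for the ratio of
  the measures of \<open>F1\<close> and \<open>F3\<close>. Averages are controlled at points of
  \<open>Z\<close> only.\<close>

definition off_exceptional :: "(real \<Rightarrow> complex) \<Rightarrow> (real \<Rightarrow> complex) \<Rightarrow> (real \<Rightarrow> complex) \<Rightarrow> real \<Rightarrow> real \<Rightarrow> real \<Rightarrow> real set \<Rightarrow> bool" where
 "off_exceptional f1 f2 f3 a M E2 Z \<longleftrightarrow>
  f1 \<in> bm \<and> sq_integrable f1 \<and> (LBINT x. (norm (f1 x))^2) \<le> a * M \<and>
  f2 \<in> bm \<and> sq_integrable f2 \<and> (LBINT x. (norm (f2 x))^2) \<le> E2^2 \<and>
  f3 \<in> bm \<and> sq_integrable f3 \<and> (LBINT x. (norm (f3 x))^2) \<le> M \<and>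
  a > 0 \<and> M > 0 \<and> E2 > 0 \<and> closed Z \<and> Z \<noteq> {} \<and> emeasure lborel (- Z) \<le> ennreal M \<and>
  (\<forall>x. norm (f3 x) \<le> 1) \<and> (\<forall>x. x \<notin> Z \<longrightarrow> f3 x = 0) \<and>
  (\<forall>z\<in>Z. \<forall>r>0. (LBINT x. indicator {z - r..z + r} x * norm (f1 x)) \<le> 40 * a * r) \<and>
  (\<forall>z\<in>Z. \<forall>r>0. (LBINT x. indicator {z - r..z + r} x * (norm (f2 x))^2) \<le> 40 * (E2 / sqrt M)^2 * r)"

lemma model_total:
 fixes d1 d2 d3 b1 b2 b3 :: real
 assumes d: "d1 \<noteq> 0" "d2 \<noteq> 0" "d3 \<noteq> 0"
  and nd: "4 * (\<bar>d1\<bar> + \<bar>d2\<bar>) \<le> \<bar>d2 * b1 - d1 * b2\<bar>" "4 * (\<bar>d1\<bar> + \<bar>d3\<bar>) \<le> \<bar>d3 * b1 - d1 * b3\<bar>" "4 * (\<bar>d2\<bar> + \<bar>d3\<bar>) \<le> \<bar>d3 * b2 - d2 * b3\<bar>"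
 shows "\<exists>C>0. \<forall>f1 f2 f3 a M E2 Z.
  off_exceptional f1 f2 f3 a M E2 Z \<longrightarrow>
  (NINT t. indicator {0<..} t * (NINT y. NINT \<eta>. ennreal (norm (trip f1 f2 f3 d1 d2 d3 b1 b2 b3 t y \<eta>))))
   \<le> ennreal (C * (sqrt M * E2 * (a * ln (exp 1 + 1 / a))))"
proof -
 \<comment> \<open>The least demanding \<open>R\<close> and then \<open>D\<close> are not sought:
   sums over the three functions satisfy all \<open>adm\<close> conditions at once, and they depend
   only on the \<open>d\<close> and \<open>b\<close>, hence so does the final constant.\<close>
 define R where "R = (4 + \<bar>b1\<bar>) / \<bar>d1\<bar> + (4 + \<bar>b2\<bar>) / \<bar>d2\<bar> + (4 + \<bar>b3\<bar>) / \<bar>d3\<bar>"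
 define D where "D = 4 + (\<bar>d1\<bar> * R + \<bar>b1\<bar>) + (\<bar>d2\<bar> * R + \<bar>b2\<bar>) + (\<bar>d3\<bar> * R + \<bar>b3\<bar>)"
 have Rj: "(4 + \<bar>b1\<bar>) / \<bar>d1\<bar> \<le> R" "(4 + \<bar>b2\<bar>) / \<bar>d2\<bar> \<le> R" "(4 + \<bar>b3\<bar>) / \<bar>d3\<bar> \<le> R" "R \<ge> 0"
  unfolding R_def by (auto intro!: add_nonneg_nonneg divide_nonneg_nonneg)
 have Dj: "\<bar>d1\<bar> * R + \<bar>b1\<bar> \<le> D" "\<bar>d2\<bar> * R + \<bar>b2\<bar> \<le> D" "\<bar>d3\<bar> * R + \<bar>b3\<bar> \<le> D" "D \<ge> 4"
  using Rj(4) unfolding D_def by (auto intro!: add_nonneg_nonneg mult_nonneg_nonneg)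
 define CA where "CA = trigrid.KM D R d1 d2 d3 160"
 define C where "C = \<bar>CA\<bar> * (D - 1) + CU 40 d2 d3 + 1"
 have CU0: "CU 40 d2 d3 \<ge> 0" by (simp add: CU_def)
 have C: "C > 0" using CU0 Dj by (simp add: C_def add_nonneg_pos)
 show ?thesis
 proof (intro exI[of _ C] conjI C allI impI)
  fix f1 f2 f3 :: "real \<Rightarrow> complex" and a M E2 :: real and Z :: "real set"
  assume A: "off_exceptional f1 f2 f3 a M E2 Z"
  then have f1: "f1 \<in> bm" "sq_integrable f1" "(LBINT x. (norm (f1 x))^2) \<le> a * M"
   and f2: "f2 \<in> bm" "sq_integrable f2" "(LBINT x. (norm (f2 x))^2) \<le> E2^2"
   and f3: "f3 \<in> bm" "sq_integrable f3" "(LBINT x. (norm (f3 x))^2) \<le> M"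
   and pos: "a > 0" "M > 0" "E2 > 0" and Z: "closed Z" "Z \<noteq> {}" "emeasure lborel (- Z) \<le> ennreal M"
   and f3b: "\<And>x. norm (f3 x) \<le> 1" "\<And>x. x \<notin> Z \<Longrightarrow> f3 x = 0"
   and h1: "\<And>z r. z \<in> Z \<Longrightarrow> r > 0 \<Longrightarrow> (LBINT x. indicator {z - r..z + r} x * norm (f1 x)) \<le> 40 * a * r"
   and h2: "\<And>z r. z \<in> Z \<Longrightarrow> r > 0 \<Longrightarrow> (LBINT x. indicator {z - r..z + r} x * (norm (f2 x))^2) \<le> 40 * (E2 / sqrt M)^2 * r"
   unfolding off_exceptional_def by blast+
  note [measurable] = f1(1) f2(1) f3(1)
  define Q where "Q = sqrt M * E2 * (a * ln (exp 1 + 1 / a))"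
  have L1: "ln (exp 1 + 1 / a) \<ge> 1"
  proof -
   have "ln (exp 1) \<le> ln (exp 1 + 1 / a)" using pos by (intro ln_mono) (auto intro: add_pos_pos)
   then show ?thesis by simp
  qed
  have Q0: "Q \<ge> 0" using pos L1 by (simp add: Q_def)
  have sM: "sqrt M > 0" using pos by simp
  have [measurable]: "(\<lambda>y. infdist y Z) \<in> bm"
   by (intro borel_measurable_continuous_onI continuous_intros)
  define T where "T t y \<eta> = ennreal (norm (trip f1 f2 f3 d1 d2 d3 b1 b2 b3 t y \<eta>))" for t y \<eta>
  have [measurable]: "(\<lambda>(t, y, \<eta>). T t y \<eta>) \<in> borel_measurable (borel \<Otimes>\<^sub>M borel \<Otimes>\<^sub>M borel)"
   unfolding T_def by measurable
  have Tc[measurable (raw)]: "(\<lambda>x. T (f x) (g x) (h x)) \<in> borel_measurable N"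
   if "f \<in> borel_measurable N" "g \<in> borel_measurable N" "h \<in> borel_measurable N" for f g h and N :: "'z measure"
   using that unfolding T_def by measurable
  \<comment> \<open>The part where some point of \<open>Z\<close> lies within \<open>t\<close> of
    \<open>y\<close>; moving an interval of radius \<open>r \<ge> t\<close> to that point at most
    doubles its radius. The rest \<open>V\<close> is treated by \<open>far_fiber\<close>.\<close>
  define H where "H t y \<eta> = (if infdist y Z \<le> t then T t y \<eta> else 0)" for t y \<eta>
  define V where "V t y \<eta> = (if infdist y Z \<le> t then 0 else T t y \<eta>)" for t y \<eta>
  have HV: "T t y \<eta> = H t y \<eta> + V t y \<eta>" for t y \<eta> by (simp add: H_def V_def)
  have Hc[measurable (raw)]: "(\<lambda>x. H (f x) (g x) (h x)) \<in> borel_measurable N"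
   and Vc[measurable (raw)]: "(\<lambda>x. V (f x) (g x) (h x)) \<in> borel_measurable N"
   if [measurable]: "f \<in> borel_measurable N" "g \<in> borel_measurable N" "h \<in> borel_measurable N" for f g h and N :: "'z measure"
   unfolding H_def V_def by measurable
  have M0: "(NINT t. indicator {0<..} t * (NINT y. NINT \<eta>. H t y \<eta>)) \<le> ennreal (D - 1) * ennreal (CA * Q)"
  proof (rule disc_bound)
   show "(\<lambda>(t, y, \<eta>). H t y \<eta>) \<in> borel_measurable (borel \<Otimes>\<^sub>M borel \<Otimes>\<^sub>M borel)" by measurable
   show "D > 1" using Dj by simp
   fix \<rho> r1 r2 :: real and P :: "(int \<times> int \<times> int) set"
   assume \<rho>: "1 \<le> \<rho>" and P: "finite P"
   interpret trigrid D \<rho> r1 r2 R f1 f2 f3 d1 d2 d3 b1 b2 b3 "sqrt a * sqrt M" E2 "sqrt M"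
   proof (unfold_locales)
    have ad: "grid.adm D R dd bb" if "dd \<noteq> 0" "(4 + \<bar>bb\<bar>) / \<bar>dd\<bar> \<le> R" "\<bar>dd\<bar> * R + \<bar>bb\<bar> \<le> D" for dd bb
    proof -
     interpret grid D \<rho> r1 r2 R by unfold_locales (use Dj \<rho> Rj in auto)
     show ?thesis unfolding adm_def using that by (simp add: pos_divide_le_eq)
    qed
    show "grid.adm D R d1 b1" "grid.adm D R d2 b2" "grid.adm D R d3 b3" using ad d Rj Dj by auto
   qed (use Dj \<rho> Rj f1 f2 f3 pos nd in \<open>auto simp: power_mult_distrib\<close>)
   define P' where "P' = {p\<in>P. infdist (yy p) Z \<le> tt p}"
   have fP': "finite P'" using P by (simp add: P'_def)
   have zex: "\<exists>z\<in>Z. \<bar>yy p - z\<bar> \<le> tt p" if "p \<in> P'" for p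
   proof -
    obtain z where "z \<in> Z" "infdist (yy p) Z = dist (yy p) z" using infdist_attains_inf[OF Z(1,2)] by blast
    then show ?thesis using that by (auto simp: P'_def dist_real_def)
   qed
   have move: "(LBINT x. indicator {yy p - r..yy p + r} x * h x) \<le> c * (2 * r)"
    if p: "p \<in> P'" and r: "r \<ge> tt p" and hz: "\<And>z r. z \<in> Z \<Longrightarrow> r > 0 \<Longrightarrow> (LBINT x. indicator {z - r..z + r} x * h x) \<le> c * r"
     and hi: "\<And>u v. integrable lborel (\<lambda>x. indicator {u..v} x * h x)" and h0: "\<And>x. h x \<ge> 0" for h :: "real \<Rightarrow> real" and p r c
   proof -
    obtain z where z: "z \<in> Z" "\<bar>yy p - z\<bar> \<le> tt p" using zex[OF p] by blast
    have r0: "r > 0" using r tt_pos[of p] by linarith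
    have "(LBINT x. indicator {yy p - r..yy p + r} x * h x) \<le> (LBINT x. indicator {z - 2 * r..z + 2 * r} x * h x)"
    proof (rule integral_mono'[OF hi])
     fix x
     have "x \<in> {z - 2 * r..z + 2 * r}" if "x \<in> {yy p - r..yy p + r}"
      using that z r unfolding atLeastAtMost_iff by linarith
     then show "indicator {yy p - r..yy p + r} x * h x \<le> indicator {z - 2 * r..z + 2 * r} x * h x"
      by (intro mult_right_mono h0) (auto simp: indicator_def)
    qed (simp add: h0)
    then show ?thesis using hz[OF z(1), of "2 * r"] r0 by linarith
   qed
   \<comment> \<open>A common constant for the three averages: doubling the radius gives
     \<open>2 * 40\<close> for \<open>f1\<close>, the passage from squares gives
     \<open>2 * sqrt 80\<close> for \<open>f2\<close>, and the bound by 1 gives 2 for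
     \<open>f3\<close>.\<close>
   have g: "(\<Sum>p\<in>P'. gg p) \<le> KM 160 * (sqrt M * E2 * (a * ln (exp 1 + 1 / a)))"
   proof (rule model_bound[OF fP' pos(1,2)])
    fix p r assume p: "p \<in> P'" and r: "tt p \<le> r"
    have r0: "r > 0" using r tt_pos[of p] by linarith
    have "(LBINT x. indicator {yy p - r..yy p + r} x * norm (f1 x)) \<le> 40 * a * (2 * r)"
     by (rule move[OF p r h1 L2_mult_indicator[OF f1(1,2)]]) auto
    also have "... \<le> 160 * a * r" using pos r0 by simp
    finally show "(LBINT x. indicator {yy p - r..yy p + r} x * norm (f1 x)) \<le> 160 * a * r" .
    have "(LBINT x. indicator {yy p - r..yy p + r} x * norm (f2 x)) \<le> sqrt (2 * (40 * (E2 / sqrt M)^2)) * (2 * r)"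
     by (rule move[OF p r L1_from_L2_avg[OF f2(1,2) _ _ h2] L2_mult_indicator[OF f2(1,2)]]) auto
    also have "sqrt (2 * (40 * (E2 / sqrt M)^2)) = sqrt 80 * (E2 / sqrt M)" using pos by (simp add: real_sqrt_mult real_sqrt_divide)
    also have "sqrt 80 * (E2 / sqrt M) * (2 * r) \<le> 80 * (E2 / sqrt M) * (2 * r)"
     using pos r0 by (intro mult_right_mono real_le_lsqrt) auto
    finally show "(LBINT x. indicator {yy p - r..yy p + r} x * norm (f2 x)) \<le> 160 * (E2 / sqrt M) * r" by simp
    have "(LBINT x. indicator {yy p - r..yy p + r} x * norm (f3 x)) \<le> (LBINT x. indicator {yy p - r..yy p + r} x * 1)"
     by (intro integral_mono L2_mult_indicator[OF f3(1,2)] integrable_mult_left integrable_indicator_Icc mult_left_mono f3b) auto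
    also have "... \<le> 160 * r" using r0 by simp
    finally show "(LBINT x. indicator {yy p - r..yy p + r} x * norm (f3 x)) \<le> 160 * r" .
   qed auto
   have KM: "KM 160 * (sqrt M * E2 * (a * ln (exp 1 + 1 / a))) = CA * Q" by (simp add: CA_def Q_def)
   have "(\<Sum>p\<in>P. ennreal (D powi fst p) * H (\<rho> * D powi fst p) (\<rho> * D powi fst p * (real_of_int (fst (snd p)) + r1)) ((real_of_int (snd (snd p)) + r2) / (\<rho> * D powi fst p))) =
    (\<Sum>p\<in>P. ennreal (D powi fst p) * H (tt p) (yy p) (ee p))"
    by (simp only: tt_def yy_def ee_def)
   also have "... = (\<Sum>p\<in>P'. ennreal (D powi fst p) * H (tt p) (yy p) (ee p))"
    by (rule sum.mono_neutral_right) (use P in \<open>auto simp: P'_def H_def\<close>)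
   also have "... \<le> (\<Sum>p\<in>P'. ennreal (gg p))"
   proof (rule sum_mono)
    fix p assume p: "p \<in> P'"
    have "1 * D powi fst p \<le> tt p" unfolding tt_def using \<rho> Dj by (intro mult_right_mono) auto
    then have "ennreal (D powi fst p) * H (tt p) (yy p) (ee p) \<le> ennreal (tt p) * T (tt p) (yy p) (ee p)"
     using p by (intro mult_mono ennreal_leI) (auto simp: P'_def H_def)
    also have "... = ennreal (gg p)"
     unfolding T_def norm_trip gg_def N1_def N2_def N3_def FF_def th_def
     using tt_pos[of p] by (simp add: ennreal_mult)
    finally show "ennreal (D powi fst p) * H (tt p) (yy p) (ee p) \<le> ennreal (gg p)" .
   qed
   also have "... = ennreal (\<Sum>p\<in>P'. gg p)" by (rule sum_ennreal) (rule gg_nonneg)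
   also have "... \<le> ennreal (CA * Q)" using g unfolding KM by (rule ennreal_leI)
   finally show "(\<Sum>p\<in>P. ennreal (D powi fst p) * H (\<rho> * D powi fst p) (\<rho> * D powi fst p * (real_of_int (fst (snd p)) + r1)) ((real_of_int (snd (snd p)) + r2) / (\<rho> * D powi fst p))) \<le> ennreal (CA * Q)" .
  qed
  define l where "l = E2 / sqrt M"
  have l0: "l \<ge> 0" using pos by (simp add: l_def)
  have fib: "indicator {0<..} t * (NINT \<eta>. V t y \<eta>) \<le> ennreal (CU 40 d2 d3 * (a * l / infdist y Z)) * indicator {0..infdist y Z} t * indicator (- Z) y" for t y
  proof (cases "0 < t \<and> t < infdist y Z")
   case True
   then have yZ: "y \<notin> Z" by auto
   obtain z where z: "z \<in> Z" "infdist y Z = dist y z" using infdist_attains_inf[OF Z(1,2)] by blast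
   have "(NINT \<eta>. V t y \<eta>) = (NINT \<eta>. ennreal (norm (emb f1 y (d1 * \<eta> + b1 / t) t) * norm (emb f2 y (d2 * \<eta> + b2 / t) t) * norm (emb f3 y (d3 * \<eta> + b3 / t) t)))"
    using True unfolding V_def T_def norm_trip by simp
   also have "... \<le> ennreal (CU 40 d2 d3 * (a * l / infdist y Z))"
   proof (rule far_fiber[OF f1(1,2) f2(1,2) f3(1,2) d(2,3), where z=z])
    show "f3 x = 0" if "\<bar>x - y\<bar> < infdist y Z" for x
    proof (rule f3b(2))
     show "x \<notin> Z" using infdist_le[of x Z y] that by (auto simp: dist_real_def abs_minus_commute)
    qed
   qed (use True z pos l0 h1[OF z(1)] h2[OF z(1)] f3b in \<open>auto simp: dist_real_def l_def\<close>)
   finally show ?thesis using True yZ by simp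
  next
   case False
   then show ?thesis by (cases "0 < t") (auto simp: V_def)
  qed
  \<comment> \<open>Integrating in \<open>t\<close> first cancels \<open>1 / infdist y Z\<close>;
    after that only the measure of \<open>- Z\<close> enters. The result has no logarithm, and the
    logarithm in \<open>Q\<close> is at least 1.\<close>
  have MU: "(NINT t. indicator {0<..} t * (NINT y. NINT \<eta>. V t y \<eta>)) \<le> ennreal (CU 40 d2 d3 * Q)"
  proof -
   have mZ[measurable]: "- Z \<in> sets borel" using Z(1) by auto
   have "(NINT t. indicator {0<..} t * (NINT y. NINT \<eta>. V t y \<eta>)) = (NINT t. NINT y. indicator {0<..} t * (NINT \<eta>. V t y \<eta>))"
    by (intro nn_integral_cong nn_integral_cmult[symmetric]) measurable
   also have "... \<le> (NINT t. NINT y. ennreal (CU 40 d2 d3 * (a * l / infdist y Z)) * indicator {0..infdist y Z} t * indicator (- Z) y)"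
    by (intro nn_integral_mono fib)
   also have "... = (NINT y. NINT t. ennreal (CU 40 d2 d3 * (a * l / infdist y Z)) * indicator {0..infdist y Z} t * indicator (- Z) y)"
   proof (rule lborel_pair.Fubini')
    have [measurable]: "(\<lambda>y. indicator (- Z) y :: ennreal) \<in> bm" using mZ by (rule borel_measurable_indicator)
    have [measurable]: "Measurable.pred (borel \<Otimes>\<^sub>M borel) (\<lambda>x. snd x \<in> {0..infdist (fst x) Z})"
     unfolding atLeastAtMost_iff by measurable
    show "(\<lambda>(y, t). ennreal (CU 40 d2 d3 * (a * l / infdist y Z)) * indicator {0..infdist y Z} t * indicator (- Z) y) \<in> borel_measurable (lborel \<Otimes>\<^sub>M lborel)"
     by measurable
   qed
   also have "... \<le> (NINT y. ennreal (CU 40 d2 d3 * (a * l)) * indicator (- Z) y)"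
   proof (rule nn_integral_mono)
    fix y
    have "(NINT t. ennreal (CU 40 d2 d3 * (a * l / infdist y Z)) * indicator {0..infdist y Z} t * indicator (- Z) y) = (NINT t. ennreal (CU 40 d2 d3 * (a * l / infdist y Z)) * indicator (- Z) y * indicator {0..infdist y Z} t)"
     by (simp only: mult_ac)
    also have "... = ennreal (CU 40 d2 d3 * (a * l / infdist y Z)) * indicator (- Z) y * ennreal (infdist y Z)"
     by (subst nn_integral_cmult_indicator) (auto simp: infdist_nonneg)
    also have "... = ennreal (CU 40 d2 d3 * (a * l / infdist y Z) * infdist y Z) * indicator (- Z) y"
     using CU0 pos l0 infdist_nonneg[of y Z] by (subst ennreal_mult) (auto simp: mult_ac)
    also have "... \<le> ennreal (CU 40 d2 d3 * (a * l)) * indicator (- Z) y"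
     using CU0 pos l0 by (intro mult_right_mono ennreal_leI) auto
    finally show "(NINT t. ennreal (CU 40 d2 d3 * (a * l / infdist y Z)) * indicator {0..infdist y Z} t * indicator (- Z) y) \<le> ennreal (CU 40 d2 d3 * (a * l)) * indicator (- Z) y" .
   qed
   also have "... = ennreal (CU 40 d2 d3 * (a * l)) * emeasure lborel (- Z)" by (rule nn_integral_cmult_indicator) simp
   also have "... \<le> ennreal (CU 40 d2 d3 * (a * l)) * ennreal M" by (intro mult_left_mono Z) simp
   also have "... = ennreal (CU 40 d2 d3 * (a * l) * M)" using CU0 pos l0 by (subst ennreal_mult) auto
   also have "... \<le> ennreal (CU 40 d2 d3 * Q)"
   proof (intro ennreal_leI)
    have "l * M = E2 * sqrt M"
    proof -
     have "e / s * m = e * s" if "m = s * s" "s > 0" for e s m :: real using that by simp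
     from this[OF _ sM, of M E2] show ?thesis using pos unfolding l_def by simp
    qed
    then have "a * l * M = sqrt M * E2 * (a * 1)" by (simp add: mult_ac)
    also have "... \<le> Q" unfolding Q_def using pos L1 by (intro mult_left_mono) auto
    finally have "CU 40 d2 d3 * (a * l * M) \<le> CU 40 d2 d3 * Q" using CU0 by (intro mult_left_mono) auto
    then show "CU 40 d2 d3 * (a * l) * M \<le> CU 40 d2 d3 * Q" by (simp only: mult.assoc)
   qed
   finally show ?thesis .
  qed
  have "(NINT t. indicator {0<..} t * (NINT y. NINT \<eta>. T t y \<eta>)) =
   (NINT t. indicator {0<..} t * (NINT y. NINT \<eta>. H t y \<eta>) + indicator {0<..} t * (NINT y. NINT \<eta>. V t y \<eta>))"
  proof (rule nn_integral_cong)
   fix t :: real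
   have "(NINT y. NINT \<eta>. T t y \<eta>) = (NINT y. (NINT \<eta>. H t y \<eta>) + (NINT \<eta>. V t y \<eta>))"
    unfolding HV by (intro nn_integral_cong nn_integral_add) measurable
   also have "... = (NINT y. NINT \<eta>. H t y \<eta>) + (NINT y. NINT \<eta>. V t y \<eta>)"
    by (rule nn_integral_add) measurable
   finally show "indicator {0<..} t * (NINT y. NINT \<eta>. T t y \<eta>) = indicator {0<..} t * (NINT y. NINT \<eta>. H t y \<eta>) + indicator {0<..} t * (NINT y. NINT \<eta>. V t y \<eta>)"
    by (simp only: distrib_left)
  qed
  also have "... = (NINT t. indicator {0<..} t * (NINT y. NINT \<eta>. H t y \<eta>)) + (NINT t. indicator {0<..} t * (NINT y. NINT \<eta>. V t y \<eta>))"
   by (rule nn_integral_add) measurable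
  also have "... \<le> ennreal (D - 1) * ennreal (CA * Q) + ennreal (CU 40 d2 d3 * Q)" by (intro add_mono M0 MU)
  also have "... \<le> ennreal (D - 1) * ennreal (\<bar>CA\<bar> * Q) + ennreal (CU 40 d2 d3 * Q)"
   using Q0 by (intro add_right_mono mult_left_mono ennreal_leI mult_right_mono) auto
  also have "... = ennreal ((D - 1) * (\<bar>CA\<bar> * Q) + CU 40 d2 d3 * Q)"
   using Q0 Dj CU0 by (simp add: ennreal_mult ennreal_plus)
  also have "... \<le> ennreal (C * Q)"
   using Q0 by (intro ennreal_leI) (simp add: C_def algebra_simps)
  finally show "(NINT t. indicator {0<..} t * (NINT y. NINT \<eta>. ennreal (norm (trip f1 f2 f3 d1 d2 d3 b1 b2 b3 t y \<eta>))))
   \<le> ennreal (C * (sqrt M * E2 * (a * ln (exp 1 + 1 / a))))" unfolding T_def Q_def .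
 qed
qed

section \<open>Wave packet representation of the trilinear form\<close>

lemma nn_integral_shift:
 fixes f :: "real \<Rightarrow> ennreal"
 assumes [measurable]: "f \<in> bm"
 shows "(NINT x. f (x + h)) = (NINT x. f x)"
 using nn_integral_real_affine[of f 1 h] by (simp add: add.commute)

lemma L2_affine:
 fixes f :: "real \<Rightarrow> complex"
 assumes f: "sq_integrable f" and a: "a \<noteq> 0"
 shows "integrable lborel (\<lambda>\<tau>. (norm (f (x + a * \<tau>)))^2)"
  "(LBINT \<tau>. (norm (f (x + a * \<tau>)))^2) = (LBINT x. (norm (f x))^2) / \<bar>a\<bar>"
 using lborel_integrable_real_affine[OF f a, of x] lborel_integral_real_affine[OF a, of "\<lambda>x. (norm (f x))^2" x] a
 by simp_all

text \<open>Translating \<open>x\<close> by \<open>b3 * \<tau>\<close> frees \<open>f3\<close> from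
  \<open>\<tau>\<close>. Cauchy-Schwarz in \<open>\<tau>\<close> then handles the two other
  functions, as distinct slopes leave nondegenerate substitutions.\<close>

lemma tri_integrable:
 fixes f1 f2 f3 :: "real \<Rightarrow> complex" and b1 b2 b3 :: real
 assumes f1: "f1 \<in> bm" "sq_integrable f1"
  and f2: "f2 \<in> bm" "sq_integrable f2"
  and f3: "integrable lborel f3" and b: "b1 \<noteq> b3" "b2 \<noteq> b3"
 shows "integrable (lborel \<Otimes>\<^sub>M lborel) (\<lambda>(\<tau>, x). f1 (x - b1 * \<tau>) * f2 (x - b2 * \<tau>) * f3 (x - b3 * \<tau>))"
proof (rule integrableI_bounded)
 have [measurable]: "f1 \<in> bm" "f2 \<in> bm" "f3 \<in> bm" using f1 f2 f3 by auto
 show "(\<lambda>(\<tau>, x). f1 (x - b1 * \<tau>) * f2 (x - b2 * \<tau>) * f3 (x - b3 * \<tau>)) \<in> borel_measurable (lborel \<Otimes>\<^sub>M lborel)" by measurable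
 define a c where "a = b3 - b1" and "c = b3 - b2"
 have ac: "a \<noteq> 0" "c \<noteq> 0" using b by (auto simp: a_def c_def)
 define K where "K = sqrt ((LBINT x. (norm (f1 x))^2) / \<bar>a\<bar>) * sqrt ((LBINT x. (norm (f2 x))^2) / \<bar>c\<bar>)"
 have one: "(NINT \<tau>. ennreal (norm (f1 (x + a * \<tau>)) * norm (f2 (x + c * \<tau>)))) \<le> ennreal K" for x
 proof -
  have "integrable lborel (\<lambda>\<tau>. norm (f1 (x + a * \<tau>)) * norm (f2 (x + c * \<tau>)))"
   by (rule integrable_mult_L2) (use L2_affine(1)[OF f1(2) ac(1)] L2_affine(1)[OF f2(2) ac(2)] in auto)
  then have "(NINT \<tau>. ennreal (norm (f1 (x + a * \<tau>)) * norm (f2 (x + c * \<tau>)))) = ennreal (LBINT \<tau>. norm (f1 (x + a * \<tau>)) * norm (f2 (x + c * \<tau>)))"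
   by (rule nn_integral_eq_integral) simp
  also have "(LBINT \<tau>. norm (f1 (x + a * \<tau>)) * norm (f2 (x + c * \<tau>))) = (LBINT \<tau>. \<bar>norm (f1 (x + a * \<tau>)) * norm (f2 (x + c * \<tau>))\<bar>)" by simp
  also have "... \<le> K" unfolding K_def L2_affine(2)[OF f1(2) ac(1), of x, symmetric] L2_affine(2)[OF f2(2) ac(2), of x, symmetric]
   by (rule CS_integral) (use L2_affine(1)[OF f1(2) ac(1)] L2_affine(1)[OF f2(2) ac(2)] in auto)
  finally show ?thesis by (simp add: ennreal_leI)
 qed
 have "(\<integral>\<^sup>+p. ennreal (norm ((\<lambda>(\<tau>, x). f1 (x - b1 * \<tau>) * f2 (x - b2 * \<tau>) * f3 (x - b3 * \<tau>)) p)) \<partial>(lborel \<Otimes>\<^sub>M lborel)) =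
  (NINT \<tau>. NINT x. ennreal (norm (f1 (x - b1 * \<tau>) * f2 (x - b2 * \<tau>) * f3 (x - b3 * \<tau>))))"
  by (subst lborel.nn_integral_fst[symmetric]) auto
 also have "... = (NINT \<tau>. NINT x. ennreal (norm (f1 (x + a * \<tau>)) * norm (f2 (x + c * \<tau>)) * norm (f3 x)))"
 proof (rule nn_integral_cong)
  fix \<tau> :: real
  have "(NINT x. ennreal (norm (f1 (x - b1 * \<tau>) * f2 (x - b2 * \<tau>) * f3 (x - b3 * \<tau>)))) =
   (NINT x. (\<lambda>x. ennreal (norm (f1 (x + a * \<tau>)) * norm (f2 (x + c * \<tau>)) * norm (f3 x))) (x + - (b3 * \<tau>)))"
   by (intro nn_integral_cong) (simp add: norm_mult a_def c_def left_diff_distrib)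
  also have "... = (NINT x. ennreal (norm (f1 (x + a * \<tau>)) * norm (f2 (x + c * \<tau>)) * norm (f3 x)))"
   by (rule nn_integral_shift) measurable
  finally show "(NINT x. ennreal (norm (f1 (x - b1 * \<tau>) * f2 (x - b2 * \<tau>) * f3 (x - b3 * \<tau>)))) = (NINT x. ennreal (norm (f1 (x + a * \<tau>)) * norm (f2 (x + c * \<tau>)) * norm (f3 x)))" .
 qed
 also have "... = (NINT x. NINT \<tau>. ennreal (norm (f1 (x + a * \<tau>)) * norm (f2 (x + c * \<tau>)) * norm (f3 x)))"
  by (rule lborel_pair.Fubini') measurable
 also have "... = (NINT x. (NINT \<tau>. ennreal (norm (f1 (x + a * \<tau>)) * norm (f2 (x + c * \<tau>)))) * ennreal (norm (f3 x)))"
  by (intro nn_integral_cong, subst nn_integral_multc[symmetric]) (auto simp: ennreal_mult)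
 also have "... \<le> (NINT x. ennreal K * ennreal (norm (f3 x)))" by (intro nn_integral_mono mult_right_mono one) simp
 also have "... = ennreal K * ennreal (LBINT x. norm (f3 x))"
  using f3 by (subst nn_integral_cmult) (auto simp: nn_integral_eq_integral)
 also have "... < \<infinity>" by (simp add: ennreal_mult_less_top)
 finally show "(\<integral>\<^sup>+p. ennreal (norm ((\<lambda>(\<tau>, x). f1 (x - b1 * \<tau>) * f2 (x - b2 * \<tau>) * f3 (x - b3 * \<tau>)) p)) \<partial>(lborel \<Otimes>\<^sub>M lborel)) < \<infinity>" .
qed

section \<open>The frequency integral of a product of three transforms\<close>

definition dil :: "real \<Rightarrow> (real \<Rightarrow> complex) \<Rightarrow> real \<Rightarrow> complex" where
 "dil d f u = cx (1 / \<bar>d\<bar>) * f (u / d)"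

lemma dil:
 fixes f :: "real \<Rightarrow> complex"
 assumes d: "d \<noteq> 0"
 shows "integrable lborel f \<Longrightarrow> integrable lborel (dil d f)" "ft (dil d f) \<eta> = ft f (d * \<eta>)"
  "sq_integrable f \<Longrightarrow> integrable lborel (\<lambda>x. (norm (dil d f x))^2)"
proof -
 show "integrable lborel (dil d f)" if "integrable lborel f"
  unfolding dil_def using lborel_integrable_real_affine[OF that, of "1/d" 0] d by (intro integrable_mult_right) simp
 show "integrable lborel (\<lambda>x. (norm (dil d f x))^2)" if "sq_integrable f"
  unfolding dil_def norm_mult power_mult_distrib using lborel_integrable_real_affine[OF that, of "1/d" 0] d by (intro integrable_mult_right) simp
 have "ft (dil d f) \<eta> = \<bar>d\<bar> *\<^sub>R (LBINT x. dil d f (0 + d * x) * cis (- (\<eta> * (0 + d * x))))"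
  unfolding ft_def by (rule lborel_integral_real_affine[OF d])
 also have "... = \<bar>d\<bar> *\<^sub>R (LBINT x. (f x * cis (- (d * \<eta> * x))) * cx (1 / \<bar>d\<bar>))"
  using d by (intro arg_cong[where f="\<lambda>z. \<bar>d\<bar> *\<^sub>R z"] bochner_cong refl) (simp add: dil_def mult_ac)
 also have "... = ft f (d * \<eta>)" unfolding ft_def using d by (simp only: integral_mult_left_zero scaleR_conv_of_real mult.assoc[symmetric]) simp
 finally show "ft (dil d f) \<eta> = ft f (d * \<eta>)" .
qed

text \<open>The product of the first two transforms is the transform of a convolution of dilates;
  Plancherel pairs it with the third, and a linear substitution with Jacobian \<open>d1 * d2\<close>
  rewrites the convolution as an integral along the direction \<open>b\<close>.\<close>

lemma ft_triple:
 fixes f1 f2 f3 :: "real \<Rightarrow> complex" and b1 b2 b3 :: real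
 assumes f1: "integrable lborel f1" "sq_integrable f1"
  and f2: "integrable lborel f2" "sq_integrable f2"
  and f3: "integrable lborel f3" "sq_integrable f3"
  and b: "b1 \<noteq> b2" "b1 \<noteq> b3" "b2 \<noteq> b3"
 shows "(LBINT \<eta>. ft f1 ((b2 - b3) * \<eta>) * ft f2 ((b3 - b1) * \<eta>) * ft f3 ((b1 - b2) * \<eta>)) =
  cx (2 * pi) * (LBINT \<tau>. LBINT x. f1 (x - b1 * \<tau>) * f2 (x - b2 * \<tau>) * f3 (x - b3 * \<tau>))"
proof -
 have [measurable]: "f1 \<in> bm" "f2 \<in> bm" "f3 \<in> bm" using f1 f2 f3 by auto
 define d1 d2 d3 where "d1 = b2 - b3" and "d2 = b3 - b1" and "d3 = b1 - b2"
 have d: "d1 \<noteq> 0" "d2 \<noteq> 0" "d3 \<noteq> 0" "- d3 \<noteq> 0" using b by (auto simp: d1_def d2_def d3_def)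
 define G1 G2 G3 where "G1 = dil d1 f1" and "G2 = dil d2 f2" and "G3 = dil d3 f3"
 have G1: "integrable lborel G1" "sq_integrable G1" unfolding G1_def by (intro dil d f1)+
 have G2: "integrable lborel G2" "sq_integrable G2" unfolding G2_def by (intro dil d f2)+
 have G3: "integrable lborel G3" "sq_integrable G3" unfolding G3_def by (intro dil d f3)+
 have [measurable]: "G1 \<in> bm" "G2 \<in> bm" "G3 \<in> bm" using G1 G2 G3 by auto
 define k where "k x = cnj (G3 (- x))" for x
 have k1: "integrable lborel k" unfolding k_def using integrable_lborel_minus[OF G3(1), of 0] by simp
 have k2: "sq_integrable k" unfolding k_def using integrable_lborel_minus[OF G3(2), of 0] by simp
 have ftk: "cnj (ft k \<eta>) = ft G3 \<eta>" for \<eta> using ft_refl_cnj[of k \<eta>] by (simp add: k_def)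
 have cb: "norm (conv G1 G2 x) \<le> sqrt (LBINT x. (norm (G1 x))^2) * sqrt (LBINT y. (norm (G2 (x - y)))^2)" for x
  unfolding conv_def by (rule CS_integral_norm) (use G1 G2 integrable_lborel_minus[OF G2(2), of x] in auto)
 have cb': "norm (conv G1 G2 x) \<le> sqrt (LBINT x. (norm (G1 x))^2) * sqrt (LBINT y. (norm (G2 y))^2)" for x
  using cb[of x] unfolding integral_lborel_minus[of "\<lambda>y. (norm (G2 y))^2" x] .
 have c1: "integrable lborel (conv G1 G2)" by (rule conv_integrable[OF G1(1) G2(1)])
 have c2: "integrable lborel (\<lambda>x. (norm (conv G1 G2 x))^2)" by (rule bounded_L1_L2[OF c1 cb'])
 have inner: "conv G1 G2 (- d3 * z) = (LBINT \<tau>. f1 (z + d2 * \<tau>) * f2 (z - d1 * \<tau>))" for z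
 proof -
  have d12: "d1 * d2 \<noteq> 0" using d by simp
  have "conv G1 G2 (- d3 * z) = \<bar>d1 * d2\<bar> *\<^sub>R (LBINT \<tau>. G1 (d1 * z + d1 * d2 * \<tau>) * G2 (- d3 * z - (d1 * z + d1 * d2 * \<tau>)))"
   unfolding conv_def by (rule lborel_integral_real_affine[OF d12])
  also have "... = \<bar>d1 * d2\<bar> *\<^sub>R (LBINT \<tau>. (f1 (z + d2 * \<tau>) * f2 (z - d1 * \<tau>)) * cx (1 / \<bar>d1 * d2\<bar>))"
  proof (intro arg_cong[where f="\<lambda>z. \<bar>d1 * d2\<bar> *\<^sub>R z"] bochner_cong refl)
   fix \<tau> :: real
   have 1: "(d1 * z + d1 * d2 * \<tau>) / d1 = z + d2 * \<tau>" using d by (simp add: add_divide_distrib)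
   \<comment> \<open>This is where \<open>d1 + d2 + d3 = 0\<close> enters: it makes the argument of
     \<open>f2\<close> after dilation a pure shift of \<open>z\<close>.\<close>
   have "- d3 * z - (d1 * z + d1 * d2 * \<tau>) = d2 * (z - d1 * \<tau>)" unfolding d1_def d2_def d3_def by (simp add: algebra_simps)
   then have 2: "(- d3 * z - (d1 * z + d1 * d2 * \<tau>)) / d2 = z - d1 * \<tau>" using d by simp
   show "G1 (d1 * z + d1 * d2 * \<tau>) * G2 (- d3 * z - (d1 * z + d1 * d2 * \<tau>)) = (f1 (z + d2 * \<tau>) * f2 (z - d1 * \<tau>)) * cx (1 / \<bar>d1 * d2\<bar>)"
    unfolding G1_def G2_def dil_def 1 2 by (simp add: abs_mult)
  qed
  also have "... = (LBINT \<tau>. f1 (z + d2 * \<tau>) * f2 (z - d1 * \<tau>))"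
   using d12 by (simp only: integral_mult_left_zero scaleR_conv_of_real) simp
  finally show ?thesis .
 qed
 have "(LBINT \<eta>. ft f1 ((b2 - b3) * \<eta>) * ft f2 ((b3 - b1) * \<eta>) * ft f3 ((b1 - b2) * \<eta>)) = (LBINT \<eta>. ft (conv G1 G2) \<eta> * cnj (ft k \<eta>))"
  unfolding ftk ft_conv[OF G1(1) G2(1)] unfolding G1_def G2_def G3_def dil(2)[OF d(1)] dil(2)[OF d(2)] dil(2)[OF d(3)] by (simp only: d1_def d2_def d3_def)
 also have "... = cx (2 * pi) * (LBINT x. conv G1 G2 x * cnj (k x))" by (rule plancherel(2)[OF c1 c2 k1 k2])
 also have "(LBINT x. conv G1 G2 x * cnj (k x)) = \<bar>- d3\<bar> *\<^sub>R (LBINT z. conv G1 G2 (0 + - d3 * z) * cnj (k (0 + - d3 * z)))"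
  by (rule lborel_integral_real_affine[OF d(4)])
 also have "... = (LBINT z. conv G1 G2 (- d3 * z) * f3 z)"
 proof -
  have "(LBINT z. conv G1 G2 (0 + - d3 * z) * cnj (k (0 + - d3 * z))) = (LBINT z. (conv G1 G2 (- d3 * z) * f3 z) * cx (1 / \<bar>d3\<bar>))"
   using d by (intro bochner_cong refl) (simp add: k_def G3_def dil_def)
  then show ?thesis using d by (simp only: integral_mult_left_zero scaleR_conv_of_real) simp
 qed
 also have "... = (LBINT z. LBINT \<tau>. f1 (z + d2 * \<tau>) * f2 (z - d1 * \<tau>) * f3 z)" unfolding inner by simp
 also have "... = (LBINT \<tau>. LBINT z. f1 (z + d2 * \<tau>) * f2 (z - d1 * \<tau>) * f3 z)"
 proof (rule lborel_pair.Fubini_integral)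
  show "integrable (lborel \<Otimes>\<^sub>M lborel) (\<lambda>(\<tau>, z). f1 (z + d2 * \<tau>) * f2 (z - d1 * \<tau>) * f3 z)"
   using tri_integrable[OF _ f1(2) _ f2(2) f3(1), of "- d2" 0 d1] d by simp
 qed
 also have "... = (LBINT \<tau>. LBINT x. f1 (x - b1 * \<tau>) * f2 (x - b2 * \<tau>) * f3 (x - b3 * \<tau>))"
 proof (rule bochner_cong[OF refl])
  fix \<tau> :: real
  have "(LBINT z. f1 (z + d2 * \<tau>) * f2 (z - d1 * \<tau>) * f3 z) = (LBINT x. (\<lambda>z. f1 (z + d2 * \<tau>) * f2 (z - d1 * \<tau>) * f3 z) (x + - (b3 * \<tau>)))"
   by (rule integral_lborel_shift[symmetric])
  then show "(LBINT z. f1 (z + d2 * \<tau>) * f2 (z - d1 * \<tau>) * f3 z) = (LBINT x. f1 (x - b1 * \<tau>) * f2 (x - b2 * \<tau>) * f3 (x - b3 * \<tau>))"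
   by (simp add: d1_def d2_def left_diff_distrib)
 qed
 finally show ?thesis .
qed

text \<open>The weight that the three windows leave after the position is integrated out;
  \<open>v\<close> stands for \<open>\<tau> / t\<close>.\<close>

definition GG :: "real \<Rightarrow> real \<Rightarrow> real \<Rightarrow> real \<Rightarrow> real" where
 "GG b1 b2 b3 v = (LBINT y. phi (y - b1 * v) * phi (y - b2 * v) * phi (y - b3 * v))"

definition slice :: "(real \<Rightarrow> complex) \<Rightarrow> (real \<Rightarrow> complex) \<Rightarrow> (real \<Rightarrow> complex) \<Rightarrow> real \<Rightarrow> real \<Rightarrow> real \<Rightarrow> real \<Rightarrow> complex" where
 "slice f1 f2 f3 b1 b2 b3 \<tau> = (LBINT x. f1 (x - b1 * \<tau>) * f2 (x - b2 * \<tau>) * f3 (x - b3 * \<tau>))"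

lemma phi3_integrable: "integrable lborel (\<lambda>y. phi (y - p) * phi (y - q) * phi (y - r))"
proof (rule dominated_integrable)
 show "integrable lborel (\<lambda>y. phi (y - r))" using integrable_lborel_shift[OF phi_integrable, of "-r"] by simp
 show "AE y in lborel. norm (phi (y - p) * phi (y - q) * phi (y - r)) \<le> norm (phi (y - r))"
  using phi_le1 by (intro AE_I2) (auto simp: phi_nonneg intro!: mult_left_le_one_le mult_le_one)
qed measurable

lemma trip_eta_integral:
 assumes f1: "f1 \<in> bm" "sq_integrable f1"
  and f2: "f2 \<in> bm" "sq_integrable f2"
  and f3: "f3 \<in> bm" "sq_integrable f3"
  and b: "b1 \<noteq> b2" "b1 \<noteq> b3" "b2 \<noteq> b3" "b1 + b2 + b3 = 0" "b1^2 + b2^2 + b3^2 = 1" and t: "t > 0"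
 shows "(LBINT \<eta>. trip f1 f2 f3 (b2 - b3) (b3 - b1) (b1 - b2) (k * b1) (k * b2) (k * b3) t y \<eta>) =
  cx (2 * pi) * (LBINT \<tau>. LBINT x. f1 (x - b1 * \<tau>) * f2 (x - b2 * \<tau>) * f3 (x - b3 * \<tau>) * cis (k * \<tau> / t) *
   cx (phi ((x - b1 * \<tau> - y) / t) * phi ((x - b2 * \<tau> - y) / t) * phi ((x - b3 * \<tau> - y) / t) / t^3))"
proof -
 define g where "g f c x = f x * cx (phi ((x - y) / t) / t) * cis (- (k * c / t * x))" for f :: "real \<Rightarrow> complex" and c x
 have g: "integrable lborel (g f c)" "integrable lborel (\<lambda>x. (norm (g f c x))^2)"
  if f: "f \<in> bm" "sq_integrable f" for f c
 proof -
  show "integrable lborel (g f c)" unfolding g_def by (rule integrable_mult_cis[OF emb_integrand(3)[OF f t]]) measurable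
  have "norm (g f c x) = norm (f x * cx (phi ((x - y) / t) / t))" for x
   by (simp only: g_def norm_mult[of _ "cis z" for z] norm_cis mult_1_right)
  then show "integrable lborel (\<lambda>x. (norm (g f c x))^2)" using emb_integrand(4)[OF f t, of y] by simp
 qed
 have e: "emb f y (d * \<eta> + k * c / t) t = ft (g f c) (d * \<eta>)" for f d \<eta> c
  unfolding emb_eq_ft ft_def g_def by (intro bochner_cong refl) (simp add: mult.assoc cis_mult distrib_right add.commute)
 \<comment> \<open>The dependence on \<open>x\<close> drops out because the \<open>b\<close> sum to
   zero, and the coefficient of \<open>\<tau>\<close> is \<open>k / t\<close> because their squares
   sum to one.\<close>
 have ph: "cis (- (k * b1 / t * (x - b1 * \<tau>))) * cis (- (k * b2 / t * (x - b2 * \<tau>))) * cis (- (k * b3 / t * (x - b3 * \<tau>))) = cis (k * \<tau> / t)" for x \<tau>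
 proof -
  have "- (k * b1 / t * (x - b1 * \<tau>)) + - (k * b2 / t * (x - b2 * \<tau>)) + - (k * b3 / t * (x - b3 * \<tau>)) =
   k / t * (\<tau> * (b1^2 + b2^2 + b3^2) - x * (b1 + b2 + b3))" by (simp add: algebra_simps power2_eq_square add_divide_distrib diff_divide_distrib)
  then show ?thesis unfolding b(4,5) by (simp add: cis_mult)
 qed
 have prd: "g f1 b1 (x - b1 * \<tau>) * g f2 b2 (x - b2 * \<tau>) * g f3 b3 (x - b3 * \<tau>) =
   f1 (x - b1 * \<tau>) * f2 (x - b2 * \<tau>) * f3 (x - b3 * \<tau>) * cis (k * \<tau> / t) *
   cx (phi ((x - b1 * \<tau> - y) / t) * phi ((x - b2 * \<tau> - y) / t) * phi ((x - b3 * \<tau> - y) / t) / t^3)" for x \<tau>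
 proof -
  have *: "u1 * p1 * c1 * (u2 * p2 * c2) * (u3 * p3 * c3) = u1 * u2 * u3 * (c1 * c2 * c3) * (p1 * p2 * p3)" for u1 u2 u3 p1 p2 p3 c1 c2 c3 :: complex
   by (simp only: mult_ac)
  show ?thesis unfolding g_def * ph by (simp add: power3_eq_cube)
 qed
 show ?thesis unfolding trip_def e
  by (subst ft_triple) (use f1 f2 f3 g b in \<open>auto simp: prd\<close>)
qed

text \<open>The position integral of the three windows equals \<open>GG\<close> at
  \<open>\<tau> / t\<close> divided by \<open>t^2\<close>; the substitution
  \<open>\<tau> = t v\<close> then absorbs one power of \<open>t\<close>. Fubini rests on the joint
  integrability from \<open>tri_integrable\<close> and on the boundedness of
  \<open>GG\<close>.\<close>

lemma trip_plane_integral: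
 assumes f1: "f1 \<in> bm" "sq_integrable f1"
  and f2: "f2 \<in> bm" "sq_integrable f2"
  and f3: "integrable lborel f3" "sq_integrable f3"
  and b: "b1 \<noteq> b2" "b1 \<noteq> b3" "b2 \<noteq> b3" "b1 + b2 + b3 = 0" "b1^2 + b2^2 + b3^2 = 1" and t: "t > 0"
 shows "(LBINT y. LBINT \<eta>. trip f1 f2 f3 (b2 - b3) (b3 - b1) (b1 - b2) (k * b1) (k * b2) (k * b3) t y \<eta>) =
  cx (2 * pi) * (LBINT v. cis (k * v) * cx (GG b1 b2 b3 v / t) * slice f1 f2 f3 b1 b2 b3 (t * v))"
proof -
 have [measurable]: "f1 \<in> bm" "f2 \<in> bm" "f3 \<in> bm" using f1 f2 f3 by auto
 interpret P: pair_sigma_finite "lborel \<Otimes>\<^sub>M lborel :: (real \<times> real) measure" "lborel :: real measure" ..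
 define F where "F p = f1 (snd p - b1 * fst p) * f2 (snd p - b2 * fst p) * f3 (snd p - b3 * fst p)" for p :: "real \<times> real"
 define S where "S p y = phi ((snd p - b1 * fst p - y) / t) * phi ((snd p - b2 * fst p - y) / t) * phi ((snd p - b3 * fst p - y) / t) / t^3" for p :: "real \<times> real" and y
 have [measurable]: "F \<in> borel_measurable (borel \<Otimes>\<^sub>M borel)" unfolding F_def by measurable
 have Fi: "integrable (lborel \<Otimes>\<^sub>M lborel) F"
  using tri_integrable[OF f1 f2 f3(1) b(2,3)] unfolding F_def by (simp add: case_prod_unfold)
 have S0: "S p y \<ge> 0" for p y unfolding S_def using t by (intro divide_nonneg_nonneg mult_nonneg_nonneg phi_nonneg) auto
 have S1: "integrable lborel (S p)" "(LBINT y. S p y) = GG b1 b2 b3 (fst p / t) / t^2" for p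
 proof -
  define x \<tau> where "x = snd p" and "\<tau> = fst p"
  define h where "h u = phi (u - b1 * \<tau> / t) * phi (u - b2 * \<tau> / t) * phi (u - b3 * \<tau> / t) / t^3" for u
  have hi: "integrable lborel h" unfolding h_def by (intro integrable_divide phi3_integrable)
  have "(x - c * \<tau> - y) / t = (x - y) / t - c * \<tau> / t" for c y by (simp add: diff_divide_distrib)
  then have eq: "S p y = h ((x - y) / t)" for y unfolding S_def h_def x_def[symmetric] \<tau>_def[symmetric] by (simp only:)
  have t': "- (1 / t) \<noteq> 0" using t by simp
  have e2: "h ((x - y) / t) = h (x / t + - (1 / t) * y)" for y by (simp add: diff_divide_distrib)
  show "integrable lborel (S p)" unfolding eq e2 by (rule lborel_integrable_real_affine[OF hi t'])
  have "(LBINT u. h u) = \<bar>- (1 / t)\<bar> *\<^sub>R (LBINT y. S p y)" unfolding eq e2 by (rule lborel_integral_real_affine[OF t'])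
  moreover have "(LBINT u. h u) = GG b1 b2 b3 (fst p / t) / t^3" by (simp add: h_def GG_def \<tau>_def)
  ultimately show "(LBINT y. S p y) = GG b1 b2 b3 (fst p / t) / t^2" using t by (simp add: field_simps power2_eq_square power3_eq_cube)
 qed
 have Gb: "\<bar>GG b1 b2 b3 v\<bar> \<le> (LBINT y. phi y)" for v
 proof -
  have "GG b1 b2 b3 v \<le> (LBINT y. phi (y + - (b3 * v)))" unfolding GG_def
   by (intro integral_mono phi3_integrable integrable_lborel_shift phi_integrable) (auto simp: phi_nonneg phi_le1 intro!: mult_left_le_one_le mult_le_one)
  moreover have "GG b1 b2 b3 v \<ge> 0" unfolding GG_def by (intro integral_nonneg_AE AE_I2 mult_nonneg_nonneg phi_nonneg)
  ultimately show ?thesis by (simp only: integral_lborel_shift abs_of_nonneg)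
 qed
 define Kf where "Kf p y = F p * cis (k * fst p / t) * cx (S p y)" for p y
 have [measurable]: "(\<lambda>(p, y). Kf p y) \<in> borel_measurable ((borel \<Otimes>\<^sub>M borel) \<Otimes>\<^sub>M borel)" unfolding Kf_def S_def by measurable
 have mG[measurable]: "GG b1 b2 b3 \<in> bm" unfolding GG_def by measurable
 have KI: "integrable ((lborel \<Otimes>\<^sub>M lborel) \<Otimes>\<^sub>M lborel) (\<lambda>(p, y). Kf p y)"
 proof (rule P.Fubini_integrable)
  show "(\<lambda>(p, y). Kf p y) \<in> borel_measurable ((lborel \<Otimes>\<^sub>M lborel) \<Otimes>\<^sub>M lborel)" by measurable
  have n: "norm (Kf p y) = norm (F p) * S p y" for p y using S0 by (simp add: Kf_def norm_mult)
  have "integrable (lborel \<Otimes>\<^sub>M lborel) (\<lambda>p. norm (F p) * (GG b1 b2 b3 (fst p / t) / t^2))"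
  proof (rule dominated_integrable)
   show "integrable (lborel \<Otimes>\<^sub>M lborel) (\<lambda>p. norm (F p) * ((LBINT y. phi y) / t^2))" using Fi by (intro integrable_mult_left integrable_norm)
   show "AE p in lborel \<Otimes>\<^sub>M lborel. norm (norm (F p) * (GG b1 b2 b3 (fst p / t) / t^2)) \<le> norm (norm (F p) * ((LBINT y. phi y) / t^2))"
    using Gb by (intro AE_I2) (auto simp: abs_mult intro!: mult_left_mono divide_right_mono order_trans[OF Gb])
  qed measurable
  then show "integrable (lborel \<Otimes>\<^sub>M lborel) (\<lambda>p. LBINT y. norm (case (p, y) of (p, y) \<Rightarrow> Kf p y))"
   unfolding prod.case n integral_mult_right_zero S1 .
  show "AE p in lborel \<Otimes>\<^sub>M lborel. integrable lborel (\<lambda>y. case (p, y) of (p, y) \<Rightarrow> Kf p y)"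
   unfolding prod.case Kf_def using S1(1) by (intro AE_I2 integrable_mult_right integrable_of_real)
 qed
 have inn: "(LBINT y. Kf p y) = F p * cis (k * fst p / t) * cx (GG b1 b2 b3 (fst p / t) / t^2)" for p
  unfolding Kf_def integral_mult_right_zero integral_complex_of_real S1 ..
 have I2: "integrable (lborel \<Otimes>\<^sub>M lborel) (\<lambda>p. F p * cis (k * fst p / t) * cx (GG b1 b2 b3 (fst p / t) / t^2))"
  using P.integrable_fst[OF KI] unfolding inn .
 have Kp: "integrable (lborel \<Otimes>\<^sub>M lborel) (\<lambda>p. Kf p y)" for y
 proof (rule dominated_integrable)
  show "integrable (lborel \<Otimes>\<^sub>M lborel) (\<lambda>p. F p * cx (1 / t^3))" by (intro integrable_mult_left Fi)
  have "S p y \<le> 1 / t^3" for p unfolding S_def using t by (intro divide_right_mono mult_le_one) (auto simp: phi_nonneg phi_le1 intro!: mult_le_one)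
  then show "AE p in lborel \<Otimes>\<^sub>M lborel. norm (Kf p y) \<le> norm (F p * cx (1 / t^3))"
   using S0 t unfolding Kf_def norm_mult norm_of_real norm_cis mult_1_right
   by (intro AE_I2 mult_left_mono) (simp_all add: abs_of_nonneg)
 qed (unfold Kf_def S_def, measurable)
 have "(LBINT y. LBINT \<eta>. trip f1 f2 f3 (b2 - b3) (b3 - b1) (b1 - b2) (k * b1) (k * b2) (k * b3) t y \<eta>) =
  (LBINT y. cx (2 * pi) * (LBINT \<tau>. LBINT x. Kf (\<tau>, x) y))"
  by (subst trip_eta_integral[OF f1 f2 _ f3(2) b t]) (auto simp: Kf_def F_def S_def)
 also have "... = cx (2 * pi) * (LBINT y. \<integral>p. Kf p y \<partial>(lborel \<Otimes>\<^sub>M lborel))"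
  unfolding integral_mult_right_zero lborel_pair.integral_fst'[OF Kp] ..
 also have "(LBINT y. \<integral>p. Kf p y \<partial>(lborel \<Otimes>\<^sub>M lborel)) = (\<integral>p. (LBINT y. Kf p y) \<partial>(lborel \<Otimes>\<^sub>M lborel))"
  by (rule P.Fubini_integral[OF KI])
 also have "... = (LBINT \<tau>. LBINT x. F (\<tau>, x) * cis (k * \<tau> / t) * cx (GG b1 b2 b3 (\<tau> / t) / t^2))"
  unfolding inn lborel_pair.integral_fst'[OF I2, symmetric] by simp
 also have "... = (LBINT \<tau>. slice f1 f2 f3 b1 b2 b3 \<tau> * cis (k * \<tau> / t) * cx (GG b1 b2 b3 (\<tau> / t) / t^2))"
  unfolding integral_mult_left_zero by (simp add: slice_def F_def)
 also have "... = (LBINT v. slice f1 f2 f3 b1 b2 b3 (t * v) * cis (k * (t * v) / t) * cx (GG b1 b2 b3 (t * v / t) / t^2)) * t"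
  by (rule integral_lborel_rescale[OF t])
 also have "... = (LBINT v. slice f1 f2 f3 b1 b2 b3 (t * v) * cis (k * (t * v) / t) * cx (GG b1 b2 b3 (t * v / t) / t^2) * cx t)"
  by (rule integral_mult_left_zero[symmetric])
 also have "... = (LBINT v. cis (k * v) * cx (GG b1 b2 b3 v / t) * slice f1 f2 f3 b1 b2 b3 (t * v))"
  using t by (intro bochner_cong refl) (simp add: power2_eq_square)
 finally show ?thesis .
qed

section \<open>The kernel \<open>GG\<close> and its sine transform\<close>

lemma GG_measurable[measurable]: "GG b1 b2 b3 \<in> bm"
 unfolding GG_def by measurable

lemma GG_nonneg: "GG b1 b2 b3 v \<ge> 0"
 unfolding GG_def by (intro integral_nonneg_AE AE_I2 mult_nonneg_nonneg phi_nonneg)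

lemma GG_even: "GG b1 b2 b3 (- v) = GG b1 b2 b3 v"
proof -
 have "phi (y - b * - v) = phi (0 - y - b * v)" for y b using phi_minus[of "y + b * v"] by simp
 then show ?thesis unfolding GG_def using integral_lborel_minus[of "\<lambda>y. phi (y - b1 * v) * phi (y - b2 * v) * phi (y - b3 * v)" 0] by simp
qed

text \<open>The points \<open>y - b1 * v\<close> and \<open>y - b2 * v\<close> are
  \<open>|b1 - b2| * |v|\<close> apart, so the brackets of the first two windows multiply to at
  least \<open>1 + |b1 - b2| * |v|\<close>; the third window is kept for the integration.\<close>

lemma GG_decay: "GG b1 b2 b3 v \<le> 625^2 * (LBINT y. phi y) / (1 + \<bar>b1 - b2\<bar> * \<bar>v\<bar>)^4"
proof -
 define K where "K = 625^2 / (1 + \<bar>b1 - b2\<bar> * \<bar>v\<bar>)^4"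
 have pp: "phi (y - b1 * v) * phi (y - b2 * v) \<le> K" for y
 proof -
  define p q where "p = y - b1 * v" and "q = y - b2 * v"
  have "phi p * phi q \<le> (625 / (1 + \<bar>p\<bar>)^4) * (625 / (1 + \<bar>q\<bar>)^4)" by (intro mult_mono phi_le phi_nonneg divide_nonneg_nonneg) auto
  also have "... = 625^2 / ((1 + \<bar>p\<bar>) * (1 + \<bar>q\<bar>))^4" by (simp add: power_mult_distrib)
  also have "... \<le> K" unfolding K_def
  proof (intro divide_left_mono power_mono)
   have "\<bar>b1 - b2\<bar> * \<bar>v\<bar> = \<bar>q - p\<bar>" by (simp add: p_def q_def abs_mult[symmetric] left_diff_distrib)
   also have "... \<le> \<bar>p\<bar> + \<bar>q\<bar>" by linarith
   finally have "\<bar>b1 - b2\<bar> * \<bar>v\<bar> \<le> \<bar>p\<bar> + \<bar>q\<bar>" .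
   then show "1 + \<bar>b1 - b2\<bar> * \<bar>v\<bar> \<le> (1 + \<bar>p\<bar>) * (1 + \<bar>q\<bar>)"
   proof -
    have "(1 + \<bar>p\<bar>) * (1 + \<bar>q\<bar>) = 1 + (\<bar>p\<bar> + \<bar>q\<bar>) + \<bar>p\<bar> * \<bar>q\<bar>" by (simp add: algebra_simps)
    moreover have "0 \<le> \<bar>p\<bar> * \<bar>q\<bar>" by simp
    ultimately show ?thesis using \<open>\<bar>b1 - b2\<bar> * \<bar>v\<bar> \<le> \<bar>p\<bar> + \<bar>q\<bar>\<close> by linarith
   qed
  qed (auto intro!: mult_pos_pos zero_less_power add_pos_nonneg)
  finally show ?thesis by (simp add: p_def q_def)
 qed
 have "GG b1 b2 b3 v \<le> (LBINT y. K * phi (y + - (b3 * v)))"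
  unfolding GG_def using pp
  by (intro integral_mono phi3_integrable integrable_mult_right integrable_lborel_shift phi_integrable) (auto intro!: mult_right_mono phi_nonneg)
 also have "... = K * (LBINT y. phi y)" by (simp only: integral_mult_right_zero integral_lborel_shift)
 finally show ?thesis by (simp add: K_def)
qed

text \<open>The weight \<open>1 + |v|\<close> pays for comparing truncations at the levels
  \<open>e\<close> and \<open>e * |v|\<close>, which costs \<open>|v| + 1 / |v|\<close>; a factor
  \<open>sin (k * |v|)\<close> absorbs the second term.\<close>

lemma GG_moment:
 assumes "b1 \<noteq> b2"
 shows "integrable lborel (\<lambda>v. GG b1 b2 b3 v * (1 + \<bar>v\<bar>))"
proof -
 define d where "d = \<bar>b1 - b2\<bar>"
 have d: "d > 0" using assms by (simp add: d_def)
 define I where "I = (LBINT y. phi y)"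
 have I0: "I \<ge> 0" unfolding I_def by (intro integral_nonneg_AE AE_I2 phi_nonneg)
 show ?thesis
 proof (rule dominated_integrable)
  have "integrable lborel (\<lambda>v. 1 / (1 + \<bar>d * v\<bar>)^2 :: real)" by (rule integrable_lborel_scale[OF br2_integrable]) (use d in simp)
  then show "integrable lborel (\<lambda>v. (625^2 * I * (1 + 1 / d)) * (1 / (1 + \<bar>d * v\<bar>)^2))" by (rule integrable_mult_right)
  show "AE v in lborel. norm (GG b1 b2 b3 v * (1 + \<bar>v\<bar>)) \<le> norm ((625^2 * I * (1 + 1 / d)) * (1 / (1 + \<bar>d * v\<bar>)^2))"
  proof (intro AE_I2)
   fix v :: real
   define w where "w = 1 + d * \<bar>v\<bar>"
   have w: "w \<ge> 1" using d by (simp add: w_def)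
   have v: "1 + \<bar>v\<bar> \<le> (1 + 1 / d) * w" using d by (simp add: w_def field_simps add_increasing)
   have "GG b1 b2 b3 v * (1 + \<bar>v\<bar>) \<le> (625^2 * I / w^4) * ((1 + 1 / d) * w)"
    using GG_decay[of b1 b2 b3 v] v I0 w by (intro mult_mono) (auto simp: w_def d_def I_def intro!: divide_nonneg_nonneg)
   also have "... = (625^2 * I * (1 + 1 / d)) * (1 / w^3)" using w by (simp add: power3_eq_cube power4_eq_xxxx)
   also have "... \<le> (625^2 * I * (1 + 1 / d)) * (1 / w^2)"
    using w I0 d by (intro mult_left_mono divide_left_mono power_increasing mult_pos_pos) auto
   finally show "norm (GG b1 b2 b3 v * (1 + \<bar>v\<bar>)) \<le> norm ((625^2 * I * (1 + 1 / d)) * (1 / (1 + \<bar>d * v\<bar>)^2))"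
    using GG_nonneg[of b1 b2 b3 v] I0 d by (simp add: w_def abs_mult)
  qed
 qed measurable
qed

lemma GG_integrable:
 assumes "b1 \<noteq> b2"
 shows "integrable lborel (GG b1 b2 b3)"
proof (rule dominated_integrable[OF GG_moment[OF assms, of b3]])
 show "AE x in lborel. norm (GG b1 b2 b3 x) \<le> norm (GG b1 b2 b3 x * (1 + \<bar>x\<bar>))"
  using mult_left_mono[OF _ GG_nonneg, of 1 "1 + \<bar>x\<bar>" for x] by (intro AE_I2) (simp add: abs_mult GG_nonneg)
qed measurable

text \<open>By \<open>phi_lip\<close> at 0 the window is at least 1/2 on
  \<open>|x| \<le> 1/8000\<close>. The product of three such values is 1/8, and it holds on an
  interval of length 1/8000.\<close>

lemma GG_lower:
 assumes b: "\<bar>b1\<bar> \<le> 1" "\<bar>b2\<bar> \<le> 1" "\<bar>b3\<bar> \<le> 1" and v: "\<bar>v\<bar> \<le> 1/16000"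
 shows "GG b1 b2 b3 v \<ge> 1/64000"
proof -
 have half: "phi x \<ge> 1/2" if "\<bar>x\<bar> \<le> 1/8000" for x
  using phi_lip[of x 0] that phi_0 by (simp add: abs_le_iff)
 have near: "phi (y - b * v) \<ge> 1/2" if y: "\<bar>y\<bar> \<le> 1/16000" and b: "\<bar>b\<bar> \<le> 1" for y b
 proof (rule half)
  have "\<bar>b * v\<bar> \<le> 1 * (1/16000)" unfolding abs_mult using b v by (intro mult_mono) auto
  then show "\<bar>y - b * v\<bar> \<le> 1/8000" using y by linarith
 qed
 have "(1/64000::real) = (LBINT y. indicator {-1/16000..1/16000::real} y * (1/8))" by simp
 also have "... \<le> GG b1 b2 b3 v" unfolding GG_def
 proof (intro integral_mono phi3_integrable integrable_mult_left integrable_indicator_Icc)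
  fix y
  show "indicator {-1/16000..1/16000} y * (1/8) \<le> phi (y - b1 * v) * phi (y - b2 * v) * phi (y - b3 * v)"
  proof (cases "y \<in> {-1/16000..1/16000}")
   case True
   then have y: "\<bar>y\<bar> \<le> 1/16000" by auto
   have "(1/2) * (1/2) * (1/2) \<le> phi (y - b1 * v) * phi (y - b2 * v) * phi (y - b3 * v)"
    by (intro mult_mono near y b mult_nonneg_nonneg phi_nonneg) auto
   then show ?thesis using True by simp
  qed (simp add: phi_nonneg)
 qed
 finally show ?thesis .
qed

text \<open>The ramp replaces a sharp cutoff because its sine integral has a pointwise lower bound
  of order \<open>Y / v\<close> once \<open>Y * v \<ge> 2\<close>, whereas a sharp cutoff gives
  \<open>(1 - cos (Y * v)) / v\<close>, which has zeros.\<close>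

lemma ramp_sine_integral:
 fixes v Y :: real
 assumes v: "v > 0" and Y: "Y > 0"
 shows "(LBINT \<kappa>. indicator {0..Y} \<kappa> * (Y - \<kappa>) * sin (\<kappa> * v)) = Y / v - sin (Y * v) / v^2"
proof -
 define A B where "A = 1 / v" and "B = 1 / v^2"
 have AB: "v * A = 1" "v * B = A" using v by (auto simp: A_def B_def power2_eq_square)
 define Fa where "Fa \<kappa> = ((\<kappa> - Y) * cos (\<kappa> * v)) * A - sin (\<kappa> * v) * B" for \<kappa>
 have "(LBINT \<kappa>. ((Y - \<kappa>) * sin (\<kappa> * v)) * indicator {0..Y} \<kappa>) = Fa Y - Fa 0"
 proof (rule integral_FTC_Icc_real)
  fix \<kappa> :: real
  have "DERIV Fa \<kappa> :> (cos (\<kappa> * v) - (\<kappa> - Y) * (sin (\<kappa> * v) * v)) * A - cos (\<kappa> * v) * v * B"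
   unfolding Fa_def by (auto intro!: derivative_eq_intros)
  also have "(cos (\<kappa> * v) - (\<kappa> - Y) * (sin (\<kappa> * v) * v)) * A - cos (\<kappa> * v) * v * B = cos (\<kappa> * v) * (A - v * B) + (Y - \<kappa>) * sin (\<kappa> * v) * (v * A)"
   by (simp add: algebra_simps)
  finally show "DERIV Fa \<kappa> :> (Y - \<kappa>) * sin (\<kappa> * v)" by (simp add: AB)
 qed (use Y in auto)
 then show ?thesis by (simp add: Fa_def A_def B_def mult_ac)
qed

text \<open>If the sine transform of \<open>GG\<close> vanished from 16 on, pairing it with the ramp \<open>Y - \<kappa>\<close> on \<open>[0, Y]\<close>
 would be \<open>O(Y)\<close>; but the pairing is at least of order \<open>Y log Y\<close>.\<close>

lemma sine_transform_nonzero: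
 fixes b1 b2 b3 :: real
 assumes b12: "b1 \<noteq> b2" and b: "\<bar>b1\<bar> \<le> 1" "\<bar>b2\<bar> \<le> 1" "\<bar>b3\<bar> \<le> 1"
 shows "\<exists>\<kappa>\<ge>16. (LBINT v. sin (\<kappa> * \<bar>v\<bar>) * GG b1 b2 b3 v) \<noteq> 0"
proof (rule ccontr)
 define G where "G = GG b1 b2 b3"
 define c where "c \<kappa> = (LBINT v. sin (\<kappa> * \<bar>v\<bar>) * G v)" for \<kappa>
 assume "\<not> ?thesis"
 then have c0: "c \<kappa> = 0" if "\<kappa> \<ge> 16" for \<kappa> using that by (auto simp: c_def G_def)
 have Gm[measurable]: "G \<in> bm" by (simp add: G_def)
 have Gi: "integrable lborel G" unfolding G_def by (rule GG_integrable[OF b12])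
 have G0: "G v \<ge> 0" for v by (simp add: G_def GG_nonneg)
 define I where "I = (LBINT v. G v)"
 have I0: "I \<ge> 0" unfolding I_def by (intro integral_nonneg_AE AE_I2 G0)
 define r :: real where "r = 1/16000"
 \<comment> \<open>The exponent makes the integral of \<open>1 / v\<close> over
   \<open>[2 / Y, r]\<close> equal to \<open>128 * I / r + 1\<close>. Multiplied by
   \<open>Y * r / 8\<close> it exceeds the upper bound \<open>16 * (Y * I)\<close> by
   \<open>Y * r / 8\<close>.\<close>
 define e where "e = exp (128 * I / r + 1)"
 have e1: "e \<ge> 1" using I0 by (simp add: e_def r_def)
 define Y where "Y = 2 / r * e"
 have Y: "Y \<ge> 16" "2 / Y \<le> r" "2 / Y > 0" using e1 by (simp_all add: Y_def r_def divide_simps)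
 define K where "K \<kappa> v = indicator {0..Y} \<kappa> * (Y - \<kappa>) * (sin (\<kappa> * \<bar>v\<bar>) * G v)" for \<kappa> v
 have Km[measurable]: "(\<lambda>(\<kappa>, v). K \<kappa> v) \<in> borel_measurable (borel \<Otimes>\<^sub>M borel)" unfolding K_def by measurable
 have sG: "integrable lborel (\<lambda>v. sin (\<kappa> * \<bar>v\<bar>) * G v)" for \<kappa>
  by (rule dominated_integrable[OF Gi]) (use G0 in \<open>auto simp: abs_mult intro!: AE_I2 mult_left_le_one_le\<close>)
 have cI: "\<bar>c \<kappa>\<bar> \<le> I" for \<kappa>
 proof -
  have "\<bar>c \<kappa>\<bar> \<le> (LBINT v. \<bar>sin (\<kappa> * \<bar>v\<bar>) * G v\<bar>)" unfolding c_def by (rule integral_abs_bound)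
  also have "... \<le> I" unfolding I_def by (intro integral_mono integrable_abs sG Gi) (auto simp: abs_mult G0 intro!: mult_left_le_one_le)
  finally show ?thesis .
 qed
 have Ki: "integrable (lborel \<Otimes>\<^sub>M lborel) (\<lambda>(\<kappa>, v). K \<kappa> v)"
 proof (rule dominated_integrable)
  have "integrable (lborel \<Otimes>\<^sub>M lborel) (\<lambda>(\<kappa>::real, v). indicator {0..Y} \<kappa> * Y * G v)"
  proof (rule lborel_pair.Fubini_integrable)
   show "integrable lborel (\<lambda>\<kappa>. LBINT v. norm (case (\<kappa>, v) of (\<kappa>, v) \<Rightarrow> indicator {0..Y} \<kappa> * Y * G v))"
    unfolding prod.case norm_mult integral_mult_right_zero
    using integrable_mult_left[OF integrable_indicator_Icc, of 0 Y "norm Y * (LBINT v. norm (G v))"] by (simp add: mult.assoc)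
   show "AE \<kappa> in lborel. integrable lborel (\<lambda>v. case (\<kappa>, v) of (\<kappa>, v) \<Rightarrow> indicator {0..Y} \<kappa> * Y * G v)"
    unfolding prod.case by (intro AE_I2 integrable_mult_right Gi)
  qed measurable
  then show "integrable (lborel \<Otimes>\<^sub>M lborel) (\<lambda>(\<kappa>::real, v). indicator {0..Y} \<kappa> * Y * G v)" .
  have "\<bar>K \<kappa> v\<bar> \<le> indicator {0..Y} \<kappa> * Y * G v" for \<kappa> v
  proof (cases "\<kappa> \<in> {0..Y}")
   case True
   have "\<bar>Y - \<kappa>\<bar> * (\<bar>sin (\<kappa> * \<bar>v\<bar>)\<bar> * G v) \<le> Y * (1 * G v)" using True G0 by (intro mult_mono) auto
   then show ?thesis using True G0 by (simp add: K_def abs_mult)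
  qed (simp add: K_def)
  then show "AE p in lborel \<Otimes>\<^sub>M lborel. norm (case p of (\<kappa>, v) \<Rightarrow> K \<kappa> v) \<le> norm (case p of (\<kappa>, v) \<Rightarrow> indicator {0..Y} \<kappa> * Y * G v)"
   by (intro AE_I2) (auto split: prod.split intro!: order_trans[OF _ abs_ge_self])
 qed measurable
 have inn: "(LBINT v. K \<kappa> v) = indicator {0..Y} \<kappa> * (Y - \<kappa>) * c \<kappa>" for \<kappa> unfolding K_def c_def by (rule integral_mult_right_zero)
 define q where "q v = (LBINT \<kappa>. indicator {0..Y} \<kappa> * (Y - \<kappa>) * sin (\<kappa> * \<bar>v\<bar>))" for v
 have out: "(LBINT \<kappa>. K \<kappa> v) = q v * G v" for v
  unfolding K_def q_def mult.assoc[symmetric] by (rule integral_mult_left_zero)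
 have eq: "(LBINT v. q v * G v) = (LBINT \<kappa>. indicator {0..Y} \<kappa> * (Y - \<kappa>) * c \<kappa>)"
  using lborel_pair.Fubini_integral[OF Ki] unfolding inn out .
 \<comment> \<open>Beyond 16 the transform \<open>c\<close> vanishes by assumption; up to 16 it is
   at most \<open>I\<close> and the ramp at most \<open>Y\<close>.\<close>
 have up: "(LBINT \<kappa>. indicator {0..Y} \<kappa> * (Y - \<kappa>) * c \<kappa>) \<le> 16 * (Y * I)"
 proof -
  have "(LBINT \<kappa>. indicator {0..Y} \<kappa> * (Y - \<kappa>) * c \<kappa>) \<le> (LBINT \<kappa>. indicator {0..16::real} \<kappa> * (Y * I))"
  proof (rule integral_mono')
   show "integrable lborel (\<lambda>\<kappa>. indicator {0..16::real} \<kappa> * (Y * I))" by (intro integrable_mult_left integrable_indicator_Icc)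
   fix \<kappa> :: real
   show "0 \<le> indicator {0..16} \<kappa> * (Y * I)" using Y I0 by simp
   show "indicator {0..Y} \<kappa> * (Y - \<kappa>) * c \<kappa> \<le> indicator {0..16} \<kappa> * (Y * I)"
   proof (cases "\<kappa> \<in> {0..16}")
    case True
    have "(Y - \<kappa>) * c \<kappa> \<le> Y * I" using True Y cI[of \<kappa>] I0 by (intro order_trans[OF mult_left_mono[of "c \<kappa>" I] mult_right_mono]) auto
    then show ?thesis using True Y by simp
   next
    case False
    then show ?thesis using c0[of \<kappa>] by (auto simp: indicator_def)
   qed
  qed
  also have "... = 16 * (Y * I)" by simp
  finally show ?thesis .
 qed
 have qe: "q v = Y / \<bar>v\<bar> - sin (Y * \<bar>v\<bar>) / \<bar>v\<bar>^2" if "v \<noteq> 0" for v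
  unfolding q_def using ramp_sine_integral[of "\<bar>v\<bar>" Y] that Y by simp
 have q0: "q v \<ge> 0" for v
 proof (cases "v = 0")
  case False
  have "sin (Y * \<bar>v\<bar>) / \<bar>v\<bar>^2 \<le> Y * \<bar>v\<bar> / \<bar>v\<bar>^2" using Y by (intro divide_right_mono sin_x_le_x) auto
  also have "... = Y / \<bar>v\<bar>" using False by (simp add: power2_eq_square del: abs_mult_self_eq)
  finally show ?thesis using qe[OF False] by simp
 qed (simp add: q_def)
 have qG: "integrable lborel (\<lambda>v. q v * G v)" using lborel_pair.integrable_snd[OF Ki] unfolding out .
 have low: "(LBINT v. (1 / v) * indicator {2/Y..r} v) * (Y * r / 8) \<le> (LBINT v. q v * G v)"
 proof -
  have "(LBINT v. (1 / v) * indicator {2/Y..r} v) * (Y * r / 8) = (LBINT v. (1 / v) * indicator {2/Y..r} v * (Y * r / 8))"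
   by (rule integral_mult_left_zero[symmetric])
  also have "... \<le> (LBINT v. q v * G v)"
  proof (rule integral_mono'[OF qG])
   fix v
   show "0 \<le> q v * G v" by (intro mult_nonneg_nonneg q0 G0)
   show "(1 / v) * indicator {2/Y..r} v * (Y * r / 8) \<le> q v * G v"
   proof (cases "v \<in> {2/Y..r}")
    case True
    then have "v \<ge> 2 / Y" "v \<le> r" by auto
    then have v: "v > 0" "v \<ge> 2 / Y" "v \<le> r" using Y(3) by linarith+
    have Yv: "Y * v \<ge> 2" using v(2) Y(1) by (simp add: field_simps)
    have "sin (Y * v) / v^2 \<le> (Y * v / 2) / v^2" using Yv by (intro divide_right_mono order_trans[OF sin_le_one]) auto
    also have "... = Y / v / 2" using v by (simp add: power2_eq_square)
    finally have "Y / (2 * v) \<le> q v" using qe[of v] v by simp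
    moreover have "G v \<ge> r / 4" unfolding G_def using GG_lower[OF b, of v] v by (simp add: r_def)
    ultimately have "Y / (2 * v) * (r / 4) \<le> q v * G v" using v Y G0 by (intro mult_mono) (auto simp: r_def q0)
    then show ?thesis using True by simp
   qed (simp add: q0 G0)
  qed
  finally show ?thesis .
 qed
 have "(LBINT v. (1 / v) * indicator {2/Y..r} v) = ln r - ln (2/Y)"
 proof (rule integral_FTC_Icc_real)
  fix x assume "2 / Y \<le> x"
  then have x: "x > 0" using Y(3) by linarith
  show "DERIV ln x :> 1 / x" using DERIV_ln_divide[OF x] .
  show "isCont (\<lambda>v. 1 / v) x" using x by (intro continuous_intros) auto
 qed (rule Y(2))
 also have "... = 128 * I / r + 1"
 proof -
  have "2 / Y = r * exp (- (128 * I / r + 1))" by (simp only: Y_def e_def exp_minus) (simp add: r_def inverse_eq_divide)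
  moreover have "ln (r * exp (- (128 * I / r + 1))) = ln r - (128 * I / r + 1)" by (subst ln_mult) (auto simp: r_def)
  ultimately show ?thesis by simp
 qed
 finally have "(128 * I / r + 1) * (Y * r / 8) \<le> (LBINT v. q v * G v)" using low by simp
 then have "(128 * I / r + 1) * (Y * r / 8) \<le> 16 * (Y * I)" using eq up by linarith
 moreover have "(128 * I / r + 1) * (Y * r / 8) = 16 * (Y * I) + Y * r / 8" by (simp add: r_def algebra_simps)
 ultimately show False using Y by (simp add: r_def)
qed

section \<open>Sharp truncations\<close>

definition Lam :: "(real \<Rightarrow> complex) \<Rightarrow> real \<Rightarrow> complex" where
 "Lam L e = (LBINT \<tau>. (if e < \<bar>\<tau>\<bar> then L \<tau> / cx \<tau> else 0))"

text \<open>The difference of the truncations at \<open>e * |v|\<close> and \<open>e\<close> is the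
  integral of \<open>L (e * s)\<close> against \<open>m\<close>, a function of \<open>s\<close> that
  does not depend on \<open>e\<close> and lives on \<open>|s|\<close> between 1 and
  \<open>|v|\<close>. Its L1 norm gives the bound; since \<open>m\<close> is odd, the limit
  \<open>L 0\<close> times its integral is 0.\<close>

lemma Lam_ratio:
 fixes L :: "real \<Rightarrow> complex"
 assumes L: "integrable lborel L" "\<And>\<tau>. norm (L \<tau>) \<le> B" "\<And>h::nat \<Rightarrow> real. h \<longlonglongrightarrow> 0 \<Longrightarrow> (\<lambda>n. L (h n)) \<longlonglongrightarrow> L 0"
  and v: "v \<noteq> 0"
 shows "e > 0 \<Longrightarrow> norm (Lam L (e * \<bar>v\<bar>) - Lam L e) \<le> 2 * B * (\<bar>v\<bar> + 1 / \<bar>v\<bar>)"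
  "(\<And>n. u n > 0) \<Longrightarrow> u \<longlonglongrightarrow> 0 \<Longrightarrow> (\<lambda>n. Lam L (u n * \<bar>v\<bar>) - Lam L (u n)) \<longlonglongrightarrow> 0"
proof -
 have [measurable]: "L \<in> bm" using L by auto
 have B0: "B \<ge> 0" using L(2)[of 0] norm_ge_zero order_trans by blast
 define m where "m s = ((if \<bar>v\<bar> < \<bar>s\<bar> then 1 else 0) - (if 1 < \<bar>s\<bar> then 1 else 0)) / s" for s :: real
 define R \<rho> where "R = max 1 \<bar>v\<bar>" and "\<rho> = min 1 \<bar>v\<bar>"
 have R: "R \<ge> 0" "\<rho> > 0" using v by (auto simp: R_def \<rho>_def)
 have mb: "\<bar>m s\<bar> \<le> indicator {-R..R} s * (1 / \<rho>)" for s
 proof (cases "\<rho> \<le> \<bar>s\<bar> \<and> \<bar>s\<bar> \<le> R")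
  case True
  have "\<bar>m s\<bar> \<le> 1 / \<bar>s\<bar>" by (auto simp: m_def)
  also have "... \<le> 1 / \<rho>" using True R by (intro divide_left_mono) auto
  finally show ?thesis using True by (simp add: abs_le_iff indicator_def)
 next
  case False
  then have "m s = 0" by (auto simp: m_def R_def \<rho>_def)
  then show ?thesis using R by simp
 qed
 have mm[measurable]: "m \<in> bm" unfolding m_def by measurable
 have mi: "integrable lborel m"
  by (rule dominated_integrable[OF integrable_mult_left[OF integrable_indicator_Icc, of "-R" R "1 / \<rho>"]])
   (use mb R in \<open>auto intro!: AE_I2\<close>)
 have mI: "(LBINT s. \<bar>m s\<bar>) \<le> 2 * (\<bar>v\<bar> + 1 / \<bar>v\<bar>)"
 proof -
  have "(LBINT s. \<bar>m s\<bar>) \<le> (LBINT s. indicator {-R..R} s * (1 / \<rho>))"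
   by (intro integral_mono mb integrable_abs mi integrable_mult_left integrable_indicator_Icc)
  also have "... = 2 * (R / \<rho>)" using R by simp
  also have "R / \<rho> \<le> \<bar>v\<bar> + 1 / \<bar>v\<bar>" using v by (auto simp: R_def \<rho>_def max_def min_def)
  finally show ?thesis by simp
 qed
 have odd: "(LBINT s. m s) = 0"
 proof -
  have "m (0 - s) = - m s" for s by (simp add: m_def)
  then have "(LBINT s. m s) = - (LBINT s. m s)" using integral_lborel_minus[of m 0] by simp
  then show ?thesis by simp
 qed
 have Lti: "integrable lborel (\<lambda>\<tau>. if \<delta> < \<bar>\<tau>\<bar> then L \<tau> / cx \<tau> else 0)" if "\<delta> > 0" for \<delta>
 proof (rule dominated_integrable)
  show "integrable lborel (\<lambda>\<tau>. L \<tau> / cx \<delta>)" using L by simp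
  show "AE \<tau> in lborel. norm (if \<delta> < \<bar>\<tau>\<bar> then L \<tau> / cx \<tau> else 0) \<le> norm (L \<tau> / cx \<delta>)"
   using that by (intro AE_I2) (auto simp: norm_divide intro!: divide_left_mono mult_pos_pos)
 qed measurable
 have rep: "Lam L (e * \<bar>v\<bar>) - Lam L e = (LBINT s. cx (m s) * L (e * s))" if e: "e > 0" for e
 proof -
  have "Lam L (e * \<bar>v\<bar>) - Lam L e = (LBINT \<tau>. (if e * \<bar>v\<bar> < \<bar>\<tau>\<bar> then L \<tau> / cx \<tau> else 0) - (if e < \<bar>\<tau>\<bar> then L \<tau> / cx \<tau> else 0))"
   unfolding Lam_def using v e by (subst Bochner_Integration.integral_diff) (auto intro!: Lti)
  also have "... = (LBINT s. (if e * \<bar>v\<bar> < \<bar>e * s\<bar> then L (e * s) / cx (e * s) else 0) - (if e < \<bar>e * s\<bar> then L (e * s) / cx (e * s) else 0)) * e"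
   by (rule integral_lborel_rescale[OF e])
  also have "... = (LBINT s. ((if e * \<bar>v\<bar> < \<bar>e * s\<bar> then L (e * s) / cx (e * s) else 0) - (if e < \<bar>e * s\<bar> then L (e * s) / cx (e * s) else 0)) * e)"
   by (rule integral_mult_left_zero[symmetric])
  also have "... = (LBINT s. cx (m s) * L (e * s))"
  proof (intro bochner_cong refl)
   fix s :: real
   have "e * \<bar>v\<bar> < \<bar>e * s\<bar> \<longleftrightarrow> \<bar>v\<bar> < \<bar>s\<bar>" "e < \<bar>e * s\<bar> \<longleftrightarrow> 1 < \<bar>s\<bar>" using e by (simp_all add: abs_mult)
   then show "((if e * \<bar>v\<bar> < \<bar>e * s\<bar> then L (e * s) / cx (e * s) else 0) - (if e < \<bar>e * s\<bar> then L (e * s) / cx (e * s) else 0)) * e = cx (m s) * L (e * s)"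
    using e by (auto simp: m_def)
  qed
  finally show ?thesis .
 qed
 have nb: "norm (cx (m s) * L x) \<le> B * \<bar>m s\<bar>" for s x
  using mult_right_mono[OF L(2)[of x], of "\<bar>m s\<bar>"] by (simp add: norm_mult mult.commute)
 have Bi: "integrable lborel (\<lambda>s. B * \<bar>m s\<bar>)" by (intro integrable_mult_right integrable_abs mi)
 show "norm (Lam L (e * \<bar>v\<bar>) - Lam L e) \<le> 2 * B * (\<bar>v\<bar> + 1 / \<bar>v\<bar>)" if e: "e > 0" for e
 proof -
  have "norm (Lam L (e * \<bar>v\<bar>) - Lam L e) \<le> (LBINT s. norm (cx (m s) * L (e * s)))"
   unfolding rep[OF e] by (rule integral_norm_bound)
  also have "... \<le> (LBINT s. B * \<bar>m s\<bar>)" by (rule integral_mono'[OF Bi nb]) (use B0 in simp)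
  also have "... \<le> B * (2 * (\<bar>v\<bar> + 1 / \<bar>v\<bar>))" unfolding integral_mult_right_zero by (intro mult_left_mono mI B0)
  finally show ?thesis by (simp add: mult_ac)
 qed
 show "(\<lambda>n. Lam L (u n * \<bar>v\<bar>) - Lam L (u n)) \<longlonglongrightarrow> 0" if u: "\<And>n. u n > 0" "u \<longlonglongrightarrow> 0" for u
 proof -
  have "(\<lambda>n. LBINT s. cx (m s) * L (u n * s)) \<longlonglongrightarrow> (LBINT s. cx (m s) * L 0)"
  proof (rule integral_dominated_convergence)
   show "integrable lborel (\<lambda>s. B * \<bar>m s\<bar>)" by (rule Bi)
   show "AE s in lborel. (\<lambda>n. cx (m s) * L (u n * s)) \<longlonglongrightarrow> cx (m s) * L 0"
    by (intro AE_I2 tendsto_mult_left L(3)) (use tendsto_mult_left_zero[OF u(2)] in simp)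
   show "AE s in lborel. norm (cx (m s) * L (u n * s)) \<le> B * \<bar>m s\<bar>" for n by (intro AE_I2 nb)
  qed measurable
  also have "(LBINT s. cx (m s) * L 0) = 0"
   unfolding integral_mult_left_zero integral_complex_of_real odd by simp
  finally show ?thesis unfolding rep[OF u(1)] .
 qed
qed

text \<open>Averaging the truncations against \<open>sin (k\<bar>v\<bar>) G v\<close> at scale \<open>\<bar>v\<bar>\<close> gives the wave packet integral of \<open>W\<close>;
 letting the scale tend to \<open>0\<close> the average may be replaced by the sharp truncation.\<close>

lemma principal_value_representation:
 fixes L :: "real \<Rightarrow> complex" and G :: "real \<Rightarrow> real"
 assumes L: "integrable lborel L" "\<And>\<tau>. norm (L \<tau>) \<le> B" "\<And>h::nat \<Rightarrow> real. h \<longlonglongrightarrow> 0 \<Longrightarrow> (\<lambda>n. L (h n)) \<longlonglongrightarrow> L 0"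
  and G: "integrable lborel (\<lambda>v. G v * (1 + \<bar>v\<bar>))" "\<And>v. G v \<ge> 0" and Gm[measurable]: "G \<in> bm"
  and W: "\<And>t. W t = (LBINT v. cx (sin (k * v) * G v / t) * L (t * v))" "integrable lborel W"
  and c: "(LBINT v. sin (k * \<bar>v\<bar>) * G v) = c" "c \<noteq> 0"
 shows "(Lam L \<longlongrightarrow> (LBINT t. W t) / cx c) (at_right 0)"
proof (rule tendsto_at_right_sequentially[of 0 1])
 have [measurable]: "L \<in> bm" using L by auto
 have B0: "B \<ge> 0" using L(2)[of 0] norm_ge_zero order_trans by blast
 fix e :: "nat \<Rightarrow> real" assume e: "\<And>n. 0 < e n" "e \<longlonglongrightarrow> 0"
 define Q where "Q v = sin (k * \<bar>v\<bar>) * G v" for v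
 have Qm[measurable]: "Q \<in> bm" unfolding Q_def by measurable
 have Lm[measurable]: "Lam L \<in> bm" unfolding Lam_def by measurable
 have Gi: "integrable lborel G"
 proof (rule dominated_integrable[OF G(1)])
  show "AE x in lborel. norm (G x) \<le> norm (G x * (1 + \<bar>x\<bar>))"
   using mult_left_mono[OF _ G(2), of 1 "1 + \<bar>x\<bar>" for x] by (intro AE_I2) (simp add: abs_mult G(2))
 qed measurable
 have Qi: "integrable lborel Q" unfolding Q_def
  by (rule dominated_integrable[OF Gi]) (use G(2) in \<open>auto simp: abs_mult intro!: AE_I2 mult_left_le_one_le\<close>)
 \<comment> \<open>The error made when each truncation level \<open>e n * |v|\<close> is replaced by
   \<open>e n\<close>. The first part of \<open>Lam_ratio\<close> provides the majorant
   \<open>E\<close>, the second the pointwise limit.\<close>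
 define D where "D n v = cx (Q v) * (Lam L (e n * \<bar>v\<bar>) - Lam L (e n))" for n v
 have Dm: "D n \<in> borel_measurable lborel" for n unfolding D_def by measurable
 define E where "E v = 2 * B * (1 + \<bar>k\<bar>) * (G v * (1 + \<bar>v\<bar>))" for v
 have Ei: "integrable lborel E" unfolding E_def by (rule integrable_mult_right[OF G(1)])
 have Db: "norm (D n v) \<le> E v" for n v
 proof (cases "v = 0")
  case True
  then show ?thesis using B0 G(2)[of 0] by (simp add: D_def Q_def E_def)
 next
  case False
  have s1: "\<bar>sin (k * \<bar>v\<bar>)\<bar> * \<bar>v\<bar> \<le> 1 * \<bar>v\<bar>" by (intro mult_right_mono) auto
  have "\<bar>sin (k * \<bar>v\<bar>)\<bar> * (1 / \<bar>v\<bar>) \<le> (\<bar>k\<bar> * \<bar>v\<bar>) * (1 / \<bar>v\<bar>)"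
   using abs_sin_x_le_abs_x[of "k * \<bar>v\<bar>"] by (intro mult_right_mono) (auto simp: abs_mult)
  then have s2: "\<bar>sin (k * \<bar>v\<bar>)\<bar> * (1 / \<bar>v\<bar>) \<le> \<bar>k\<bar>" using False by simp
  have "\<bar>v\<bar> + \<bar>k\<bar> \<le> (1 + \<bar>k\<bar>) * (1 + \<bar>v\<bar>)" by (simp add: algebra_simps)
  then have s: "\<bar>sin (k * \<bar>v\<bar>)\<bar> * (\<bar>v\<bar> + 1 / \<bar>v\<bar>) \<le> (1 + \<bar>k\<bar>) * (1 + \<bar>v\<bar>)" using s1 s2 unfolding distrib_left by linarith
  have "norm (D n v) \<le> \<bar>Q v\<bar> * (2 * B * (\<bar>v\<bar> + 1 / \<bar>v\<bar>))"
   unfolding D_def norm_mult norm_of_real by (intro mult_left_mono Lam_ratio(1)[OF L False e(1)]) auto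
  also have "... = 2 * B * G v * (\<bar>sin (k * \<bar>v\<bar>)\<bar> * (\<bar>v\<bar> + 1 / \<bar>v\<bar>))" using G(2) by (simp add: Q_def abs_mult mult_ac)
  also have "... \<le> 2 * B * G v * ((1 + \<bar>k\<bar>) * (1 + \<bar>v\<bar>))" using B0 G(2) by (intro mult_left_mono s) auto
  also have "... = E v" unfolding E_def by (simp only: mult_ac)
  finally show ?thesis .
 qed
 have Di: "integrable lborel (D n)" for n
  by (rule dominated_integrable[OF Ei Dm]) (auto intro!: AE_I2 order_trans[OF Db])
 have D0: "(\<lambda>n. LBINT v. D n v) \<longlonglongrightarrow> (\<integral>v. 0 \<partial>(lborel :: real measure))"
 proof (rule integral_dominated_convergence[where w=E])
  show "AE v in lborel. (\<lambda>n. D n v) \<longlonglongrightarrow> 0"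
  proof (intro AE_I2)
   fix v
   show "(\<lambda>n. D n v) \<longlonglongrightarrow> 0"
   proof (cases "v = 0")
    case False
    show ?thesis unfolding D_def by (intro tendsto_mult_right_zero Lam_ratio(2)[OF L False e])
   qed (simp add: D_def Q_def)
  qed
  show "AE v in lborel. norm (D n v) \<le> E v" for n by (intro AE_I2 Db)
 qed (use Dm Ei in simp_all)
 define Wt where "Wt n t = (if e n < \<bar>t\<bar> then W t else 0)" for n t
 have Wm[measurable]: "W \<in> bm" using W(2) by auto
 have Wlim: "(\<lambda>n. LBINT t. Wt n t) \<longlonglongrightarrow> (LBINT t. W t)"
 proof (rule integral_dominated_convergence[where w="\<lambda>t. norm (W t)"])
  show "AE t in lborel. (\<lambda>n. Wt n t) \<longlonglongrightarrow> W t"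
  proof (rule AE_mp[OF AE_lborel_singleton[of 0]], intro AE_I2 impI)
   fix t :: real assume "t \<noteq> 0"
   then have "\<forall>\<^sub>F n in sequentially. e n < \<bar>t\<bar>" by (intro order_tendstoD(2)[OF e(2)]) simp
   then have "\<forall>\<^sub>F n in sequentially. Wt n t = W t" by eventually_elim (simp add: Wt_def)
   then show "(\<lambda>n. Wt n t) \<longlonglongrightarrow> W t" by (rule tendsto_eventually)
  qed
 qed (auto simp: Wt_def W(2))
 \<comment> \<open>Under \<open>\<tau> = t * v\<close> the cutoff \<open>|t| > e n\<close> becomes
   \<open>|\<tau>| > e n * |v|\<close>, so each \<open>v\<close> sees a sharp truncation at its own
   level; cutting off in \<open>t\<close> also makes the exchange of integrals legitimate.\<close>
 have Wt: "(LBINT t. Wt n t) = (LBINT v. D n v) + cx c * Lam L (e n)" for n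
 proof -
  define K where "K v t = (if e n < \<bar>t\<bar> then cx (sin (k * v) * G v / t) * L (t * v) else 0)" for v t
  have Km[measurable]: "(\<lambda>(v, t). K v t) \<in> borel_measurable (borel \<Otimes>\<^sub>M borel)" unfolding K_def by measurable
  have L1: "integrable lborel (\<lambda>t. L (t * v))" "(LBINT t. norm (L (t * v))) = (LBINT t. norm (L t)) / \<bar>v\<bar>" if "v \<noteq> 0" for v
   using integrable_lborel_scale[OF L(1) that] integral_lborel_scale[OF that, of "\<lambda>t. norm (L t)"] by (simp_all add: mult.commute divide_inverse)
  have Kb: "norm (K v t) \<le> \<bar>sin (k * v)\<bar> * G v / e n * norm (L (t * v))" for v t
proof (cases "e n < \<bar>t\<bar>")
   case True
   have "\<bar>sin (k * v) * G v\<bar> / \<bar>t\<bar> * norm (L (t * v)) \<le> \<bar>sin (k * v) * G v\<bar> / e n * norm (L (t * v))"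
    using True e(1)[of n] by (intro mult_right_mono divide_left_mono mult_pos_pos) auto
   then show ?thesis using True G(2)[of v] by (simp add: K_def norm_mult norm_divide abs_mult)
  next
   case False
   then show ?thesis using e(1)[of n] G(2)[of v] by (simp add: K_def)
  qed
  have Ki: "integrable lborel (K v)" for v
  proof (cases "v = 0")
   case False
   show ?thesis
    by (rule dominated_integrable[OF integrable_mult_right[OF integrable_norm[OF L1(1)[OF False]], of "\<bar>sin (k * v)\<bar> * G v / e n"]])
     (use Kb e(1)[of n] G(2)[of v] in \<open>auto simp: abs_mult intro!: AE_I2\<close>)
  next
   case True
   then have "K v = (\<lambda>t. 0)" by (auto simp: K_def)
   then show ?thesis by simp
  qed
  have KI: "integrable (lborel \<Otimes>\<^sub>M lborel) (\<lambda>(v, t). K v t)"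
  proof (rule lborel_pair.Fubini_integrable)
   show "integrable lborel (\<lambda>v. LBINT t. norm (case (v, t) of (v, t) \<Rightarrow> K v t))"
   proof (rule dominated_integrable)
    show "integrable lborel (\<lambda>v. \<bar>k\<bar> * (LBINT t. norm (L t)) / e n * G v)" by (rule integrable_mult_right[OF Gi])
    show "AE v in lborel. norm (LBINT t. norm (case (v, t) of (v, t) \<Rightarrow> K v t)) \<le> norm (\<bar>k\<bar> * (LBINT t. norm (L t)) / e n * G v)"
    proof (intro AE_I2)
     fix v :: real
     define I where "I = (LBINT t. norm (L t))"
     have I0: "I \<ge> 0" by (simp add: I_def)
     have "(LBINT t. norm (K v t)) \<le> \<bar>k\<bar> * I / e n * G v"
     proof (cases "v = 0")
      case False
      have "(LBINT t. norm (K v t)) \<le> (LBINT t. \<bar>sin (k * v)\<bar> * G v / e n * norm (L (t * v)))"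
       by (intro integral_mono integrable_norm Ki integrable_mult_right L1(1) False Kb)
      also have "... = \<bar>sin (k * v)\<bar> * G v / e n * (I / \<bar>v\<bar>)" by (simp only: integral_mult_right_zero L1(2)[OF False] I_def)
      also have "... \<le> (\<bar>k\<bar> * \<bar>v\<bar>) * G v / e n * (I / \<bar>v\<bar>)"
       using abs_sin_x_le_abs_x[of "k * v"] e(1)[of n] G(2)[of v] I0 by (intro mult_right_mono divide_right_mono) (auto simp: abs_mult)
      also have "... = \<bar>k\<bar> * I / e n * G v" using False by simp
      finally show ?thesis .
     next
      case True
      then have "K v = (\<lambda>t. 0)" by (auto simp: K_def)
      then show ?thesis using I0 e(1)[of n] G(2)[of v] by (simp add: less_imp_le)
     qed
     then show "norm (LBINT t. norm (case (v, t) of (v, t) \<Rightarrow> K v t)) \<le> norm (\<bar>k\<bar> * (LBINT t. norm (L t)) / e n * G v)"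
      unfolding prod.case real_norm_def I_def[symmetric] by (intro order_trans[OF _ abs_ge_self]) simp
    qed
   qed measurable
  qed (auto intro!: Ki)
  have "(LBINT t. Wt n t) = (LBINT t. LBINT v. K v t)"
   by (intro bochner_cong refl) (simp add: Wt_def K_def W(1))
  also have "... = (LBINT v. LBINT t. K v t)" by (rule lborel_pair.Fubini_integral[OF KI])
  also have "... = (LBINT v. cx (Q v) * Lam L (e n * \<bar>v\<bar>))"
  proof (intro bochner_cong refl)
   fix v :: real
   show "(LBINT t. K v t) = cx (Q v) * Lam L (e n * \<bar>v\<bar>)"
   proof (cases "v = 0")
    case False
    have "Lam L (e n * \<bar>v\<bar>) = \<bar>v\<bar> *\<^sub>R (LBINT t. (if e n * \<bar>v\<bar> < \<bar>0 + v * t\<bar> then L (0 + v * t) / cx (0 + v * t) else 0))"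
     unfolding Lam_def by (rule lborel_integral_real_affine[OF False])
    also have "... = (LBINT t. cx \<bar>v\<bar> * (if e n * \<bar>v\<bar> < \<bar>0 + v * t\<bar> then L (0 + v * t) / cx (0 + v * t) else 0))"
     unfolding scaleR_conv_of_real by (rule integral_mult_right_zero[symmetric])
    finally have "cx (Q v) * Lam L (e n * \<bar>v\<bar>) = (LBINT t. cx (Q v) * (cx \<bar>v\<bar> * (if e n * \<bar>v\<bar> < \<bar>0 + v * t\<bar> then L (0 + v * t) / cx (0 + v * t) else 0)))"
     by (simp only: integral_mult_right_zero)
    also have "... = (LBINT t. K v t)"
    proof (intro bochner_cong refl)
     fix t :: real
     have i: "e n * \<bar>v\<bar> < \<bar>0 + v * t\<bar> \<longleftrightarrow> e n < \<bar>t\<bar>" using False by (simp add: abs_mult mult.commute)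
     have q: "Q v * \<bar>v\<bar> = sin (k * v) * G v * v" by (cases "v \<ge> 0") (auto simp: Q_def)
     have "cx (Q v) * (cx \<bar>v\<bar> * (L (v * t) / cx (v * t))) = cx (Q v * \<bar>v\<bar>) * (L (v * t) / cx (v * t))" by simp
     also have "... = cx (sin (k * v) * G v / t) * L (t * v)" unfolding q using False by (simp add: mult_ac)
     finally show "cx (Q v) * (cx \<bar>v\<bar> * (if e n * \<bar>v\<bar> < \<bar>0 + v * t\<bar> then L (0 + v * t) / cx (0 + v * t) else 0)) = K v t"
      unfolding i K_def by simp
    qed
    finally show ?thesis by (rule sym)
   next
    case True
    then have "K v = (\<lambda>t. 0)" by (auto simp: K_def)
    then show ?thesis using True by (simp add: Q_def)
   qed
  qed
  also have "... = (LBINT v. D n v + cx (Q v) * Lam L (e n))"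
   by (intro bochner_cong refl) (simp add: D_def algebra_simps)
  also have "... = (LBINT v. D n v) + (LBINT v. cx (Q v) * Lam L (e n))"
   by (intro Bochner_Integration.integral_add Di integrable_mult_left integrable_of_real Qi)
  also have "(LBINT v. cx (Q v) * Lam L (e n)) = cx c * Lam L (e n)"
   unfolding integral_mult_left_zero integral_complex_of_real using c(1) by (simp add: Q_def)
  finally show ?thesis .
 qed
 have "(\<lambda>n. ((LBINT t. Wt n t) - (LBINT v. D n v)) / cx c) \<longlonglongrightarrow> ((LBINT t. W t) - (\<integral>v. 0 \<partial>(lborel :: real measure))) / cx c"
  using c(2) by (intro tendsto_divide tendsto_diff Wlim D0 tendsto_const) simp
 then show "(\<lambda>n. Lam L (e n)) \<longlonglongrightarrow> (LBINT t. W t) / cx c"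
  unfolding Wt using c(2) by simp
qed simp

text \<open>Leaves \<open>f3\<close>, which the estimates below use only as a bounded function,
  unshifted and puts the shift on \<open>f1\<close> and \<open>f2\<close>, for which translations
  are continuous in L2.\<close>

lemma slice_shift: "slice f1 f2 f3 b1 b2 b3 \<tau> = (LBINT x. f1 (x + (b3 - b1) * \<tau>) * (f2 (x + (b3 - b2) * \<tau>) * f3 x))"
proof -
 have "slice f1 f2 f3 b1 b2 b3 \<tau> = (LBINT x. (\<lambda>x. f1 (x + (b3 - b1) * \<tau>) * (f2 (x + (b3 - b2) * \<tau>) * f3 x)) (x + - (b3 * \<tau>)))"
  unfolding slice_def by (intro bochner_cong refl) (simp add: left_diff_distrib mult.assoc)
 also have "... = (LBINT x. f1 (x + (b3 - b1) * \<tau>) * (f2 (x + (b3 - b2) * \<tau>) * f3 x))" by (rule integral_lborel_shift)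
 finally show ?thesis .
qed

lemma slice_measurable[measurable]:
 assumes [measurable]: "f1 \<in> bm" "f2 \<in> bm" "f3 \<in> bm"
 shows "slice f1 f2 f3 b1 b2 b3 \<in> bm"
 unfolding slice_def by measurable

lemma CS_bounded:
 fixes u w z :: "real \<Rightarrow> complex"
 assumes u: "u \<in> bm" "sq_integrable u"
  and w: "w \<in> bm" "sq_integrable w"
  and z: "z \<in> bm" "\<And>x. norm (z x) \<le> 1"
 shows "integrable lborel (\<lambda>x. u x * (w x * z x))"
  "norm (LBINT x. u x * (w x * z x)) \<le> sqrt (LBINT x. (norm (u x))^2) * sqrt (LBINT x. (norm (w x))^2)"
proof -
 note [measurable] = u(1) w(1) z(1)
 have le: "(norm (w x * z x))^2 \<le> (norm (w x))^2" for x
  unfolding norm_mult by (intro power_mono mult_left_le z(2)) auto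
 have i: "integrable lborel (\<lambda>x. (norm (w x * z x))^2)"
  by (rule dominated_integrable[OF w(2)]) (use le in \<open>simp_all del: norm_mult\<close>)
 show "integrable lborel (\<lambda>x. u x * (w x * z x))" by (rule integrable_mult_L2[OF _ _ u(2) i]) measurable
 have "norm (LBINT x. u x * (w x * z x)) \<le> sqrt (LBINT x. (norm (u x))^2) * sqrt (LBINT x. (norm (w x * z x))^2)"
  by (rule CS_integral_norm[OF _ _ u(2) i]) measurable
 also have "... \<le> sqrt (LBINT x. (norm (u x))^2) * sqrt (LBINT x. (norm (w x))^2)"
  by (intro mult_left_mono real_sqrt_le_mono integral_mono i w(2) le) (auto intro!: integral_nonneg_AE AE_I2)
 finally show "norm (LBINT x. u x * (w x * z x)) \<le> sqrt (LBINT x. (norm (u x))^2) * sqrt (LBINT x. (norm (w x))^2)" .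
qed

lemma L2_shift:
 fixes f :: "real \<Rightarrow> complex"
 assumes f: "f \<in> bm" "sq_integrable f"
 shows "(\<lambda>x. f (x + h)) \<in> bm" "integrable lborel (\<lambda>x. (norm (f (x + h)))^2)"
  "(LBINT x. (norm (f (x + h)))^2) = (LBINT x. (norm (f x))^2)"
  "(\<lambda>x. f (x + h) - f x) \<in> bm" "integrable lborel (\<lambda>x. (norm (f (x + h) - f x))^2)"
proof -
 note [measurable] = f(1)
 show "(\<lambda>x. f (x + h)) \<in> bm" "(\<lambda>x. f (x + h) - f x) \<in> bm" by measurable
 show s: "integrable lborel (\<lambda>x. (norm (f (x + h)))^2)" by (rule integrable_lborel_shift[OF f(2)])
 show "(LBINT x. (norm (f (x + h)))^2) = (LBINT x. (norm (f x))^2)" by (rule integral_lborel_shift)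
 show "integrable lborel (\<lambda>x. (norm (f (x + h) - f x))^2)"
 proof (rule dominated_integrable)
  show "integrable lborel (\<lambda>x. 2 * ((norm (f (x + h)))^2 + (norm (f x))^2))" by (intro integrable_mult_right Bochner_Integration.integrable_add s f(2))
  have "(norm (a - b))^2 \<le> 2 * ((norm a)^2 + (norm b)^2)" for a b :: complex
  proof -
   have "(norm (a - b))^2 \<le> (norm a + norm b)^2" by (intro power_mono norm_triangle_ineq4) auto
   also have "... \<le> 2 * ((norm a)^2 + (norm b)^2)" using sum_squares_bound[of "norm a" "norm b"] by (simp add: power2_sum)
   finally show ?thesis .
  qed
  then show "AE x in lborel. norm ((norm (f (x + h) - f x))^2) \<le> norm (2 * ((norm (f (x + h)))^2 + (norm (f x))^2))"
   by (intro AE_I2) simp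
 qed measurable
qed

lemma slice_bound:
 assumes f1: "f1 \<in> bm" "sq_integrable f1"
  and f2: "f2 \<in> bm" "sq_integrable f2"
  and f3: "f3 \<in> bm" "\<And>x. norm (f3 x) \<le> 1"
 shows "norm (slice f1 f2 f3 b1 b2 b3 \<tau>) \<le> sqrt (LBINT x. (norm (f1 x))^2) * sqrt (LBINT x. (norm (f2 x))^2)"
 using CS_bounded(2)[OF L2_shift(1,2)[OF f1, of "(b3 - b1) * \<tau>"] L2_shift(1,2)[OF f2, of "(b3 - b2) * \<tau>"] f3]
 unfolding slice_shift L2_shift(3)[OF f1] L2_shift(3)[OF f2] .

lemma slice_cont:
 fixes h :: "nat \<Rightarrow> real"
 assumes f1: "f1 \<in> bm" "sq_integrable f1"
  and f2: "f2 \<in> bm" "sq_integrable f2"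
  and f3: "f3 \<in> bm" "\<And>x. norm (f3 x) \<le> 1" and h: "h \<longlonglongrightarrow> 0"
 shows "(\<lambda>n. slice f1 f2 f3 b1 b2 b3 (h n)) \<longlonglongrightarrow> slice f1 f2 f3 b1 b2 b3 0"
proof -
 define p q where "p n = (b3 - b1) * h n" and "q n = (b3 - b2) * h n" for n
 have pq: "p \<longlonglongrightarrow> 0" "q \<longlonglongrightarrow> 0" unfolding p_def q_def using tendsto_mult_right_zero[OF h] by auto
 define E where "E n = sqrt (LBINT x. (norm (f1 (x + p n) - f1 x))^2) * sqrt (LBINT x. (norm (f2 x))^2)
  + sqrt (LBINT x. (norm (f1 x))^2) * sqrt (LBINT x. (norm (f2 (x + q n) - f2 x))^2)" for n
 have "E \<longlonglongrightarrow> sqrt 0 * sqrt (LBINT x. (norm (f2 x))^2) + sqrt (LBINT x. (norm (f1 x))^2) * sqrt 0"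
  unfolding E_def by (intro tendsto_intros L2_trans f1 f2 pq)
 then have E: "E \<longlonglongrightarrow> 0" by simp
 have "norm (slice f1 f2 f3 b1 b2 b3 (h n) - slice f1 f2 f3 b1 b2 b3 0) \<le> E n" for n
 proof -
  have "slice f1 f2 f3 b1 b2 b3 (h n) - slice f1 f2 f3 b1 b2 b3 0 = (LBINT x. f1 (x + p n) * (f2 (x + q n) * f3 x) - f1 x * (f2 x * f3 x))"
   unfolding slice_shift p_def[symmetric] q_def[symmetric]
   using CS_bounded(1)[OF L2_shift(1,2)[OF f1, of "p n"] L2_shift(1,2)[OF f2, of "q n"] f3] CS_bounded(1)[OF f1 f2 f3]
   by (subst Bochner_Integration.integral_diff[symmetric]) simp_all
  also have "... = (LBINT x. (f1 (x + p n) - f1 x) * (f2 (x + q n) * f3 x) + f1 x * ((f2 (x + q n) - f2 x) * f3 x))"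
   by (intro bochner_cong refl) (simp add: algebra_simps)
  also have "... = (LBINT x. (f1 (x + p n) - f1 x) * (f2 (x + q n) * f3 x)) + (LBINT x. f1 x * ((f2 (x + q n) - f2 x) * f3 x))"
   by (intro Bochner_Integration.integral_add CS_bounded(1) L2_shift f1 f2 f3)
  finally have eq: "slice f1 f2 f3 b1 b2 b3 (h n) - slice f1 f2 f3 b1 b2 b3 0 = (LBINT x. (f1 (x + p n) - f1 x) * (f2 (x + q n) * f3 x)) + (LBINT x. f1 x * ((f2 (x + q n) - f2 x) * f3 x))" .
  show ?thesis unfolding eq E_def
   using CS_bounded(2)[OF L2_shift(4,5)[OF f1, of "p n"] L2_shift(1,2)[OF f2, of "q n"] f3] CS_bounded(2)[OF f1 L2_shift(4,5)[OF f2, of "q n"] f3]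
   unfolding L2_shift(3)[OF f2] by (intro order_trans[OF norm_triangle_ineq] add_mono)
 qed
 then have "(\<lambda>n. slice f1 f2 f3 b1 b2 b3 (h n) - slice f1 f2 f3 b1 b2 b3 0) \<longlonglongrightarrow> 0"
  by (intro tendsto_norm_zero_cancel[OF tendsto_sandwich[OF _ _ tendsto_const E]]) auto
 then show ?thesis by (simp add: LIM_zero_iff)
qed

text \<open>For a function that is not integrable the Bochner integral is 0 by convention, so this
  case is trivial. The iterated integrals defining \<open>A\<close> can thus be bounded before their
  integrability is known.\<close>

lemma norm_integral_le_nn_integral:
 fixes f :: "'a \<Rightarrow> 'b::{banach, second_countable_topology}"
 shows "ennreal (norm (\<integral>x. f x \<partial>M)) \<le> (\<integral>\<^sup>+x. ennreal (norm (f x)) \<partial>M)"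
 by (cases "integrable M f") (auto intro: integral_norm_bound_ennreal simp: not_integrable_integral_eq)

section \<open>Existence of the limit of sharp truncations, with its bound\<close>

lemma Lam_limit:
 fixes b1 b2 b3 :: real
 assumes nd: "nondegenerate b1 b2 b3"
 shows "\<exists>C>0. \<forall>f1 f2 f3 a M E2 Z.
  off_exceptional f1 f2 f3 a M E2 Z \<and> integrable lborel f3 \<longrightarrow>
  (\<exists>l. (Lam (slice f1 f2 f3 b1 b2 b3) \<longlongrightarrow> l) (at_right 0) \<and> norm l \<le> C * (sqrt M * E2 * (a * ln (exp 1 + 1 / a))))"
proof -
 have b: "b1 \<noteq> b2" "b1 \<noteq> b3" "b2 \<noteq> b3" "b1 + b2 + b3 = 0" "b1^2 + b2^2 + b3^2 = 1" using nd by (auto simp: nondegenerate_def)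
 have d: "b2 - b3 \<noteq> 0" "b3 - b1 \<noteq> 0" "b1 - b2 \<noteq> 0" using b by auto
 have b1: "\<bar>b1\<bar> \<le> 1" "\<bar>b2\<bar> \<le> 1" "\<bar>b3\<bar> \<le> 1"
  using b(5) zero_le_power2[of b1] zero_le_power2[of b2] zero_le_power2[of b3] unfolding abs_square_le_1[symmetric] by linarith+
 obtain k where k: "k \<ge> 16" and c0: "(LBINT v. sin (k * \<bar>v\<bar>) * GG b1 b2 b3 v) \<noteq> 0"
  using sine_transform_nonzero[OF b(1) b1] by blast
 define c where "c = (LBINT v. sin (k * \<bar>v\<bar>) * GG b1 b2 b3 v)"
 have b3: "b3 = - b1 - b2" using b(4) by simp
 \<comment> \<open>Once \<open>b3 = - b1 - b2\<close> is substituted, each minor of \<open>d\<close>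
   and \<open>b\<close> is the sum of the squares up to sign, so the parameter \<open>s\<close>
   alone fixes the determinants.\<close>
 have det: "(b3 - b1) * (s * b1) - (b2 - b3) * (s * b2) = - s" "(b1 - b2) * (s * b1) - (b2 - b3) * (s * b3) = s" "(b1 - b2) * (s * b2) - (b3 - b1) * (s * b3) = - s" for s
 proof -
  have "(b3 - b1) * (s * b1) - (b2 - b3) * (s * b2) = - s * (b1^2 + b2^2 + b3^2)" "(b1 - b2) * (s * b1) - (b2 - b3) * (s * b3) = s * (b1^2 + b2^2 + b3^2)"
   "(b1 - b2) * (s * b2) - (b3 - b1) * (s * b3) = - s * (b1^2 + b2^2 + b3^2)"
   unfolding b3 by (simp_all add: algebra_simps power2_eq_square)
  then show "(b3 - b1) * (s * b1) - (b2 - b3) * (s * b2) = - s" "(b1 - b2) * (s * b1) - (b2 - b3) * (s * b3) = s" "(b1 - b2) * (s * b2) - (b3 - b1) * (s * b3) = - s"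
   unfolding b(5) by simp_all
 qed
 have mt: "\<exists>C>0. \<forall>f1 f2 f3 a M E2 Z.
  off_exceptional f1 f2 f3 a M E2 Z \<longrightarrow>
  (NINT t. indicator {0<..} t * (NINT y. NINT \<eta>. ennreal (norm (trip f1 f2 f3 (b2 - b3) (b3 - b1) (b1 - b2) (s * b1) (s * b2) (s * b3) t y \<eta>))))
   \<le> ennreal (C * (sqrt M * E2 * (a * ln (exp 1 + 1 / a))))" if s: "s = k \<or> s = - k" for s
 proof (rule model_total[OF d])
  \<comment> \<open>Differences of the \<open>b\<close> are at most 2, so the determinant conditions
    ask for \<open>4 * (2 + 2) = 16\<close>; this is the 16 in the choice of
    \<open>k\<close>.\<close>
  have bb: "\<bar>b2 - b3\<bar> \<le> 2" "\<bar>b3 - b1\<bar> \<le> 2" "\<bar>b1 - b2\<bar> \<le> 2" using b1 by linarith+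
  have four: "4 * (x + y) \<le> z" if "x \<le> 2" "y \<le> 2" "16 \<le> z" for x y z :: real using that by simp
  have s16: "16 \<le> \<bar>s\<bar>" using s k by auto
  show "4 * (\<bar>b2 - b3\<bar> + \<bar>b3 - b1\<bar>) \<le> \<bar>(b3 - b1) * (s * b1) - (b2 - b3) * (s * b2)\<bar>"
   "4 * (\<bar>b2 - b3\<bar> + \<bar>b1 - b2\<bar>) \<le> \<bar>(b1 - b2) * (s * b1) - (b2 - b3) * (s * b3)\<bar>"
   "4 * (\<bar>b3 - b1\<bar> + \<bar>b1 - b2\<bar>) \<le> \<bar>(b1 - b2) * (s * b2) - (b3 - b1) * (s * b3)\<bar>"
   unfolding det abs_minus_cancel by (rule four; fact)+
 qed
 obtain C1 where C1: "C1 > 0" "\<And>f1 f2 f3 a M E2 Z.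
  off_exceptional f1 f2 f3 a M E2 Z \<Longrightarrow>
  (NINT t. indicator {0<..} t * (NINT y. NINT \<eta>. ennreal (norm (trip f1 f2 f3 (b2 - b3) (b3 - b1) (b1 - b2) (k * b1) (k * b2) (k * b3) t y \<eta>))))
   \<le> ennreal (C1 * (sqrt M * E2 * (a * ln (exp 1 + 1 / a))))" using mt[of k] by blast
 obtain C2 where C2: "C2 > 0" "\<And>f1 f2 f3 a M E2 Z.
  off_exceptional f1 f2 f3 a M E2 Z \<Longrightarrow>
  (NINT t. indicator {0<..} t * (NINT y. NINT \<eta>. ennreal (norm (trip f1 f2 f3 (b2 - b3) (b3 - b1) (b1 - b2) (- k * b1) (- k * b2) (- k * b3) t y \<eta>))))
   \<le> ennreal (C2 * (sqrt M * E2 * (a * ln (exp 1 + 1 / a))))" using mt[of "- k"] by blast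
 define C where "C = 2 * (C1 + C2) / \<bar>c\<bar>"
 have C: "C > 0" using C1(1) C2(1) c0 by (simp add: C_def c_def)
 show ?thesis
 proof (intro exI[of _ C] conjI C allI impI)
  fix f1 f2 f3 :: "real \<Rightarrow> complex" and a M E2 :: real and Z :: "real set"
  assume A: "off_exceptional f1 f2 f3 a M E2 Z \<and> integrable lborel f3"
  then have f1: "f1 \<in> bm" "sq_integrable f1"
   and f2: "f2 \<in> bm" "sq_integrable f2"
   and f3: "integrable lborel f3" "\<And>x. norm (f3 x) \<le> 1" and pos: "a > 0" "M > 0" "E2 > 0"
   unfolding off_exceptional_def by blast+
  have f3m: "f3 \<in> bm" using f3 by auto
  note [measurable] = f1(1) f2(1) f3m
  have f32: "sq_integrable f3" by (rule bounded_L1_L2[OF f3])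
  define X where "X = sqrt M * E2 * (a * ln (exp 1 + 1 / a))"
  have X0: "X \<ge> 0" using pos unfolding X_def by (intro mult_nonneg_nonneg ln_ge_zero) (auto intro: add_increasing2)
  define A where "A s t = (LBINT y. LBINT \<eta>. trip f1 f2 f3 (b2 - b3) (b3 - b1) (b1 - b2) (s * b1) (s * b2) (s * b3) t y \<eta>)" for s t
  have mA[measurable]: "A s \<in> bm" for s unfolding A_def by measurable
  have An: "(NINT t. indicator {0<..} t * ennreal (norm (A s t))) \<le>
   (NINT t. indicator {0<..} t * (NINT y. NINT \<eta>. ennreal (norm (trip f1 f2 f3 (b2 - b3) (b3 - b1) (b1 - b2) (s * b1) (s * b2) (s * b3) t y \<eta>))))" for s
   unfolding A_def
   by (intro nn_integral_mono mult_left_mono order_trans[OF norm_integral_le_nn_integral] nn_integral_mono norm_integral_le_nn_integral) auto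
  have A1: "(NINT t. indicator {0<..} t * ennreal (norm (A k t))) \<le> ennreal (C1 * X)"
   unfolding X_def by (rule order_trans[OF An C1(2)]) (use A in blast)
  have A2: "(NINT t. indicator {0<..} t * ennreal (norm (A (- k) t))) \<le> ennreal (C2 * X)"
   unfolding X_def by (rule order_trans[OF An C2(2)]) (use A in blast)
  define L where "L = slice f1 f2 f3 b1 b2 b3"
  define G where "G = GG b1 b2 b3"
  have [measurable]: "L \<in> bm" "G \<in> bm" unfolding L_def G_def by measurable
  define B where "B = sqrt (LBINT x. (norm (f1 x))^2) * sqrt (LBINT x. (norm (f2 x))^2)"
  have Lb: "norm (L \<tau>) \<le> B" for \<tau> unfolding L_def B_def by (rule slice_bound[OF f1 f2 f3m f3(2)])
  have Li: "integrable lborel L"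
   using lborel_pair.integrable_fst[OF tri_integrable[OF f1 f2 f3(1) b(2,3)]] by (simp add: L_def slice_def[abs_def])
  have Lc: "(\<lambda>n. L (h n)) \<longlonglongrightarrow> L 0" if "h \<longlonglongrightarrow> 0" for h :: "nat \<Rightarrow> real" unfolding L_def by (rule slice_cont[OF f1 f2 f3m f3(2) that])
  define W where "W t = (LBINT v. cx (sin (k * v) * G v / t) * L (t * v))" for t
  have Wm[measurable]: "W \<in> bm" unfolding W_def by measurable
  \<comment> \<open>The difference of the two signs replaces \<open>cis\<close> by its sine part. As
    \<open>GG\<close> is even, this makes the kernel odd in \<open>v\<close>, the symmetry of
    \<open>1 / \<tau>\<close>; the factor is \<open>2 * pi\<close> times
    \<open>2 * \<i>\<close>.\<close>
  have Weq: "A k t - A (- k) t = 4 * cx pi * \<i> * W t" if t: "t > 0" for t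
  proof -
   have i: "integrable lborel (\<lambda>v. cis (s * v) * cx (G v / t) * L (t * v))" for s
   proof (rule dominated_integrable)
    show "integrable lborel (\<lambda>v. G v * (B / t))" unfolding G_def by (intro integrable_mult_left GG_integrable b)
    show "AE v in lborel. norm (cis (s * v) * cx (G v / t) * L (t * v)) \<le> norm (G v * (B / t))"
    proof (intro AE_I2)
     fix v
     have "norm (cis (s * v) * cx (G v / t) * L (t * v)) = G v / t * norm (L (t * v))"
      using t by (simp add: norm_mult G_def GG_nonneg norm_divide)
     also have "... \<le> G v / t * B" using t by (intro mult_left_mono Lb) (simp add: G_def GG_nonneg)
     also have "... \<le> norm (G v * (B / t))" unfolding real_norm_def by (intro order_trans[OF _ abs_ge_self]) simp
     finally show "norm (cis (s * v) * cx (G v / t) * L (t * v)) \<le> norm (G v * (B / t))" .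
    qed
   qed measurable
   have "A k t - A (- k) t = cx (2 * pi) * ((LBINT v. cis (k * v) * cx (G v / t) * L (t * v)) - (LBINT v. cis (- k * v) * cx (G v / t) * L (t * v)))"
    unfolding A_def trip_plane_integral[OF f1 f2 f3(1) f32 b t] G_def L_def by (simp only: right_diff_distrib)
   also have "(LBINT v. cis (k * v) * cx (G v / t) * L (t * v)) - (LBINT v. cis (- k * v) * cx (G v / t) * L (t * v)) =
    (LBINT v. cis (k * v) * cx (G v / t) * L (t * v) - cis (- k * v) * cx (G v / t) * L (t * v))"
    by (rule Bochner_Integration.integral_diff[OF i i, symmetric])
   also have "... = (LBINT v. 2 * \<i> * (cx (sin (k * v) * G v / t) * L (t * v)))"
   proof (intro bochner_cong refl)
    fix v
    have "cis (k * v) - cis (- k * v) = 2 * \<i> * cx (sin (k * v))" by (simp add: complex_eq_iff)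
    moreover have "c1 * g * l - c2 * g * l = 2 * \<i> * (sn * g * l)" if "c1 - c2 = 2 * \<i> * sn" for c1 c2 sn g l :: complex
     unfolding left_diff_distrib[symmetric] that by (simp only: mult.assoc)
    ultimately show "cis (k * v) * cx (G v / t) * L (t * v) - cis (- k * v) * cx (G v / t) * L (t * v) = 2 * \<i> * (cx (sin (k * v) * G v / t) * L (t * v))"
     by (simp only: of_real_mult[symmetric] times_divide_eq_right[symmetric])
   qed
   also have "... = 2 * \<i> * W t" unfolding W_def by (rule integral_mult_right_zero)
   finally show ?thesis by simp
  qed
  \<comment> \<open>The packet integral covers \<open>t > 0\<close> only, whereas the representation
    integrates \<open>W\<close> over the line; evenness costs a factor 2.\<close>
  have Weven: "W (- t) = W t" for t
  proof -
   have "W (- t) = (LBINT v. (\<lambda>v. cx (sin (k * v) * G v / t) * L (t * v)) (0 - v))"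
    unfolding W_def by (intro bochner_cong refl) (simp add: G_def GG_even)
   also have "... = W t" unfolding W_def by (rule integral_lborel_minus)
   finally show ?thesis .
  qed
  have W0: "W 0 = 0" by (simp add: W_def)
  have Wb: "indicator {0<..} t * ennreal (norm (W t)) \<le> indicator {0<..} t * ennreal (norm (A k t)) + indicator {0<..} t * ennreal (norm (A (- k) t))" for t
  proof (cases "t > 0")
   case True
   have "norm (W t) \<le> 4 * pi * norm (W t)" using pi_gt3 mult_right_mono[of 1 "4 * pi" "norm (W t)"] by simp
   also have "... = norm (A k t - A (- k) t)" unfolding Weq[OF True] by (simp add: norm_mult)
   also have "... \<le> norm (A k t) + norm (A (- k) t)" by (rule norm_triangle_ineq4)
   finally show ?thesis using True by (simp add: ennreal_plus[symmetric] del: ennreal_plus)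
  qed simp
  have hW: "(NINT t. indicator {0<..} t * ennreal (norm (W t))) \<le> ennreal ((C1 + C2) * X)"
  proof -
   have "(NINT t. indicator {0<..} t * ennreal (norm (W t))) \<le> (NINT t. indicator {0<..} t * ennreal (norm (A k t)) + indicator {0<..} t * ennreal (norm (A (- k) t)))"
    by (intro nn_integral_mono Wb)
   also have "... = (NINT t. indicator {0<..} t * ennreal (norm (A k t))) + (NINT t. indicator {0<..} t * ennreal (norm (A (- k) t)))"
    by (rule nn_integral_add) measurable
   also have "... \<le> ennreal (C1 * X) + ennreal (C2 * X)" by (intro add_mono A1 A2)
   also have "... = ennreal ((C1 + C2) * X)" using C1(1) C2(1) X0 by (simp add: ennreal_plus[symmetric] distrib_right del: ennreal_plus)
   finally show ?thesis .
  qed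
  have fW: "(NINT t. ennreal (norm (W t))) \<le> ennreal (2 * (C1 + C2) * X)"
  proof -
   have "(NINT t. ennreal (norm (W t))) = (NINT t. indicator {0<..} t * ennreal (norm (W t)) + indicator {0<..} (- t) * ennreal (norm (W (- t))))"
   proof (rule nn_integral_cong)
    fix t :: real
    show "ennreal (norm (W t)) = indicator {0<..} t * ennreal (norm (W t)) + indicator {0<..} (- t) * ennreal (norm (W (- t)))"
     by (cases t "0::real" rule: linorder_cases) (auto simp: Weven W0)
   qed
   also have "... = (NINT t. indicator {0<..} t * ennreal (norm (W t))) + (NINT t. indicator {0<..} (- t) * ennreal (norm (W (- t))))"
    by (rule nn_integral_add) measurable
   also have "(NINT t. indicator {0<..} (- t) * ennreal (norm (W (- t)))) = (NINT t. indicator {0<..} t * ennreal (norm (W t)))"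
    using nn_integral_real_affine[of "\<lambda>t. indicator {0<..} t * ennreal (norm (W t))" "-1" 0] by simp
   also have "(NINT t. indicator {0<..} t * ennreal (norm (W t))) + (NINT t. indicator {0<..} t * ennreal (norm (W t))) \<le> ennreal ((C1 + C2) * X) + ennreal ((C1 + C2) * X)"
    by (intro add_mono hW)
   also have "... = ennreal (2 * (C1 + C2) * X)" using C1(1) C2(1) X0 by (simp add: ennreal_plus[symmetric] del: ennreal_plus)
   finally show ?thesis .
  qed
  have Wi: "integrable lborel W"
   by (rule integrableI_bounded) (use fW in \<open>auto intro: le_less_trans\<close>)
  have lim: "(Lam L \<longlongrightarrow> (LBINT t. W t) / cx c) (at_right 0)"
  proof (rule principal_value_representation[OF Li Lb Lc _ _ _ _ Wi])
   show "integrable lborel (\<lambda>v. G v * (1 + \<bar>v\<bar>))" unfolding G_def by (rule GG_moment[OF b(1)])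
   show "G v \<ge> 0" for v by (simp add: G_def GG_nonneg)
   show "G \<in> bm" by measurable
   show "W t = (LBINT v. cx (sin (k * v) * G v / t) * L (t * v))" for t by (rule W_def)
   show "(LBINT v. sin (k * \<bar>v\<bar>) * G v) = c" "c \<noteq> 0" using c0 by (simp_all add: c_def G_def)
  qed
  have "ennreal (norm (LBINT t. W t)) \<le> ennreal (2 * (C1 + C2) * X)" by (rule order_trans[OF norm_integral_le_nn_integral fW])
  then have nW: "norm (LBINT t. W t) \<le> 2 * (C1 + C2) * X" using C1(1) C2(1) X0 by (subst (asm) ennreal_le_iff) auto
  have "norm ((LBINT t. W t) / cx c) \<le> 2 * (C1 + C2) * X / \<bar>c\<bar>"
   unfolding norm_divide norm_of_real by (intro divide_right_mono nW) simp
  also have "... = C * X" by (simp add: C_def)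
  finally show "\<exists>l. (Lam (slice f1 f2 f3 b1 b2 b3) \<longlongrightarrow> l) (at_right 0) \<and> norm l \<le> C * (sqrt M * E2 * (a * ln (exp 1 + 1 / a)))"
   using lim unfolding L_def X_def by blast
 qed
qed

section \<open>Lebesgue measurable functions and the theorem\<close>

lemma borel_measurable_completion_AE:
 assumes g: "g \<in> borel_measurable (completion M)" and ae: "AE x in completion M. f x = g x"
 shows "f \<in> borel_measurable (completion M)"
proof (rule measurableI)
 fix A :: "'b set" assume A: "A \<in> sets borel"
 show "f -` A \<inter> space (completion M) \<in> sets (completion M)"
 proof (rule completion.in_sets_AE)
  show "AE x in completion M. x \<in> g -` A \<inter> space (completion M) \<longleftrightarrow> x \<in> f -` A \<inter> space (completion M)"
   using ae by eventually_elim auto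
  show "g -` A \<inter> space (completion M) \<in> sets (completion M)" using g A by (rule measurable_sets)
 qed auto
qed simp

lemma integral_completion_AE:
 fixes f g :: "'a \<Rightarrow> 'b::{banach, second_countable_topology}"
 assumes g: "g \<in> borel_measurable M" and ae: "AE x in M. f x = g x"
 shows "(\<integral>x. f x \<partial>completion M) = (\<integral>x. g x \<partial>M)" "integrable (completion M) f \<longleftrightarrow> integrable M g"
proof -
 have gc: "g \<in> borel_measurable (completion M)" using g by (rule measurable_completion)
 have fc: "f \<in> borel_measurable (completion M)" by (rule borel_measurable_completion_AE[OF gc AE_completion[OF ae]])
 show "(\<integral>x. f x \<partial>completion M) = (\<integral>x. g x \<partial>M)"
  using integral_cong_AE[OF fc gc AE_completion[OF ae]] integral_completion[OF g] by simp
 show "integrable (completion M) f \<longleftrightarrow> integrable M g"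
  using integrable_cong_AE[OF fc gc AE_completion[OF ae]] integrable_completion[OF g] by simp
qed

lemma completion_ex_borel_complex:
 fixes f :: "'a \<Rightarrow> complex"
 assumes [measurable]: "f \<in> borel_measurable (completion M)"
 shows "\<exists>g\<in>borel_measurable M. AE x in M. f x = g x"
proof -
 have "(\<lambda>x. Re (f x)) \<in> borel_measurable (completion M)" "(\<lambda>x. Im (f x)) \<in> borel_measurable (completion M)" by measurable
 note ri = this[THEN completion_ex_borel_measurable_real]
 obtain u where u: "u \<in> borel_measurable M" "AE x in M. Re (f x) = u x" using ri(1) by blast
 obtain v where v: "v \<in> borel_measurable M" "AE x in M. Im (f x) = v x" using ri(2) by blast
 note [measurable] = u(1) v(1)
 have "AE x in M. f x = Complex (u x) (v x)" using u(2) v(2) by eventually_elim (simp add: complex_eq_iff)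
 moreover have "(\<lambda>x. Complex (u x) (v x)) \<in> borel_measurable M" unfolding borel_measurable_complex_iff by simp
 ultimately show ?thesis by (rule bexI)
qed

text \<open>For \<open>b \<noteq> 0\<close> an affine substitution carries the null set to a null
  set of \<open>t\<close> for every \<open>x\<close>. For \<open>b = 0\<close>, which nondegeneracy
  allows for one of the three slopes, the inner statement is constant in \<open>t\<close> and the
  exception falls on \<open>x\<close>.\<close>

lemma AE_line:
 fixes b :: real
 assumes ae: "AE y in lborel. P y"
 shows "AE x in lborel. AE t in lborel. P (x - b * t)"
proof (cases "b = 0")
 case True
 show ?thesis using ae by eventually_elim (simp add: True)
next
 case False
 obtain N where N: "N \<in> null_sets lborel" "{y. \<not> P y} \<subseteq> N" using ae unfolding eventually_ae_filter by auto
 have "AE t in lborel. x + - b * t \<notin> N" for x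
  by (rule AE_borel_affine) (use False N AE_not_in[OF N(1)] in auto)
 then have "AE t in lborel. P (x - b * t)" for x
  by (rule eventually_mono) (use N(2) in auto)
 then show ?thesis by simp
qed

text \<open>Away from \<open>t = 0\<close> the integrand is jointly integrable. Borel
  representatives do not change the iterated integral, by \<open>AE_line\<close>, and Fubini brings
  the \<open>x\<close> integral inside, where it becomes \<open>slice\<close>.\<close>

lemma Lambda_trunc_eq_Lam:
 assumes f1: "f1 \<in> bm" "sq_integrable f1"
  and f2: "f2 \<in> bm" "sq_integrable f2"
  and f3: "integrable lborel f3" and b: "b1 \<noteq> b3" "b2 \<noteq> b3" and e: "e > 0"
  and ae: "AE x in lborel. g1 x = f1 x" "AE x in lborel. g2 x = f2 x" "AE x in lborel. g3 x = f3 x"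
 shows "Lambda_trunc b1 b2 b3 g1 g2 g3 e = Lam (slice f1 f2 f3 b1 b2 b3) e"
proof -
 note [measurable] = f1(1) f2(1)
 have [measurable]: "f3 \<in> bm" using f3 by auto
 define F where "F x t = f1 (x - b1 * t) * f2 (x - b2 * t) * f3 (x - b3 * t)" for x t
 have Fi: "integrable (lborel \<Otimes>\<^sub>M lborel) (\<lambda>(t, x). F x t)" unfolding F_def by (rule tri_integrable[OF f1 f2 f3 b])
 have KI: "integrable (lborel \<Otimes>\<^sub>M lborel) (\<lambda>(t, x). if e < \<bar>t\<bar> then F x t / cx t else 0)"
 proof (rule dominated_integrable)
  show "integrable (lborel \<Otimes>\<^sub>M lborel) (\<lambda>p. (case p of (t, x) \<Rightarrow> F x t) / cx e)" using Fi by simp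
  show "(\<lambda>(t, x). if e < \<bar>t\<bar> then F x t / cx t else 0) \<in> borel_measurable (lborel \<Otimes>\<^sub>M lborel)" unfolding F_def by measurable
  show "AE p in lborel \<Otimes>\<^sub>M lborel. norm (case p of (t, x) \<Rightarrow> if e < \<bar>t\<bar> then F x t / cx t else 0) \<le> norm ((case p of (t, x) \<Rightarrow> F x t) / cx e)"
   using e by (intro AE_I2) (auto simp: norm_divide split: prod.split intro!: divide_left_mono mult_pos_pos)
 qed
 have "AE x in lborel. (\<integral>t. (if e < \<bar>t\<bar> then g1 (x - b1 * t) * g2 (x - b2 * t) * g3 (x - b3 * t) / cx t else 0) \<partial>lebesgue) =
   (LBINT t. (if e < \<bar>t\<bar> then F x t / cx t else 0))"
  using AE_line[OF ae(1), of b1] AE_line[OF ae(2), of b2] AE_line[OF ae(3), of b3]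
 proof eventually_elim
  case (elim x)
  show ?case
  proof (rule integral_completion_AE(1))
   show "(\<lambda>t. if e < \<bar>t\<bar> then F x t / cx t else 0) \<in> borel_measurable lborel" unfolding F_def by measurable
   show "AE t in lborel. (if e < \<bar>t\<bar> then g1 (x - b1 * t) * g2 (x - b2 * t) * g3 (x - b3 * t) / cx t else 0) = (if e < \<bar>t\<bar> then F x t / cx t else 0)"
    using elim by eventually_elim (simp add: F_def)
  qed
 qed
 then have "Lambda_trunc b1 b2 b3 g1 g2 g3 e = (LBINT x. LBINT t. (if e < \<bar>t\<bar> then F x t / cx t else 0))"
  unfolding Lambda_trunc_def
 proof (intro integral_completion_AE(1))
  show "(\<lambda>x. LBINT t. (if e < \<bar>t\<bar> then F x t / cx t else 0)) \<in> borel_measurable lborel" unfolding F_def by measurable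
 qed
 also have "... = (LBINT t. LBINT x. (if e < \<bar>t\<bar> then F x t / cx t else 0))"
  by (rule lborel_pair.Fubini_integral[OF KI])
 also have "... = Lam (slice f1 f2 f3 b1 b2 b3) e"
  unfolding Lam_def by (intro bochner_cong refl) (auto simp: slice_def F_def)
 finally show ?thesis .
qed

lemma Lambda_eq:
 assumes f1: "f1 \<in> bm" "sq_integrable f1"
  and f2: "f2 \<in> bm" "sq_integrable f2"
  and f3: "integrable lborel f3" and b: "b1 \<noteq> b3" "b2 \<noteq> b3"
  and ae: "AE x in lborel. g1 x = f1 x" "AE x in lborel. g2 x = f2 x" "AE x in lborel. g3 x = f3 x"
  and l: "(Lam (slice f1 f2 f3 b1 b2 b3) \<longlongrightarrow> l) (at_right 0)"
 shows "Lambda b1 b2 b3 g1 g2 g3 = l"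
 unfolding Lambda_def
proof (rule tendsto_Lim)
 have "\<forall>\<^sub>F e in at_right 0. Lam (slice f1 f2 f3 b1 b2 b3) e = Lambda_trunc b1 b2 b3 g1 g2 g3 e"
  using eventually_at_right_less[of "0::real"] by eventually_elim (rule Lambda_trunc_eq_Lam[OF f1 f2 f3 b _ ae, symmetric])
 then show "(Lambda_trunc b1 b2 b3 g1 g2 g3 \<longlongrightarrow> l) (at_right 0)" by (rule Lim_transform_eventually[OF l])
qed (rule trivial_limit_at_right_real)

text \<open>A Borel representative is set to 0 where it exceeds 1 or where the point is outside
  \<open>Z\<close>. The bound and the support then hold everywhere, as
  \<open>off_exceptional\<close> demands, and not merely almost everywhere.\<close>

lemma borel_version_bounded:
 fixes f :: "real \<Rightarrow> complex"
 assumes f: "f \<in> borel_measurable lebesgue" "\<And>x. norm (f x) \<le> indicator F x"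
  and F: "F \<in> sets lebesgue" "emeasure lebesgue F < \<infinity>" and Z: "F \<subseteq> Z" "Z \<in> sets borel"
 shows "\<exists>g. g \<in> bm \<and> (AE x in lborel. f x = g x) \<and> (\<forall>x. norm (g x) \<le> 1) \<and> (\<forall>x. x \<notin> Z \<longrightarrow> g x = 0) \<and>
  integrable lborel g \<and> sq_integrable g \<and> (LBINT x. (norm (g x))^2) \<le> measure lebesgue F"
proof -
 obtain h where h: "h \<in> borel_measurable lborel" "AE x in lborel. f x = h x" using completion_ex_borel_complex[OF f(1)] by auto
 define g where "g x = (if norm (h x) \<le> 1 \<and> x \<in> Z then h x else 0)" for x
 have [measurable]: "h \<in> bm" "Z \<in> sets borel" using h Z by auto
 have gm[measurable]: "g \<in> bm" unfolding g_def by measurable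
 have ae: "AE x in lborel. f x = g x" using h(2)
 proof eventually_elim
  case (elim x)
  have "norm (f x) \<le> 1" by (rule order_trans[OF f(2)]) (simp add: indicator_def)
  moreover have "f x = 0" if "x \<notin> Z" 
  proof -
   have "x \<notin> F" using that Z(1) by blast
   then show ?thesis using f(2)[of x] by simp
  qed
  ultimately show ?case using elim by (auto simp: g_def)
 qed
 have g1: "norm (g x) \<le> 1" for x by (simp add: g_def)
 have iF: "integrable lebesgue (indicator F :: real \<Rightarrow> real)" using F by (rule integrable_real_indicator)
 have i1: "integrable lebesgue f" by (rule dominated_integrable[OF iF f(1)]) (use f(2) in auto)
 have gi: "integrable lborel g" using i1 integral_completion_AE(2)[OF _ ae] by simp
 have sq: "(norm (f x))^2 \<le> indicator F x" for x
  using f(2)[of x] by (auto simp: indicator_def power_le_one split: if_splits)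
 have ae2: "AE x in lborel. (norm (f x))^2 = (norm (g x))^2" using ae by eventually_elim simp
 have gi2: "sq_integrable g" by (rule bounded_L1_L2[OF gi g1])
 have i2: "integrable lebesgue (\<lambda>x. (norm (f x))^2)" using gi2 integral_completion_AE(2)[OF _ ae2] by simp
 have "(LBINT x. (norm (g x))^2) = (\<integral>x. (norm (f x))^2 \<partial>lebesgue)" by (rule integral_completion_AE(1)[OF _ ae2, symmetric]) measurable
 also have "... \<le> (\<integral>x. indicator F x \<partial>lebesgue)" by (intro integral_mono i2 iF sq)
 also have "... = measure lebesgue F" using F by simp
 finally have "(LBINT x. (norm (g x))^2) \<le> measure lebesgue F" .
 then show ?thesis using gm ae g1 gi gi2 by (intro exI[of _ g]) (simp add: g_def)
qed

theorem theorem1: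
  fixes b1 b2 b3 :: real
  assumes "nondegenerate b1 b2 b3"
  shows "\<exists>C>0. \<forall>f2 F1 F3. in_L2 f2 \<and> finite_pos_set F1 \<and> finite_pos_set F3 \<longrightarrow>
    (\<exists>F3'. major_subset F3' F3 \<and>
      (\<forall>f1 f3. f1 \<in> borel_measurable lebesgue \<and> f3 \<in> borel_measurable lebesgue \<and>
         (\<forall>x. norm (f1 x) \<le> indicator F1 x) \<and> (\<forall>x. norm (f3 x) \<le> indicator F3' x) \<longrightarrow>
         norm (Lambda b1 b2 b3 f1 f2 f3)
           \<le> C * measure lebesgue F1 * L2norm f2 * measure lebesgue F3 powr (-1/2)
               * ln (exp 1 + measure lebesgue F3 / measure lebesgue F1)))"
proof -
 have b: "b1 \<noteq> b3" "b2 \<noteq> b3" using assms by (auto simp: nondegenerate_def)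
 obtain C where C: "C > 0" and main: "\<And>f1 f2 f3 a M E2 Z. off_exceptional f1 f2 f3 a M E2 Z \<and> integrable lborel f3 \<Longrightarrow>
  (\<exists>l. (Lam (slice f1 f2 f3 b1 b2 b3) \<longlongrightarrow> l) (at_right 0) \<and> norm l \<le> C * (sqrt M * E2 * (a * ln (exp 1 + 1 / a))))"
  using Lam_limit[OF assms] by blast
 show ?thesis
 proof (intro exI[of _ C] conjI C allI impI)
  fix f2 F1 F3
  assume A: "in_L2 f2 \<and> finite_pos_set F1 \<and> finite_pos_set F3"
  define m M E2 where "m = measure lebesgue F1" and "M = measure lebesgue F3" and "E2 = L2norm f2"
  have F1: "F1 \<in> sets lebesgue" "emeasure lebesgue F1 < \<infinity>" "m > 0" and F3: "F3 \<in> sets lebesgue" "emeasure lebesgue F3 < \<infinity>" "M > 0"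
   using A by (auto simp: finite_pos_set_def m_def M_def)
  have F3f: "F3 \<in> fmeasurable lebesgue" using F3 by (intro fmeasurableI) auto
  obtain g2 where g2: "g2 \<in> bm" "AE x in lborel. f2 x = g2 x"
   using completion_ex_borel_complex[of f2 lborel] A by (auto simp: in_L2_def)
  note [measurable] = g2(1)
  have ae2: "AE x in lborel. (norm (f2 x))^2 = (norm (g2 x))^2" using g2(2) by eventually_elim simp
  have g22: "sq_integrable g2" using A integral_completion_AE(2)[OF _ ae2] by (simp add: in_L2_def)
  have n0: "0 \<le> (LBINT x. (norm (g2 x))^2)" by simp
  have E2sq: "(LBINT x. (norm (g2 x))^2) = E2^2" and E20: "E2 \<ge> 0"
   using integral_completion_AE(1)[OF _ ae2] n0 by (simp_all add: E2_def L2norm_def)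
  show "\<exists>F3'. major_subset F3' F3 \<and>
   (\<forall>f1 f3. f1 \<in> borel_measurable lebesgue \<and> f3 \<in> borel_measurable lebesgue \<and>
    (\<forall>x. norm (f1 x) \<le> indicator F1 x) \<and> (\<forall>x. norm (f3 x) \<le> indicator F3' x) \<longrightarrow>
    norm (Lambda b1 b2 b3 f1 f2 f3)
     \<le> C * measure lebesgue F1 * L2norm f2 * measure lebesgue F3 powr (-1/2)
       * ln (exp 1 + measure lebesgue F3 / measure lebesgue F1))"
  \<comment> \<open>The threshold for the maximal function of \<open>|f2|^2\<close> is proportional
    to the squared norm and has to be positive; a vanishing \<open>f2\<close> makes the form 0 and
    is treated apart.\<close>
  proof (cases "E2 = 0")
   case True
   have "AE x in lborel. (norm (g2 x))^2 = 0" using integral_nonneg_eq_0_iff_AE[OF g22] E2sq True by simp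
   then have ae0: "AE x in lborel. f2 x = (\<lambda>x. 0) x" using g2(2) by eventually_elim simp
   show ?thesis
   proof (intro exI[of _ F3] conjI allI impI)
    show "major_subset F3 F3" using F3 by (simp add: major_subset_def)
    fix f1 f3 :: "real \<Rightarrow> complex"
    assume f: "f1 \<in> borel_measurable lebesgue \<and> f3 \<in> borel_measurable lebesgue \<and>
    (\<forall>x. norm (f1 x) \<le> indicator F1 x) \<and> (\<forall>x. norm (f3 x) \<le> indicator F3 x)"
    obtain g1 where g1: "g1 \<in> bm" "AE x in lborel. f1 x = g1 x" "sq_integrable g1"
     using borel_version_bounded[of f1 F1 UNIV] f F1 by auto
    obtain g3 where g3: "AE x in lborel. f3 x = g3 x" "integrable lborel g3"
     using borel_version_bounded[of f3 F3 UNIV] f F3 by auto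
    have z: "slice g1 (\<lambda>x. 0) g3 b1 b2 b3 \<tau> = 0" for \<tau> by (simp add: slice_def)
    have "Lam (slice g1 (\<lambda>x. 0) g3 b1 b2 b3) = (\<lambda>e. 0)" unfolding Lam_def fun_eq_iff z div_0 if_cancel by simp
    then have "(Lam (slice g1 (\<lambda>x. 0) g3 b1 b2 b3) \<longlongrightarrow> 0) (at_right 0)" by simp
    from Lambda_eq[OF g1(1,3) _ _ g3(2) b g1(2) ae0 g3(1) this]
    show "norm (Lambda b1 b2 b3 f1 f2 f3) \<le> C * measure lebesgue F1 * L2norm f2 * measure lebesgue F3 powr (-1/2) * ln (exp 1 + measure lebesgue F3 / measure lebesgue F1)"
     using True by (simp add: E2_def)
   qed
  next
   case False
   then have E2: "E2 > 0" using E20 by simp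
   define a where "a = m / M"
   have a: "a > 0" "a * M = m" using F1 F3 by (simp_all add: a_def)
   obtain u :: "real \<Rightarrow> real" where u: "u \<in> borel_measurable lborel" "AE x in lborel. indicator F1 x = u x"
    using completion_ex_borel_measurable_real[of "indicator F1" lborel] F1 by auto
   define h1 where "h1 x = \<bar>u x\<bar>" for x
   have h1m[measurable]: "h1 \<in> bm" using u unfolding h1_def by simp
   have h1ae: "AE x in lborel. indicator F1 x = h1 x" using u(2)
   proof eventually_elim
    case (elim x)
    show ?case unfolding h1_def elim[symmetric] by simp
   qed
   have h1i: "integrable lborel h1"
    using integral_completion_AE(2)[OF _ h1ae] integrable_real_indicator[OF F1(1,2)] by simp
   have h1I: "(LBINT x. h1 x) = m"
    using integral_completion_AE(1)[OF _ h1ae] F1 by (simp add: m_def)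
   define h2 where "h2 x = (norm (g2 x))^2" for x
   have h2i: "integrable lborel h2" unfolding h2_def by (rule g22)
   \<comment> \<open>With the weak-type constant 10 the factor 40 gives each exceptional set measure
     at most \<open>M / 4\<close>, so at least half of \<open>F3\<close> survives. The first set is
     built from the indicator of \<open>F1\<close>, which dominates every admissible
     \<open>f1\<close>; hence the major subset does not depend on \<open>f1\<close>.\<close>
   define l1 l2 where "l1 = 40 * a" and "l2 = 40 * (E2 / sqrt M)^2"
   have l: "l1 > 0" "l2 > 0" using a E2 F3 by (simp_all add: l1_def l2_def)
   have h0: "h1 x \<ge> 0" "h2 x \<ge> 0" for x by (simp_all add: h1_def h2_def)
   note hl1 = hl_weak[OF h1i h0(1) l(1)] and hl2 = hl_weak[OF h2i h0(2) l(2)]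
   obtain W1 where W1: "open W1" "emeasure lborel W1 \<le> ennreal (10 * (LBINT x. h1 x) / l1)"
    "\<And>z r. z \<notin> W1 \<Longrightarrow> r > 0 \<Longrightarrow> (LBINT x. indicator {z - r..z + r} x * h1 x) \<le> l1 * r"
    by (rule that[OF hl1(1,2)]) (rule hl1(3))
   obtain W2 where W2: "open W2" "emeasure lborel W2 \<le> ennreal (10 * (LBINT x. h2 x) / l2)"
    "\<And>z r. z \<notin> W2 \<Longrightarrow> r > 0 \<Longrightarrow> (LBINT x. indicator {z - r..z + r} x * h2 x) \<le> l2 * r"
    by (rule that[OF hl2(1,2)]) (rule hl2(3))
   define Z where "Z = - (W1 \<union> W2)"
   have Z: "closed Z" unfolding Z_def using W1(1) W2(1) by (intro closed_Compl open_Un)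
   have mZ: "- Z \<in> sets borel" "Z \<in> sets borel" using Z by auto
   have "emeasure lborel (- Z) \<le> emeasure lborel W1 + emeasure lborel W2"
    unfolding Z_def double_complement by (rule emeasure_subadditive) (use W1 W2 in auto)
   also have "... \<le> ennreal (M / 4) + ennreal (M / 4)"
   proof (intro add_mono)
    have "10 * (LBINT x. h1 x) / l1 = M / 4" unfolding h1I l1_def a_def using F1(3) F3(3) by simp
    with W1(2) show "emeasure lborel W1 \<le> ennreal (M / 4)" by (simp only:)
    have "(LBINT x. h2 x) = E2^2" unfolding h2_def by (rule E2sq)
    then have "10 * (LBINT x. h2 x) / l2 = M / 4" using E2 F3 by (simp add: l2_def power_divide)
    with W2(2) show "emeasure lborel W2 \<le> ennreal (M / 4)" by (simp only:)
   qed
   also have "... = ennreal (M / 2)" using F3 by (simp add: ennreal_plus[symmetric] del: ennreal_plus)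
   finally have eZ: "emeasure lborel (- Z) \<le> ennreal (M / 2)" .
   have eZM: "emeasure lborel (- Z) \<le> ennreal M" by (rule order_trans[OF eZ]) (use F3 in \<open>simp add: ennreal_leI\<close>)
   have Zne: "Z \<noteq> {}"
   proof
    assume "Z = {}"
    then have "emeasure lborel (UNIV :: real set) \<le> ennreal (M / 2)" using eZ by simp
    then show False by (simp add: top_unique)
   qed
   have Zf: "- Z \<in> fmeasurable lebesgue" using mZ eZ by (intro fmeasurableI) (auto intro: le_less_trans)
   have mZ2: "measure lebesgue (- Z) \<le> M / 2"
   proof -
    have "measure lebesgue (- Z) = enn2real (emeasure lborel (- Z))" using mZ by (simp add: measure_def)
    also have "... \<le> M / 2" by (rule enn2real_leI[OF _ eZ]) (use F3 in simp)
    finally show ?thesis .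
   qed
   show ?thesis
   proof (intro exI[of _ "F3 \<inter> Z"] conjI allI impI)
    have sZ: "F3 \<inter> Z \<in> sets lebesgue" using F3(1) mZ by auto
    have fZ: "F3 \<inter> Z \<in> fmeasurable lebesgue" by (rule fmeasurableI2[OF F3f]) (use sZ in auto)
    have "M \<le> measure lebesgue (F3 \<inter> Z \<union> - Z)" unfolding M_def
     by (rule measure_mono_fmeasurable) (use F3 fZ Zf in auto)
    also have "... \<le> measure lebesgue (F3 \<inter> Z) + measure lebesgue (- Z)"
     by (rule measure_Un_le) (use fZ Zf in auto)
    finally have "M \<le> 2 * measure lebesgue (F3 \<inter> Z)" using mZ2 by simp
    then show "major_subset (F3 \<inter> Z) F3" using sZ by (simp add: major_subset_def M_def)
    have le: "measure lebesgue (F3 \<inter> Z) \<le> M" unfolding M_def by (rule measure_mono_fmeasurable) (use sZ F3f in auto)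
    have efin: "emeasure lebesgue (F3 \<inter> Z) < \<infinity>" using fZ by (auto simp: fmeasurable_def)
    fix f1 f3 :: "real \<Rightarrow> complex"
    assume f: "f1 \<in> borel_measurable lebesgue \<and> f3 \<in> borel_measurable lebesgue \<and>
    (\<forall>x. norm (f1 x) \<le> indicator F1 x) \<and> (\<forall>x. norm (f3 x) \<le> indicator (F3 \<inter> Z) x)"
    obtain g1 where g1: "g1 \<in> bm" "AE x in lborel. f1 x = g1 x" "sq_integrable g1" "(LBINT x. (norm (g1 x))^2) \<le> m"
     using borel_version_bounded[of f1 F1 UNIV] f F1 by (auto simp: m_def)
    obtain g3 where g3: "g3 \<in> bm" "AE x in lborel. f3 x = g3 x" "integrable lborel g3" "\<forall>x. norm (g3 x) \<le> 1" "\<forall>x. x \<notin> Z \<longrightarrow> g3 x = 0"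
     "sq_integrable g3" "(LBINT x. (norm (g3 x))^2) \<le> measure lebesgue (F3 \<inter> Z)"
     using borel_version_bounded[of f3 "F3 \<inter> Z" Z] f sZ efin mZ by auto
    have av1: "(LBINT x. indicator {z - r..z + r} x * norm (g1 x)) \<le> 40 * a * r" if z: "z \<in> Z" "r > 0" for z r
    proof -
     have "(LBINT x. indicator {z - r..z + r} x * norm (g1 x)) \<le> (LBINT x. indicator {z - r..z + r} x * h1 x)"
     proof (rule integral_mono_AE)
      show "integrable lborel (\<lambda>x. indicator {z - r..z + r} x * norm (g1 x))" by (rule L2_mult_indicator[OF g1(1,3)])
      show "integrable lborel (\<lambda>x. indicator {z - r..z + r} x * h1 x)" using integrable_mult_indicator[of "{z - r..z + r}" lborel h1] h1i by simp
      show "AE x in lborel. indicator {z - r..z + r} x * norm (g1 x) \<le> indicator {z - r..z + r} x * h1 x"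
       using h1ae g1(2)
      proof eventually_elim
       case (elim x)
       have "norm (g1 x) \<le> h1 x" using f elim by metis
       then show ?case by (intro mult_left_mono) auto
      qed
     qed
     also have "... \<le> 40 * a * r" using W1(3)[of z r] z by (simp add: Z_def l1_def)
     finally show ?thesis .
    qed
    have av2: "(LBINT x. indicator {z - r..z + r} x * (norm (g2 x))^2) \<le> 40 * (E2 / sqrt M)^2 * r" if z: "z \<in> Z" "r > 0" for z r
     using W2(3)[of z r] z by (simp add: Z_def l2_def h2_def)
    have "off_exceptional g1 g2 g3 a M E2 Z"
     unfolding off_exceptional_def using g1 g2 g22 E2sq g3 a F3 E2 Z Zne eZM av1 av2 le by auto
    then obtain l where l: "(Lam (slice g1 g2 g3 b1 b2 b3) \<longlongrightarrow> l) (at_right 0)" "norm l \<le> C * (sqrt M * E2 * (a * ln (exp 1 + 1 / a)))"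
     using main g3(3) by blast
    have "Lambda b1 b2 b3 f1 f2 f3 = l" by (rule Lambda_eq[OF g1(1,3) g2(1) g22 g3(3) b g1(2) g2(2) g3(2) l(1)])
    moreover have "C * (sqrt M * E2 * (a * ln (exp 1 + 1 / a))) = C * m * E2 * M powr (-1/2) * ln (exp 1 + M / m)"
    proof -
     have p: "M powr (-1/2) = 1 / sqrt M" using F3 by (simp add: powr_minus_divide powr_half_sqrt)
     have q: "sqrt M * a = m * (1 / sqrt M)" using F3 by (simp add: a_def field_simps)
     have r: "1 / a = M / m" by (simp add: a_def)
     have "C * (sqrt M * E2 * (a * ln (exp 1 + 1 / a))) = C * E2 * (sqrt M * a) * ln (exp 1 + 1 / a)" by (simp only: mult_ac)
     also have "... = C * m * E2 * M powr (-1/2) * ln (exp 1 + M / m)" unfolding p q r by (simp only: mult_ac)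
     finally show ?thesis .
    qed
    ultimately show "norm (Lambda b1 b2 b3 f1 f2 f3) \<le> C * measure lebesgue F1 * L2norm f2 * measure lebesgue F3 powr (-1/2) * ln (exp 1 + measure lebesgue F3 / measure lebesgue F1)"
     using l(2) by (simp only: m_def M_def E2_def)
   qed
  qed
 qed
qed

end
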